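(* Let $n\ge3$, let $0<\alpha,\beta<1$ be such that $\epsilon_0:=3-2\alpha-\beta\in(0,2)$, and let $f$ be the force described in the context. Set $\mathcal R=\{(x',x_n)\in\overline{\mathbb R^n_+}:|x'|\ge2,\ x_n\ge0\}$. Let $$w(x,t)=\int_0^t\int_{\mathbb R^n_+}K(x,y,t-s)f(y,s)\,dy\,ds$$ be the solution of the Stokes system $w_t-\Delta w+\nabla\Pi=f$, $\operatorname{div}w=0$ in $\mathbb R^n_+\times(0,1)$, $w|_{x_n=0}=0$, $w|_{t=0}=0$. Then $w$ is Hölder continuous in $\mathcal R\times(0,1)$ with the optimal exponent $\epsilon_0$, that is, $$w\in C^{\epsilon_0,\frac12\epsilon_0}(\mathcal R\times(0,1)),$$ and, whenever $\epsilon>\epsilon_0$, $$w\notin L^\infty(0,1;C^{\epsilon}(\mathcal R))\qquad\text{and}\qquad w\notin C^{\frac\epsilon2}(0,1;L^\infty(\mathcal R)).$$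
   Context: Notation: $x=(x',x_n)$ with $x'\in\mathbb R^{n-1}$; $\mathbb R_+=(0,\infty)$; $\mathbb R^n_+=\{x\in\mathbb R^n:x_n>0\}$; $y^*=(y',-y_n)$; $\delta_{ij}$ is the Kronecker delta. $C^{\epsilon_0,\frac12\epsilon_0}$ is the usual anisotropic (parabolic) Hölder space, with exponent $\epsilon_0$ in $x$ and $\frac12\epsilon_0$ in $t$; for $\epsilon>1$, $C^\epsilon$ is the usual Hölder space of functions with Hölder continuous derivatives. Force $f$: $g(x)=g^{\mathcal T}(x')g^{\mathcal N}(x_n)$ with non-negative $g^{\mathcal T}\in C_c^\infty(\mathbb R^{n-1})$, not identically zero, with support compactly contained in $\{|x'|<1\}$, and non-negative $g^{\mathcal N}\in C^\infty(\mathbb R_+)$ with support contained in $(0,2)$ and $g^{\mathcal N}(x_n)=x_n^{1-\beta}$ for $x_n\in(0,1]$. Let $a>0$ be a constant, $h(t)=(t-\frac12)^{-\alpha}\chi_{(\frac12,\infty)}(t)$, and $f(x,t)=\big(0,\ a\,\partial_{x_n}g(x)h(t),\ 0,\dots,0,\ -a\,\partial_{x_2}g(x)h(t)\big)$, i.e. $f_2=a\,\partial_{x_n}g\,h$, $f_n=-a\,\partial_{x_2}g\,h$, and all other components vanish. Green tensor $K=(K_{ij})$: with $\Gamma(x,t)=(4\pi t)^{-n/2}e^{-|x|^2/(4t)}$ and $N(x)=-c_n|x|^{2-n}$, $c_n=(n(n-2)\omega_n)^{-1}$ ($\omega_n$ the volume of the unit ball), $$K_{ij}(x,y,t)=\delta_{ij}\big(\Gamma(x-y,t)-\Gamma(x-y^*,t)\big)-4(1-\delta_{jn})D_{x_j}\int_0^{x_n}\int_{\mathbb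 R^{n-1}}\Gamma(x-y^*-z,t)D_{z_i}N(z)\,dz .$$ *)

theory Defs
  imports "HOL-Analysis.Analysis" "HOL-Probability.Essential_Supremum"
begin

text \<open>
  A point \<open>x = (x', x\<^sub>n)\<close> of \<open>n\<close>-dimensional space is an element of \<open>(real ^ 'm) \<times> real\<close>, so that
  \<open>n = CARD('m) + 1\<close>, \<open>x' = fst x\<close> and \<open>x\<^sub>n = snd x\<close>; the product norm and Lebesgue measure are the
  Euclidean ones. Coordinate indices are represented by the vectors of the standard basis.
\<close>

type_synonym 'm space = "(real ^ 'm) \<times> real"

definition e_normal :: "'m::finite space"
  where "e_normal = (0, 1)"

definition e_tangent :: "'m::finite \<Rightarrow> 'm space"
  where "e_tangent k = (axis k 1, 0)"

definition half_space :: "'m::finite space set"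
  where "half_space = {x. snd x > 0}"

definition reflect :: "'m::finite space \<Rightarrow> 'm space"
  where "reflect y = (fst y, - snd y)"

definition partial :: "'a::real_normed_vector \<Rightarrow> ('a \<Rightarrow> real) \<Rightarrow> 'a \<Rightarrow> real"
  where "partial b u x = deriv (\<lambda>s. u (x + s *\<^sub>R b)) 0"


section \<open>Function spaces\<close>

primrec Ck_on :: "nat \<Rightarrow> 'a::euclidean_space set \<Rightarrow> ('a \<Rightarrow> real) \<Rightarrow> bool"
  where
    "Ck_on 0 S u \<longleftrightarrow> continuous_on S u"
  | "Ck_on (Suc k) S u \<longleftrightarrow>
       (\<exists>u'. (\<forall>x\<in>S. (u has_derivative u' x) (at x)) \<and> (\<forall>b\<in>Basis. Ck_on k S (\<lambda>x. u' x b)))"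

text \<open>Intended for open \<open>S\<close>.\<close>

definition smooth_on :: "'a::euclidean_space set \<Rightarrow> ('a \<Rightarrow> real) \<Rightarrow> bool"
  where "smooth_on S u \<longleftrightarrow> (\<forall>k. Ck_on k S u)"

text \<open>
  An exponent \<open>\<gamma> > 0\<close> is split as \<open>\<gamma> = k + \<sigma>\<close> with \<open>k\<close> a natural number and \<open>0 < \<sigma> \<le> 1\<close>. In
  particular, for an integer \<open>\<gamma>\<close> the highest derivatives are required to be Lipschitz.
\<close>

definition holder_order :: "real \<Rightarrow> nat"
  where "holder_order \<gamma> = nat (\<lceil>\<gamma>\<rceil> - 1)"

definition holder_exp :: "real \<Rightarrow> real"
  where "holder_exp \<gamma> = \<gamma> - real (holder_order \<gamma>)"

text \<open>
  \<open>holder_le k \<sigma> S M u\<close> says that the \<open>C\<^bsup>k+\<sigma>\<^esup>(S)\<close> norm of \<open>u\<close>, in the form of the maximum of the sup norms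
  of all partial derivatives of order at most \<open>k\<close> and the \<open>\<sigma>\<close>-seminorms of those of order \<open>k\<close>, exists
  and is at most \<open>M\<close>. Derivatives at boundary points of \<open>S\<close> are taken within \<open>S\<close>; this is meant for
  sets (such as the closure of a Lipschitz domain) on which they are unique.
\<close>

primrec holder_le ::
    "nat \<Rightarrow> real \<Rightarrow> 'a::euclidean_space set \<Rightarrow> real \<Rightarrow> ('a \<Rightarrow> 'b::real_normed_vector) \<Rightarrow> bool"
  where
    "holder_le 0 \<sigma> S M u \<longleftrightarrow>
       (\<forall>x\<in>S. norm (u x) \<le> M) \<and>
       (\<forall>x\<in>S. \<forall>y\<in>S. norm (u x - u y) \<le> M * norm (x - y) powr \<sigma>)"
  | "holder_le (Suc k) \<sigma> S M u \<longleftrightarrow>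
       (\<forall>x\<in>S. norm (u x) \<le> M) \<and>
       (\<exists>u'. (\<forall>x\<in>S. (u has_derivative u' x) (at x within S)) \<and>
             (\<forall>b\<in>Basis. holder_le k \<sigma> S M (\<lambda>x. u' x b)))"

text \<open>
  Membership in \<open>L\<^sup>\<infinity>(I; C\<^sup>\<gamma>(S))\<close>: the essential supremum over \<open>t\<close> of the Hoelder norms is finite. Strong
  measurability with values in the nonseparable space \<open>C\<^sup>\<gamma>(S)\<close> is not demanded, so that
  non-membership expresses the lack of a uniform bound.
\<close>

definition Linf_holder ::
    "real \<Rightarrow> 'a::euclidean_space set \<Rightarrow> real set \<Rightarrow> ('a \<Rightarrow> real \<Rightarrow> 'b::real_normed_vector) \<Rightarrow> bool"
  where "Linf_holder \<gamma> S I u \<longleftrightarrow>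
    (\<exists>M. AE t in lborel. t \<in> I \<longrightarrow> holder_le (holder_order \<gamma>) (holder_exp \<gamma>) S M (\<lambda>x. u x t))"

definition Linf_norm ::
    "'a::euclidean_space set \<Rightarrow> ('a \<Rightarrow> 'b::real_normed_vector) \<Rightarrow> ereal"
  where "Linf_norm S u =
    (if u \<in> borel_measurable (lebesgue_on S)
     then esssup (lebesgue_on S) (\<lambda>x. ereal (norm (u x))) else \<infinity>)"

text \<open>
  \<open>C\<^bsup>k+\<sigma>\<^esup>(I; L\<^sup>\<infinity>(S))\<close>, where \<open>F t\<close> is the value at time \<open>t\<close>; time derivatives are derivatives of maps
  into \<open>L\<^sup>\<infinity>(S)\<close>.
\<close>

primrec holder_time_Linf ::
    "nat \<Rightarrow> real \<Rightarrow> real set \<Rightarrow> 'a::euclidean_space set \<Rightarrow>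
     (real \<Rightarrow> 'a \<Rightarrow> 'b::real_normed_vector) \<Rightarrow> bool"
  where
    "holder_time_Linf 0 \<sigma> I S F \<longleftrightarrow>
       (\<exists>M::real. (\<forall>t\<in>I. Linf_norm S (F t) \<le> ereal M) \<and>
          (\<forall>t\<in>I. \<forall>s\<in>I. Linf_norm S (\<lambda>x. F t x - F s x) \<le> ereal (M * \<bar>t - s\<bar> powr \<sigma>)))"
  | "holder_time_Linf (Suc k) \<sigma> I S F \<longleftrightarrow>
       (\<exists>M::real. \<forall>t\<in>I. Linf_norm S (F t) \<le> ereal M) \<and>
       (\<exists>F'. (\<forall>t\<in>I. ((\<lambda>s. Linf_norm S (\<lambda>x. (F s x - F t x) /\<^sub>R (s - t) - F' t x)) \<longlongrightarrow> 0)
                       (at t within I)) \<and>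
             holder_time_Linf k \<sigma> I S F')"

definition holder_Linf ::
    "real \<Rightarrow> real set \<Rightarrow> 'a::euclidean_space set \<Rightarrow> ('a \<Rightarrow> real \<Rightarrow> 'b::real_normed_vector) \<Rightarrow> bool"
  where "holder_Linf \<gamma> I S u \<longleftrightarrow>
    holder_time_Linf (holder_order \<gamma>) (holder_exp \<gamma>) I S (\<lambda>t x. u x t)"

text \<open>
  The parabolic space \<open>C\<^bsup>\<gamma>,\<gamma>/2\<^esup>(S \<times> I)\<close> for \<open>0 < \<gamma> < 2\<close>: first for \<open>\<gamma> \<le> 1\<close>, then in general. For
  \<open>1 < \<gamma> < 2\<close> the spatial gradient is parabolically Hoelder of order \<open>\<gamma> - 1\<close>, and the function itself is
  Hoelder of order \<open>\<gamma>/2\<close> in time.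
\<close>

definition parabolic_holder_low ::
    "real \<Rightarrow> 'a::euclidean_space set \<Rightarrow> real set \<Rightarrow> ('a \<Rightarrow> real \<Rightarrow> 'b::real_normed_vector) \<Rightarrow> bool"
  where "parabolic_holder_low \<gamma> S I u \<longleftrightarrow>
    (\<exists>M. (\<forall>x\<in>S. \<forall>t\<in>I. norm (u x t) \<le> M) \<and>
         (\<forall>x\<in>S. \<forall>y\<in>S. \<forall>t\<in>I. \<forall>s\<in>I.
            norm (u x t - u y s) \<le> M * (norm (x - y) powr \<gamma> + \<bar>t - s\<bar> powr (\<gamma> / 2))))"

definition parabolic_holder ::
    "real \<Rightarrow> 'a::euclidean_space set \<Rightarrow> real set \<Rightarrow> ('a \<Rightarrow> real \<Rightarrow> 'b::real_normed_vector) \<Rightarrow> bool"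
  where "parabolic_holder \<gamma> S I u \<longleftrightarrow>
    (if \<gamma> \<le> 1 then parabolic_holder_low \<gamma> S I u
     else (\<exists>M. (\<forall>x\<in>S. \<forall>t\<in>I. norm (u x t) \<le> M) \<and>
               (\<forall>x\<in>S. \<forall>t\<in>I. \<forall>s\<in>I. norm (u x t - u x s) \<le> M * \<bar>t - s\<bar> powr (\<gamma> / 2))) \<and>
          (\<exists>u'. (\<forall>x\<in>S. \<forall>t\<in>I. ((\<lambda>y. u y t) has_derivative u' x t) (at x within S)) \<and>
                (\<forall>b\<in>Basis. parabolic_holder_low (\<gamma> - 1) S I (\<lambda>x t. u' x t b))))"


section \<open>The Green tensor of the Stokes system in the half space\<close>

definition heat_kernel :: "'a::euclidean_space \<Rightarrow> real \<Rightarrow> real"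
  where "heat_kernel x t =
    (4 * pi * t) powr (- real DIM('a) / 2) * exp (- (norm x)\<^sup>2 / (4 * t))"

definition newton_potential :: "'a::euclidean_space \<Rightarrow> real"
  where "newton_potential x =
    - (1 / (real DIM('a) * (real DIM('a) - 2) * unit_ball_vol (real DIM('a))))
      * norm x powr (2 - real DIM('a))"

definition green_aux :: "'m::finite space \<Rightarrow> 'm space \<Rightarrow> real \<Rightarrow> 'm space \<Rightarrow> real"
  where "green_aux i y t x =
    (LINT zn:{0<..<snd x}|lborel. LINT z'|lborel.
       heat_kernel (x - reflect y - (z', zn)) t * partial i newton_potential (z', zn))"

definition green_tensor ::
    "'m::finite space \<Rightarrow> 'm space \<Rightarrow> 'm space \<Rightarrow> 'm space \<Rightarrow> real \<Rightarrow> real"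
  where "green_tensor i j x y t =
    of_bool (i = j) * (heat_kernel (x - y) t - heat_kernel (x - reflect y) t)
    - 4 * (1 - of_bool (j = e_normal)) * partial j (green_aux i y t) x"

text \<open>
  The vector field with components
  \<open>w\<^sub>i(x,t) = \<integral>\<^sub>0\<^sup>t \<integral> \<Sum>\<^sub>j K\<^sub>i\<^sub>j(x,y,t-s) f\<^sub>j(y,s) dy ds\<close>, \<open>y\<close> ranging over the half space.
\<close>

definition stokes_solution ::
    "('m::finite space \<Rightarrow> real \<Rightarrow> 'm space) \<Rightarrow> 'm space \<Rightarrow> real \<Rightarrow> 'm space"
  where "stokes_solution f x t =
    (\<Sum>i\<in>Basis.
       (LINT s:{0<..<t}|lborel. LINT y:half_space|lborel.
          \<Sum>j\<in>Basis. green_tensor i j x y (t - s) * (f y s \<bullet> j)) *\<^sub>R i)"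


section \<open>The force\<close>

definition time_profile :: "real \<Rightarrow> real \<Rightarrow> real"
  where "time_profile \<alpha> t = (if 1/2 < t then (t - 1/2) powr (- \<alpha>) else 0)"

definition tangential_cutoff :: "(real ^ 'm::finite \<Rightarrow> real) \<Rightarrow> bool"
  where "tangential_cutoff gT \<longleftrightarrow>
    smooth_on UNIV gT \<and> (\<forall>x. 0 \<le> gT x) \<and> (\<exists>x. gT x \<noteq> 0) \<and> closure {x. gT x \<noteq> 0} \<subseteq> ball 0 1"

text \<open>
  Only the values on \<open>{0<..}\<close> matter; the support is the closure relative to \<open>{0<..}\<close>.
\<close>

definition normal_profile :: "real \<Rightarrow> (real \<Rightarrow> real) \<Rightarrow> bool"
  where "normal_profile \<beta> gN \<longleftrightarrow>
    smooth_on {0<..} gN \<and> (\<forall>r>0. 0 \<le> gN r) \<and>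
    closure {r. 0 < r \<and> gN r \<noteq> 0} \<inter> {0<..} \<subseteq> {0<..<2} \<and>
    (\<forall>r\<in>{0<..1}. gN r = r powr (1 - \<beta>))"

text \<open>The index \<open>k\<close> is the tangential coordinate direction in which the force acts.\<close>

definition stokes_force ::
    "real \<Rightarrow> real \<Rightarrow> 'm::finite \<Rightarrow> (real ^ 'm \<Rightarrow> real) \<Rightarrow> (real \<Rightarrow> real) \<Rightarrow> 'm space \<Rightarrow> real \<Rightarrow> 'm space"
  where "stokes_force a \<alpha> k gT gN x t =
    (let g = (\<lambda>x. gT (fst x) * gN (snd x)) in
       (a * partial e_normal g x * time_profile \<alpha> t) *\<^sub>R e_tangent k
       - (a * partial (e_tangent k) g x * time_profile \<alpha> t) *\<^sub>R e_normal)"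

definition far_region :: "'m::finite space set"
  where "far_region = {x. 2 \<le> norm (fst x) \<and> 0 \<le> snd x}"

end

theory Submission
  imports Defs "HOL-Probability.Distributions"
begin

text \<open>The force is switched on at time 1/2, so that each component of the solution is
\<open>time_conv \<alpha> (\<theta> x) (t - 1/2)\<close>, the convolution of \<open>T powr (- \<alpha>)\<close> in time with a scalar kernel
\<open>\<theta>\<close>, the response after a given delay (\<open>stokes_solution_eq\<close>). Far from the support of the force, the Dirichlet
part of \<open>\<theta>\<close> is harmless: the heat kernel and its derivatives are bounded there and of order of the elapsed
time. All singular behaviour comes from the nonlocal term of the Green tensor, which transports the
boundary layer to every tangential position. Integrating first over the normal variable of the force,
this term is a convolution in \<open>x\<^sub>n\<close> of \<open>layer0\<close>, which carries the profile \<open>y powr (- \<beta>)\<close> smoothed by the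
Gaussian, with a heat average of a tangential potential of \<open>\<partial>\<^sub>k g\<close> (a Poisson or a Newtonian extension).
The layer has mass of order \<open>T powr p\<close> with \<open>p = (1 - \<beta>) / 2\<close>, is concentrated at distance
\<open>sqrt T\<close> from the boundary, and each space derivative costs a factor \<open>T powr (- 1/2)\<close>.

Upper bound. These scaling laws are the content of \<open>singular_kernel\<close>. Inserting them in the time
convolution gives Beta integrals, and since \<open>1 - \<alpha> + p\<close> is half of the claimed exponent, every such
kernel yields a parabolically Hoelder function (\<open>singular_kernel_parabolic_holder\<close>).

Lower bound. Around the point at tangential distance 4 in direction \<open>k\<close>, the potential of
\<open>\<partial>\<^sub>k\<partial>\<^sub>k g\<close> equals \<open>\<partial>\<^sub>k\<partial>\<^sub>k\<close> of the Newtonian potential of \<open>g \<ge> 0\<close>, whose kernel is strictly convex in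
direction \<open>k\<close> there. Hence the \<open>k\<close>-th kernel is at least \<open>c * T powr p\<close> once \<open>x\<^sub>n\<close> exceeds a multiple of
\<open>sqrt T\<close>, and the same is true of its second difference along the normal, because almost all of the
layer has already been collected (\<open>theta_lower\<close>, \<open>solution_lower\<close>). So within the distance \<open>sqrt T\<close> the
solution rises from its boundary value 0 to the size \<open>T powr (\<epsilon>0 / 2)\<close> and then bends, which contradicts
spatial smoothness beyond \<open>\<epsilon>0\<close> (\<open>not_Linf_holder\<close>); and during the time \<open>T\<close> it leaves 0 by the same amount,
which contradicts smoothness in time beyond \<open>\<epsilon>0 / 2\<close> (\<open>not_holder_Linf\<close>).\<close>

abbreviation hk :: "'a::euclidean_space => real => real" where "hk == heat_kernel"

section \<open>Integration tools\<close>

lemma abs_integral_le: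
 fixes f g :: "'a => real"
 assumes g: "integrable M g" and le: "!!x. x \<in> space M ==> \<bar>f x\<bar> <= g x"
 shows "\<bar>\<integral>x. f x \<partial>M\<bar> <= (\<integral>x. g x \<partial>M)"
proof (cases "integrable M f")
 case True
 have "\<bar>\<integral>x. f x \<partial>M\<bar> <= (\<integral>x. \<bar>f x\<bar> \<partial>M)" using integral_norm_bound[of M f] by simp
 also have "... <= (\<integral>x. g x \<partial>M)" using True g le by (intro integral_mono) auto
 finally show ?thesis .
next
 case False
 have "0 <= (\<integral>x. g x \<partial>M)" using le by (intro Bochner_Integration.integral_nonneg) (auto intro: order_trans[OF abs_ge_zero])
 with False show ?thesis by (simp add: not_integrable_integral_eq)
qed

text \<open>The majorant bounds the difference quotients and the derivative alike, so that one function serves for dominated convergence.\<close>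
lemma has_derivative_integral_dominated:
 fixes f :: "'a::real_normed_vector => 'b => real"
 assumes xS: "x \<in> S"
  and int: "!!y. y \<in> S ==> integrable M (f y)"
  and meas: "!!h. (%om. f' om h) \<in> borel_measurable M"
  and der: "!!om. om \<in> space M ==> ((%y. f y om) has_derivative f' om) (at x within S)"
  and lip: "!!y om. y \<in> S ==> om \<in> space M ==> \<bar>f y om - f x om\<bar> <= g om * norm (y - x)"
  and bound: "!!h om. om \<in> space M ==> \<bar>f' om h\<bar> <= g om * norm h"
  and g: "integrable M g"
 shows "((%y. \<integral>om. f y om \<partial>M) has_derivative (%h. \<integral>om. f' om h \<partial>M)) (at x within S)"
proof -
 have lin: "linear (f' om)" if "om \<in> space M" for om
  using der[OF that] has_derivative_bounded_linear bounded_linear.linear by blast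
 have int': "integrable M (%om. f' om h)" for h
 proof (rule Bochner_Integration.integrable_bound)
  show "integrable M (%om. g om * norm h)" using g by simp
  show "AE om in M. norm (f' om h) <= norm (g om * norm h)"
   using bound by (intro AE_I2) (auto intro: order_trans[OF _ abs_ge_self])
 qed (rule meas)
 have bl: "bounded_linear (%h. \<integral>om. f' om h \<partial>M)"
 proof (rule bounded_linear_intro[where K = "\<integral>om. g om \<partial>M"])
  fix h k
  have "(\<integral>om. f' om (h + k) \<partial>M) = (\<integral>om. f' om h + f' om k \<partial>M)"
   by (rule Bochner_Integration.integral_cong) (auto simp: linear_add[OF lin])
  then show "(\<integral>om. f' om (h + k) \<partial>M) = (\<integral>om. f' om h \<partial>M) + (\<integral>om. f' om k \<partial>M)"
   using int' by simp
 next
  fix r h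
  have "(\<integral>om. f' om (r *\<^sub>R h) \<partial>M) = (\<integral>om. r * f' om h \<partial>M)"
   by (rule Bochner_Integration.integral_cong) (auto simp: linear_cmul[OF lin])
  then show "(\<integral>om. f' om (r *\<^sub>R h) \<partial>M) = r *\<^sub>R (\<integral>om. f' om h \<partial>M)" by simp
 next
  fix h
  have "norm (\<integral>om. f' om h \<partial>M) <= (\<integral>om. g om * norm h \<partial>M)"
   unfolding real_norm_def by (rule abs_integral_le) (use int' g bound in auto)
  then show "norm (\<integral>om. f' om h \<partial>M) <= norm h * (\<integral>om. g om \<partial>M)"
   by (simp add: mult.commute)
 qed
 show ?thesis
  unfolding has_derivative_within
 proof (intro conjI bl)
  show "((%y. (1 / norm (y - x)) *\<^sub>R ((\<integral>om. f y om \<partial>M) - ((\<integral>om. f x om \<partial>M) + (\<integral>om. f' om (y - x) \<partial>M))))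
    \<longlongrightarrow> 0) (at x within S)"
   unfolding tendsto_at_iff_sequentially
  proof (intro allI impI)
   fix X assume X: "\<forall>i. X i \<in> S - {x}" and lim: "X \<longlonglongrightarrow> x"
   let ?q = "%i om. (1 / norm (X i - x)) * (f (X i) om - (f x om + f' om (X i - x)))"
   have "(%i. \<integral>om. ?q i om \<partial>M) \<longlonglongrightarrow> (\<integral>om. 0 \<partial>M)"
   proof (rule integral_dominated_convergence[where w = "%om. 2 * g om"])
    show "integrable M (%om. 2 * g om)" using g by simp
    show "?q i \<in> borel_measurable M" for i
     using int[of "X i"] int[OF xS] X meas[of "X i - x"] by (auto intro!: borel_measurable_times borel_measurable_diff borel_measurable_add)
    show "AE om in M. (%i. ?q i om) \<longlonglongrightarrow> 0"
    proof (rule AE_I2)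
     fix om assume w: "om \<in> space M"
     have "((%y. (1 / norm (y - x)) *\<^sub>R (f y om - (f x om + f' om (y - x)))) \<longlongrightarrow> 0) (at x within S)"
      using der[OF w] unfolding has_derivative_within by auto
     then have "((%y. (1 / norm (y - x)) *\<^sub>R (f y om - (f x om + f' om (y - x)))) \<circ> X) \<longlonglongrightarrow> 0"
      using X lim unfolding tendsto_at_iff_sequentially by blast
     then show "(%i. ?q i om) \<longlonglongrightarrow> 0" by (simp add: o_def)
    qed
    show "AE om in M. norm (?q i om) <= 2 * g om" for i
    proof (rule AE_I2)
     fix om assume w: "om \<in> space M"
     have n: "norm (X i - x) > 0" using X by auto
     have "\<bar>f (X i) om - (f x om + f' om (X i - x))\<bar> <= 2 * g om * norm (X i - x)"
      using lip[of "X i" om] bound[of om "X i - x"] X w by (auto simp: abs_le_iff)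
     then show "norm (?q i om) <= 2 * g om"
      using n by (simp add: abs_mult field_simps)
    qed
   qed simp
   moreover have eq: "(\<integral>om. ?q i om \<partial>M) = (1 / norm (X i - x)) *
     ((\<integral>om. f (X i) om \<partial>M) - ((\<integral>om. f x om \<partial>M) + (\<integral>om. f' om (X i - x) \<partial>M)))" for i
    using int[of "X i"] int[OF xS] X int'[of "X i - x"] by simp
   moreover have z: "(\<integral>om. 0 \<partial>M) = (0::real)" by simp
   ultimately show "((%y. (1 / norm (y - x)) *\<^sub>R ((\<integral>om. f y om \<partial>M) - ((\<integral>om. f x om \<partial>M) + (\<integral>om. f' om (y - x) \<partial>M)))) \<circ> X) \<longlonglongrightarrow> 0"
    unfolding o_def real_scaleR_def eq z by blast
  qed
 qed
qed

lemma integrable_prod_components: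
 fixes f :: "real => real"
 assumes "integrable lborel f"
 shows "integrable lborel (%z::'a::euclidean_space. \<Prod>b\<in>Basis. f (z \<bullet> b))"
  and "(\<integral>z. (\<Prod>b\<in>Basis. f (z \<bullet> b)) \<partial>(lborel :: 'a measure)) = (LBINT u. f u) ^ DIM('a)"
proof -
 interpret product_sigma_finite "%_::'a. lborel :: real measure" ..
 have [measurable]: "f \<in> borel_measurable borel" using assms by auto
 have eq: "(\<Prod>b\<in>Basis. f ((\<Sum>c\<in>Basis. x c *\<^sub>R c) \<bullet> b)) = (\<Prod>b\<in>(Basis::'a set). f (x b))" for x
  by (rule prod.cong) (auto simp: inner_sum_left inner_Basis if_distrib cong: if_cong)
 have m: "(%x. \<Sum>c\<in>Basis. x c *\<^sub>R c) \<in> (\<Pi>\<^sub>M b\<in>Basis. lborel) \<rightarrow>\<^sub>M (borel :: 'a measure)" by measurable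
 show "integrable lborel (%z::'a. \<Prod>b\<in>Basis. f (z \<bullet> b))"
  unfolding lborel_eq[where 'a = 'a]
  by (subst integrable_distr_eq[OF m]) (auto simp: eq intro!: product_integrable_prod assms)
 show "(\<integral>z. (\<Prod>b\<in>Basis. f (z \<bullet> b)) \<partial>(lborel :: 'a measure)) = (LBINT u. f u) ^ DIM('a)"
  unfolding lborel_eq[where 'a = 'a]
  by (subst integral_distr[OF m]) (auto simp: eq assms intro!: trans[OF product_integral_prod])
qed

lemma lborel_affine_transfer:
 fixes f :: "'a::euclidean_space => real"
 assumes c: "c ~= 0"
 shows "integrable lborel (%x. f (t + c *\<^sub>R x)) \<longleftrightarrow> integrable lborel f"
  and "(LBINT x. f (t + c *\<^sub>R x)) = (LBINT x. f x) / \<bar>c\<bar> ^ DIM('a)"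
proof -
 have T: "(%x. t + c *\<^sub>R x) \<in> lborel \<rightarrow>\<^sub>M (borel :: 'a measure)" by measurable
 let ?T' = "%x. (- (1 / c) *\<^sub>R t) + (1 / c) *\<^sub>R x"
 have T': "?T' \<in> borel \<rightarrow>\<^sub>M (borel :: 'a measure)" by measurable
 have inv: "?T' (t + c *\<^sub>R x) = x" "t + c *\<^sub>R ?T' x = x" for x
  using c by (auto simp: algebra_simps)
 have ms: "(%x. f (t + c *\<^sub>R x)) \<in> borel_measurable borel \<longleftrightarrow> f \<in> borel_measurable borel"
 proof
  assume "(%x. f (t + c *\<^sub>R x)) \<in> borel_measurable borel"
  from measurable_compose[OF T' this] show "f \<in> borel_measurable borel" by (simp only: inv)
 next
  assume "f \<in> borel_measurable borel"
  then show "(%x. f (t + c *\<^sub>R x)) \<in> borel_measurable borel"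
   using measurable_compose[of "%x. t + c *\<^sub>R x" borel borel f] by auto
 qed
 have *: "lborel = density (distr lborel borel (%x. t + c *\<^sub>R x)) (%_. ennreal (\<bar>c\<bar> ^ DIM('a)))"
  using lborel_affine[OF c, of t] by (simp add: ennreal_power)
 have i: "integrable lborel f \<longleftrightarrow> integrable lborel (%x. f (t + c *\<^sub>R x))" if f: "f \<in> borel_measurable borel"
  by (subst *) (simp add: integrable_density integrable_distr_eq f c)
 show I: "integrable lborel (%x. f (t + c *\<^sub>R x)) \<longleftrightarrow> integrable lborel f"
 proof (cases "f \<in> borel_measurable borel")
  case False
  then have "\<not> integrable lborel f" "\<not> integrable lborel (%x. f (t + c *\<^sub>R x))"
   using ms borel_measurable_integrable[of lborel f]
    borel_measurable_integrable[of lborel "%x. f (t + c *\<^sub>R x)"] by auto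
  then show ?thesis by simp
 qed (use i in simp)
 have "(LBINT x. f x) = \<bar>c\<bar> ^ DIM('a) * (LBINT x. f (t + c *\<^sub>R x))" if f: "f \<in> borel_measurable borel"
  by (subst *) (simp add: integral_density integral_distr f c)
 moreover have "(LBINT x. f x) = 0 \<and> (LBINT x. f (t + c *\<^sub>R x)) = 0" if "f \<notin> borel_measurable borel"
 proof -
  have "\<not> integrable lborel f" "\<not> integrable lborel (%x. f (t + c *\<^sub>R x))"
   using that ms borel_measurable_integrable[of lborel f]
    borel_measurable_integrable[of lborel "%x. f (t + c *\<^sub>R x)"] by auto
  then show ?thesis by (simp add: not_integrable_integral_eq)
 qed
 ultimately show "(LBINT x. f (t + c *\<^sub>R x)) = (LBINT x. f x) / \<bar>c\<bar> ^ DIM('a)"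
  using c by (cases "f \<in> borel_measurable borel") auto
qed

lemma lborel_reflect:
 fixes f :: "'a::euclidean_space => real"
 shows "integrable lborel (%x. f (t - x)) \<longleftrightarrow> integrable lborel f"
  and "(LBINT x. f (t - x)) = (LBINT x. f x)"
 using lborel_affine_transfer[of "-1" f t] by simp_all

text \<open>The Beta integral on \<open>(0, T)\<close>; the power of \<open>T\<close> produced by scaling is the source of every Hoelder exponent below.\<close>
lemma Beta_convolution:
 fixes T :: real
 assumes "\<alpha> < 1" "-1 < q" "0 <= T"
 shows "set_integrable lborel {0<..<T} (%t'. (T - t') powr (- \<alpha>) * t' powr q)"
  and "(LINT t':{0<..<T}|lborel. (T - t') powr (- \<alpha>) * t' powr q) = Beta (1 + q) (1 - \<alpha>) * T powr (1 - \<alpha> + q)"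
proof -
 let ?f = "%t'. indicator {0<..<T} t' * ((T - t') powr (- \<alpha>) * t' powr q)"
 let ?g = "%t. t powr ((1 + q) - 1) * (1 - t) powr ((1 - \<alpha>) - 1)"
 have "integrable lborel ?f \<and> (LBINT t'. ?f t') = Beta (1 + q) (1 - \<alpha>) * T powr (1 - \<alpha> + q)"
 proof (cases "T = 0")
  case False
  then have T: "T > 0" using assms by simp
  have si: "set_integrable lborel {0..1} ?g" using assms by (intro integrable_Beta) auto
  have "(LINT t:{0..1}|lborel. ?g t) = integral {0..1} ?g"
   by (rule set_borel_integral_eq_integral(2)[OF si])
  also have "... = Beta (1 + q) (1 - \<alpha>)"
   using has_integral_Beta_real[of "1 + q" "1 - \<alpha>"] assms by (auto intro: integral_unique)
  finally have val: "(LBINT t. indicator {0..1} t * ?g t) = Beta (1 + q) (1 - \<alpha>)"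
   by (simp add: set_lebesgue_integral_def)
  have eq: "?f (0 + T *\<^sub>R t) = T powr (q - \<alpha>) * (indicator {0..1} t * ?g t)" if "t ~= 0" "t ~= 1" for t
  proof (cases "t \<in> {0<..<1}")
   case True
   have "?f (0 + T *\<^sub>R t) = (T * (1 - t)) powr (- \<alpha>) * (T * t) powr q"
    using T True by (auto simp: algebra_simps)
   also have "... = T powr (- \<alpha>) * (1 - t) powr (- \<alpha>) * (T powr q * t powr q)"
    using True T by (subst (1 2) powr_mult) auto
   also have "T powr (- \<alpha>) * (1 - t) powr (- \<alpha>) * (T powr q * t powr q) = T powr (q - \<alpha>) * (t powr q * (1 - t) powr (- \<alpha>))"
    using T by (simp add: powr_diff powr_minus field_simps)
   finally show ?thesis using True by simp
  next
   case False
   then show ?thesis using that T by (auto simp: indicator_def zero_less_mult_iff)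
  qed
  have AE: "AE t in lborel. ?f (0 + T *\<^sub>R t) = T powr (q - \<alpha>) * (indicator {0..1} t * ?g t)"
   using AE_lborel_singleton[of "0::real"] AE_lborel_singleton[of "1::real"]
   by eventually_elim (rule eq)
  have "integrable lborel (%t. ?f (0 + T *\<^sub>R t)) \<longleftrightarrow> integrable lborel (%t. T powr (q - \<alpha>) * (indicator {0..1} t * ?g t))"
   by (rule integrable_cong_AE[OF _ _ AE]) auto
  moreover have "integrable lborel (%t. T powr (q - \<alpha>) * (indicator {0..1} t * ?g t))"
   using si by (intro integrable_mult_right) (simp add: set_integrable_def)
  ultimately have 1: "integrable lborel ?f"
   using lborel_affine_transfer(1)[of T ?f 0] T by simp
  have "(LBINT t. ?f (0 + T *\<^sub>R t)) = (LBINT t. T powr (q - \<alpha>) * (indicator {0..1} t * ?g t))"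
   by (rule integral_cong_AE[OF _ _ AE]) auto
  also have "... = T powr (q - \<alpha>) * Beta (1 + q) (1 - \<alpha>)" using val by simp
  finally have "(LBINT t. ?f t) = T * (T powr (q - \<alpha>) * Beta (1 + q) (1 - \<alpha>))"
   using lborel_affine_transfer(2)[of T ?f 0] T by (simp add: field_simps)
  moreover have "T * T powr (q - \<alpha>) = T powr (1 - \<alpha> + q)"
   using T powr_add[of T 1 "q - \<alpha>"] by (simp add: algebra_simps)
  ultimately have "(LBINT t. ?f t) = Beta (1 + q) (1 - \<alpha>) * T powr (1 - \<alpha> + q)"
   by (metis mult.assoc mult.commute)
  with 1 show ?thesis by blast
 qed simp
 then show "set_integrable lborel {0<..<T} (%t'. (T - t') powr (- \<alpha>) * t' powr q)"
  and "(LINT t':{0<..<T}|lborel. (T - t') powr (- \<alpha>) * t' powr q) = Beta (1 + q) (1 - \<alpha>) * T powr (1 - \<alpha> + q)"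
  by (simp_all add: set_integrable_def set_lebesgue_integral_def)
qed

lemma Beta_real_pos: "0 < a ==> 0 < b ==> 0 < Beta a (b::real)"
 by (simp add: Beta_altdef rGamma_inverse_Gamma Gamma_real_pos)

lemma AE_components_nonzero:
 "AE z in (lborel :: 'a::euclidean_space measure). \<forall>b\<in>Basis. z \<bullet> b ~= 0"
proof (subst AE_finite_all)
 show "\<forall>b\<in>Basis. AE z in (lborel :: 'a measure). z \<bullet> b ~= 0"
 proof
  fix b :: 'a assume b: "b \<in> Basis"
  have "negligible {x. x \<bullet> b = 0}" by (rule negligible_standard_hyperplane[OF b])
  then have "AE x in lebesgue. x \<bullet> b ~= 0"
   unfolding negligible_iff_null_sets by (intro AE_I'[of "{x. x \<bullet> b = 0}"]) auto
  then show "AE z in (lborel :: 'a measure). z \<bullet> b ~= 0"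
   by (simp add: AE_completion_iff)
 qed
qed simp

lemma integrable_powr_near_0:
 assumes "r < (1::real)"
 shows "integrable lborel (%u::real. indicator {-1<..<1} u * \<bar>u\<bar> powr (- r))"
proof -
 have "set_integrable lborel {0<..<1} (%t'::real. (1 - t') powr (- 0) * t' powr (- r))"
  using assms by (intro Beta_convolution) auto
 then have 1: "integrable lborel (%u::real. indicator {0<..<1} u * u powr (- r))"
  unfolding set_integrable_def
  by (rule Bochner_Integration.integrable_cong[THEN iffD1, OF refl, rotated]) (auto split: split_indicator)
 have 2: "integrable lborel (%u::real. indicator {0<..<1} (-u) * (-u) powr (- r))"
  using lborel_reflect(1)[of "%u::real. indicator {0<..<1} u * u powr (- r)" 0] 1 by simp
 show ?thesis
  by (rule Bochner_Integration.integrable_cong[THEN iffD1, OF refl _ Bochner_Integration.integrable_add[OF 1 2]])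
    (auto split: split_indicator)
qed

text \<open>The singularity is bounded by a product over the coordinates, which avoids polar coordinates.\<close>
lemma integrable_norm_powr_ball:
 fixes s :: real
 assumes "0 <= s" "s < DIM('a)"
 shows "integrable lborel (%z::'a::euclidean_space. indicator (ball 0 1) z * norm z powr (- s))"
proof -
 define r where "r = s / DIM('a)"
 have r: "0 <= r" "r < 1" using assms by (auto simp: r_def)
 let ?f = "%u::real. indicator {-1<..<1} u * \<bar>u\<bar> powr (- r)"
 show ?thesis
 proof (rule Bochner_Integration.integrable_bound[OF integrable_prod_components(1)[OF integrable_powr_near_0[OF r(2)]]])
  show "AE z in lborel. norm (indicator (ball 0 1) z * norm z powr (- s)) <= norm (\<Prod>b\<in>Basis. ?f ((z::'a) \<bullet> b))"
   using AE_components_nonzero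
  proof eventually_elim
   case (elim z)
   show ?case
   proof (cases "z \<in> ball 0 1")
    case True
    have ib: "\<bar>z \<bullet> b\<bar> < 1" if "b \<in> Basis" for b
     using Basis_le_norm[OF that, of z] True by (auto simp: dist_norm)
    have z: "norm z > 0" using elim SOME_Basis by fastforce
    have "norm z powr (- s) = (\<Prod>b\<in>(Basis::'a set). norm z powr (- r))"
     using z by (simp add: r_def powr_power)
    also have "... <= (\<Prod>b\<in>(Basis::'a set). \<bar>z \<bullet> b\<bar> powr (- r))"
     using elim r Basis_le_norm[of _ z] by (intro prod_mono conjI powr_mono2') auto
    also have "... = (\<Prod>b\<in>Basis. ?f (z \<bullet> b))"
     using ib by (intro prod.cong) (auto simp: abs_less_iff)
    finally show ?thesis using True by (simp add: abs_of_nonneg prod_nonneg)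
   qed (simp)
  qed
 qed (intro borel_measurable_times borel_measurable_indicator, auto)
qed

lemma integrable_japanese_1:
 assumes "r > (1/2::real)"
 shows "integrable lborel (%u::real. (1 + u\<^sup>2) powr (- r))"
proof -
 have "((%x. x powr (- 2 * r)) has_integral - (1 powr (- 2 * r + 1)) / (- 2 * r + 1)) {1..}"
  using assms by (intro has_integral_powr_to_inf) auto
 then have "(%x::real. x powr (- 2 * r)) absolutely_integrable_on {1..}"
  by (intro nonnegative_absolutely_integrable_1) (auto simp: has_integral_integrable)
 then have "integrable lebesgue (%x::real. indicator {1..} x * x powr (- 2 * r))"
  by (simp add: set_integrable_def)
 then have 1: "integrable lborel (%x::real. indicator {1..} x * x powr (- 2 * r))"
  by (subst (asm) integrable_completion) auto
 have 2: "integrable lborel (%x::real. indicator {1..} (-x) * (-x) powr (- 2 * r))"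
  using lborel_reflect(1)[of "%x::real. indicator {1..} x * x powr (- 2 * r)" 0] 1 by simp
 have 3: "integrable lborel (%x::real. indicator {-1..1} x * 1 :: real)" by (simp add: emeasure_lborel_Icc_eq)
 show ?thesis
 proof (rule Bochner_Integration.integrable_bound[OF Bochner_Integration.integrable_add[OF Bochner_Integration.integrable_add[OF 1 2] 3]])
  show "AE u in lborel. norm ((1 + u\<^sup>2) powr (- r)) <= norm (indicator {1..} u * u powr (- 2 * r) + indicator {1..} (-u) * (-u) powr (- 2 * r) + indicator {-1..1} u * 1 :: real)"
  proof (rule AE_I2)
   fix u :: real
   have A: "(1 + u\<^sup>2) powr (- r) <= 1" using assms
    using powr_mono2'[of "- r" 1 "1 + u\<^sup>2"] by simp
   have B: "(1 + u\<^sup>2) powr (- r) <= \<bar>u\<bar> powr (- 2 * r)" if "\<bar>u\<bar> \<ge> 1"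
   proof -
    have "(1 + u\<^sup>2) powr (- r) <= (u\<^sup>2) powr (- r)" using assms that by (intro powr_mono2') auto
    also have "(u\<^sup>2) powr (- r) = \<bar>u\<bar> powr (- 2 * r)"
     using powr_powr[of "\<bar>u\<bar>" 2 "- r"] that by simp
    finally show ?thesis .
   qed
   have nn: "0 <= u powr (- 2 * r)" "0 <= (- u) powr (-2 * r)" by auto
   consider "u \<ge> 1" | "u <= -1" | "-1 < u" "u < 1" by linarith
   then show "norm ((1 + u\<^sup>2) powr (- r)) <= norm (indicator {1..} u * u powr (- 2 * r) + indicator {1..} (-u) * (-u) powr (- 2 * r) + indicator {-1..1} u * 1 :: real)"
    using A B nn by cases (auto simp: indicator_def)
  qed
 qed measurable
qed

lemma integrable_japanese:
 fixes s :: real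
 assumes "s > DIM('a) / 2"
 shows "integrable lborel (%z::'a::euclidean_space. (1 + (norm z)\<^sup>2) powr (- s))"
proof -
 define r where "r = s / DIM('a)"
 have r: "r > 1/2" using assms by (auto simp: r_def field_simps)
 show ?thesis
 proof (rule Bochner_Integration.integrable_bound[OF integrable_prod_components(1)[OF integrable_japanese_1[OF r]]])
  show "AE z in lborel. norm ((1 + (norm z)\<^sup>2) powr (- s)) <= norm (\<Prod>b\<in>Basis. (1 + ((z::'a) \<bullet> b)\<^sup>2) powr (- r))"
  proof (rule AE_I2)
   fix z :: 'a
   have pos: "0 < 1 + (norm z)\<^sup>2" by (simp add: add_pos_nonneg)
   have "(1 + (norm z)\<^sup>2) powr (- s) = (\<Prod>b\<in>(Basis::'a set). (1 + (norm z)\<^sup>2) powr (- r))"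
    using pos by (simp add: r_def powr_power)
   also have "... <= (\<Prod>b\<in>(Basis::'a set). (1 + (z \<bullet> b)\<^sup>2) powr (- r))"
   proof (intro prod_mono conjI powr_mono2')
    fix b :: 'a assume "b \<in> Basis"
    then have "\<bar>z \<bullet> b\<bar>\<^sup>2 <= (norm z)\<^sup>2" by (intro power_mono Basis_le_norm) auto
    then show "1 + (z \<bullet> b)\<^sup>2 <= 1 + (norm z)\<^sup>2" by simp
   qed (use r in \<open>auto simp: add_pos_nonneg\<close>)
   finally show "norm ((1 + (norm z)\<^sup>2) powr (- s)) <= norm (\<Prod>b\<in>Basis. (1 + (z \<bullet> b)\<^sup>2) powr (- r))"
    by (simp add: abs_of_nonneg prod_nonneg)
  qed
 qed (simp only: measurable_lborel2, intro borel_measurable_continuous_onI continuous_intros,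
    auto simp: add_nonneg_eq_0_iff)
qed

section \<open>Gaussian estimates\<close>

lemma heat_kernel_measurable [measurable]:
 fixes f :: "'b => 'a::euclidean_space"
 assumes [measurable]: "f \<in> borel_measurable M" "g \<in> borel_measurable M"
 shows "(%x. hk (f x) (g x)) \<in> borel_measurable M"
 unfolding heat_kernel_def by measurable

lemma heat_kernel_nonneg [simp]: "0 <= hk z t"
 by (simp add: heat_kernel_def)

lemma heat_kernel_minus [simp]: "hk (- z) t = hk z t"
 by (simp add: heat_kernel_def)

lemma heat_kernel_real:
 assumes "0 < t"
 shows "hk (u::real) t = normal_density 0 (sqrt (2 * t)) u"
proof -
 have "(4 * pi * t) powr (- (1/2)) = 1 / sqrt (4 * pi * t)"
  using powr_minus_divide[of "4 * pi * t" "1/2"] powr_half_sqrt[of "4 * pi * t"] assms by simp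
 then show ?thesis using assms by (simp add: heat_kernel_def normal_density_def)
qed

lemma heat_kernel_components:
 assumes "0 < t"
 shows "hk (z::'a::euclidean_space) t = (\<Prod>b\<in>Basis. hk (z \<bullet> b) t)"
proof -
 have "exp (- (norm z)\<^sup>2 / (4 * t)) = exp (\<Sum>b\<in>Basis. - (z \<bullet> b)\<^sup>2 / (4 * t))"
  by (simp add: norm_eq_sqrt_inner euclidean_inner[of z z] sum_nonneg power2_eq_square
    sum_negf sum_divide_distrib)
 also have "... = (\<Prod>b\<in>Basis. exp (- (z \<bullet> b)\<^sup>2 / (4 * t)))"
  by (simp add: exp_sum)
 finally show ?thesis
  using assms by (simp add: heat_kernel_def prod.distrib powr_power)
qed

lemma heat_kernel_integrable: "0 < t ==> integrable lborel (%z::'a::euclidean_space. hk z t)"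
 using integrable_prod_components(1)[of "%u. hk u t"]
 by (simp add: heat_kernel_components[where 'a = 'a] heat_kernel_real cong: prod.cong)

lemma heat_kernel_integral: "0 < t ==> (LBINT z. hk (z::'a::euclidean_space) t) = 1"
 using integrable_prod_components(2)[of "%u. hk u t"]
 by (simp add: heat_kernel_components[where 'a = 'a] heat_kernel_real cong: prod.cong)

lemma heat_kernel_Pair:
 assumes "0 < t"
 shows "hk (a::'a::euclidean_space, b::'b::euclidean_space) t = hk a t * hk b t"
proof -
 have "- (norm (a, b))\<^sup>2 / (4 * t) = - (norm a)\<^sup>2 / (4 * t) + - (norm b)\<^sup>2 / (4 * t)"
  by (simp add: norm_Pair add_divide_distrib diff_divide_distrib)
 then have 1: "exp (- (norm (a, b))\<^sup>2 / (4 * t)) = exp (- (norm a)\<^sup>2 / (4 * t)) * exp (- (norm b)\<^sup>2 / (4 * t))"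
  by (simp only: exp_add)
 have "- real DIM('a \<times> 'b) / 2 = - real DIM('a) / 2 + - real DIM('b) / 2"
  by (simp add: diff_divide_distrib)
 then have 2: "(4 * pi * t) powr (- real DIM('a \<times> 'b) / 2) = (4 * pi * t) powr (- real DIM('a) / 2) * (4 * pi * t) powr (- real DIM('b) / 2)"
  by (simp only: powr_add)
 show ?thesis unfolding heat_kernel_def 1 2 by (simp only: mult_ac)
qed

lemma heat_kernel_le: "0 < t ==> hk (z::'a::euclidean_space) t <= (4 * pi * t) powr (- real DIM('a) / 2)"
 by (simp add: heat_kernel_def mult_left_le)

lemma heat_kernel_real_le:
 assumes "0 < t"
 shows "hk (u::real) t <= t powr (- (1/2))"
proof -
 have "hk u t <= (4 * pi * t) powr (- (1/2))"
  using heat_kernel_le[OF assms, of u] by simp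
 also have "... <= t powr (- (1/2))"
  using assms pi_gt3 by (intro powr_mono2') auto
 finally show ?thesis .
qed

lemma heat_kernel_real_mono:
 assumes "0 < t" "\<bar>u\<bar> <= \<bar>v\<bar>"
 shows "hk (v::real) t <= hk u t"
 using assms by (auto simp: heat_kernel_def intro!: mult_left_mono divide_right_mono simp: abs_le_square_iff)

lemma heat_kernel_add_le:
 assumes "0 < t" "0 <= y" "0 <= z"
 shows "hk (y + z :: real) t <= sqrt (4 * pi * t) * hk y t * hk z t"
proof -
 let ?k = "(4 * pi * t) powr (- (1/2))"
 have k: "sqrt (4 * pi * t) * ?k = 1"
  using assms by (simp add: powr_minus powr_half_sqrt)
 have "exp (- (y + z)\<^sup>2 / (4 * t)) <= exp (- y\<^sup>2 / (4 * t)) * exp (- z\<^sup>2 / (4 * t))"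
 proof -
  have "- (y + z)\<^sup>2 / (4 * t) <= (- y\<^sup>2 + - z\<^sup>2) / (4 * t)"
   using assms by (intro divide_right_mono) (auto simp: power2_sum)
  then show ?thesis by (simp add: exp_add[symmetric] diff_divide_distrib)
 qed
 then have "?k * exp (- (y + z)\<^sup>2 / (4 * t)) <= ?k * (exp (- y\<^sup>2 / (4 * t)) * exp (- z\<^sup>2 / (4 * t)))"
  by (intro mult_left_mono) auto
 also have "... = sqrt (4 * pi * t) * ?k * (?k * (exp (- y\<^sup>2 / (4 * t)) * exp (- z\<^sup>2 / (4 * t))))"
  using k by simp
 finally show ?thesis by (simp add: heat_kernel_def mult_ac)
qed

lemma heat_kernel_double:
 assumes "0 < t"
 shows "hk (z::'a::euclidean_space) t
  = 2 powr (real DIM('a) / 2) * exp (- (norm z)\<^sup>2 / (8 * t)) * hk z (2 * t)"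
proof -
 have 1: "(4 * pi * t) powr (- real DIM('a) / 2) = 2 powr (real DIM('a) / 2) * (4 * pi * (2 * t)) powr (- real DIM('a) / 2)"
  using assms powr_mult[of 2 "4 * pi * t" "- real DIM('a) / 2"]
  by (simp add: powr_minus field_simps)
 have 2: "exp (- (norm z)\<^sup>2 / (4 * t)) = exp (- (norm z)\<^sup>2 / (8 * t)) * exp (- (norm z)\<^sup>2 / (4 * (2 * t)))"
  using assms by (simp add: exp_add[symmetric])
 show ?thesis unfolding heat_kernel_def 1 2 by simp
qed

definition gauss_const :: "'a::euclidean_space itself => real"
 where "gauss_const _ = (16 + 8 * DIM('a)) * 2 powr (real DIM('a) / 2)"

lemma gauss_const_pos: "0 < gauss_const TYPE('a::euclidean_space)"
 by (simp add: gauss_const_def)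

text \<open>Polynomial factors in \<open>norm z / sqrt t\<close> are absorbed by doubling the time in the Gaussian. All later derivative bounds have this form.\<close>
lemma heat_kernel_poly:
 assumes "0 < t"
 shows "(1 + DIM('a) + (norm z)\<^sup>2 / t) * hk (z::'a::euclidean_space) t <= gauss_const TYPE('a) * hk z (2 * t)"
proof -
 define v where "v = (norm z)\<^sup>2 / (8 * t)"
 have v: "0 <= v" using assms by (simp add: v_def)
 have "(1 + DIM('a) + 8 * v) * exp (- v) <= 16 + 8 * DIM('a)"
 proof -
  have e: "1 + v <= exp v" by (rule exp_ge_add_one_self)
  have "1 + DIM('a) + 8 * v <= (16 + 8 * DIM('a)) * (1 + v)"
   using v by (simp add: algebra_simps)
  also have "... <= (16 + 8 * DIM('a)) * exp v" using e by (intro mult_left_mono) auto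
  finally show ?thesis by (simp add: exp_minus field_simps)
 qed
 then have "((1 + DIM('a) + 8 * v) * exp (- v)) * (2 powr (real DIM('a) / 2) * hk z (2 * t))
   <= (16 + 8 * DIM('a)) * (2 powr (real DIM('a) / 2) * hk z (2 * t))"
  by (intro mult_right_mono) auto
 moreover have "8 * v = (norm z)\<^sup>2 / t" "exp (- (norm z)\<^sup>2 / (8 * t)) = exp (- v)"
  using assms by (simp_all add: v_def)
 ultimately show ?thesis
  unfolding heat_kernel_double[OF assms, of z] gauss_const_def by (simp only: mult_ac)
qed

lemma heat_kernel_le_double:
 assumes "0 < t"
 shows "hk (z::'a::euclidean_space) t <= gauss_const TYPE('a) * hk z (2 * t)"
proof -
 have "1 * hk z t <= (1 + DIM('a) + (norm z)\<^sup>2 / t) * hk z t"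
  using assms by (intro mult_right_mono) auto
 then show ?thesis using heat_kernel_poly[OF assms, of z] by linarith
qed

lemma heat_kernel_moment:
 assumes "0 < t"
 shows "norm z * hk (z::'a::euclidean_space) t <= gauss_const TYPE('a) * sqrt t * hk z (2 * t)"
proof -
 define r where "r = norm z / sqrt t"
 have r: "norm z = r * sqrt t" "r\<^sup>2 = (norm z)\<^sup>2 / t" using assms by (auto simp: r_def power_divide)
 have "0 <= r" "0 <= (r - 1)\<^sup>2" using assms by (auto simp: r_def)
 then have "r <= 1 + r\<^sup>2" by (simp add: power2_diff)
 then have "r * hk z t <= (1 + DIM('a) + (norm z)\<^sup>2 / t) * hk z t"
  unfolding r(2)[symmetric] by (intro mult_right_mono) auto
 also have "... <= gauss_const TYPE('a) * hk z (2 * t)" by (rule heat_kernel_poly[OF assms])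
 finally have "sqrt t * (r * hk z t) <= sqrt t * (gauss_const TYPE('a) * hk z (2 * t))"
  using assms by (intro mult_left_mono) auto
 then show ?thesis unfolding r(1) by (simp add: mult_ac)
qed

lemma heat_kernel_has_derivative:
 assumes "t ~= 0"
 shows "((%z. hk z t) has_derivative (%h. - (z \<bullet> h) / (2 * t) * hk z t)) (at z within S)"
 unfolding heat_kernel_def power2_norm_eq_inner
 using assms by (auto intro!: derivative_eq_intros simp: inner_commute field_simps)

lemma heat_kernel_gradient_bound:
 assumes "0 < t"
 shows "\<bar>- (z \<bullet> h) / (2 * t) * hk z t\<bar> <= gauss_const TYPE('a) * t powr (- (1/2)) * norm h * hk (z::'a::euclidean_space) (2 * t)"
proof -
 have "\<bar>- (z \<bullet> h) / (2 * t) * hk z t\<bar> = \<bar>z \<bullet> h\<bar> / (2 * t) * hk z t"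
  using assms by (simp add: abs_mult)
 also have "... <= (norm z * norm h) / t * hk z t"
  using assms Cauchy_Schwarz_ineq2[of z h] by (intro mult_right_mono frac_le) auto
 also have "... = norm h / t * (norm z * hk z t)" by simp
 also have "... <= norm h / t * (gauss_const TYPE('a) * sqrt t * hk z (2 * t))"
  using assms by (intro mult_left_mono heat_kernel_moment) auto
 also have "... = gauss_const TYPE('a) * t powr (- (1/2)) * norm h * hk z (2 * t)"
  using assms by (simp add: powr_minus powr_half_sqrt field_simps)
 finally show ?thesis .
qed

lemma heat_kernel_gradient_has_derivative:
 assumes "t ~= 0"
 shows "((%z. - (z \<bullet> h) / (2 * t) * hk z t) has_derivative
  (%k. ((z \<bullet> h) * (z \<bullet> k) / (4 * t\<^sup>2) - (k \<bullet> h) / (2 * t)) * hk z t)) (at z within S)"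
 using assms
 by (auto intro!: derivative_eq_intros heat_kernel_has_derivative simp: field_simps power2_eq_square)

lemma heat_kernel_hessian_bound:
 assumes "0 < t"
 shows "\<bar>((z \<bullet> h) * (z \<bullet> k) / (4 * t\<^sup>2) - (k \<bullet> h) / (2 * t)) * hk z t\<bar>
  <= gauss_const TYPE('a) / t * norm h * norm k * hk (z::'a::euclidean_space) (2 * t)"
proof -
 have "\<bar>(z \<bullet> h) * (z \<bullet> k)\<bar> <= (norm z * norm h) * (norm z * norm k)"
  unfolding abs_mult by (intro mult_mono Cauchy_Schwarz_ineq2) auto
 then have "\<bar>(z \<bullet> h) * (z \<bullet> k) / (4 * t\<^sup>2)\<bar> <= ((norm z * norm h) * (norm z * norm k)) / (4 * t\<^sup>2)"
  by (simp add: divide_right_mono)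
 also have "... = ((norm z)\<^sup>2 / t) / (4 * t) * (norm h * norm k)" by (simp add: power2_eq_square mult_ac)
 also have "... <= ((norm z)\<^sup>2 / t) / t * (norm h * norm k)"
  using assms by (intro mult_right_mono frac_le) auto
 finally have 1: "\<bar>(z \<bullet> h) * (z \<bullet> k) / (4 * t\<^sup>2)\<bar> <= ((norm z)\<^sup>2 / t) / t * (norm h * norm k)" .
 have "\<bar>(k \<bullet> h) / (2 * t)\<bar> <= (norm k * norm h) / t"
  using assms Cauchy_Schwarz_ineq2[of k h] by (auto intro!: frac_le)
 then have 2: "\<bar>(k \<bullet> h) / (2 * t)\<bar> <= 1 / t * (norm h * norm k)" by (simp add: mult.commute)
 have "\<bar>(z \<bullet> h) * (z \<bullet> k) / (4 * t\<^sup>2) - (k \<bullet> h) / (2 * t)\<bar> <= \<bar>(z \<bullet> h) * (z \<bullet> k) / (4 * t\<^sup>2)\<bar> + \<bar>(k \<bullet> h) / (2 * t)\<bar>"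
  by (rule abs_triangle_ineq4)
 also have "... <= ((norm z)\<^sup>2 / t) / t * (norm h * norm k) + 1 / t * (norm h * norm k)"
  by (rule add_mono[OF 1 2])
 also have "... = (1 + (norm z)\<^sup>2 / t) * (norm h * norm k / t)"
  by (simp add: add_divide_distrib algebra_simps)
 also have "... <= (1 + DIM('a) + (norm z)\<^sup>2 / t) * (norm h * norm k / t)"
  using assms by (intro mult_right_mono) auto
 finally have "\<bar>(z \<bullet> h) * (z \<bullet> k) / (4 * t\<^sup>2) - (k \<bullet> h) / (2 * t)\<bar> * hk z t
   <= (1 + DIM('a) + (norm z)\<^sup>2 / t) * (norm h * norm k / t) * hk z t"
  by (intro mult_right_mono) auto
 also have "... = (norm h * norm k / t) * ((1 + DIM('a) + (norm z)\<^sup>2 / t) * hk z t)" by simp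
 also have "... <= (norm h * norm k / t) * (gauss_const TYPE('a) * hk z (2 * t))"
  using assms by (intro mult_left_mono heat_kernel_poly) auto
 finally show ?thesis by (simp add: abs_mult mult_ac)
qed

lemma heat_kernel_time_derivative:
 assumes "0 < t"
 shows "((%t. hk (z::'a::euclidean_space) t) has_real_derivative
   ((norm z)\<^sup>2 / (4 * t\<^sup>2) - DIM('a) / (2 * t)) * hk z t) (at t)"
proof -
 have "(4 * pi * t) powr (- real DIM('a) / 2 - 1) = (4 * pi * t) powr (- real DIM('a) / 2) / (4 * pi * t)"
  using assms powr_diff[of "4 * pi * t" "- real DIM('a) / 2" 1] by simp
 then show ?thesis
  unfolding heat_kernel_def using assms
  by (auto intro!: derivative_eq_intros simp: field_simps power2_eq_square)
qed

text \<open>Within a time interval \<open>[s, 2 * s]\<close> all Gaussians are dominated by the one at time \<open>4 * s\<close>, so that the mean value theorem applies.\<close>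
lemma heat_kernel_time_difference:
 assumes "0 < s" "s <= t" "t <= 2 * s"
 shows "\<bar>hk z t - hk z s\<bar>
  <= gauss_const TYPE('a) * 2 powr (DIM('a) / 2) * (t - s) / s * hk (z::'a::euclidean_space) (4 * s)"
proof -
 let ?C = "gauss_const TYPE('a) * 2 powr (DIM('a) / 2) / s * hk z (4 * s)"
 have "norm (hk z t - hk z s) <= ?C * norm (t - s)"
 proof (rule field_differentiable_bound[where S = "{s..t}" and f' = "%t. ((norm z)\<^sup>2 / (4 * t\<^sup>2) - DIM('a) / (2 * t)) * hk z t"])
  fix r assume r: "r \<in> {s..t}"
  then have r0: "0 < r" "r <= 2 * s" using assms by auto
  show "((%t. hk z t) has_real_derivative
    ((norm z)\<^sup>2 / (4 * r\<^sup>2) - DIM('a) / (2 * r)) * hk z r) (at r within {s..t})"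
   using heat_kernel_time_derivative[OF r0(1), of z] by (rule has_field_derivative_at_within)
  have a: "(norm z)\<^sup>2 / (4 * r\<^sup>2) <= ((norm z)\<^sup>2 / r) / r"
   using r0 by (simp add: power2_eq_square frac_le)
  have b: "DIM('a) / (2 * r) <= DIM('a) / r" using r0 by (auto intro: frac_le)
  have nn: "0 <= (norm z)\<^sup>2 / (4 * r\<^sup>2)" "0 <= DIM('a) / (2 * r)" "0 <= 1 / r" using r0 by auto
  have "\<bar>(norm z)\<^sup>2 / (4 * r\<^sup>2) - DIM('a) / (2 * r)\<bar> <= 1 / r + DIM('a) / r + ((norm z)\<^sup>2 / r) / r"
   using a b nn by linarith
  also have "... = (1 + DIM('a) + (norm z)\<^sup>2 / r) / r" by (simp add: add_divide_distrib)
  finally have "\<bar>(norm z)\<^sup>2 / (4 * r\<^sup>2) - DIM('a) / (2 * r)\<bar> * hk z r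
    <= (1 + DIM('a) + (norm z)\<^sup>2 / r) / r * hk z r" by (intro mult_right_mono) auto
  also have "... = 1 / r * ((1 + DIM('a) + (norm z)\<^sup>2 / r) * hk z r)" by simp
  also have "... <= 1 / s * (gauss_const TYPE('a) * hk z (2 * r))"
   using r assms r0 by (intro mult_mono heat_kernel_poly) (auto intro!: frac_le)
  also have "hk z (2 * r) <= 2 powr (DIM('a) / 2) * hk z (4 * s)"
  proof -
   have "(4 * pi * (2 * r)) powr (- real DIM('a) / 2) <= (4 * pi * (2 * s)) powr (- real DIM('a) / 2)"
    using assms r by (intro powr_mono2') auto
   moreover have "exp (- (norm z)\<^sup>2 / (4 * (2 * r))) <= exp (- (norm z)\<^sup>2 / (4 * (4 * s)))"
    using assms r r0 by (auto intro!: divide_left_mono mult_pos_pos)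
   ultimately have "hk z (2 * r) <= (4 * pi * (2 * s)) powr (- real DIM('a) / 2) * exp (- (norm z)\<^sup>2 / (4 * (4 * s)))"
    unfolding heat_kernel_def by (intro mult_mono) auto
   also have "(4 * pi * (2 * s)) powr (- real DIM('a) / 2) = 2 powr (DIM('a) / 2) * (4 * pi * (4 * s)) powr (- real DIM('a) / 2)"
    using assms powr_mult[of 2 "4 * pi * (2 * s)" "- real DIM('a) / 2"]
    by (simp add: powr_minus field_simps)
   finally show ?thesis by (simp add: heat_kernel_def mult_ac)
  qed
  finally show "norm (((norm z)\<^sup>2 / (4 * r\<^sup>2) - DIM('a) / (2 * r)) * hk z r) <= ?C"
   using assms gauss_const_pos[where 'a = 'a] by (simp add: abs_mult mult_left_mono divide_right_mono mult_ac)
 qed (use assms in auto)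
 then show ?thesis using assms by (simp add: mult_ac)
qed

text \<open>The power of \<open>t\<close> is the one dictated by scaling: the Gaussian has the width \<open>sqrt t\<close>.\<close>
lemma heat_kernel_singular_integral:
 fixes \<beta> :: real
 assumes "\<beta> < 1" "0 <= \<beta>"
 obtains M where "0 < M"
  "!!t. 0 < t ==> integrable lborel (%y::real. indicator {0<..} y * y powr (- \<beta>) * hk y t)"
  "!!t. 0 < t ==> (LBINT y. indicator {0<..} y * y powr (- \<beta>) * hk (y::real) t) <= M * t powr (- \<beta> / 2)"
proof -
 let ?f = "%t y::real. indicator {0<..} y * y powr (- \<beta>) * hk y t"
 have i1: "integrable lborel (?f 1)"
 proof (rule Bochner_Integration.integrable_bound[OF Bochner_Integration.integrable_add[OF
    integrable_powr_near_0[OF assms(1)] heat_kernel_integrable[of 1]]])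
  show "AE y in lborel. norm (?f 1 y) <= norm (indicator {-1<..<1} y * \<bar>y\<bar> powr - \<beta> + hk y 1)"
  proof (rule AE_I2)
   fix y :: real
   have h: "hk y 1 <= 1" using heat_kernel_real_le[of 1 y] by simp
   consider "y <= 0" | "0 < y" "y < 1" | "1 <= y" by linarith
   then show "norm (?f 1 y) <= norm (indicator {-1<..<1} y * \<bar>y\<bar> powr - \<beta> + hk y 1)"
   proof cases
    case 2
    then have "y powr (- \<beta>) * hk y 1 <= y powr (- \<beta>) + hk y 1"
     using h by (intro add_increasing2 mult_left_le) auto
    then show ?thesis using 2 by (simp add: abs_mult)
   next
    case 3
    have "y powr (- \<beta>) <= 1"
     using powr_mono2'[of "- \<beta>" 1 y] 3 assms by simp
    then have "y powr (- \<beta>) * hk y 1 <= hk y 1"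
     by (intro mult_left_le_one_le) auto
    then show ?thesis using 3 by (simp add: abs_mult)
   qed auto
  qed
 qed auto
 have eq: "?f t (0 + sqrt t *\<^sub>R u) = t powr (- \<beta> / 2) / sqrt t * ?f 1 u" if "0 < t" for t u
 proof (cases "u > 0")
  case True
  have "(sqrt t * u) powr (- \<beta>) = t powr (- \<beta> / 2) * u powr (- \<beta>)"
  proof -
   have "sqrt t powr (- \<beta>) = t powr (- \<beta> / 2)"
    using powr_powr[of t "1/2" "- \<beta>"] powr_half_sqrt[of t] that by simp
   then show ?thesis using powr_mult[of "sqrt t" u "- \<beta>"] by simp
  qed
  moreover have "hk (sqrt t * u) t = hk u 1 / sqrt t"
  proof -
   have "(4 * pi * t) powr (- (1/2)) = (4 * pi) powr (- (1/2)) * t powr (- (1/2))"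
    using that by (intro powr_mult)
   then have "(4 * pi * t) powr (- (1/2)) = (4 * pi) powr (- (1/2)) / sqrt t"
    using that powr_minus_divide[of t "1/2"] powr_half_sqrt[of t] by simp
   moreover have "- (norm (sqrt t * u))\<^sup>2 / (4 * t) = - (norm u)\<^sup>2 / (4 * 1)"
    using that by (simp add: power_mult_distrib)
   moreover have "- real DIM(real) / 2 = - (1/2)" by simp
   ultimately show ?thesis unfolding heat_kernel_def by (simp only: mult_1_right) simp
  qed
  ultimately show ?thesis using True that by simp
 next
  case False
  then show ?thesis using that by (auto simp: indicator_def zero_less_mult_iff)
 qed
 have "integrable lborel (%u. ?f t (0 + sqrt t *\<^sub>R u))" if "0 < t" for t
  unfolding eq[OF that] using i1 by simp
 then have A: "integrable lborel (?f t)" if "0 < t" for t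
  using lborel_affine_transfer(1)[of "sqrt t" "?f t" 0] that by simp
 have B: "(LBINT y. ?f t y) = t powr (- \<beta> / 2) * (LBINT y. ?f 1 y)" if "0 < t" for t
 proof -
  have "(LBINT u. ?f t (0 + sqrt t *\<^sub>R u)) = t powr (- \<beta> / 2) / sqrt t * (LBINT y. ?f 1 y)"
   unfolding eq[OF that] by simp
  then show ?thesis
   using lborel_affine_transfer(2)[of "sqrt t" "?f t" 0] that by simp
 qed
 have nn: "0 <= (LBINT y. ?f 1 y)" by (intro Bochner_Integration.integral_nonneg) auto
 show ?thesis
 proof (rule that[of "(LBINT y. ?f 1 y) + 1"])
  show "0 < (LBINT y. ?f 1 y) + 1" using nn by linarith
  show "integrable lborel (?f t)" if "0 < t" for t using A[OF that] .
  show "(LBINT y. ?f t y) <= ((LBINT y. ?f 1 y) + 1) * t powr (- \<beta> / 2)" if "0 < t" for t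
   unfolding B[OF that] by (simp add: algebra_simps)
 qed
qed

section \<open>Time convolution with a singular kernel\<close>

lemma abs_integral_le_AE:
 fixes f g :: "'a => real"
 assumes g: "integrable M g" and le: "AE x in M. \<bar>f x\<bar> <= g x"
 shows "\<bar>\<integral>x. f x \<partial>M\<bar> <= (\<integral>x. g x \<partial>M)"
proof (cases "integrable M f")
 case True
 have "\<bar>\<integral>x. f x \<partial>M\<bar> <= (\<integral>x. \<bar>f x\<bar> \<partial>M)" using integral_norm_bound[of M f] by simp
 also have "... <= (\<integral>x. g x \<partial>M)" using True g le by (intro integral_mono_AE) auto
 finally show ?thesis .
next
 case False
 have "0 <= (\<integral>x. g x \<partial>M)" using le by (intro integral_nonneg_AE) (auto elim!: eventually_mono)
 with False show ?thesis by (simp add: not_integrable_integral_eq)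
qed

definition time_conv :: "real => (real => real) => real => real"
 where "time_conv \<alpha> f T = (LINT t':{0<..<T}|lborel. (T - t') powr (- \<alpha>) * f t')"

lemma time_conv_nonpos: "T <= 0 ==> time_conv \<alpha> f T = 0"
 by (simp add: time_conv_def set_lebesgue_integral_def)

lemma time_conv_max: "time_conv \<alpha> f (max T 0) = time_conv \<alpha> f T"
 by (cases "T <= 0") (auto simp: time_conv_nonpos)

lemma powr_sub_le:
 fixes a b q :: real
 assumes "0 <= a" "a <= b" "0 < q" "q <= 1"
 shows "b powr q - a powr q <= (b - a) powr q"
proof (cases "b = 0")
 case False
 then have b: "0 < b" using assms by simp
 have *: "c * b powr (q - 1) <= c powr q" if "0 <= c" "c <= b" for c
 proof (cases "c = 0")
  case False
  then have "b powr (q - 1) <= c powr (q - 1)" using that assms by (intro powr_mono2') auto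
  then have "c * b powr (q - 1) <= c * c powr (q - 1)" using that by (intro mult_left_mono)
  also have "... = c powr q" using False that powr_add[of c 1 "q - 1"] by simp
  finally show ?thesis .
 qed simp
 have "b powr q = a * b powr (q - 1) + (b - a) * b powr (q - 1)"
  using b powr_add[of b 1 "q - 1"] by (simp add: algebra_simps)
 then show ?thesis using *[of a] *[of "b - a"] assms by linarith
qed (use assms in auto)

lemma set_integrable_conv_bound:
 fixes f :: "real => real"
 assumes "\<alpha> < 1" "-1 < q" "0 <= T"
  and m: "set_borel_measurable lborel {0<..<T} f"
  and b: "!!t'. 0 < t' ==> t' < T ==> \<bar>f t'\<bar> <= C * t' powr q"
 shows "set_integrable lborel {0<..<T} (%t'. (T - t') powr (- \<alpha>) * f t')"
 unfolding set_integrable_def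
proof (rule Bochner_Integration.integrable_bound)
 show "integrable lborel (%t'. C * (indicator {0<..<T} t' *\<^sub>R ((T - t') powr (- \<alpha>) * t' powr q)))"
  using Beta_convolution(1)[OF assms(1-3)] by (auto simp: set_integrable_def)
 have "(%t'. (T - t') powr (- \<alpha>) * (indicator {0<..<T} t' *\<^sub>R f t')) \<in> borel_measurable lborel"
  using m unfolding set_borel_measurable_def by (intro borel_measurable_times) auto
 then show "(%t'. indicator {0<..<T} t' *\<^sub>R ((T - t') powr (- \<alpha>) * f t')) \<in> borel_measurable lborel"
  by (simp add: mult_ac)
 show "AE t' in lborel. norm (indicator {0<..<T} t' *\<^sub>R ((T - t') powr (- \<alpha>) * f t'))
  <= norm (C * (indicator {0<..<T} t' *\<^sub>R ((T - t') powr (- \<alpha>) * t' powr q)))"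
 proof (rule AE_I2)
  fix t' :: real
  have "(T - t') powr (- \<alpha>) * \<bar>f t'\<bar> <= \<bar>C * ((T - t') powr (- \<alpha>) * t' powr q)\<bar>" if "0 < t'" "t' < T"
  proof -
   have "(T - t') powr (- \<alpha>) * \<bar>f t'\<bar> <= (T - t') powr (- \<alpha>) * (C * t' powr q)"
    using b[OF that] by (intro mult_left_mono) auto
   also have "... <= \<bar>C * ((T - t') powr (- \<alpha>) * t' powr q)\<bar>"
    by (simp add: mult_ac)
   finally show ?thesis .
  qed
  then show "norm (indicator {0<..<T} t' *\<^sub>R ((T - t') powr (- \<alpha>) * f t'))
   <= norm (C * (indicator {0<..<T} t' *\<^sub>R ((T - t') powr (- \<alpha>) * t' powr q)))"
   by (auto simp: abs_mult indicator_def)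
 qed
qed

lemma time_conv_bound:
 assumes "\<alpha> < 1" "-1 < q" "0 <= T"
  and b: "!!t'. 0 < t' ==> t' < T ==> \<bar>f t'\<bar> <= C * t' powr q"
 shows "\<bar>time_conv \<alpha> f T\<bar> <= C * Beta (1 + q) (1 - \<alpha>) * T powr (1 - \<alpha> + q)"
proof -
 have "\<bar>time_conv \<alpha> f T\<bar> <= (LBINT t'. C * (indicator {0<..<T} t' *\<^sub>R ((T - t') powr (- \<alpha>) * t' powr q)))"
  unfolding time_conv_def set_lebesgue_integral_def
 proof (rule abs_integral_le)
  show "integrable lborel (%t'. C * (indicator {0<..<T} t' *\<^sub>R ((T - t') powr (- \<alpha>) * t' powr q)))"
   using Beta_convolution(1)[OF assms(1-3)] by (auto simp: set_integrable_def)
  fix t' :: real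
  have "(T - t') powr (- \<alpha>) * \<bar>f t'\<bar> <= C * ((T - t') powr (- \<alpha>) * t' powr q)" if "0 < t'" "t' < T"
   using mult_left_mono[OF b[OF that], of "(T - t') powr (- \<alpha>)"] by (simp add: mult_ac)
  then show "\<bar>indicator {0<..<T} t' *\<^sub>R ((T - t') powr (- \<alpha>) * f t')\<bar>
    <= C * (indicator {0<..<T} t' *\<^sub>R ((T - t') powr (- \<alpha>) * t' powr q))"
   by (auto simp: abs_mult indicator_def)
 qed
 also have "... = C * (Beta (1 + q) (1 - \<alpha>) * T powr (1 - \<alpha> + q))"
  using Beta_convolution(2)[OF assms(1-3)] by (simp add: set_lebesgue_integral_def)
 finally show ?thesis by simp
qed

lemma time_conv_diff:
 assumes "set_integrable lborel {0<..<T} (%t'. (T - t') powr (- \<alpha>) * f t')"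
  and "set_integrable lborel {0<..<T} (%t'. (T - t') powr (- \<alpha>) * g t')"
 shows "time_conv \<alpha> f T - time_conv \<alpha> g T = time_conv \<alpha> (%t'. f t' - g t') T"
 unfolding time_conv_def using set_integral_diff(2)[OF assms] by (simp add: algebra_simps)

lemma time_conv_reflect:
 "time_conv \<alpha> f T = (LBINT \<sigma>. indicator {0<..<T} \<sigma> * (\<sigma> powr (- \<alpha>) * f (T - \<sigma>)))"
proof -
 have "time_conv \<alpha> f T = (LBINT t'. indicator {0<..<T} t' * ((T - t') powr (- \<alpha>) * f t'))"
  by (simp add: time_conv_def set_lebesgue_integral_def)
 also have "... = (LBINT \<sigma>. indicator {0<..<T} (T - \<sigma>) * ((T - (T - \<sigma>)) powr (- \<alpha>) * f (T - \<sigma>)))"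
  by (rule lborel_reflect(2)[symmetric])
 also have "... = (LBINT \<sigma>. indicator {0<..<T} \<sigma> * (\<sigma> powr (- \<alpha>) * f (T - \<sigma>)))"
  by (rule Bochner_Integration.integral_cong) (auto simp: indicator_def)
 finally show ?thesis .
qed

lemma set_integrable_reflect:
 fixes f :: "real => real"
 assumes "set_integrable lborel {0<..<T} (%t'. (T - t') powr (- \<alpha>) * f t')"
 shows "integrable lborel (%\<sigma>. indicator {0<..<T} \<sigma> * (\<sigma> powr (- \<alpha>) * f (T - \<sigma>)))"
proof -
 have "integrable lborel (%\<sigma>. indicator {0<..<T} (T - \<sigma>) * ((T - (T - \<sigma>)) powr (- \<alpha>) * f (T - \<sigma>)))"
  using lborel_reflect(1)[of "%t'. indicator {0<..<T} t' * ((T - t') powr (- \<alpha>) * f t')" T] assms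
  by (simp add: set_integrable_def)
 then show ?thesis
  by (rule Bochner_Integration.integrable_cong[THEN iffD1, rotated -1]) (auto simp: indicator_def)
qed

text \<open>After a substitution that moves \<open>T\<close> into \<open>f\<close>, the increment of \<open>f\<close> is controlled by the increment of \<open>C * t powr p\<close>; so the
increment of the convolution is at most that of the convolution of this power, which is a Beta integral. The hypothesis on increments, a monotone
majorant, is what makes the argument free of singular integrals.\<close>
lemma time_conv_increment:
 assumes \<alpha>: "\<alpha> < 1" and p: "0 < p" "1 - \<alpha> + p <= 1" and T: "0 <= T1" "T1 <= T2"
  and m: "set_borel_measurable lborel {0<..<T2} f"
  and b: "!!t'. 0 < t' ==> t' < T2 ==> \<bar>f t'\<bar> <= C * t' powr p"
  and d: "!!t'1 t'2. 0 < t'1 ==> t'1 <= t'2 ==> t'2 < T2 ==> \<bar>f t'2 - f t'1\<bar> <= C * (t'2 powr p - t'1 powr p)"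
  and C: "0 <= C"
 shows "\<bar>time_conv \<alpha> f T2 - time_conv \<alpha> f T1\<bar> <= C * Beta (1 + p) (1 - \<alpha>) * (T2 - T1) powr (1 - \<alpha> + p)"
proof -
 have m1: "set_borel_measurable lborel {0<..<T1} f"
  by (rule set_borel_measurable_subset[OF m]) (use T in auto)
 let ?I = "%T g \<sigma>. indicator {0<..<T} \<sigma> * (\<sigma> powr (- \<alpha>) * g (T - \<sigma>)) :: real"
 let ?P = "%t'::real. t' powr p"
 have q: "-1 < p" using p by simp
 have iP: "integrable lborel (?I T1 ?P)" "integrable lborel (?I T2 ?P)"
  using T by (intro set_integrable_reflect Beta_convolution \<alpha> q; simp)+
 have if2: "integrable lborel (?I T2 f)"
  by (intro set_integrable_reflect set_integrable_conv_bound[OF \<alpha> q _ m b]) (use T in auto)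
 have if1: "integrable lborel (?I T1 f)"
  by (intro set_integrable_reflect set_integrable_conv_bound[OF \<alpha> q _ m1 b]) (use T in auto)
 have "\<bar>time_conv \<alpha> f T2 - time_conv \<alpha> f T1\<bar> = \<bar>LBINT \<sigma>. ?I T2 f \<sigma> - ?I T1 f \<sigma>\<bar>"
  unfolding time_conv_reflect using if1 if2 by simp
 also have "... <= (LBINT \<sigma>. C * (?I T2 ?P \<sigma> - ?I T1 ?P \<sigma>))"
 proof (rule abs_integral_le)
  show "integrable lborel (%\<sigma>. C * (?I T2 ?P \<sigma> - ?I T1 ?P \<sigma>))" using iP by simp
  fix \<sigma> :: real
  consider "\<sigma> <= 0 \<or> T2 <= \<sigma>" | "0 < \<sigma>" "\<sigma> < T1" | "0 < \<sigma>" "T1 <= \<sigma>" "\<sigma> < T2" by linarith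
  then show "\<bar>?I T2 f \<sigma> - ?I T1 f \<sigma>\<bar> <= C * (?I T2 ?P \<sigma> - ?I T1 ?P \<sigma>)"
  proof cases
   case 1
   then show ?thesis using T by auto
  next
   case 2
   have "\<bar>f (T2 - \<sigma>) - f (T1 - \<sigma>)\<bar> <= C * ((T2 - \<sigma>) powr p - (T1 - \<sigma>) powr p)"
    using 2 T by (intro d) auto
   from mult_left_mono[OF this, of "\<sigma> powr (- \<alpha>)"]
   have "\<bar>\<sigma> powr (- \<alpha>) * (f (T2 - \<sigma>) - f (T1 - \<sigma>))\<bar> <= C * (\<sigma> powr (- \<alpha>) * ((T2 - \<sigma>) powr p - (T1 - \<sigma>) powr p))"
    by (simp add: abs_mult mult_ac)
   then show ?thesis using 2 T by (simp add: right_diff_distrib)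
  next
   case 3
   have "\<bar>f (T2 - \<sigma>)\<bar> <= C * (T2 - \<sigma>) powr p" using 3 T by (intro b) auto
   from mult_left_mono[OF this, of "\<sigma> powr (- \<alpha>)"]
   have "\<bar>\<sigma> powr (- \<alpha>) * f (T2 - \<sigma>)\<bar> <= C * (\<sigma> powr (- \<alpha>) * (T2 - \<sigma>) powr p)"
    by (simp add: abs_mult mult_ac)
   then show ?thesis using 3 T by simp
  qed
 qed
 also have "... = C * (time_conv \<alpha> ?P T2 - time_conv \<alpha> ?P T1)"
  unfolding time_conv_reflect using iP by simp
 also have "... = C * (Beta (1 + p) (1 - \<alpha>) * (T2 powr (1 - \<alpha> + p) - T1 powr (1 - \<alpha> + p)))"
  unfolding time_conv_def using T by (simp add: Beta_convolution(2)[OF \<alpha> q] right_diff_distrib)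
 also have "... <= C * (Beta (1 + p) (1 - \<alpha>) * (T2 - T1) powr (1 - \<alpha> + p))"
  using T p \<alpha> C Beta_real_pos[of "1 + p" "1 - \<alpha>"] by (intro mult_left_mono powr_sub_le) auto
 finally show ?thesis by simp
qed

text \<open>The counterpart for kernels that blow up at 0.\<close>
lemma time_conv_increment_singular:
 assumes \<alpha>: "0 <= \<alpha>" "\<alpha> < 1" and b: "0 <= b" "b < 1" "\<alpha> + b <= 1" and T: "0 <= T1" "T1 <= T2"
  and m: "set_borel_measurable lborel {0<..<T2} f"
  and fb: "!!t'. 0 < t' ==> t' < T2 ==> \<bar>f t'\<bar> <= C * t' powr (- b)"
  and C: "0 <= C"
 shows "\<bar>time_conv \<alpha> f T2 - time_conv \<alpha> f T1\<bar> <= 2 * C * Beta (1 - b) (1 - \<alpha>) * (T2 - T1) powr (1 - \<alpha> - b)"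
proof -
 have m1: "set_borel_measurable lborel {0<..<T1} f"
  by (rule set_borel_measurable_subset[OF m]) (use T in auto)
 have q: "-1 < - b" using b by simp
 let ?k = "%T t'. indicator {0<..<T} t' * (T - t') powr (- \<alpha>) :: real"
 let ?P = "%t'::real. t' powr (- b)"
 have iP: "integrable lborel (%t'. ?k T t' * ?P t')" if "0 <= T" for T
  using Beta_convolution(1)[OF \<alpha>(2) q that] by (simp add: set_integrable_def mult_ac)
 have vP: "(LBINT t'. ?k T t' * ?P t') = Beta (1 - b) (1 - \<alpha>) * T powr (1 - \<alpha> - b)" if "0 <= T" for T
  using Beta_convolution(2)[OF \<alpha>(2) q that] by (simp add: set_lebesgue_integral_def mult_ac)
 have if2: "integrable lborel (%t'. ?k T2 t' * f t')"
  using set_integrable_conv_bound[OF \<alpha>(2) q _ m fb] T by (simp add: set_integrable_def mult_ac)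
 have if1: "integrable lborel (%t'. ?k T1 t' * f t')"
  using set_integrable_conv_bound[OF \<alpha>(2) q _ m1 fb] T by (simp add: set_integrable_def mult_ac)
 let ?R = "%t'. ?k (T2 - T1) (- T1 + 1 *\<^sub>R t') * ?P (- T1 + 1 *\<^sub>R t')"
 have iR: "integrable lborel ?R"
  using lborel_affine_transfer(1)[of 1 "%t'. ?k (T2 - T1) t' * ?P t'" "- T1"] iP[of "T2 - T1"] T by simp
 have vR: "(LBINT t'. ?R t') = Beta (1 - b) (1 - \<alpha>) * (T2 - T1) powr (1 - \<alpha> - b)"
  using lborel_affine_transfer(2)[of 1 "%t'. ?k (T2 - T1) t' * ?P t'" "- T1"] vP[of "T2 - T1"] T by simp
 have tc: "time_conv \<alpha> f T = (LBINT t'. ?k T t' * f t')" for T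
  by (simp add: time_conv_def set_lebesgue_integral_def mult_ac)
 have "\<bar>time_conv \<alpha> f T2 - time_conv \<alpha> f T1\<bar> = \<bar>LBINT t'. ?k T2 t' * f t' - ?k T1 t' * f t'\<bar>"
  unfolding tc using if1 if2 by simp
 also have "... <= (LBINT t'. C * (?k T1 t' * ?P t' - ?k T2 t' * ?P t' + 2 * ?R t'))"
 proof (rule abs_integral_le_AE)
  show "integrable lborel (%t'. C * (?k T1 t' * ?P t' - ?k T2 t' * ?P t' + 2 * ?R t'))"
   using iP[of T1] iP[of T2] iR T by simp
  have pw: "\<bar>?k T2 t' * f t' - ?k T1 t' * f t'\<bar> <= C * (?k T1 t' * ?P t' - ?k T2 t' * ?P t' + 2 * ?R t')"
   if ne: "t' ~= T1" for t'
  proof -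
  consider "t' <= 0 \<or> T2 <= t'" | "0 < t'" "t' < T1" | "0 < t'" "T1 < t'" "t' < T2" using ne by linarith
  then show ?thesis
  proof cases
   case 1
   then show ?thesis using T C by (auto simp: indicator_def)
  next
   case 2
   have le: "(T2 - t') powr (- \<alpha>) <= (T1 - t') powr (- \<alpha>)"
    using 2 T \<alpha> by (intro powr_mono2') auto
   have "\<bar>((T2 - t') powr (- \<alpha>) - (T1 - t') powr (- \<alpha>)) * f t'\<bar>
     = ((T1 - t') powr (- \<alpha>) - (T2 - t') powr (- \<alpha>)) * \<bar>f t'\<bar>"
    using le by (simp add: abs_mult)
   also have "... <= ((T1 - t') powr (- \<alpha>) - (T2 - t') powr (- \<alpha>)) * (C * ?P t')"
    using le 2 T by (intro mult_left_mono fb) auto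
   finally show ?thesis using 2 T by (simp add: indicator_def algebra_simps)
  next
   case 3
   define k where "k = (T2 - t') powr (- \<alpha>)"
   define P where "P = ?P t'"
   define R where "R = ?P (t' - T1)"
   have A: "k * \<bar>f t'\<bar> <= k * (C * P)"
    unfolding k_def P_def using 3 by (intro mult_left_mono fb) auto
   have B: "k * (C * P) <= k * (C * R)"
    unfolding k_def P_def R_def using 3 T b C by (intro mult_left_mono powr_mono2') auto
   have "C * (0 - k * P + 2 * (k * R)) - k * \<bar>f t'\<bar> = 2 * (k * (C * R) - k * (C * P)) + (k * (C * P) - k * \<bar>f t'\<bar>)"
    by (simp add: algebra_simps)
   also have "... \<ge> 0" using A B by (intro add_nonneg_nonneg mult_nonneg_nonneg) simp_all
   finally have "k * \<bar>f t'\<bar> <= C * (0 - k * P + 2 * (k * R))" by (simp only: diff_ge_0_iff_ge)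
   then show ?thesis using 3 T by (simp add: indicator_def abs_mult k_def P_def R_def)
  qed
  qed
  show "AE t' in lborel. \<bar>?k T2 t' * f t' - ?k T1 t' * f t'\<bar> <= C * (?k T1 t' * ?P t' - ?k T2 t' * ?P t' + 2 * ?R t')"
   using AE_lborel_singleton[of T1] by eventually_elim (rule pw)
 qed
 also have "... = C * (Beta (1 - b) (1 - \<alpha>) * (T1 powr (1 - \<alpha> - b) - T2 powr (1 - \<alpha> - b) + 2 * (T2 - T1) powr (1 - \<alpha> - b)))"
 proof -
  have "(LBINT t'. C * (?k T1 t' * ?P t' - ?k T2 t' * ?P t' + 2 * ?R t'))
    = C * ((LBINT t'. ?k T1 t' * ?P t') - (LBINT t'. ?k T2 t' * ?P t') + 2 * (LBINT t'. ?R t'))"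
   using iP[of T1] iP[of T2] iR T by simp
  then show ?thesis using vR vP[of T1] vP[of T2] T by (simp add: algebra_simps)
 qed
 also have "... <= C * (Beta (1 - b) (1 - \<alpha>) * (2 * (T2 - T1) powr (1 - \<alpha> - b)))"
 proof -
  have "T1 powr (1 - \<alpha> - b) <= T2 powr (1 - \<alpha> - b)"
   using T b by (intro powr_mono2) auto
  then show ?thesis
   using C Beta_real_pos[of "1 - b" "1 - \<alpha>"] b \<alpha> by (intro mult_left_mono) auto
 qed
 finally show ?thesis by (simp add: mult_ac)
qed

text \<open>The scaling laws of a kernel that lives on the length scale \<open>sqrt t\<close> and has size \<open>t powr p\<close>: a space derivative costs
\<open>t powr (- 1/2)\<close>, a time derivative \<open>1 / t\<close>, and a Hoelder difference of order \<open>\<sigma>\<close> of the gradient costs \<open>t powr (- \<sigma> / 2)\<close>. The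
function \<open>\<theta>'\<close> is the spatial derivative within \<open>S\<close>.\<close>
definition singular_kernel_by ::
  "real => ('a::euclidean_space => real => 'a => real) => real => real => 'a set => ('a => real => real) => bool"
 where "singular_kernel_by C \<theta>' p \<sigma> S \<theta> \<longleftrightarrow> 0 <= C \<and>
  (\<forall>x\<in>S. \<forall>t'\<in>{0<..<1}. \<bar>\<theta> x t'\<bar> <= C * t' powr p) \<and>
  (\<forall>x\<in>S. \<forall>y\<in>S. \<forall>t'\<in>{0<..<1}. \<bar>\<theta> x t' - \<theta> y t'\<bar> <= C * t' powr (p - 1/2) * norm (x - y)) \<and>
  (\<forall>x\<in>S. \<forall>t'1 t'2. 0 < t'1 --> t'1 <= t'2 --> t'2 <= 2 * t'1 --> t'2 < 1 -->
    \<bar>\<theta> x t'2 - \<theta> x t'1\<bar> <= C * t'1 powr (p - 1) * (t'2 - t'1)) \<and>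
  (\<forall>x\<in>S. \<forall>t'\<in>{0<..<1}. ((%y. \<theta> y t') has_derivative \<theta>' x t') (at x within S)) \<and>
  (\<forall>x\<in>S. \<forall>t'\<in>{0<..<1}. \<forall>h. \<bar>\<theta>' x t' h\<bar> <= C * t' powr (p - 1/2) * norm h) \<and>
  (\<forall>x\<in>S. \<forall>y\<in>S. \<forall>t'\<in>{0<..<1}. \<forall>h.
    \<bar>\<theta>' x t' h - \<theta>' y t' h\<bar> <= C * t' powr (p - (1 + \<sigma>) / 2) * norm (x - y) powr \<sigma> * norm h)"

definition singular_kernel ::
  "real => real => 'a::euclidean_space set => ('a => real => real) => bool"
 where "singular_kernel p \<sigma> S \<theta> \<longleftrightarrow> (\<exists>C \<theta>'. singular_kernel_by C \<theta>' p \<sigma> S \<theta>)"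

text \<open>From each point a ray in every coordinate direction stays in the set, so that derivatives within the set are limits of difference quotients along
sequences; this gives their measurability in time.\<close>
definition has_rays :: "'a::euclidean_space set => bool"
 where "has_rays S \<longleftrightarrow> (\<forall>x\<in>S. \<forall>b\<in>Basis. \<exists>c\<in>{b, - b}. \<forall>s\<ge>0. x + s *\<^sub>R c \<in> S)"

lemma singular_kernel_byD:
 assumes "singular_kernel_by C \<theta>' p \<sigma> S \<theta>"
 shows "0 <= C"
  and "x \<in> S ==> 0 < t' ==> t' < 1 ==> \<bar>\<theta> x t'\<bar> <= C * t' powr p"
  and "x \<in> S ==> y \<in> S ==> 0 < t' ==> t' < 1 ==> \<bar>\<theta> x t' - \<theta> y t'\<bar> <= C * t' powr (p - 1/2) * norm (x - y)"
  and "x \<in> S ==> 0 < t'1 ==> t'1 <= t'2 ==> t'2 <= 2 * t'1 ==> t'2 < 1 ==>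
    \<bar>\<theta> x t'2 - \<theta> x t'1\<bar> <= C * t'1 powr (p - 1) * (t'2 - t'1)"
  and "x \<in> S ==> 0 < t' ==> t' < 1 ==> ((%y. \<theta> y t') has_derivative \<theta>' x t') (at x within S)"
  and "x \<in> S ==> 0 < t' ==> t' < 1 ==> \<bar>\<theta>' x t' h\<bar> <= C * t' powr (p - 1/2) * norm h"
  and "x \<in> S ==> y \<in> S ==> 0 < t' ==> t' < 1 ==>
    \<bar>\<theta>' x t' h - \<theta>' y t' h\<bar> <= C * t' powr (p - (1 + \<sigma>) / 2) * norm (x - y) powr \<sigma> * norm h"
 using assms unfolding singular_kernel_by_def by auto

lemma powr_increment_lower:
 fixes p a b :: real
 assumes "0 < p" "p <= 1" "0 < a" "a <= b" "b <= 2 * a"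
 shows "a powr (p - 1) * (b - a) <= 2 powr (1 - p) / p * (b powr p - a powr p)"
proof (cases "a = b")
 case False
 then have ab: "a < b" using assms by simp
 have "\<exists>z>a. z < b \<and> b powr p - a powr p = (b - a) * (p * z powr (p - 1))"
  using assms ab by (intro MVT2) (auto intro!: derivative_eq_intros)
 then obtain z where z: "a < z" "z < b" and eq: "b powr p - a powr p = (b - a) * (p * z powr (p - 1))" by auto
 have "(2 * a) powr (p - 1) <= z powr (p - 1)" using z assms by (intro powr_mono2') auto
 moreover have "(2 * a) powr (p - 1) = 2 powr (p - 1) * a powr (p - 1)" by (rule powr_mult)
 moreover have "2 powr (1 - p) * (2 powr (p - 1)) = (1::real)" by (simp add: powr_add[symmetric])
 ultimately have "a powr (p - 1) <= 2 powr (1 - p) * z powr (p - 1)"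
  by (metis mult.assoc mult_1 mult_left_mono powr_ge_zero)
 then have "a powr (p - 1) * (b - a) <= 2 powr (1 - p) * z powr (p - 1) * (b - a)"
  using ab by (intro mult_right_mono) auto
 also have "... = 2 powr (1 - p) / p * (b powr p - a powr p)" unfolding eq using assms by simp
 finally show ?thesis .
qed simp

lemma singular_kernel_time_increment:
 assumes K: "singular_kernel_by C \<theta>' p \<sigma> S \<theta>" and p: "0 < p" "p <= 1"
 obtains C' where "C <= C'" "!!x t'1 t'2. x \<in> S ==> 0 < t'1 ==> t'1 <= t'2 ==> t'2 < 1 ==>
   \<bar>\<theta> x t'2 - \<theta> x t'1\<bar> <= C' * (t'2 powr p - t'1 powr p)"
proof -
 note D = singular_kernel_byD[OF K]
 define c where "c = 1 - 2 powr (- p)"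
 have c: "0 < c"
  using powr_less_mono[of "- p" 0 2] p by (simp add: c_def)
 define C' where "C' = C + C * (2 powr (1 - p) / p) + 2 * C / c"
 have nn: "0 <= C" "0 <= C * (2 powr (1 - p) / p)" "0 <= 2 * C / c" using D(1) c p by auto
 have "\<bar>\<theta> x t'2 - \<theta> x t'1\<bar> <= C' * (t'2 powr p - t'1 powr p)" if x: "x \<in> S" and t: "0 < t'1" "t'1 <= t'2" "t'2 < 1" for x t'1 t'2
 proof -
  have m: "0 <= t'2 powr p - t'1 powr p" using t p by (simp add: powr_mono2)
  show ?thesis
  proof (cases "t'2 <= 2 * t'1")
   case True
   have "\<bar>\<theta> x t'2 - \<theta> x t'1\<bar> <= C * (t'1 powr (p - 1) * (t'2 - t'1))"
    using D(4)[OF x t(1,2) True t(3)] by (simp add: mult.assoc)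
   also have "... <= C * (2 powr (1 - p) / p * (t'2 powr p - t'1 powr p))"
    using powr_increment_lower[OF p t(1,2) True] D(1) by (rule mult_left_mono)
   also have "... = C * (2 powr (1 - p) / p) * (t'2 powr p - t'1 powr p)" by simp
   also have "... <= C' * (t'2 powr p - t'1 powr p)"
    using nn by (intro mult_right_mono m) (simp add: C'_def)
   finally show ?thesis .
  next
   case False
   have "t'1 powr p <= (t'2 / 2) powr p" using False t p by (intro powr_mono2) auto
   also have "... = 2 powr (- p) * t'2 powr p" using t powr_divide[of t'2 2 p] by (simp add: powr_minus_divide)
   finally have l: "c * t'2 powr p <= t'2 powr p - t'1 powr p" by (simp add: c_def algebra_simps)
   have "\<bar>\<theta> x t'2 - \<theta> x t'1\<bar> <= C * t'2 powr p + C * t'1 powr p"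
    using D(2)[of x t'1] D(2)[of x t'2] x t by linarith
   also have "... <= 2 * C * t'2 powr p" using mult_left_mono[of "t'1 powr p" "t'2 powr p" C] m D(1) by simp
   also have "... = 2 * C / c * (c * t'2 powr p)" using c by simp
   also have "... <= 2 * C / c * (t'2 powr p - t'1 powr p)" using l nn by (intro mult_left_mono)
   also have "... <= C' * (t'2 powr p - t'1 powr p)"
    using nn by (intro mult_right_mono m) (simp add: C'_def)
   finally show ?thesis .
  qed
 qed
 then show ?thesis using that[of C'] nn by (simp add: C'_def)
qed

lemma singular_kernel_measurable:
 assumes K: "singular_kernel_by C \<theta>' p \<sigma> S \<theta>" and p: "0 < p" "p <= 1" and x: "x \<in> S" and T: "T <= 1"
 shows "set_borel_measurable lborel {0<..<T} (\<theta> x)"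
proof -
 obtain C' where C': "!!x t'1 t'2. x \<in> S ==> 0 < t'1 ==> t'1 <= t'2 ==> t'2 < 1 ==>
   \<bar>\<theta> x t'2 - \<theta> x t'1\<bar> <= C' * (t'2 powr p - t'1 powr p)"
  using singular_kernel_time_increment[OF K p] by metis
 have "continuous_on {0<..<1} (\<theta> x)"
  unfolding continuous_on_def
 proof
  fix s :: real assume s: "s \<in> {0<..<1}"
  have "((%t. C' * \<bar>t powr p - s powr p\<bar>) \<longlongrightarrow> C' * \<bar>s powr p - s powr p\<bar>) (at s within {0<..<1})"
   using s by (intro tendsto_intros) auto
  then have lim: "((%t. C' * \<bar>t powr p - s powr p\<bar>) \<longlongrightarrow> 0) (at s within {0<..<1})" by simp
  have "\<forall>\<^sub>F t in at s within {0<..<1}. norm (\<theta> x t - \<theta> x s) <= C' * \<bar>t powr p - s powr p\<bar>"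
   unfolding eventually_at_filter
  proof (rule always_eventually, intro allI impI)
   fix t :: real assume t: "t \<in> {0<..<1}"
   show "norm (\<theta> x t - \<theta> x s) <= C' * \<bar>t powr p - s powr p\<bar>"
   proof (cases "s <= t")
    case True
    then have "s powr p <= t powr p" using s p by (intro powr_mono2) auto
    then show ?thesis using C'[OF x, of s t] s t True by simp
   next
    case False
    then have "t powr p <= s powr p" using t p by (intro powr_mono2) auto
    then show ?thesis using C'[OF x, of t s] s t False by (simp add: abs_minus_commute)
   qed
  qed
  then have "((%t. \<theta> x t - \<theta> x s) \<longlongrightarrow> 0) (at s within {0<..<1})"
   using lim by (rule Lim_null_comparison)
  then show "(\<theta> x \<longlongrightarrow> \<theta> x s) (at s within {0<..<1})" by (simp add: LIM_zero_iff)
 qed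
 then have "continuous_on {0<..<T} (\<theta> x)" using T by (auto elim: continuous_on_subset)
 then show ?thesis
  unfolding set_borel_measurable_def using borel_measurable_continuous_on_indicator[of "{0<..<T}" "\<theta> x"] by simp
qed

lemma has_derivative_quotient_limit:
 fixes f :: "'a::euclidean_space => real"
 assumes "(f has_derivative f') (at x within S)" and c: "norm c = 1" and S: "!!s. 0 <= s ==> x + s *\<^sub>R c \<in> S"
 shows "(%n. real (Suc n) * (f (x + (1 / real (Suc n)) *\<^sub>R c) - f x)) \<longlonglongrightarrow> f' c"
proof -
 define X where "X n = x + (1 / real (Suc n)) *\<^sub>R c" for n
 have lin: "linear f'" using assms(1) has_derivative_bounded_linear bounded_linear.linear by blast
 have "((%y. (1 / norm (y - x)) *\<^sub>R (f y - (f x + f' (y - x)))) \<longlongrightarrow> 0) (at x within S)"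
  using assms(1) unfolding has_derivative_within by auto
 moreover have "\<forall>i. X i \<in> S - {x}" using c S by (auto simp: X_def)
 moreover have "X \<longlonglongrightarrow> x"
 proof -
  have "(%n. x + inverse (real (Suc n)) *\<^sub>R c) \<longlonglongrightarrow> x + 0 *\<^sub>R c"
   by (intro tendsto_intros LIMSEQ_inverse_real_of_nat)
  then show ?thesis by (simp add: X_def[abs_def] inverse_eq_divide)
 qed
 ultimately have "((%y. (1 / norm (y - x)) *\<^sub>R (f y - (f x + f' (y - x)))) \<circ> X) \<longlonglongrightarrow> 0"
  unfolding tendsto_at_iff_sequentially by blast
 moreover have "(1 / norm (X n - x)) *\<^sub>R (f (X n) - (f x + f' (X n - x))) = real (Suc n) * (f (X n) - f x) - f' c" for n
 proof -
  have "X n - x = (1 / real (Suc n)) *\<^sub>R c" by (simp add: X_def)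
  moreover from this have "f' (X n - x) = (1 / real (Suc n)) * f' c" by (simp add: linear_cmul[OF lin])
  moreover have "norm (X n - x) = 1 / real (Suc n)" using c calculation(1) by simp
  ultimately show ?thesis by (simp add: algebra_simps del: of_nat_Suc)
 qed
 ultimately have "(%n. real (Suc n) * (f (X n) - f x) - f' c) \<longlonglongrightarrow> 0" by (simp add: o_def)
 then show ?thesis by (simp add: LIM_zero_iff X_def)
qed

lemma singular_kernel_derivative_measurable:
 assumes K: "singular_kernel_by C \<theta>' p \<sigma> S \<theta>" and p: "0 < p" "p <= 1" and x: "x \<in> S" and T: "T <= 1"
  and S: "has_rays S"
 shows "set_borel_measurable lborel {0<..<T} (%t'. \<theta>' x t' h)"
proof -
 note D = singular_kernel_byD[OF K]
 have lin: "linear (\<theta>' x t')" if "0 < t'" "t' < T" for t'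
  using D(5)[OF x, of t'] that T has_derivative_bounded_linear bounded_linear.linear by force
 have c: "set_borel_measurable lborel {0<..<T} (%t'. \<theta>' x t' c)"
  if c: "norm c = 1" "!!s. 0 <= s ==> x + s *\<^sub>R c \<in> S" for c
  unfolding set_borel_measurable_def
 proof (rule borel_measurable_LIMSEQ_real)
  fix t' :: real
  show "(%n. real (Suc n) * (indicator {0<..<T} t' *\<^sub>R \<theta> (x + (1 / real (Suc n)) *\<^sub>R c) t' - indicator {0<..<T} t' *\<^sub>R \<theta> x t'))
    \<longlonglongrightarrow> indicator {0<..<T} t' *\<^sub>R \<theta>' x t' c"
  proof (cases "t' \<in> {0<..<T}")
   case True
   then show ?thesis using has_derivative_quotient_limit[OF D(5)[OF x, of t'] c] T by simp
  qed simp
 next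
  fix n
  show "(%t'. real (Suc n) * (indicator {0<..<T} t' *\<^sub>R \<theta> (x + (1 / real (Suc n)) *\<^sub>R c) t' - indicator {0<..<T} t' *\<^sub>R \<theta> x t')) \<in> borel_measurable lborel"
   using singular_kernel_measurable[OF K p _ T] x c(2)[of "1 / real (Suc n)"] unfolding set_borel_measurable_def
   by (intro borel_measurable_times borel_measurable_diff) auto
 qed
 have b: "set_borel_measurable lborel {0<..<T} (%t'. \<theta>' x t' b)" if b: "b \<in> Basis" for b
 proof -
  obtain c where "c \<in> {b, - b}" and cs: "!!s. 0 <= s ==> x + s *\<^sub>R c \<in> S"
   using S x b unfolding has_rays_def by blast
  then consider "c = b" | "c = - b" by auto
  then show ?thesis
  proof cases
   case 1
   then show ?thesis using c[of b] cs b by simp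
  next
   case 2
   have eq: "indicator {0<..<T} t' *\<^sub>R \<theta>' x t' b = - (indicator {0<..<T} t' *\<^sub>R \<theta>' x t' (- b))" for t'
    using linear_neg[OF lin, of t' b] by (auto simp: indicator_def)
   show ?thesis
    unfolding set_borel_measurable_def eq using c[of "- b"] cs b 2
    by (auto simp: set_borel_measurable_def)
  qed
 qed
 have "indicator {0<..<T} t' *\<^sub>R \<theta>' x t' h = (\<Sum>b\<in>Basis. (h \<bullet> b) * (indicator {0<..<T} t' *\<^sub>R \<theta>' x t' b))" for t'
 proof (cases "t' \<in> {0<..<T}")
  case True
  have "\<theta>' x t' h = \<theta>' x t' (\<Sum>b\<in>Basis. (h \<bullet> b) *\<^sub>R b)" by (simp add: euclidean_representation)
  also have "... = (\<Sum>b\<in>Basis. (h \<bullet> b) * \<theta>' x t' b)"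
   using True by (simp add: linear_sum[OF lin] linear_cmul[OF lin])
  finally show ?thesis using True by simp
 qed simp
 then show ?thesis
  using b unfolding set_borel_measurable_def by simp
qed

lemma time_conv_has_derivative:
 assumes K: "singular_kernel_by C \<theta>' p \<sigma> S \<theta>" and p: "0 < p" "p <= 1" and \<alpha>: "\<alpha> < 1"
  and x: "x \<in> S" and T: "T <= 1" and S: "has_rays S"
 shows "((%y. time_conv \<alpha> (\<theta> y) T) has_derivative (%h. time_conv \<alpha> (%t'. \<theta>' x t' h) T)) (at x within S)"
proof (cases "T <= 0")
 case True
 then show ?thesis by (simp add: time_conv_nonpos)
next
 case False
 then have T0: "0 <= T" by simp
 note D = singular_kernel_byD[OF K]
 have q: "-1 < p" "-1 < p - 1/2" using p by auto
 show ?thesis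
  unfolding time_conv_def set_lebesgue_integral_def
 proof (rule has_derivative_integral_dominated[where
    g = "%t'. C * (indicator {0<..<T} t' *\<^sub>R ((T - t') powr (- \<alpha>) * t' powr (p - 1/2)))"])
  show "integrable lborel (%t'. indicator {0<..<T} t' *\<^sub>R ((T - t') powr (- \<alpha>) * \<theta> y t'))" if "y \<in> S" for y
   using set_integrable_conv_bound[OF \<alpha> q(1) T0 singular_kernel_measurable[OF K p that T], of C] D(2)[OF that] T
   by (simp add: set_integrable_def)
  show "(%t'. indicator {0<..<T} t' *\<^sub>R ((T - t') powr (- \<alpha>) * \<theta>' x t' h)) \<in> borel_measurable lborel" for h
   using set_integrable_conv_bound[OF \<alpha> q(2) T0 singular_kernel_derivative_measurable[OF K p x T S], of h "C * norm h"] D(6)[OF x] T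
   by (simp add: set_integrable_def mult_ac)
  show "integrable lborel (%t'. C * (indicator {0<..<T} t' *\<^sub>R ((T - t') powr (- \<alpha>) * t' powr (p - 1/2))))"
   using Beta_convolution(1)[OF \<alpha> q(2) T0] by (auto simp: set_integrable_def)
  fix t' :: real
  show "((%y. indicator {0<..<T} t' *\<^sub>R ((T - t') powr (- \<alpha>) * \<theta> y t')) has_derivative
    (%h. indicator {0<..<T} t' *\<^sub>R ((T - t') powr (- \<alpha>) * \<theta>' x t' h))) (at x within S)"
  proof (cases "t' \<in> {0<..<T}")
   case True
   then show ?thesis using D(5)[OF x, of t'] T by (auto intro: has_derivative_mult_right)
  qed simp
  have *: "(T - t') powr (- \<alpha>) * \<bar>a\<bar> <= C * ((T - t') powr (- \<alpha>) * t' powr (p - 1/2)) * r"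
   if "\<bar>a\<bar> <= C * t' powr (p - 1/2) * r" for a r
   using mult_left_mono[OF that, of "(T - t') powr (- \<alpha>)"] by (simp add: mult_ac)
  show "\<bar>indicator {0<..<T} t' *\<^sub>R ((T - t') powr (- \<alpha>) * \<theta> y t') - indicator {0<..<T} t' *\<^sub>R ((T - t') powr (- \<alpha>) * \<theta> x t')\<bar>
    <= C * (indicator {0<..<T} t' *\<^sub>R ((T - t') powr (- \<alpha>) * t' powr (p - 1/2))) * norm (y - x)" if "y \<in> S" for y
  proof (cases "t' \<in> {0<..<T}")
   case True
   then show ?thesis using *[OF D(3)[OF that x, of t']] T by (simp add: right_diff_distrib[symmetric] abs_mult)
  qed simp
  show "\<bar>indicator {0<..<T} t' *\<^sub>R ((T - t') powr (- \<alpha>) * \<theta>' x t' h)\<bar>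
    <= C * (indicator {0<..<T} t' *\<^sub>R ((T - t') powr (- \<alpha>) * t' powr (p - 1/2))) * norm h" for h
  proof (cases "t' \<in> {0<..<T}")
   case True
   then show ?thesis using *[OF D(6)[OF x, of t' h]] T by (simp add: abs_mult)
  qed simp
 qed (rule x)
qed

text \<open>In space, the bound by size is played against the Lipschitz bound on the length scale set by the square root of the time; for \<open>\<epsilon>0 > 1\<close> the same is done for the
gradient. In time, the increments of the convolution are controlled by those of a power of the delay.\<close>
theorem singular_kernel_parabolic_holder:
 fixes S :: "'a::euclidean_space set"
 assumes \<alpha>: "0 < \<alpha>" "\<alpha> < 1" and \<beta>: "0 < \<beta>" "\<beta> < 1"
  and \<epsilon>: "\<epsilon>0 = 3 - 2 * \<alpha> - \<beta>" "0 < \<epsilon>0" "\<epsilon>0 < 2" and p: "p = (1 - \<beta>) / 2"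
  and \<sigma>: "1 < \<epsilon>0 ==> \<sigma> = \<epsilon>0 - 1"
  and K: "singular_kernel p \<sigma> S \<theta>" and S: "has_rays S"
 shows "parabolic_holder \<epsilon>0 S {0<..<1} (%x t. time_conv \<alpha> (\<theta> x) (t - 1/2))"
proof -
 obtain C \<theta>' where K: "singular_kernel_by C \<theta>' p \<sigma> S \<theta>"
  using K unfolding singular_kernel_def by blast
 note D = singular_kernel_byD[OF K]
 have p01: "0 < p" "p <= 1" using p \<beta> by auto
 have q: "-1 < p" "-1 < p - 1/2" using p01 by auto
 have e: "1 - \<alpha> + p = \<epsilon>0 / 2" "1 - \<alpha> + (p - 1/2) = (\<epsilon>0 - 1) / 2" using \<epsilon> p by auto
 define B0 where "B0 = Beta (1 + p) (1 - \<alpha>)"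
 define B1 where "B1 = Beta (1 + (p - 1/2)) (1 - \<alpha>)"
 have B: "0 < B0" "0 < B1" using Beta_real_pos \<alpha> p01 by (auto simp: B0_def B1_def)
 let ?W = "%x T. time_conv \<alpha> (\<theta> x) T"
 let ?D = "%x T h. time_conv \<alpha> (%t'. \<theta>' x t' h) T"
 have m: "set_borel_measurable lborel {0<..<T} (\<theta> x)" if "x \<in> S" "T <= 1" for x T
  using singular_kernel_measurable[OF K p01 that] .
 have m': "set_borel_measurable lborel {0<..<T} (%t'. \<theta>' x t' h)" if "x \<in> S" "T <= 1" for x T h
  using singular_kernel_derivative_measurable[OF K p01 that S] .
 have i: "set_integrable lborel {0<..<T} (%t'. (T - t') powr (- \<alpha>) * \<theta> x t')" if "x \<in> S" "0 <= T" "T <= 1" for x T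
  using set_integrable_conv_bound[OF \<alpha>(2) q(1) that(2) m[OF that(1,3)], of C] D(2)[OF that(1)] that by auto
 have i': "set_integrable lborel {0<..<T} (%t'. (T - t') powr (- \<alpha>) * \<theta>' x t' h)" if "x \<in> S" "0 <= T" "T <= 1" for x T h
  using set_integrable_conv_bound[OF \<alpha>(2) q(2) that(2) m'[OF that(1,3)], of h "C * norm h"] D(6)[OF that(1)] that
  by (simp add: mult_ac)
 obtain C' where C': "C <= C'" "!!x t'1 t'2. x \<in> S ==> 0 < t'1 ==> t'1 <= t'2 ==> t'2 < 1 ==>
   \<bar>\<theta> x t'2 - \<theta> x t'1\<bar> <= C' * (t'2 powr p - t'1 powr p)"
  using singular_kernel_time_increment[OF K p01] by metis
 have C'0: "0 <= C'" using C'(1) D(1) by simp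
 have Wb: "\<bar>?W x T\<bar> <= C' * B0 * T powr (\<epsilon>0 / 2)" if "x \<in> S" "0 <= T" "T <= 1" for x T
 proof -
  have "\<bar>?W x T\<bar> <= C * B0 * T powr (\<epsilon>0 / 2)"
   using time_conv_bound[OF \<alpha>(2) q(1) that(2), of "\<theta> x" C] D(2)[OF that(1)] that unfolding e(1) B0_def by auto
  also have "... <= C' * B0 * T powr (\<epsilon>0 / 2)" using C' B by (intro mult_right_mono) auto
  finally show ?thesis .
 qed
 have Wb1: "\<bar>?W x T\<bar> <= C' * B0" if "x \<in> S" "T <= 1" for x T
 proof -
  have "\<bar>?W x (max T 0)\<bar> <= C' * B0 * (max T 0) powr (\<epsilon>0 / 2)" using that by (intro Wb) auto
  also have "... <= C' * B0 * 1" using that \<epsilon> B C'0 by (intro mult_left_mono powr_le1) auto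
  finally show ?thesis by (simp add: time_conv_max)
 qed
 have Wt: "\<bar>?W x T2 - ?W x T1\<bar> <= C' * B0 * \<bar>T2 - T1\<bar> powr (\<epsilon>0 / 2)"
  if x: "x \<in> S" and T: "T1 <= 1" "T2 <= 1" for x T1 T2
 proof -
  have *: "\<bar>?W x T2 - ?W x T1\<bar> <= C' * B0 * (T2 - T1) powr (\<epsilon>0 / 2)" if T: "0 <= T1" "T1 <= T2" "T2 <= 1" for T1 T2
  proof -
   have "\<bar>\<theta> x t'\<bar> <= C' * t' powr p" if "0 < t'" "t' < T2" for t'
    by (rule order_trans[OF D(2)[OF x] mult_right_mono[OF C'(1)]]) (use that T in auto)
   from time_conv_increment[OF \<alpha>(2) p01(1) _ T(1,2) m[OF x T(3)] this C'(2)[OF x]] T C'0 \<epsilon>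
   show ?thesis unfolding e(1) B0_def by auto
  qed
  define a where "a = max T1 0"
   define b where "b = max T2 0"
   have ab: "0 <= a" "0 <= b" "a <= 1" "b <= 1" "\<bar>b - a\<bar> <= \<bar>T2 - T1\<bar>"
    using T by (auto simp: a_def b_def)
  have "\<bar>?W x b - ?W x a\<bar> <= C' * B0 * \<bar>b - a\<bar> powr (\<epsilon>0 / 2)"
  proof (cases "a <= b")
   case True
   then show ?thesis using *[of a b] ab by simp
  next
   case False
   then show ?thesis using *[of b a] ab by (simp add: abs_minus_commute)
  qed
  also have "... <= C' * B0 * \<bar>T2 - T1\<bar> powr (\<epsilon>0 / 2)"
   using C'0 B \<epsilon> ab by (intro mult_left_mono powr_mono2) auto
  finally show ?thesis by (simp add: time_conv_max a_def b_def)
 qed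
 show ?thesis
 proof (cases "\<epsilon>0 <= 1")
  case True
  have Wx: "\<bar>?W x T - ?W y T\<bar> <= (C' * B1 + 2 * C' * B0) * norm (x - y) powr \<epsilon>0" if x: "x \<in> S" and y: "y \<in> S" and T1: "T <= 1" for x y T
  proof -
   define d where "d = norm (x - y)"
   show ?thesis
   proof (cases "T <= 0 \<or> x = y")
    case True
    then show ?thesis using C'0 B by (auto simp: time_conv_nonpos)
   next
    case False
    then have T: "0 < T" and d: "0 < d" by (auto simp: d_def)
    have dp: "(d\<^sup>2) powr (r / 2) = d powr r" for r
     using powr_powr[of d 2 "r / 2"] d by simp
    show ?thesis
    proof (cases "d\<^sup>2 <= T")
     case True
     have "\<bar>?W x T - ?W y T\<bar> = \<bar>time_conv \<alpha> (%t'. \<theta> x t' - \<theta> y t') T\<bar>"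
      using T T1 by (subst time_conv_diff) (auto intro!: i x y)
     also have "... <= (C * d) * B1 * T powr ((\<epsilon>0 - 1) / 2)"
      using time_conv_bound[OF \<alpha>(2) q(2), of T "%t'. \<theta> x t' - \<theta> y t'" "C * d"] D(3)[OF x y] T T1
      unfolding e(2) B1_def d_def by (simp add: mult_ac)
     also have "T powr ((\<epsilon>0 - 1) / 2) <= (d\<^sup>2) powr ((\<epsilon>0 - 1) / 2)"
      using \<open>\<epsilon>0 <= 1\<close> True d by (intro powr_mono2') auto
     also have "... = d powr (\<epsilon>0 - 1)" by (rule dp)
     also have "C * d * B1 * d powr (\<epsilon>0 - 1) = C * B1 * d powr \<epsilon>0"
      using powr_add[of d 1 "\<epsilon>0 - 1"] d by (simp add: mult_ac)
     also have "... <= (C' * B1 + 2 * C' * B0) * d powr \<epsilon>0"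
      using C' C'0 B by (intro mult_right_mono) (auto intro: add_increasing2 mult_right_mono)
     finally show ?thesis using D(1) B d by (simp add: d_def mult_left_mono)
    next
     case False
     have "\<bar>?W x T - ?W y T\<bar> <= C' * B0 * T powr (\<epsilon>0 / 2) + C' * B0 * T powr (\<epsilon>0 / 2)"
      using Wb[OF x, of T] Wb[OF y, of T] T T1 by linarith
     also have "... = 2 * C' * B0 * T powr (\<epsilon>0 / 2)" by simp
     also have "... <= 2 * C' * B0 * (d\<^sup>2) powr (\<epsilon>0 / 2)"
      using C'0 B False T \<epsilon> by (intro mult_left_mono powr_mono2) auto
     also have "... = 2 * C' * B0 * d powr \<epsilon>0" by (simp only: dp)
     also have "... <= (C' * B1 + 2 * C' * B0) * d powr \<epsilon>0"
      using C'0 B by (intro mult_right_mono) auto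
     finally show ?thesis by (simp add: d_def)
    qed
   qed
  qed
  define M where "M = C' * B1 + 2 * C' * B0 + C' * B0"
  have nn: "0 <= C' * B1" "0 <= C' * B0" using C'0 B by auto
  have M: "C' * B0 <= M" "C' * B1 + 2 * C' * B0 <= M" unfolding M_def using nn by linarith+
  have "parabolic_holder_low \<epsilon>0 S {0<..<1} (%x t. ?W x (t - 1/2))"
   unfolding parabolic_holder_low_def
  proof (intro exI[of _ M] conjI ballI)
   fix x t assume "x \<in> S" "t \<in> {0<..<1::real}"
   then show "norm (?W x (t - 1/2)) <= M" using Wb1[of x "t - 1/2"] M by auto
  next
   fix x y t s assume x: "x \<in> S" and y: "y \<in> S" and t: "t \<in> {0<..<1::real}" and s: "s \<in> {0<..<1::real}"
   have "norm (?W x (t - 1/2) - ?W y (s - 1/2))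
    <= \<bar>?W x (t - 1/2) - ?W y (t - 1/2)\<bar> + \<bar>?W y (t - 1/2) - ?W y (s - 1/2)\<bar>" by simp
   also have "... <= (C' * B1 + 2 * C' * B0) * norm (x - y) powr \<epsilon>0 + C' * B0 * \<bar>t - s\<bar> powr (\<epsilon>0 / 2)"
    using Wx[OF x y, of "t - 1/2"] Wt[OF y, of "s - 1/2" "t - 1/2"] t s by (intro add_mono) auto
   also have "... <= M * norm (x - y) powr \<epsilon>0 + M * \<bar>t - s\<bar> powr (\<epsilon>0 / 2)"
    using M by (intro add_mono mult_right_mono) auto
   finally show "norm (?W x (t - 1/2) - ?W y (s - 1/2)) <= M * (norm (x - y) powr \<epsilon>0 + \<bar>t - s\<bar> powr (\<epsilon>0 / 2))"
    by (simp add: algebra_simps)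
  qed
  then show ?thesis using True by (simp add: parabolic_holder_def)
 next
  case False
  then have \<sigma>': "\<sigma> = \<epsilon>0 - 1" "0 < \<sigma>" using \<sigma> by auto
  have q2: "-1 < p - (1 + \<sigma>) / 2" "1 - \<alpha> + (p - (1 + \<sigma>) / 2) = 0"
   using \<sigma>' \<epsilon> p \<alpha> by (auto simp: field_simps)
  define B2 where "B2 = Beta (1 + (p - (1 + \<sigma>) / 2)) (1 - \<alpha>)"
  have B2: "0 < B2" unfolding B2_def using q2 \<alpha> by (intro Beta_real_pos) auto
  have Db: "\<bar>?D x T h\<bar> <= C * B1 * norm h" if x: "x \<in> S" and T1: "T <= 1" for x T h
  proof (cases "T <= 0")
   case False
   have "\<bar>?D x T h\<bar> <= C * norm h * B1 * T powr ((\<epsilon>0 - 1) / 2)"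
    using time_conv_bound[OF \<alpha>(2) q(2), of T "%t'. \<theta>' x t' h" "C * norm h"] D(6)[OF x] False T1
    unfolding e(2) B1_def by (simp add: mult_ac)
   also have "... <= C * norm h * B1 * 1"
    using False T1 D(1) B \<sigma>' by (intro mult_left_mono powr_le1) auto
   finally show ?thesis by (simp add: mult_ac)
  qed (use D(1) B in \<open>simp add: time_conv_nonpos\<close>)
  have Dt: "\<bar>?D x T2 h - ?D x T1 h\<bar> <= 2 * C * B1 * norm h * \<bar>T2 - T1\<bar> powr (\<sigma> / 2)"
   if x: "x \<in> S" and T: "T1 <= 1" "T2 <= 1" for x T1 T2 h
  proof -
   have *: "\<bar>?D x T2 h - ?D x T1 h\<bar> <= 2 * C * B1 * norm h * (T2 - T1) powr (\<sigma> / 2)" if T: "0 <= T1" "T1 <= T2" "T2 <= 1" for T1 T2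
   proof -
    have "\<bar>\<theta>' x t' h\<bar> <= (C * norm h) * t' powr (- (1/2 - p))" if "0 < t'" "t' < T2" for t'
     using D(6)[OF x, of t' h] that T by (simp add: mult_ac)
    moreover have "0 <= \<alpha>" "0 <= 1/2 - p" "1/2 - p < 1" "\<alpha> + (1/2 - p) <= 1" "0 <= C * norm h"
     using \<alpha> p01 p \<beta> D(1) \<epsilon> False by (simp_all add: field_simps)
    ultimately have "\<bar>?D x T2 h - ?D x T1 h\<bar> <= 2 * (C * norm h) * Beta (1 - (1/2 - p)) (1 - \<alpha>) * (T2 - T1) powr (1 - \<alpha> - (1/2 - p))"
     by (intro time_conv_increment_singular[OF _ \<alpha>(2) _ _ _ T(1,2) m'[OF x T(3)]])
    moreover have "1 - (1/2 - p) = 1 + (p - 1/2)" "1 - \<alpha> - (1/2 - p) = \<sigma> / 2" using e(2) \<sigma>' by auto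
    ultimately show ?thesis by (simp add: B1_def mult_ac)
   qed
   define a where "a = max T1 0"
   define b where "b = max T2 0"
   have ab: "0 <= a" "0 <= b" "a <= 1" "b <= 1" "\<bar>b - a\<bar> <= \<bar>T2 - T1\<bar>"
    using T by (auto simp: a_def b_def)
   have "\<bar>?D x b h - ?D x a h\<bar> <= 2 * C * B1 * norm h * \<bar>b - a\<bar> powr (\<sigma> / 2)"
   proof (cases "a <= b")
    case True
    then show ?thesis using *[of a b] ab by simp
   next
    case False
    then show ?thesis using *[of b a] ab by (simp add: abs_minus_commute)
   qed
   also have "... <= 2 * C * B1 * norm h * \<bar>T2 - T1\<bar> powr (\<sigma> / 2)"
    using D(1) B \<sigma>' ab by (intro mult_left_mono powr_mono2) auto
   finally show ?thesis by (simp add: time_conv_max a_def b_def)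
  qed
  have Dx: "\<bar>?D x T h - ?D y T h\<bar> <= C * B2 * norm h * norm (x - y) powr \<sigma>" if x: "x \<in> S" and y: "y \<in> S" and T1: "T <= 1" for x y T h
  proof (cases "T <= 0")
   case False
   have "\<bar>?D x T h - ?D y T h\<bar> = \<bar>time_conv \<alpha> (%t'. \<theta>' x t' h - \<theta>' y t' h) T\<bar>"
    using False T1 by (subst time_conv_diff) (auto intro!: i' x y)
   also have "... <= (C * norm (x - y) powr \<sigma> * norm h) * B2 * T powr 0"
    using time_conv_bound[OF \<alpha>(2) q2(1), of T "%t'. \<theta>' x t' h - \<theta>' y t' h" "C * norm (x - y) powr \<sigma> * norm h"]
     D(7)[OF x y] False T1
    unfolding q2(2) B2_def by (simp add: mult_ac)
   finally show ?thesis using False by (simp add: mult_ac)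
  qed (use D(1) B2 in \<open>simp add: time_conv_nonpos\<close>)
  define M where "M = C * B1 + C * B2 + 2 * C * B1"
  have nn: "0 <= C * B1" "0 <= C * B2" using D(1) B B2 by auto
  have M: "C * B1 <= M" "C * B2 <= M" "2 * C * B1 <= M" unfolding M_def using nn by linarith+
  have low: "parabolic_holder_low (\<epsilon>0 - 1) S {0<..<1} (%x t. ?D x (t - 1/2) b)" if b: "b \<in> Basis" for b
   unfolding parabolic_holder_low_def
  proof (intro exI[of _ M] conjI ballI)
   fix x t assume "x \<in> S" "t \<in> {0<..<1::real}"
   then show "norm (?D x (t - 1/2) b) <= M" using Db[of x "t - 1/2" b] M b by auto
  next
   fix x y t s assume x: "x \<in> S" and y: "y \<in> S" and t: "t \<in> {0<..<1::real}" and s: "s \<in> {0<..<1::real}"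
   have "norm (?D x (t - 1/2) b - ?D y (s - 1/2) b)
    <= \<bar>?D x (t - 1/2) b - ?D y (t - 1/2) b\<bar> + \<bar>?D y (t - 1/2) b - ?D y (s - 1/2) b\<bar>" by simp
   also have "... <= C * B2 * norm (x - y) powr \<sigma> + 2 * C * B1 * \<bar>t - s\<bar> powr (\<sigma> / 2)"
    using Dx[OF x y, of "t - 1/2" b] Dt[OF y, of "s - 1/2" "t - 1/2" b] t s b by (intro add_mono) auto
   also have "... <= M * norm (x - y) powr \<sigma> + M * \<bar>t - s\<bar> powr (\<sigma> / 2)"
    using M by (intro add_mono mult_right_mono) auto
   finally show "norm (?D x (t - 1/2) b - ?D y (s - 1/2) b) <= M * (norm (x - y) powr (\<epsilon>0 - 1) + \<bar>t - s\<bar> powr ((\<epsilon>0 - 1) / 2))"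
    using \<sigma>' by (simp add: algebra_simps)
  qed
  have "\<exists>M. (\<forall>x\<in>S. \<forall>t\<in>{0<..<1}. norm (?W x (t - 1/2)) <= M) \<and>
    (\<forall>x\<in>S. \<forall>t\<in>{0<..<1}. \<forall>s\<in>{0<..<1}. norm (?W x (t - 1/2) - ?W x (s - 1/2)) <= M * \<bar>t - s\<bar> powr (\<epsilon>0 / 2))"
  proof (intro exI[of _ "C' * B0"] conjI ballI)
   show "norm (?W x (t - 1/2)) <= C' * B0" if "x \<in> S" "t \<in> {0<..<1}" for x t
    using Wb1[of x "t - 1/2"] that by simp
   show "norm (?W x (t - 1/2) - ?W x (s - 1/2)) <= C' * B0 * \<bar>t - s\<bar> powr (\<epsilon>0 / 2)"
    if "x \<in> S" "t \<in> {0<..<1}" "s \<in> {0<..<1}" for x t s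
    using Wt[of x "s - 1/2" "t - 1/2"] that by simp
  qed
  moreover have der: "((%y. ?W y (t - 1/2)) has_derivative ?D x (t - 1/2)) (at x within S)" if "x \<in> S" "t \<in> {0<..<1}" for x t
   using time_conv_has_derivative[OF K p01 \<alpha>(2) that(1) _ S, of "t - 1/2"] that by auto
  moreover have "\<exists>u'. (\<forall>x\<in>S. \<forall>t\<in>{0<..<1}. ((%y. ?W y (t - 1/2)) has_derivative u' x t) (at x within S)) \<and>
    (\<forall>b\<in>Basis. parabolic_holder_low (\<epsilon>0 - 1) S {0<..<1} (%x t. u' x t b))"
   by (rule exI[of _ "%x t. ?D x (t - 1/2)"]) (use der low in blast)
  ultimately show ?thesis
   unfolding parabolic_holder_def using False by (simp only: if_False)
 qed
qed

section \<open>Closure properties of singular kernels\<close>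

lemma singular_kernel_subset:
 assumes "singular_kernel p \<sigma> S \<theta>" "S' \<subseteq> S"
 shows "singular_kernel p \<sigma> S' \<theta>"
proof -
 obtain C \<theta>' where K: "singular_kernel_by C \<theta>' p \<sigma> S \<theta>"
  using assms unfolding singular_kernel_def by blast
 note D = singular_kernel_byD[OF K]
 have "singular_kernel_by C \<theta>' p \<sigma> S' \<theta>"
  unfolding singular_kernel_by_def
 proof (intro conjI ballI allI impI)
  show "((%y. \<theta> y t') has_derivative \<theta>' x t') (at x within S')" if "x \<in> S'" "t' \<in> {0<..<1}" for x t'
   by (rule has_derivative_subset[OF D(5) assms(2)]) (use that assms(2) in auto)
 qed (use D subsetD[OF assms(2)] in auto)
 then show ?thesis unfolding singular_kernel_def by blast
qed

lemma singular_kernel_cong: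
 assumes "singular_kernel p \<sigma> S \<theta>1" and eq: "!!x t'. x \<in> S ==> 0 < t' ==> t' < 1 ==> \<theta>1 x t' = \<theta>2 x t'"
 shows "singular_kernel p \<sigma> S \<theta>2"
proof -
 obtain C \<theta>' where K: "singular_kernel_by C \<theta>' p \<sigma> S \<theta>1"
  using assms unfolding singular_kernel_def by blast
 note D = singular_kernel_byD[OF K]
 have d: "((%y. \<theta>2 y t') has_derivative \<theta>' x t') (at x within S)" if "x \<in> S" "0 < t'" "t' < 1" for x t'
  by (rule has_derivative_transform[OF that(1) _ D(5)[OF that]]) (use eq that in auto)
 have "singular_kernel_by C \<theta>' p \<sigma> S \<theta>2"
  unfolding singular_kernel_by_def
  using D(1,2,3,4,6,7) d by (auto simp: eq[symmetric])
 then show ?thesis unfolding singular_kernel_def by blast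
qed

lemma singular_kernel_scale:
 assumes "singular_kernel p \<sigma> S \<theta>"
 shows "singular_kernel p \<sigma> S (%x t'. c * \<theta> x t')"
proof -
 obtain C \<theta>' where K: "singular_kernel_by C \<theta>' p \<sigma> S \<theta>"
  using assms unfolding singular_kernel_def by blast
 note D = singular_kernel_byD[OF K]
 have *: "\<bar>c * a\<bar> <= \<bar>c\<bar> * C * r * s" if "\<bar>a\<bar> <= C * r * s" for a r s
  using mult_left_mono[OF that, of "\<bar>c\<bar>"] by (simp add: abs_mult mult_ac)
 have **: "\<bar>c * a - c * b\<bar> <= \<bar>c\<bar> * C * r * s" if "\<bar>a - b\<bar> <= C * r * s" for a b r s
  using *[OF that] by (simp add: right_diff_distrib)
 have ***: "\<bar>c * a - c * b\<bar> <= \<bar>c\<bar> * C * r * s * u" if "\<bar>a - b\<bar> <= C * r * s * u" for a b r s u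
  using **[of a b "r * s" u] that by (simp add: mult_ac)
 have "singular_kernel_by (\<bar>c\<bar> * C) (%x t' h. c * \<theta>' x t' h) p \<sigma> S (%x t'. c * \<theta> x t')"
  unfolding singular_kernel_by_def
 proof (intro conjI ballI allI impI)
  show "0 <= \<bar>c\<bar> * C" using D(1) by simp
  show "\<bar>c * \<theta> x t'\<bar> <= \<bar>c\<bar> * C * t' powr p" if "x \<in> S" "t' \<in> {0<..<1}" for x t'
   using *[of "\<theta> x t'" "t' powr p" 1] D(2)[of x t'] that by simp
  show "((%y. c * \<theta> y t') has_derivative (%h. c * \<theta>' x t' h)) (at x within S)" if "x \<in> S" "t' \<in> {0<..<1}" for x t'
   using D(5)[of x t'] that by (auto intro: has_derivative_mult_right)
 qed (use D(3,4,6,7) in \<open>auto intro!: * ** ***\<close>)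
 then show ?thesis unfolding singular_kernel_def by blast
qed

lemma singular_kernel_add:
 assumes "singular_kernel p \<sigma> S \<theta>1" "singular_kernel p \<sigma> S \<theta>2"
 shows "singular_kernel p \<sigma> S (%x t'. \<theta>1 x t' + \<theta>2 x t')"
proof -
 obtain C1 \<theta>1' where K1: "singular_kernel_by C1 \<theta>1' p \<sigma> S \<theta>1"
  using assms unfolding singular_kernel_def by blast
 obtain C2 \<theta>2' where K2: "singular_kernel_by C2 \<theta>2' p \<sigma> S \<theta>2"
  using assms unfolding singular_kernel_def by blast
 note D1 = singular_kernel_byD[OF K1]
 note D2 = singular_kernel_byD[OF K2]
 have *: "\<bar>a + b\<bar> <= (C1 + C2) * r * s" if "\<bar>a\<bar> <= C1 * r * s" "\<bar>b\<bar> <= C2 * r * s" for a b r s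
 proof -
  have "\<bar>a + b\<bar> <= C1 * r * s + C2 * r * s" using that by linarith
  then show ?thesis by (simp add: algebra_simps)
 qed
 have **: "\<bar>a + b - (c + d)\<bar> <= (C1 + C2) * r * s" if "\<bar>a - c\<bar> <= C1 * r * s" "\<bar>b - d\<bar> <= C2 * r * s" for a b c d r s
  using *[OF that] by (simp add: algebra_simps)
 have ***: "\<bar>a + b - (c + d)\<bar> <= (C1 + C2) * r * s * u" if "\<bar>a - c\<bar> <= C1 * r * s * u" "\<bar>b - d\<bar> <= C2 * r * s * u" for a b c d r s u
  using **[of a c "r * s" u b d] that by (simp add: mult_ac)
 have "singular_kernel_by (C1 + C2) (%x t' h. \<theta>1' x t' h + \<theta>2' x t' h) p \<sigma> S (%x t'. \<theta>1 x t' + \<theta>2 x t')"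
  unfolding singular_kernel_by_def
 proof (intro conjI ballI allI impI)
  show "0 <= C1 + C2" using D1(1) D2(1) by simp
  show "\<bar>\<theta>1 x t' + \<theta>2 x t'\<bar> <= (C1 + C2) * t' powr p" if "x \<in> S" "t' \<in> {0<..<1}" for x t'
   using *[of "\<theta>1 x t'" "t' powr p" 1 "\<theta>2 x t'"] D1(2)[of x t'] D2(2)[of x t'] that by simp
  show "((%y. \<theta>1 y t' + \<theta>2 y t') has_derivative (%h. \<theta>1' x t' h + \<theta>2' x t' h)) (at x within S)" if "x \<in> S" "t' \<in> {0<..<1}" for x t'
   using D1(5)[of x t'] D2(5)[of x t'] that by (auto intro: has_derivative_add)
 qed (use D1(3,4,6,7) D2(3,4,6,7) in \<open>auto intro!: * ** ***\<close>)
 then show ?thesis unfolding singular_kernel_def by blast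
qed

section \<open>The heat kernel away from its singularity\<close>

lemma heat_kernel_far_bound:
 obtains K where "0 < K" "!!(z::'a::euclidean_space) t. 1/2 <= norm z ==> 0 < t ==> t <= 4 ==> hk z t <= K * t\<^sup>2"
proof -
 define N where "N = DIM('a) + 2"
 define K where "K = fact N * 16 ^ N * 4 powr (real DIM('a) / 2)"
 have "hk z t <= K * t\<^sup>2" if z: "1/2 <= norm z" and t: "0 < t" "t <= 4" for z :: 'a and t
 proof -
  define v where "v = 1 / (16 * t)"
  have v: "0 < v" using t by (simp add: v_def)
  have "v ^ N / fact N <= exp v"
  proof -
   have "exp v = (\<Sum>n. inverse (fact n) * v ^ n)" by (simp add: exp_def)
   moreover have "(\<Sum>n\<in>{N}. inverse (fact n) * v ^ n) <= (\<Sum>n. inverse (fact n) * v ^ n)"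
    using v by (intro sum_le_suminf summable_exp) auto
   ultimately show ?thesis by (simp add: field_simps)
  qed
  then have ev: "exp (- v) <= fact N * (16 * t) ^ N"
   using v by (simp add: exp_minus v_def power_divide field_simps)
  have "(1/2)\<^sup>2 <= (norm z)\<^sup>2" using z by (intro power_mono) auto
  then have "exp (- (norm z)\<^sup>2 / (4 * t)) <= exp (- v)"
   using t by (simp add: v_def field_simps power2_eq_square)
  also note ev
  finally have 1: "exp (- (norm z)\<^sup>2 / (4 * t)) <= fact N * (16 * t) ^ N" .
  have "(4 * pi * t) powr (- real DIM('a) / 2) <= t powr (- real DIM('a) / 2)"
   using t pi_gt3 by (intro powr_mono2') auto
  then have "hk z t <= t powr (- real DIM('a) / 2) * (fact N * (16 * t) ^ N)"
   unfolding heat_kernel_def using 1 by (intro mult_mono) auto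
  also have "(16 * t) ^ N = 16 ^ N * (t powr real DIM('a) * t\<^sup>2)"
   using t by (simp add: N_def power_mult_distrib power_add powr_realpow power2_eq_square)
  also have "t powr (- real DIM('a) / 2) * (fact N * (16 ^ N * (t powr real DIM('a) * t\<^sup>2)))
    = fact N * 16 ^ N * (t powr (- real DIM('a) / 2) * t powr real DIM('a)) * t\<^sup>2"
   by simp
  also have "t powr (- real DIM('a) / 2) * t powr real DIM('a) = t powr (real DIM('a) / 2)"
   by (simp add: powr_add[symmetric])
  also have "... <= 4 powr (real DIM('a) / 2)" using t by (intro powr_mono2) auto
  finally show ?thesis by (simp add: K_def mult_left_mono mult_right_mono)
 qed
 moreover have "0 < K" by (simp add: K_def)
 ultimately show ?thesis using that by blast
qed

lemma heat_kernel_far_estimates: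
 obtains L where "0 < L"
  "!!(z::'a::euclidean_space) t. 1/2 <= norm z ==> 0 < t ==> t < 1 ==> hk z t <= L * t"
  "!!(z::'a) t h. 1/2 <= norm z ==> 0 < t ==> t < 1 ==> \<bar>- (z \<bullet> h) / (2 * t) * hk z t\<bar> <= L * norm h"
  "!!(z::'a) t h k. 1/2 <= norm z ==> 0 < t ==> t < 1 ==>
    \<bar>((z \<bullet> h) * (z \<bullet> k) / (4 * t\<^sup>2) - (k \<bullet> h) / (2 * t)) * hk z t\<bar> <= L * norm h * norm k"
  "!!(z::'a) s t. 1/2 <= norm z ==> 0 < s ==> s <= t ==> t <= 2 * s ==> t < 1 ==>
    \<bar>hk z t - hk z s\<bar> <= L * (t - s)"
proof -
 obtain K where K: "0 < K" "!!(z::'a) t. 1/2 <= norm z ==> 0 < t ==> t <= 4 ==> hk z t <= K * t\<^sup>2"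
  using heat_kernel_far_bound[where 'a = 'a] by metis
 define G where "G = gauss_const TYPE('a)"
 have G: "0 < G" unfolding G_def by (rule gauss_const_pos)
 define P where "P = 2 powr (real DIM('a) / 2)"
 have P: "0 < P" by (simp add: P_def)
 define L where "L = K + 4 * G * K + 16 * G * P * K"
 have nn: "0 < K" "0 < 4 * G * K" "0 < 16 * G * P * K" using K G P by auto
 have L: "0 < L" "K <= L" "4 * G * K <= L" "16 * G * P * K <= L" using nn unfolding L_def by linarith+
 show ?thesis
 proof (rule that[OF L(1)])
  fix z :: 'a and t :: real assume z: "1/2 <= norm z" and t: "0 < t" "t < 1"
  have "hk z t <= K * t\<^sup>2" by (rule K(2)[OF z]) (use t in auto)
  also have "... <= L * t"
   using L t K by (intro mult_mono) (auto simp: power2_eq_square mult_left_le)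
  finally show "hk z t <= L * t" .
  have K2: "hk z (2 * t) <= 4 * K * t\<^sup>2" using K(2)[OF z, of "2 * t"] t by (simp add: power2_eq_square)
  show "\<bar>- (z \<bullet> h) / (2 * t) * hk z t\<bar> <= L * norm h" for h
  proof -
   have "\<bar>- (z \<bullet> h) / (2 * t) * hk z t\<bar> <= G * t powr (- (1/2)) * norm h * hk z (2 * t)"
    unfolding G_def by (rule heat_kernel_gradient_bound[OF t(1)])
   also have "... <= G * t powr (- (1/2)) * norm h * (4 * K * t\<^sup>2)"
    using K2 G by (intro mult_left_mono) auto
   also have "... = 4 * G * K * norm h * (t powr (- (1/2)) * t powr 2)" using t by simp
   also have "t powr (- (1/2)) * t powr 2 = t powr (3/2)" by (simp add: powr_add[symmetric])
   also have "4 * G * K * norm h * t powr (3/2) <= 4 * G * K * norm h * 1"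
    using t G K by (intro mult_left_mono powr_le1) auto
   also have "... <= L * norm h" using L by (simp add: mult_right_mono)
   finally show ?thesis .
  qed
  show "\<bar>((z \<bullet> h) * (z \<bullet> k) / (4 * t\<^sup>2) - (k \<bullet> h) / (2 * t)) * hk z t\<bar> <= L * norm h * norm k" for h k
  proof -
   have "\<bar>((z \<bullet> h) * (z \<bullet> k) / (4 * t\<^sup>2) - (k \<bullet> h) / (2 * t)) * hk z t\<bar> <= G / t * norm h * norm k * hk z (2 * t)"
    unfolding G_def by (rule heat_kernel_hessian_bound[OF t(1)])
   also have "... <= G / t * norm h * norm k * (4 * K * t\<^sup>2)"
    using K2 G t by (intro mult_left_mono) auto
   also have "... = 4 * G * K * (norm h * norm k) * t" using t by (simp add: power2_eq_square)
   also have "... <= 4 * G * K * (norm h * norm k) * 1"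
    using t G K by (intro mult_left_mono) auto
   also have "... <= L * norm h * norm k" using mult_right_mono[OF L(3), of "norm h * norm k"] by (simp add: mult.assoc)
   finally show ?thesis .
  qed
 next
  fix z :: 'a and s t :: real assume z: "1/2 <= norm z" and t: "0 < s" "s <= t" "t <= 2 * s" "t < 1"
  have "\<bar>hk z t - hk z s\<bar> <= G * P * (t - s) / s * hk z (4 * s)"
   unfolding G_def P_def by (rule heat_kernel_time_difference[OF t(1-3)])
  also have "... <= G * P * (t - s) / s * (K * (4 * s)\<^sup>2)"
   using t G P by (intro mult_left_mono K(2)[OF z]) auto
  also have "... = 16 * G * P * K * (t - s) * s" using t by (simp add: power2_eq_square)
  also have "... <= 16 * G * P * K * (t - s) * 1" using t G P K by (intro mult_left_mono) auto
  also have "... <= L * (t - s)" using L t by (simp add: mult_right_mono)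
  finally show "\<bar>hk z t - hk z s\<bar> <= L * (t - s)" .
 qed
qed

text \<open>At distance at least 1 from the source, all derivatives of the heat kernel are bounded and the kernel itself is of order of the time; since \<open>p \<le> 1/2\<close>,
this is better than all the scaling laws require.\<close>
lemma local_singular_kernel:
 fixes S :: "'a::euclidean_space set" and Y :: "'b => 'a" and F :: "'b => real"
 assumes p: "0 < p" "p <= 1/2" and \<sigma>: "0 < \<sigma>" "\<sigma> <= 1"
  and F: "integrable M F" and Y: "Y \<in> borel_measurable M"
  and far: "!!x om. x \<in> S ==> F om ~= 0 ==> 1 <= norm (x - Y om)"
 shows "singular_kernel p \<sigma> S (%x t'. \<integral>om. F om * hk (x - Y om) t' \<partial>M)"
  and "\<exists>C. \<forall>x\<in>S. \<forall>t'\<in>{0<..<1}. \<bar>\<integral>om. F om * hk (x - Y om) t' \<partial>M\<bar> <= C * t'"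
proof -
 obtain L where L: "0 < L"
  and L0: "!!(z::'a) t. 1/2 <= norm z ==> 0 < t ==> t < 1 ==> hk z t <= L * t"
  and L1: "!!(z::'a) t h. 1/2 <= norm z ==> 0 < t ==> t < 1 ==> \<bar>- (z \<bullet> h) / (2 * t) * hk z t\<bar> <= L * norm h"
  and L2: "!!(z::'a) t h k. 1/2 <= norm z ==> 0 < t ==> t < 1 ==>
    \<bar>((z \<bullet> h) * (z \<bullet> k) / (4 * t\<^sup>2) - (k \<bullet> h) / (2 * t)) * hk z t\<bar> <= L * norm h * norm k"
  and Lt: "!!(z::'a) s t. 1/2 <= norm z ==> 0 < s ==> s <= t ==> t <= 2 * s ==> t < 1 ==>
    \<bar>hk z t - hk z s\<bar> <= L * (t - s)"
  by (rule heat_kernel_far_estimates[where 'a = 'a]) (rule that)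
 note [measurable] = Y borel_measurable_integrable[OF F]
 let ?e = "%x om t. hk (x - Y om) t"
 let ?g = "%x om t h. - ((x - Y om) \<bullet> h) / (2 * t) * hk (x - Y om) t"
 have hd: "((%x. ?e x om t) has_derivative ?g x om t) (at x within U)" if "0 < t" for x om t U
  using has_derivative_compose[OF has_derivative_diff[OF has_derivative_ident has_derivative_const]
    heat_kernel_has_derivative[where S = UNIV], of t "Y om" x U] that by simp
 have hd2: "((%x. ?g x om t h) has_derivative (%k. (((x - Y om) \<bullet> h) * ((x - Y om) \<bullet> k) / (4 * t\<^sup>2) - (k \<bullet> h) / (2 * t)) * hk (x - Y om) t)) (at x within U)" if "0 < t" for x om t U h
  using has_derivative_compose[OF has_derivative_diff[OF has_derivative_ident has_derivative_const]
    heat_kernel_gradient_has_derivative[where S = UNIV and h = h and t = t and z = "x - Y om"], where s = U] that by simp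
 have seg: "1/2 <= norm (u - Y om)" if "x \<in> S" "F om ~= 0" "norm (x - y) <= 1/2" "u \<in> closed_segment y x" for x y u om
 proof -
  have "norm (u - x) <= norm (y - x)" by (rule segment_bound1[OF that(4)[unfolded closed_segment_commute[of y x]], of])
  then have "norm (x - u) <= 1/2" using that(3) by (simp add: norm_minus_commute)
  moreover have "norm (x - Y om) <= norm (x - u) + norm (u - Y om)" by norm
  ultimately show ?thesis using far[OF that(1,2)] by linarith
 qed
 have far': "1/2 <= norm (x - Y om)" if "x \<in> S" "F om ~= 0" for x om using far[OF that] by simp
 have lip: "\<bar>?e x om t - ?e y om t\<bar> <= 4 * L * norm (x - y)"
  if x: "x \<in> S" and y: "y \<in> S" and w: "F om ~= 0" and t: "0 < t" "t < 1" for x y om t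
 proof (cases "norm (x - y) <= 1/2")
  case True
  have "norm (?e x om t - ?e y om t) <= L * norm (x - y)"
  proof (rule differentiable_bound[where S = "closed_segment y x" and f' = "%u. ?g u om t"])
   show "onorm (?g u om t) <= L" if u: "u \<in> closed_segment y x" for u
    using L L1[OF seg[OF x w True u] t] by (intro onorm_bound) auto
  qed (use hd t in auto)
  then show ?thesis using L by (simp add: mult_right_mono order_trans)
 next
  case False
  have "\<bar>?e x om t - ?e y om t\<bar> <= L * t + L * t"
   using L0[OF far'[OF x w] t] L0[OF far'[OF y w] t] heat_kernel_nonneg[of "x - Y om" t] heat_kernel_nonneg[of "y - Y om" t] by linarith
  also have "... = 2 * L * t" by simp
  also have "... <= 2 * L * (2 * norm (x - y))" using False t L by (intro mult_left_mono) auto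
  finally show ?thesis by simp
 qed
 have hol: "\<bar>?g x om t h - ?g y om t h\<bar> <= 4 * L * norm (x - y) powr \<sigma> * norm h"
  if x: "x \<in> S" and y: "y \<in> S" and w: "F om ~= 0" and t: "0 < t" "t < 1" for x y om t h
 proof (cases "x = y")
  case False
  then have d: "0 < norm (x - y)" by simp
  show ?thesis
  proof (cases "norm (x - y) <= 1/2")
   case True
   have "norm (?g x om t h - ?g y om t h) <= L * norm h * norm (x - y)"
   proof (rule differentiable_bound[where S = "closed_segment y x"])
    show "((%x. ?g x om t h) has_derivative (%k. (((u - Y om) \<bullet> h) * ((u - Y om) \<bullet> k) / (4 * t\<^sup>2) - (k \<bullet> h) / (2 * t)) * hk (u - Y om) t)) (at u within closed_segment y x)" for u
     by (rule hd2[OF t(1)])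
    show "onorm (%k. (((u - Y om) \<bullet> h) * ((u - Y om) \<bullet> k) / (4 * t\<^sup>2) - (k \<bullet> h) / (2 * t)) * hk (u - Y om) t) <= L * norm h" if u: "u \<in> closed_segment y x" for u
     using L L2[OF seg[OF x w True u] t, of h] by (intro onorm_bound) auto
   qed auto
   also have "... <= 4 * L * norm h * norm (x - y) powr \<sigma>"
   proof (intro mult_mono)
    show "norm (x - y) <= norm (x - y) powr \<sigma>"
     using powr_mono'[of \<sigma> 1 "norm (x - y)"] \<sigma> d True by simp
   qed (use L in auto)
   finally show ?thesis by (simp add: mult_ac)
  next
   case False
   have "\<bar>?g x om t h - ?g y om t h\<bar> <= L * norm h + L * norm h"
    using L1[OF far'[OF x w] t, of h] L1[OF far'[OF y w] t, of h] by linarith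
   also have "... = 4 * L * norm h * (1/2)" by simp
   also have "... <= 4 * L * norm h * norm (x - y) powr \<sigma>"
   proof (intro mult_left_mono)
    have "(1/2) powr 1 <= (1/2::real) powr \<sigma>" using \<sigma> by (intro powr_mono') auto
    also have "... <= norm (x - y) powr \<sigma>" using False \<sigma> by (intro powr_mono2) auto
    finally show "1/2 <= norm (x - y) powr \<sigma>" by simp
   qed (use L in auto)
   finally show ?thesis by (simp add: mult_ac)
  qed
 qed (use L in simp)
 define A where "A = (\<integral>om. \<bar>F om\<bar> \<partial>M)"
 have A: "0 <= A" unfolding A_def by (intro Bochner_Integration.integral_nonneg) auto
 have absint: "\<bar>\<integral>om. f om \<partial>M\<bar> <= A * c" if "!!om. \<bar>f om\<bar> <= \<bar>F om\<bar> * c" for f :: "'b => real" and c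
  using abs_integral_le[of M "%om. \<bar>F om\<bar> * c" f] F that by (simp add: A_def)
 have Fle: "\<bar>F om * a\<bar> <= \<bar>F om\<bar> * c" if "F om ~= 0 ==> \<bar>a\<bar> <= c" for om a c
  using that by (cases "F om = 0") (auto simp: abs_mult intro: mult_left_mono)
 have int: "integrable M (%om. F om * ?e x om t)" if "x \<in> S" "0 < t" "t < 1" for x t
 proof (rule Bochner_Integration.integrable_bound)
  show "integrable M (%om. \<bar>F om\<bar> * (L * t))" using F by simp
  show "AE om in M. norm (F om * ?e x om t) <= norm (\<bar>F om\<bar> * (L * t))"
   using Fle[of _ "?e x _ t" "L * t"] L0[OF far'[OF that(1)] that(2,3)] L that by (intro AE_I2) (auto simp: abs_mult)
 qed measurable
 have intg: "integrable M (%om. F om * ?g x om t h)" if "x \<in> S" "0 < t" "t < 1" for x t h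
 proof (rule Bochner_Integration.integrable_bound)
  show "integrable M (%om. \<bar>F om\<bar> * (L * norm h))" using F by simp
  show "AE om in M. norm (F om * ?g x om t h) <= norm (\<bar>F om\<bar> * (L * norm h))"
  proof (rule AE_I2)
   fix om
   have "\<bar>F om * ?g x om t h\<bar> <= \<bar>F om\<bar> * (L * norm h)"
    by (rule Fle, rule L1[OF far'[OF that(1)] that(2,3)])
   then show "norm (F om * ?g x om t h) <= norm (\<bar>F om\<bar> * (L * norm h))" using L by simp
  qed
 qed measurable
 let ?th = "%x t'. \<integral>om. F om * ?e x om t' \<partial>M"
 let ?th' = "%x t' h. \<integral>om. F om * ?g x om t' h \<partial>M"
 have b0: "\<bar>?th x t'\<bar> <= A * (L * t')" if "x \<in> S" "0 < t'" "t' < 1" for x t'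
  by (intro absint Fle) (use L0[OF far'[OF that(1)] that(2,3)] in auto)
 have pw: "1 <= t' powr r" if "0 < t'" "t' < 1" "r <= 0" for t' r :: real
  using powr_mono'[of r 0 t'] that by simp
 have "singular_kernel_by (A * (4 * L)) ?th' p \<sigma> S ?th"
  unfolding singular_kernel_by_def
 proof (intro conjI ballI allI impI)
  show "0 <= A * (4 * L)" using A L by simp
  fix x assume x: "x \<in> S"
  show "\<bar>?th x t'2 - ?th x t'1\<bar> <= A * (4 * L) * t'1 powr (p - 1) * (t'2 - t'1)"
   if t: "0 < t'1" "t'1 <= t'2" "t'2 <= 2 * t'1" "t'2 < 1" for t'1 t'2
  proof -
   have "\<bar>?th x t'2 - ?th x t'1\<bar> = \<bar>\<integral>om. F om * (?e x om t'2 - ?e x om t'1) \<partial>M\<bar>"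
    using int[OF x, of t'1] int[OF x, of t'2] t by (simp add: right_diff_distrib)
   also have "... <= A * (L * (t'2 - t'1))"
    by (intro absint Fle Lt far'[OF x] t)
   also have "... <= A * ((4 * L * t'1 powr (p - 1)) * (t'2 - t'1))"
    using pw[of t'1 "p - 1"] t p L A
    by (intro mult_left_mono mult_right_mono) (auto simp: mult_le_cancel_left_pos intro: order_trans[of _ "L * 1"] mult_mono)
   finally show ?thesis by (simp add: mult_ac)
  qed
  fix t' :: real assume "t' \<in> {0<..<1}"
  then have t: "0 < t'" "t' < 1" by auto
  have "A * (L * t') <= A * (4 * L * t' powr p)"
   using powr_mono'[of p 1 t'] t p L A by (intro mult_left_mono mult_mono) auto
  then show "\<bar>?th x t'\<bar> <= A * (4 * L) * t' powr p"
   using b0[OF x t] by (simp add: mult.assoc)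
  show "((%y. ?th y t') has_derivative ?th' x t') (at x within S)"
  proof (rule has_derivative_integral_dominated[where g = "%om. \<bar>F om\<bar> * (4 * L)"])
   show "((%y. F om * ?e y om t') has_derivative (%h. F om * ?g x om t' h)) (at x within S)" for om
    by (intro has_derivative_mult_right hd t)
   show "\<bar>F om * ?e y om t' - F om * ?e x om t'\<bar> <= \<bar>F om\<bar> * (4 * L) * norm (y - x)" if "y \<in> S" for y om
    using Fle[OF lip[OF that x _ t], of om] by (simp add: right_diff_distrib mult_ac)
   show "\<bar>F om * ?g x om t' h\<bar> <= \<bar>F om\<bar> * (4 * L) * norm h" for om h
   proof -
    have "\<bar>F om * ?g x om t' h\<bar> <= \<bar>F om\<bar> * (4 * L * norm h)"
    proof (rule Fle)
     assume "F om ~= 0"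
     have "L * norm h <= 4 * L * norm h" using L by (intro mult_right_mono) auto
     with L1[OF far'[OF x \<open>F om ~= 0\<close>] t, of h] show "\<bar>?g x om t' h\<bar> <= 4 * L * norm h"
      by (rule order_trans)
    qed
    then show ?thesis by (simp add: mult_ac)
   qed
   show "(%om. F om * ?g x om t' h) \<in> borel_measurable M" for h
    using intg[OF x t] by auto
  qed (use x F int t in auto)
  show "\<bar>?th' x t' h\<bar> <= A * (4 * L) * t' powr (p - 1/2) * norm h" for h
  proof -
   have "\<bar>?th' x t' h\<bar> <= A * (L * norm h)"
    by (intro absint Fle L1 far'[OF x] t)
   also have "... <= A * ((4 * L * t' powr (p - 1/2)) * norm h)"
    using pw[of t' "p - 1/2"] t p L A
    by (intro mult_left_mono mult_right_mono) (auto intro: order_trans[of _ "L * 1"] mult_mono)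
   finally show ?thesis by (simp add: mult_ac)
  qed
  fix y assume y: "y \<in> S"
  show "\<bar>?th x t' - ?th y t'\<bar> <= A * (4 * L) * t' powr (p - 1/2) * norm (x - y)"
  proof -
   have "\<bar>?th x t' - ?th y t'\<bar> = \<bar>\<integral>om. F om * (?e x om t' - ?e y om t') \<partial>M\<bar>"
    using int[OF x t] int[OF y t] by (simp add: right_diff_distrib)
   also have "... <= A * (4 * L * norm (x - y))"
    by (intro absint Fle lip x y t)
   also have "... <= A * ((4 * L * t' powr (p - 1/2)) * norm (x - y))"
    using pw[of t' "p - 1/2"] t p L A by (intro mult_left_mono mult_right_mono) auto
   finally show ?thesis by (simp add: mult_ac)
  qed
  show "\<bar>?th' x t' h - ?th' y t' h\<bar> <= A * (4 * L) * t' powr (p - (1 + \<sigma>) / 2) * norm (x - y) powr \<sigma> * norm h" for h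
  proof -
   have "\<bar>?th' x t' h - ?th' y t' h\<bar> = \<bar>\<integral>om. F om * (?g x om t' h - ?g y om t' h) \<partial>M\<bar>"
    using intg[OF x t, of h] intg[OF y t, of h] by (simp add: right_diff_distrib)
   also have "... <= A * (4 * L * norm (x - y) powr \<sigma> * norm h)"
    by (intro absint Fle hol x y t)
   also have "... <= A * ((4 * L * t' powr (p - (1 + \<sigma>) / 2)) * norm (x - y) powr \<sigma> * norm h)"
    using pw[of t' "p - (1 + \<sigma>) / 2"] t p L A \<sigma> by (intro mult_left_mono mult_right_mono) auto
   finally show ?thesis by (simp add: mult_ac)
  qed
 qed
 then show "singular_kernel p \<sigma> S ?th" unfolding singular_kernel_def by blast
 show "\<exists>C. \<forall>x\<in>S. \<forall>t'\<in>{0<..<1}. \<bar>?th x t'\<bar> <= C * t'"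
  using b0 by (intro exI[of _ "A * L"]) (auto simp: mult.assoc)
qed

section \<open>Test functions\<close>

text \<open>Smoothness with compact support in the open unit ball; the class is closed under partial derivatives, which allows to speak about operators
that commute with them.\<close>
definition test_fun :: "('a::euclidean_space => real) => bool"
 where "test_fun ka \<longleftrightarrow> smooth_on UNIV ka \<and> closure {x. ka x ~= 0} \<subseteq> ball 0 1"

lemma partial_eq:
 assumes "(u has_derivative u') (at x)"
 shows "partial b u x = u' b"
proof -
 have lin: "linear u'" using assms has_derivative_bounded_linear bounded_linear.linear by blast
 have "((%s. u (x + s *\<^sub>R b)) has_derivative (%s. u' (s *\<^sub>R b))) (at 0)"
 proof (rule has_derivative_compose[where f = "%s. x + s *\<^sub>R b" and g = u])
  show "((%s. x + s *\<^sub>R b) has_derivative (%s. s *\<^sub>R b)) (at 0)"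
   by (auto intro!: derivative_eq_intros)
  show "(u has_derivative u') (at (x + 0 *\<^sub>R b))" using assms by simp
 qed
 then have "((%s. u (x + s *\<^sub>R b)) has_derivative (%s. u' b * s)) (at 0)"
  by (simp add: linear_cmul[OF lin] mult.commute)
 then have "((%s. u (x + s *\<^sub>R b)) has_real_derivative u' b) (at 0)"
  by (simp add: has_field_derivative_def)
 then show ?thesis unfolding partial_def by (rule DERIV_imp_deriv)
qed

lemma smooth_on_has_derivative:
 fixes u :: "'a::euclidean_space => real"
 assumes "smooth_on S u" "x \<in> S"
 shows "(u has_derivative (%h. \<Sum>b\<in>Basis. (h \<bullet> b) * partial b u x)) (at x)"
proof -
 have "Ck_on (Suc 0) S u" using assms unfolding smooth_on_def by blast
 then obtain u' where u': "(u has_derivative u') (at x)" using assms(2) by auto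
 have lin: "linear u'" using u' has_derivative_bounded_linear bounded_linear.linear by blast
 have "u' h = (\<Sum>b\<in>Basis. (h \<bullet> b) * partial b u x)" for h
 proof -
  have "u' h = u' (\<Sum>b\<in>Basis. (h \<bullet> b) *\<^sub>R b)" by (simp add: euclidean_representation)
  also have "... = (\<Sum>b\<in>Basis. (h \<bullet> b) * u' b)" by (simp add: linear_sum[OF lin] linear_cmul[OF lin])
  finally show ?thesis by (simp add: partial_eq[OF u'])
 qed
 then have "u' = (%h. \<Sum>b\<in>Basis. (h \<bullet> b) * partial b u x)" by (rule ext)
 then show ?thesis using u' by simp
qed

lemma Ck_on_cong:
 assumes "open S" "!!x. x \<in> S ==> u x = v x" "Ck_on k S u"
 shows "Ck_on k S v"
proof (cases k)
 case 0
 then show ?thesis using assms continuous_on_cong[of S S u v] by auto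
next
 case (Suc j)
 then obtain u' where u': "!!x. x \<in> S ==> (u has_derivative u' x) (at x)" "!!b. b \<in> Basis ==> Ck_on j S (%x. u' x b)"
  using assms(3) by auto
 have "(v has_derivative u' x) (at x)" if "x \<in> S" for x
  by (rule has_derivative_transform_within_open[OF u'(1)[OF that] assms(1) that]) (use assms(2) in auto)
 then show ?thesis using u'(2) unfolding Suc by auto
qed

lemma smooth_on_partial:
 assumes S: "open S" and u: "smooth_on S u" and b: "b \<in> Basis"
 shows "smooth_on S (partial b u)"
 unfolding smooth_on_def
proof
 fix k
 have "Ck_on (Suc k) S u" using u unfolding smooth_on_def by blast
 then obtain u' where u': "!!x. x \<in> S ==> (u has_derivative u' x) (at x)" "!!b. b \<in> Basis ==> Ck_on k S (%x. u' x b)"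
  by auto
 show "Ck_on k S (partial b u)"
  by (rule Ck_on_cong[OF S _ u'(2)[OF b]]) (simp add: partial_eq[OF u'(1)])
qed

lemma smooth_on_continuous: "smooth_on S u ==> continuous_on S u"
 unfolding smooth_on_def by (metis Ck_on.simps(1))

lemma test_fun_partial:
 fixes ka :: "'a::euclidean_space => real"
 assumes ka: "test_fun ka" and b: "b \<in> Basis"
 shows "test_fun (partial b ka)"
proof -
 have "partial b ka x = 0" if x: "x \<notin> closure {x. ka x ~= 0}" for x
 proof -
  have "((%x. 0) has_derivative (%h. 0)) (at x)" by simp
  then have "(ka has_derivative (%h. 0)) (at x)"
   by (rule has_derivative_transform_within_open[where s = "- closure {x. ka x ~= 0}"])
     (use x closure_subset[of "{x. ka x ~= 0}"] in auto)
  then show ?thesis by (simp add: partial_eq)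
 qed
 then have "{x. partial b ka x ~= 0} \<subseteq> closure {x. ka x ~= 0}" by auto
 then have "closure {x. partial b ka x ~= 0} \<subseteq> closure {x. ka x ~= 0}" by (rule closure_minimal) simp
 then show ?thesis using ka smooth_on_partial[OF open_UNIV _ b, of ka] by (auto simp: test_fun_def)
qed

lemma test_funD:
 fixes ka :: "'a::euclidean_space => real"
 assumes ka: "test_fun ka"
 shows "continuous_on UNIV ka" and "ka \<in> borel_measurable borel"
  and "1 <= norm x ==> ka x = 0" and "integrable lborel ka" and "\<exists>C\<ge>0. \<forall>x. \<bar>ka x\<bar> <= C"
  and "(ka has_derivative (%h. \<Sum>b\<in>Basis. (h \<bullet> b) * partial b ka x)) (at x)"
proof -
 show c: "continuous_on UNIV ka" using ka smooth_on_continuous by (auto simp: test_fun_def)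
 show "ka \<in> borel_measurable borel" using c by (rule borel_measurable_continuous_onI)
 have z: "ka x = 0" if "1 <= norm x" for x
  using ka closure_subset[of "{x. ka x ~= 0}"] that by (force simp: test_fun_def)
 then show "1 <= norm x ==> ka x = 0" .
 have "integrable lborel (%x. indicator (cball 0 1) x *\<^sub>R ka x)"
  using c by (intro borel_integrable_compact) (auto intro: continuous_on_subset)
 moreover have "(%x. indicator (cball 0 1) x *\<^sub>R ka x) = ka"
  using z by (auto simp: indicator_def fun_eq_iff)
 ultimately show "integrable lborel ka" by simp
 have "compact (ka ` cball 0 1)" using c by (intro compact_continuous_image) (auto intro: continuous_on_subset)
 then obtain C where C: "0 < C" "!!y. y \<in> ka ` cball 0 1 ==> norm y <= C"
  using compact_imp_bounded bounded_pos by metis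
 have "\<bar>ka x\<bar> <= C" for x
  using C(2)[of "ka x"] C(1) z[of x] by (cases "norm x <= 1") auto
 then show "\<exists>C\<ge>0. \<forall>x. \<bar>ka x\<bar> <= C" using C(1) by (intro exI[of _ C]) auto
 show "(ka has_derivative (%h. \<Sum>b\<in>Basis. (h \<bullet> b) * partial b ka x)) (at x)"
  using ka by (intro smooth_on_has_derivative[of UNIV]) (auto simp: test_fun_def)
qed

section \<open>The boundary layer profile\<close>

text \<open>The \<open>y\<close>-derivative of the normal factor of the force: singular like \<open>y powr (- \<beta>)\<close> at the boundary.\<close>
definition profile :: "real => (real => real) => bool"
 where "profile \<beta> \<phi> \<longleftrightarrow> continuous_on {0<..} \<phi> \<and> (\<exists>A. \<forall>y>0. \<bar>\<phi> y\<bar> <= A * y powr (- \<beta>)) \<and> (\<forall>y\<ge>2. \<phi> y = 0)"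

text \<open>The profile seen through the heat kernel at distance \<open>ze\<close> beyond the boundary; \<open>layer1\<close> is its derivative in \<open>ze\<close>.\<close>
definition layer0 :: "(real => real) => real => real => real"
 where "layer0 \<phi> t' ze = (LBINT y. indicator {0<..} y * \<phi> y * hk (y + ze) t')"

definition layer1 :: "(real => real) => real => real => real"
 where "layer1 \<phi> t' ze = (LBINT y. indicator {0<..} y * \<phi> y * (- (y + ze) / (2 * t') * hk (y + ze) t'))"

lemma profile_measurable:
 assumes "profile \<beta> \<phi>"
 shows "(%y. indicator {0<..} y * \<phi> y) \<in> borel_measurable borel"
 using assms borel_measurable_continuous_on_indicator[of "{0<..}" \<phi>] by (simp add: profile_def)

lemma profile_integrable:
 assumes \<phi>: "profile \<beta> \<phi>" and \<beta>: "\<beta> < 1"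
 shows "integrable lborel (%y. indicator {0<..} y * \<phi> y)"
proof -
 obtain A where A: "!!y. 0 < y ==> \<bar>\<phi> y\<bar> <= A * y powr (- \<beta>)" and z: "!!y. 2 <= y ==> \<phi> y = 0"
  using \<phi> by (auto simp: profile_def)
 have "set_integrable lborel {0<..<2} (%y::real. (2 - y) powr (- 0) * y powr (- \<beta>))"
  using \<beta> by (intro Beta_convolution) auto
 then have "integrable lborel (%y::real. \<bar>A\<bar> * (indicator {0<..<2} y * ((2 - y) powr (- 0) * y powr (- \<beta>))))"
  by (simp add: set_integrable_def)
 then show ?thesis
 proof (rule Bochner_Integration.integrable_bound)
  show "(%y. indicator {0<..} y * \<phi> y) \<in> borel_measurable lborel"
   using profile_measurable[OF \<phi>] by simp
  show "AE y in lborel. norm (indicator {0<..} y * \<phi> y) <= norm (\<bar>A\<bar> * (indicator {0<..<2} y * ((2 - y) powr (- 0) * y powr (- \<beta>))))"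
  proof (rule AE_I2)
   fix y :: real
   show "norm (indicator {0<..} y * \<phi> y) <= norm (\<bar>A\<bar> * (indicator {0<..<2} y * ((2 - y) powr (- 0) * y powr (- \<beta>))))"
   proof (cases "0 < y \<and> y < 2")
    case True
    have "\<bar>\<phi> y\<bar> <= \<bar>A\<bar> * y powr (- \<beta>)"
     by (rule order_trans[OF A mult_right_mono]) (use True in auto)
    then show ?thesis using True by simp
   next
    case False
    then show ?thesis using z[of y] by (auto simp: indicator_def)
   qed
  qed
 qed
qed

lemma integrable_mult_bounded:
 fixes f k :: "'b => real"
 assumes "integrable M f" "k \<in> borel_measurable M" "!!x. \<bar>k x\<bar> <= B"
 shows "integrable M (%x. f x * k x)"
proof (rule Bochner_Integration.integrable_bound)
 show "integrable M (%x. f x * B)" using assms by simp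
 show "(%x. f x * k x) \<in> borel_measurable M" using assms by auto
 show "AE x in M. norm (f x * k x) <= norm (f x * B)"
 proof (rule AE_I2)
  fix x
  have "\<bar>k x\<bar> <= \<bar>B\<bar>" using assms(3)[of x] by linarith
  then show "norm (f x * k x) <= norm (f x * B)" by (simp add: abs_mult mult_left_mono)
 qed
qed

definition hk1 :: "real => real => real"
 where "hk1 t' u = - u / (2 * t') * hk u t'"

lemma hk1_bounds:
 assumes "0 < t'"
 shows "\<bar>hk1 t' u\<bar> <= gauss_const TYPE(real) * t' powr (- (1/2)) * hk u (2 * t')"
  and "((%u. hk u t') has_real_derivative hk1 t' u) (at u)"
  and "a <= u ==> a <= v ==> 0 <= a ==> \<bar>hk1 t' u - hk1 t' v\<bar> <= gauss_const TYPE(real) / t' * hk a (2 * t') * \<bar>u - v\<bar>"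
  and "\<bar>hk1 t' u - hk1 t' v\<bar> <= gauss_const TYPE(real) / t' * (2 * t') powr (- (1/2)) * \<bar>u - v\<bar>"
proof -
 show "\<bar>hk1 t' u\<bar> <= gauss_const TYPE(real) * t' powr (- (1/2)) * hk u (2 * t')"
  using heat_kernel_gradient_bound[OF assms, of u 1] by (simp add: hk1_def)
 show "((%u. hk u t') has_real_derivative hk1 t' u) (at u)"
  unfolding has_field_derivative_def
  by (rule has_derivative_eq_rhs[OF heat_kernel_has_derivative]) (use assms in \<open>auto simp: hk1_def\<close>)
 define d where "d w = (w * w / (4 * t'\<^sup>2) - 1 / (2 * t')) * hk w t'" for w :: real
 have der: "(hk1 t' has_real_derivative d w) (at w within S)" for w S
  using heat_kernel_gradient_has_derivative[of t' 1 w S] assms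
  unfolding has_field_derivative_def hk1_def d_def
  by (auto elim!: has_derivative_eq_rhs simp: fun_eq_iff algebra_simps)
 have db: "\<bar>d w\<bar> <= gauss_const TYPE(real) / t' * hk w (2 * t')" for w
  using heat_kernel_hessian_bound[OF assms, of w 1 1] by (simp add: d_def)
 have G: "0 <= gauss_const TYPE(real) / t'" using gauss_const_pos[where 'a = real] assms by simp
 show "\<bar>hk1 t' u - hk1 t' v\<bar> <= gauss_const TYPE(real) / t' * hk a (2 * t') * \<bar>u - v\<bar>" if "a <= u" "a <= v" "0 <= a"
 proof -
  have "norm (hk1 t' u - hk1 t' v) <= gauss_const TYPE(real) / t' * hk a (2 * t') * norm (u - v)"
  proof (rule field_differentiable_bound[where S = "{a..}" and f' = d])
   show "norm (d w) <= gauss_const TYPE(real) / t' * hk a (2 * t')" if "w \<in> {a..}" for w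
    using db[of w] mult_left_mono[OF heat_kernel_real_mono[of "2 * t'" a w] G] that \<open>0 <= a\<close> assms by auto
  qed (use that der in auto)
  then show ?thesis by simp
 qed
 have "norm (hk1 t' u - hk1 t' v) <= gauss_const TYPE(real) / t' * (2 * t') powr (- (1/2)) * norm (u - v)"
 proof (rule field_differentiable_bound[where S = UNIV and f' = d])
  show "norm (d w) <= gauss_const TYPE(real) / t' * (2 * t') powr (- (1/2))" for w
   using db[of w] mult_left_mono[OF heat_kernel_real_le[of "2 * t'" w] G] assms by auto
 qed (use der in auto)
 then show "\<bar>hk1 t' u - hk1 t' v\<bar> <= gauss_const TYPE(real) / t' * (2 * t') powr (- (1/2)) * \<bar>u - v\<bar>" by simp
qed

lemma hk1_measurable [measurable]: "hk1 t' \<in> borel_measurable borel"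
 unfolding hk1_def[abs_def] by measurable

lemma hk1_bounded:
 assumes "0 < t'"
 shows "\<bar>hk1 t' u\<bar> <= gauss_const TYPE(real) * t' powr (- (1/2)) * (2 * t') powr (- (1/2))"
 by (rule order_trans[OF hk1_bounds(1)[OF assms] mult_left_mono])
   (use heat_kernel_real_le[of "2 * t'" u] gauss_const_pos[where 'a = real] assms in auto)

lemma layer0_has_derivative:
 assumes \<phi>: "profile \<beta> \<phi>" and \<beta>: "\<beta> < 1" and t': "0 < t'"
 shows "(layer0 \<phi> t' has_real_derivative layer1 \<phi> t' ze) (at ze)"
  and "continuous_on UNIV (layer1 \<phi> t')"
  and "integrable lborel (%y. indicator {0<..} y * \<phi> y * hk (y + ze) t')"
  and "integrable lborel (%y. indicator {0<..} y * \<phi> y * hk1 t' (y + ze))"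
  and "layer1 \<phi> t' ze = (LBINT y. indicator {0<..} y * \<phi> y * hk1 t' (y + ze))"
proof -
 let ?p = "%y. indicator {0<..} y * \<phi> y"
 have [measurable]: "?p \<in> borel_measurable borel" by (rule profile_measurable[OF \<phi>])
 have ip: "integrable lborel ?p" by (rule profile_integrable[OF \<phi> \<beta>])
 define B where "B = gauss_const TYPE(real) * t' powr (- (1/2)) * (2 * t') powr (- (1/2))"
 have B: "\<bar>hk1 t' u\<bar> <= B" for u unfolding B_def by (rule hk1_bounded[OF t'])
 have i0: "integrable lborel (%y. ?p y * hk (y + ze) t')" for ze
  using ip by (rule integrable_mult_bounded[where B = "t' powr (- (1/2))"]) (use heat_kernel_real_le[OF t'] in auto)
 have i1: "integrable lborel (%y. ?p y * hk1 t' (y + ze))" for ze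
  using ip by (rule integrable_mult_bounded[where B = B]) (use B in auto)
 show "integrable lborel (%y. ?p y * hk (y + ze) t')" "integrable lborel (%y. ?p y * hk1 t' (y + ze))"
  by (rule i0, rule i1)
 have l1: "layer1 \<phi> t' ze = (LBINT y. ?p y * hk1 t' (y + ze))" for ze
  by (simp add: layer1_def hk1_def)
 then show "layer1 \<phi> t' ze = (LBINT y. ?p y * hk1 t' (y + ze))" .
 have der: "((%ze. hk (y + ze) t') has_real_derivative hk1 t' (y + ze)) (at ze)" for y ze
 proof -
  have "((%ze. y + ze) has_real_derivative 1) (at ze)" by (auto intro!: derivative_eq_intros)
  from DERIV_chain2[where f = "%u. hk u t'" and g = "%ze. y + ze", OF hk1_bounds(2)[OF t', of "y + ze"] this]
  show ?thesis by simp
 qed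
 have lip: "\<bar>hk (y + ze1) t' - hk (y + ze2) t'\<bar> <= B * \<bar>ze1 - ze2\<bar>" for y ze1 ze2
  using field_differentiable_bound[where S = UNIV and f' = "%ze. hk1 t' (y + ze)" and f = "%ze. hk (y + ze) t'" and B = B]
   der B by auto
 have "((%ze. LBINT y. ?p y * hk (y + ze) t') has_derivative (%h. LBINT y. ?p y * (hk1 t' (y + ze) * h))) (at ze)"
 proof (rule has_derivative_integral_dominated[where g = "%y. \<bar>?p y\<bar> * B" and S = UNIV])
  show "((%ze. ?p y * hk (y + ze) t') has_derivative (%h. ?p y * (hk1 t' (y + ze) * h))) (at ze)" for y
   using der[of y ze] by (intro has_derivative_mult_right) (simp add: has_field_derivative_def)
  show "\<bar>?p y * hk (y + \<xi>) t' - ?p y * hk (y + ze) t'\<bar> <= \<bar>?p y\<bar> * B * norm (\<xi> - ze)" for y \<xi>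
   using mult_left_mono[OF lip[of y \<xi> ze], of "\<bar>?p y\<bar>"] by (simp add: abs_mult right_diff_distrib[symmetric] mult_ac)
  show "\<bar>?p y * (hk1 t' (y + ze) * h)\<bar> <= \<bar>?p y\<bar> * B * norm h" for y h
   using mult_mono[OF B[of "y + ze"] order_refl[of "\<bar>h\<bar>"], of ] B[of 0]
    mult_left_mono[of "\<bar>hk1 t' (y + ze)\<bar> * \<bar>h\<bar>" "B * \<bar>h\<bar>" "\<bar>?p y\<bar>"] by (auto simp: abs_mult mult_ac)
 qed (use i0 ip in auto)
 moreover have "(LBINT y. ?p y * (hk1 t' (y + ze) * h)) = layer1 \<phi> t' ze * h" for h
  unfolding l1 using i1[of ze] by (subst integral_mult_left_zero[symmetric]) (simp add: mult.assoc)
 ultimately show "(layer0 \<phi> t' has_real_derivative layer1 \<phi> t' ze) (at ze)"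
  by (simp add: has_field_derivative_def layer0_def[abs_def])
 define L where "L = gauss_const TYPE(real) / t' * (2 * t') powr (- (1/2))"
 have lip1: "dist (layer1 \<phi> t' ze1) (layer1 \<phi> t' ze2) <= ((LBINT y. \<bar>?p y\<bar>) * L) * dist ze1 ze2" for ze1 ze2
 proof -
  have "\<bar>layer1 \<phi> t' ze1 - layer1 \<phi> t' ze2\<bar> = \<bar>LBINT y. ?p y * (hk1 t' (y + ze1) - hk1 t' (y + ze2))\<bar>"
   unfolding l1 using i1[of ze1] i1[of ze2] by (simp add: right_diff_distrib)
  also have "... <= (LBINT y. \<bar>?p y\<bar> * (L * \<bar>ze1 - ze2\<bar>))"
  proof (rule abs_integral_le)
   show "integrable lborel (%y. \<bar>?p y\<bar> * (L * \<bar>ze1 - ze2\<bar>))" using ip by (intro integrable_mult_left) simp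
   show "\<bar>?p y * (hk1 t' (y + ze1) - hk1 t' (y + ze2))\<bar> <= \<bar>?p y\<bar> * (L * \<bar>ze1 - ze2\<bar>)" for y
    using hk1_bounds(4)[OF t', of "y + ze1" "y + ze2"] unfolding abs_mult[of "?p y"] L_def by (intro mult_left_mono) auto
  qed
  also have "... = (LBINT y. \<bar>?p y\<bar>) * (L * \<bar>ze1 - ze2\<bar>)" by (rule integral_mult_left_zero)
  finally show ?thesis by (simp add: dist_real_def mult_ac)
 qed
 have "((LBINT y. \<bar>?p y\<bar>) * L)-lipschitz_on UNIV (layer1 \<phi> t')"
  by (rule lipschitz_onI) (use lip1 gauss_const_pos[where 'a = real] t' in
    \<open>auto simp: L_def intro!: mult_nonneg_nonneg Bochner_Integration.integral_nonneg divide_nonneg_nonneg\<close>)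
 then show "continuous_on UNIV (layer1 \<phi> t')" by (rule lipschitz_on_continuous_on)
qed

text \<open>As \<open>y\<close> and \<open>ze\<close> are nonnegative, the Gaussian at \<open>y + ze\<close> is at most a multiple of \<open>sqrt t\<close> times the product of the Gaussians at \<open>y\<close> and \<open>ze\<close>. The
integral over \<open>y\<close> then contributes the power \<open>(1 - \<beta>) / 2\<close> of the time, up to the cost of derivatives.\<close>
lemma layer_estimates:
 assumes \<phi>: "profile \<beta> \<phi>" and \<beta>: "0 < \<beta>" "\<beta> < 1" and p: "p = (1 - \<beta>) / 2"
 obtains D where "0 <= D"
  "!!t' ze. 0 < t' ==> 0 <= ze ==> \<bar>layer0 \<phi> t' ze\<bar> <= D * t' powr p * hk ze (2 * t')"
  "!!t' ze. 0 < t' ==> 0 <= ze ==> \<bar>layer1 \<phi> t' ze\<bar> <= D * t' powr (p - 1/2) * hk ze (2 * t')"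
  "!!t' ze1 ze2. 0 < t' ==> 0 <= ze1 ==> ze1 <= ze2 ==>
    \<bar>layer1 \<phi> t' ze2 - layer1 \<phi> t' ze1\<bar> <= D * t' powr (p - 1) * hk ze1 (2 * t') * (ze2 - ze1)"
  "!!s t ze. 0 < s ==> s <= t ==> t <= 2 * s ==> 0 <= ze ==>
    \<bar>layer0 \<phi> t ze - layer0 \<phi> s ze\<bar> <= D * s powr (p - 1) * (t - s) * hk ze (4 * s)"
proof -
 obtain A where A: "!!y. 0 < y ==> \<bar>\<phi> y\<bar> <= A * y powr (- \<beta>)"
  using \<phi> by (auto simp: profile_def)
 have A0: "0 <= A" using A[of 1] by simp
 obtain M where M: "0 < M"
  "!!t. 0 < t ==> integrable lborel (%y::real. indicator {0<..} y * y powr (- \<beta>) * hk y t)"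
  "!!t. 0 < t ==> (LBINT y. indicator {0<..} y * y powr (- \<beta>) * hk (y::real) t) <= M * t powr (- \<beta> / 2)"
  using heat_kernel_singular_integral[of \<beta>] \<beta> by auto
 let ?p = "%y. indicator {0<..} y * \<phi> y"
 define G where "G = gauss_const TYPE(real)"
 have G: "0 < G" unfolding G_def by (rule gauss_const_pos)
 have H: "\<bar>LBINT y. ?p y * k y\<bar> <= 4 * A * M * sqrt (4 * pi) * B * s powr p * hk ze s"
  if s: "0 < s" and ze: "0 <= ze" and B: "0 <= B" and k: "!!y. 0 < y ==> \<bar>k y\<bar> <= B * hk (y + ze) s" for s ze B k
 proof -
  let ?c = "A * B * sqrt (4 * pi * s) * hk ze s"
  let ?m = "%y. indicator {0<..} y * y powr (- \<beta>) * hk (y::real) s"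
  have "\<bar>LBINT y. ?p y * k y\<bar> <= (LBINT y. ?c * ?m y)"
  proof (rule abs_integral_le)
   show "integrable lborel (%y. ?c * ?m y)" using M(2)[OF s] by simp
   show "\<bar>?p y * k y\<bar> <= ?c * ?m y" for y
   proof (cases "0 < y")
    case True
    have "\<bar>k y\<bar> <= B * (sqrt (4 * pi * s) * hk y s * hk ze s)"
     using k[OF True] mult_left_mono[OF heat_kernel_add_le[of s y ze] B] True s ze by linarith
    then have "\<bar>\<phi> y\<bar> * \<bar>k y\<bar> <= (A * y powr (- \<beta>)) * (B * (sqrt (4 * pi * s) * hk y s * hk ze s))"
     using A[OF True] A0 by (intro mult_mono) auto
    then show ?thesis using True by (simp add: abs_mult mult_ac)
   qed simp
  qed
  also have "... = ?c * (LBINT y. ?m y)" by simp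
  also have "... <= ?c * (M * s powr (- \<beta> / 2))"
   using A0 B s by (intro mult_left_mono M(3)) auto
  also have "... = A * M * sqrt (4 * pi) * B * (s powr (1/2) * s powr (- \<beta> / 2)) * hk ze s"
   using s powr_half_sqrt[of s] by (simp add: real_sqrt_mult)
  also have "s powr (1/2) * s powr (- \<beta> / 2) = s powr p" by (simp add: p powr_add[symmetric] diff_divide_distrib)
  also have "A * M * sqrt (4 * pi) * B * s powr p * hk ze s <= 4 * A * M * sqrt (4 * pi) * B * s powr p * hk ze s"
   using A0 M(1) B by (intro mult_right_mono) auto
  finally show ?thesis .
 qed
 define D0 where "D0 = 4 * A * M * sqrt (4 * pi)"
 have D0: "0 <= D0" using A0 M by (simp add: D0_def)
 have pp: "0 < p" "p <= 1" using p \<beta> by auto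
 have s24: "(2 * t') powr p <= 4 * t' powr p" "(4 * t') powr p <= 4 * t' powr p" if "0 < t'" for t'
 proof -
  have "(4::real) powr p <= 4 powr 1" using pp by (intro powr_mono) auto
  moreover have "(2::real) powr p <= 4 powr p" using pp by (intro powr_mono2) auto
  ultimately show "(2 * t') powr p <= 4 * t' powr p" "(4 * t') powr p <= 4 * t' powr p"
   unfolding powr_mult[of 2 t'] powr_mult[of 4 t'] by (auto intro!: mult_right_mono)
 qed
 define D where "D = D0 * (G * 2 powr (1/2)) * 4"
 have D: "D0 * G * 4 <= D" "0 <= D"
 proof -
  have "1 <= (2::real) powr (1/2)" by (simp add: powr_half_sqrt)
  then have "D0 * G * 4 * 1 <= D0 * G * 4 * 2 powr (1/2)" using D0 G by (intro mult_left_mono) auto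
  then show "D0 * G * 4 <= D" by (simp add: D_def mult_ac)
  show "0 <= D" using D0 G by (simp add: D_def)
 qed
 note L = layer0_has_derivative[OF \<phi> \<beta>(2)]
 have fin: "D0 * (G * c) * (2 * t') powr p * h <= D * (c * t' powr p) * h" if "0 < t'" "0 <= c" "0 <= h" for c t' h
 proof -
  have "D0 * (G * c) * (2 * t') powr p * h <= D0 * (G * c) * (4 * t' powr p) * h"
   using s24[OF that(1)] D0 G that by (intro mult_right_mono mult_left_mono) auto
  also have "... = (D0 * G * 4) * (c * t' powr p * h)" by simp
  also have "... <= D * (c * t' powr p * h)" using D that by (intro mult_right_mono) auto
  finally show ?thesis by (simp add: mult_ac)
 qed
 show ?thesis
 proof (rule that[OF D(2)])
  fix t' ze :: real assume t': "0 < t'" and ze: "0 <= ze"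
  have "\<bar>layer0 \<phi> t' ze\<bar> <= D0 * (G * 1) * (2 * t') powr p * hk ze (2 * t')"
   unfolding layer0_def D0_def using heat_kernel_le_double[OF t', where 'a = real] G t' ze
   by (intro H) (auto simp: G_def)
  also have "... <= D * (1 * t' powr p) * hk ze (2 * t')" by (rule fin) (use t' in auto)
  finally show "\<bar>layer0 \<phi> t' ze\<bar> <= D * t' powr p * hk ze (2 * t')" by simp
  have "\<bar>layer1 \<phi> t' ze\<bar> <= D0 * (G * t' powr (- (1/2))) * (2 * t') powr p * hk ze (2 * t')"
   unfolding L(5)[OF t'] D0_def using hk1_bounds(1)[OF t'] G t' ze
   by (intro H) (auto simp: G_def)
  also have "... <= D * (t' powr (- (1/2)) * t' powr p) * hk ze (2 * t')" by (rule fin) (use t' in auto)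
  also have "t' powr (- (1/2)) * t' powr p = t' powr (p - 1/2)" by (simp add: powr_add[symmetric])
  finally show "\<bar>layer1 \<phi> t' ze\<bar> <= D * t' powr (p - 1/2) * hk ze (2 * t')" .
 next
  fix t' ze1 ze2 :: real assume t': "0 < t'" and ze: "0 <= ze1" "ze1 <= ze2"
  have "layer1 \<phi> t' ze2 - layer1 \<phi> t' ze1 = (LBINT y. ?p y * (hk1 t' (y + ze2) - hk1 t' (y + ze1)))"
   unfolding L(5)[OF t'] using L(4)[OF t'] by (simp add: right_diff_distrib)
  also have "\<bar>...\<bar> <= D0 * (G * (1 / t' * (ze2 - ze1))) * (2 * t') powr p * hk ze1 (2 * t')"
   unfolding D0_def
  proof (rule H)
   show "\<bar>hk1 t' (y + ze2) - hk1 t' (y + ze1)\<bar> <= G * (1 / t' * (ze2 - ze1)) * hk (y + ze1) (2 * t')" if "0 < y" for y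
    using hk1_bounds(3)[OF t', of "y + ze1" "y + ze2" "y + ze1"] that ze by (simp add: G_def mult_ac)
  qed (use t' ze G in auto)
  also have "... <= D * (1 / t' * (ze2 - ze1) * t' powr p) * hk ze1 (2 * t')" by (rule fin) (use t' ze in auto)
  also have "... = D * (t' powr p / t') * hk ze1 (2 * t') * (ze2 - ze1)" by simp
  also have "t' powr p / t' = t' powr (p - 1)" using t' by (simp add: powr_diff)
  finally show "\<bar>layer1 \<phi> t' ze2 - layer1 \<phi> t' ze1\<bar> <= D * t' powr (p - 1) * hk ze1 (2 * t') * (ze2 - ze1)" .
 next
  fix s t ze :: real assume s: "0 < s" "s <= t" "t <= 2 * s" and ze: "0 <= ze"
  have "layer0 \<phi> t ze - layer0 \<phi> s ze = (LBINT y. ?p y * (hk (y + ze) t - hk (y + ze) s))"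
   unfolding layer0_def using L(3)[of s ze] L(3)[of t ze] s by (simp add: right_diff_distrib)
  also have "\<bar>...\<bar> <= D0 * (G * 2 powr (1/2) * ((t - s) / s)) * (4 * s) powr p * hk ze (4 * s)"
   unfolding D0_def
  proof (rule H)
   show "\<bar>hk (y + ze) t - hk (y + ze) s\<bar> <= G * 2 powr (1/2) * ((t - s) / s) * hk (y + ze) (4 * s)" for y
    using heat_kernel_time_difference[OF s, of "y + ze"] by (simp add: G_def)
  qed (use s ze G in auto)
  also have "... <= D0 * (G * 2 powr (1/2) * ((t - s) / s)) * (4 * s powr p) * hk ze (4 * s)"
   using s24[OF s(1)] D0 G s by (intro mult_right_mono mult_left_mono) auto
  also have "... = D * (s powr p / s) * (t - s) * hk ze (4 * s)" by (simp add: D_def)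
  also have "s powr p / s = s powr (p - 1)" using s by (simp add: powr_diff)
  finally show "\<bar>layer0 \<phi> t ze - layer0 \<phi> s ze\<bar> <= D * s powr (p - 1) * (t - s) * hk ze (4 * s)" .
 qed
qed

text \<open>Leibniz rule for a variable end point with only continuous \<open>U\<close>: the derivative falls on the kernel.\<close>
lemma volterra_has_derivative:
 fixes \<psi> U :: "real => real"
 assumes U: "continuous_on {0..} U" and \<psi>: "!!ze. (\<psi> has_real_derivative \<psi>' ze) (at ze)"
  and \<psi>': "continuous_on UNIV \<psi>'" and r0: "0 <= r0"
 shows "((%r. integral {0..r} (%z. \<psi> (r - z) * U z)) has_real_derivative
   \<psi> 0 * U r0 + integral {0..r0} (%z. \<psi>' (r0 - z) * U z)) (at r0 within {0..})"
proof -
 have c\<psi>: "continuous_on UNIV \<psi>" using \<psi> by (meson DERIV_isCont continuous_at_imp_continuous_on)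
 have cg: "continuous_on {a..b} (%z. \<psi> (r - z) * U z)" if "0 <= a" for a b r
  by (intro continuous_intros continuous_on_compose2[OF c\<psi>] continuous_on_subset[OF U]) (use that in auto)
 have A: "((%r. integral (cbox 0 r0) (%z. \<psi> (r - z) * U z)) has_real_derivative integral (cbox 0 r0) (%z. \<psi>' (r0 - z) * U z)) (at r0 within {0..})"
 proof (rule leibniz_rule_field_derivative)
  show "((%r. \<psi> (r - z) * U z) has_real_derivative \<psi>' (r - z) * U z) (at r within {0..})" for r z
  proof -
   have "((%r. r - z) has_real_derivative 1) (at r within {0..})" by (auto intro!: derivative_eq_intros)
   from DERIV_chain2[where f = \<psi> and g = "%r. r - z", OF \<psi>[of "r - z"] this]
   show ?thesis by (auto intro: DERIV_cmult_right)
  qed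
  show "(%z. \<psi> (r - z) * U z) integrable_on cbox 0 r0" for r
   using cg[of 0 r0 r] by (auto intro!: integrable_continuous_interval)
  show "continuous_on ({0..} \<times> cbox 0 r0) (%(r, z). \<psi>' (r - z) * U z)"
   unfolding case_prod_unfold
   by (intro continuous_intros continuous_on_compose2[OF \<psi>'] continuous_on_compose2[OF U]) auto
 qed (use r0 in auto)
 define f where "f r = integral {0..r} (%z. \<psi> (r - z) * U z) - integral {0..r0} (%z. \<psi> (r - z) * U z)" for r
 define c where "c = \<psi> 0 * U r0"
 have B: "(f has_real_derivative c) (at r0 within {0..})"
  unfolding has_field_derivative_iff
 proof (rule Lim_withinI)
  fix e :: real assume e: "0 < e"
  have cont: "continuous_on ({0..} \<times> {0..}) (%(r, z). \<psi> (r - z) * U z)"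
   unfolding case_prod_unfold
   by (intro continuous_intros continuous_on_compose2[OF c\<psi>] continuous_on_compose2[OF U]) auto
  have "(r0, r0) \<in> {0..} \<times> {0..}" using r0 by simp
  from cont[unfolded continuous_on_iff, rule_format, OF this e]
  obtain d where d: "0 < d" and dd: "!!q. q \<in> {0..} \<times> {0..} ==> dist q (r0, r0) < d ==>
    dist ((%(r, z). \<psi> (r - z) * U z) q) ((%(r, z). \<psi> (r - z) * U z) (r0, r0)) < e"
   by blast
  have close: "\<bar>\<psi> (r - z) * U z - c\<bar> <= e" if "0 <= r" "0 <= z" "\<bar>r - r0\<bar> < d / 2" "\<bar>z - r0\<bar> < d / 2" for r z
  proof -
   have "dist (r, z) (r0, r0) <= \<bar>r - r0\<bar> + \<bar>z - r0\<bar>"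
    using sqrt_sum_squares_le_sum_abs[of "r - r0" "z - r0"] by (simp add: dist_Pair_Pair dist_real_def)
   then show ?thesis using dd[of "(r, z)"] that by (auto simp: c_def dist_real_def)
  qed
  have "dist ((f r - f r0) / (r - r0)) c <= e" if r: "0 <= r" "r ~= r0" "dist r r0 < d / 2" for r
  proof -
   have f0: "f r0 = 0" by (simp add: f_def)
   have "\<bar>f r - (r - r0) * c\<bar> <= e * \<bar>r - r0\<bar>"
   proof (cases "r0 <= r")
    case True
    have "f r = integral {r0..r} (%z. \<psi> (r - z) * U z)"
     using Henstock_Kurzweil_Integration.integral_combine[of 0 r0 r "%z. \<psi> (r - z) * U z"] r0 True cg[of 0 r r]
     by (simp add: f_def integrable_continuous_interval)
    then have "f r - (r - r0) * c = integral {r0..r} (%z. \<psi> (r - z) * U z - c)"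
     using True cg[of r0 r r] r0 by (subst Henstock_Kurzweil_Integration.integral_diff) (auto intro!: integrable_continuous_interval)
    also have "norm ... <= e * (r - r0)"
     using r True r0 cg[of r0 r r] by (intro integral_bound) (auto simp: dist_real_def intro!: close continuous_intros)
    finally show ?thesis using True by simp
   next
    case False
    have "f r = - integral {r..r0} (%z. \<psi> (r - z) * U z)"
     using Henstock_Kurzweil_Integration.integral_combine[of 0 r r0 "%z. \<psi> (r - z) * U z"] r r0 False cg[of 0 r0 r]
     by (simp add: f_def integrable_continuous_interval)
    then have "f r - (r - r0) * c = - integral {r..r0} (%z. \<psi> (r - z) * U z - c)"
     using False cg[of r r0 r] r by (subst Henstock_Kurzweil_Integration.integral_diff) (auto intro!: integrable_continuous_interval simp: algebra_simps)
    also have "norm ... <= e * (r0 - r)"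
     unfolding norm_minus_cancel
     using r False r0 cg[of r r0 r] by (intro integral_bound) (auto simp: dist_real_def intro!: close continuous_intros)
    finally show ?thesis using False by simp
   qed
   then have "\<bar>f r - (r - r0) * c\<bar> / \<bar>r - r0\<bar> <= e" using r by (simp add: divide_le_eq)
   moreover have "(f r - f r0) / (r - r0) - c = (f r - (r - r0) * c) / (r - r0)"
    using r f0 by (simp add: field_simps)
   ultimately show ?thesis by (simp add: dist_real_def abs_divide)
  qed
  then show "\<exists>d>0. \<forall>r\<in>{0..}. 0 < dist r r0 \<and> dist r r0 < d --> dist ((f r - f r0) / (r - r0)) c <= e"
   using d by (intro exI[of _ "d / 2"]) auto
 qed
 show ?thesis
  using DERIV_add[OF B A] by (simp add: f_def[abs_def] c_def)
qed

section \<open>The nonlocal kernel\<close>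

lemma norm_fst_le': "norm (fst H) <= norm H" and norm_snd_le': "norm (snd H) <= norm H"
 using norm_fst_le[of "fst H" "snd H"] norm_snd_le[of "snd H" "fst H"] by simp_all

text \<open>What is used of the tangential factor of the nonlocal term: it is bounded, Hoelder continuous up to the boundary in the normal variable \<open>z\<close>, changes in time
like a heat evolution, and commutes with tangential derivatives.\<close>
definition heat_ext_by ::
  "real => (('a::euclidean_space => real) => 'a => real => real => real) => ('a => real) => real => bool"
 where "heat_ext_by \<sigma> U ka C \<longleftrightarrow> 0 <= C \<and> (\<forall>t' x z. 0 < t' --> t' < 1 --> 0 <= z -->
  \<bar>U ka x z t'\<bar> <= C \<and>
  (\<forall>z2\<ge>0. \<bar>U ka x z t' - U ka x z2 t'\<bar> <= C * \<bar>z - z2\<bar> powr \<sigma>) \<and>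
  (\<forall>t. t' <= t --> t <= 2 * t' --> t < 1 --> \<bar>U ka x z t - U ka x z t'\<bar> <= C * ((t - t') / t')) \<and>
  ((%x. U ka x z t') has_derivative (%h. \<Sum>b\<in>Basis. (h \<bullet> b) * U (partial b ka) x z t')) (at x))"

definition heat_ext :: "real => (('a::euclidean_space => real) => 'a => real => real => real) => bool"
 where "heat_ext \<sigma> U \<longleftrightarrow> (\<forall>ka. test_fun ka --> (\<exists>C. heat_ext_by \<sigma> U ka C))"

definition layer_conv :: "(real => real) => (real => real) => real => real"
 where "layer_conv \<psi> v r = (LINT z:{0<..<r}|lborel. \<psi> (r - z) * v z)"

lemma layer_conv_integrable:
 assumes "continuous_on UNIV \<psi>" "continuous_on {0..} v"
 shows "set_integrable lborel {0<..<r} (%z. \<psi> (r - z) * v z)"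
  and "layer_conv \<psi> v r = integral {0..r} (%z. \<psi> (r - z) * v z)"
proof -
 have "continuous_on {0..r} (%z. \<psi> (r - z) * v z)"
  by (intro continuous_intros continuous_on_compose2[OF assms(1)] continuous_on_subset[OF assms(2)]) auto
 then have "set_integrable lborel {0..r} (%z. \<psi> (r - z) * v z)"
  unfolding set_integrable_def by (intro borel_integrable_compact) auto
 then show i: "set_integrable lborel {0<..<r} (%z. \<psi> (r - z) * v z)"
  by (rule set_integrable_subset) auto
 show "layer_conv \<psi> v r = integral {0..r} (%z. \<psi> (r - z) * v z)"
  unfolding layer_conv_def set_borel_integral_eq_integral(2)[OF i] by (rule integral_open_interval_real[symmetric])
qed

lemma layer_conv_bound:
 assumes s: "0 < s" and B: "0 <= B" and c: "0 <= c"
  and \<psi>: "!!ze. 0 <= ze ==> \<bar>\<psi> ze\<bar> <= B * hk ze s" and v: "!!z. 0 <= z ==> \<bar>v z\<bar> <= c"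
 shows "\<bar>layer_conv \<psi> v r\<bar> <= B * c"
proof -
 have i: "integrable lborel (%z. hk (r - z) s)" "(LBINT z. hk (r - z) s) = 1"
  using lborel_reflect[of "%z. hk z s" r] heat_kernel_integrable[OF s, where 'a = real]
   heat_kernel_integral[OF s, where 'a = real] by auto
 have "\<bar>layer_conv \<psi> v r\<bar> <= (LBINT z. (B * c) * hk (r - z) s)"
  unfolding layer_conv_def set_lebesgue_integral_def
 proof (rule abs_integral_le)
  show "integrable lborel (%z. (B * c) * hk (r - z) s)" using i by simp
  show "\<bar>indicator {0<..<r} z *\<^sub>R (\<psi> (r - z) * v z)\<bar> <= B * c * hk (r - z) s" for z
  proof (cases "z \<in> {0<..<r}")
   case True
   have "\<bar>\<psi> (r - z)\<bar> * \<bar>v z\<bar> <= (B * hk (r - z) s) * c"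
    using True B by (intro mult_mono \<psi> v) auto
   then show ?thesis using True by (simp add: abs_mult mult_ac)
  next
   case False
   then show ?thesis using B c by simp
  qed
 qed
 also have "... = B * c" using i by simp
 finally show ?thesis .
qed

lemma layer_conv_diff:
 assumes "continuous_on UNIV \<psi>" "continuous_on {0..} v" "continuous_on {0..} w"
 shows "layer_conv \<psi> v r - layer_conv \<psi> w r = layer_conv \<psi> (%z. v z - w z) r"
 unfolding layer_conv_def
 using set_integral_diff(2)[OF layer_conv_integrable(1)[OF assms(1,2)] layer_conv_integrable(1)[OF assms(1,3)]]
 by (simp add: right_diff_distrib)

lemma layer_conv_diff_left:
 assumes "continuous_on UNIV \<psi>1" "continuous_on UNIV \<psi>2" "continuous_on {0..} v"
 shows "layer_conv \<psi>1 v r - layer_conv \<psi>2 v r = layer_conv (%ze. \<psi>1 ze - \<psi>2 ze) v r"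
 unfolding layer_conv_def
 using set_integral_diff(2)[OF layer_conv_integrable(1)[OF assms(1,3)] layer_conv_integrable(1)[OF assms(2,3)]]
 by (simp add: left_diff_distrib)

lemma interpolate_powr:
 fixes t' d q \<sigma> A :: real
 assumes "0 < t'" "0 <= d" "0 < \<sigma>" "\<sigma> <= 1" "0 <= A"
  and 1: "f <= A * t' powr q" and 2: "f <= A * t' powr (q - 1/2) * d"
 shows "f <= A * t' powr (q - \<sigma>/2) * d powr \<sigma>"
proof (cases "d = 0")
 case True
 then show ?thesis using 2 by simp
next
 case False
 then have d: "0 < d" using assms by simp
 define r where "r = d * t' powr (- (1/2))"
 have r: "0 < r" using d assms by (simp add: r_def)
 have "r powr \<sigma> = d powr \<sigma> * t' powr (- \<sigma> / 2)"
  by (simp add: r_def powr_mult powr_powr)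
 then have eq: "A * t' powr (q - \<sigma>/2) * d powr \<sigma> = A * t' powr q * r powr \<sigma>"
  using powr_add[of t' q "- \<sigma> / 2"] by simp
 have eq2: "A * t' powr (q - 1/2) * d = A * t' powr q * r"
  using powr_add[of t' q "- (1/2)"] by (simp add: r_def)
 show ?thesis
 proof (cases "r <= 1")
  case True
  then have "r <= r powr \<sigma>" using powr_mono'[of \<sigma> 1 r] r assms by simp
  then have "A * t' powr q * r <= A * t' powr q * r powr \<sigma>" using assms by (intro mult_left_mono) auto
  then show ?thesis using 2 eq eq2 by linarith
 next
  case False
  then have "1 <= r powr \<sigma>" using assms by (intro ge_one_powr_ge_zero) auto
  then have "A * t' powr q * 1 <= A * t' powr q * r powr \<sigma>" using assms by (intro mult_left_mono) auto
  then show ?thesis using 1 eq by linarith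
 qed
qed

lemma heat_extD:
 assumes U: "heat_ext \<sigma> U" and ka: "test_fun ka"
 obtains C L where "0 <= C" "0 <= L"
  "!!x z t'. 0 < t' ==> t' < 1 ==> 0 <= z ==> \<bar>U ka x z t'\<bar> <= C"
  "!!x z1 z2 t'. 0 < t' ==> t' < 1 ==> 0 <= z1 ==> 0 <= z2 ==> \<bar>U ka x z1 t' - U ka x z2 t'\<bar> <= C * \<bar>z1 - z2\<bar> powr \<sigma>"
  "!!x z t' t. 0 < t' ==> t' <= t ==> t <= 2 * t' ==> t < 1 ==> 0 <= z ==> \<bar>U ka x z t - U ka x z t'\<bar> <= C * ((t - t') / t')"
  "!!x z t'. 0 < t' ==> t' < 1 ==> 0 <= z ==>
    ((%x. U ka x z t') has_derivative (%h. \<Sum>b\<in>Basis. (h \<bullet> b) * U (partial b ka) x z t')) (at x)"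
  "!!x y z t'. 0 < t' ==> t' < 1 ==> 0 <= z ==> \<bar>U ka x z t' - U ka y z t'\<bar> <= L * norm (x - y)"
  "!!x z t' h. 0 < t' ==> t' < 1 ==> 0 <= z ==> \<bar>\<Sum>b\<in>Basis. (h \<bullet> b) * U (partial b ka) x z t'\<bar> <= L * norm h"
proof -
 have "\<exists>C. heat_ext_by \<sigma> U (partial b ka) C" if "b \<in> Basis" for b
  using U test_fun_partial[OF ka that] unfolding heat_ext_def by blast
 then obtain Cb where "!!b. b \<in> Basis ==> heat_ext_by \<sigma> U (partial b ka) (Cb b)" by metis
 then have Cb: "!!b. b \<in> Basis ==> 0 <= Cb b"
  "!!b x z t'. b \<in> Basis ==> 0 < t' ==> t' < 1 ==> 0 <= z ==> \<bar>U (partial b ka) x z t'\<bar> <= Cb b"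
  unfolding heat_ext_by_def by auto
 define L where "L = (\<Sum>b\<in>Basis. Cb b)"
 have L: "0 <= L" unfolding L_def using Cb by (intro sum_nonneg) auto
 have grad: "\<bar>\<Sum>b\<in>Basis. (h \<bullet> b) * U (partial b ka) x z t'\<bar> <= L * norm h" if "0 < t'" "t' < 1" "0 <= z" for x z t' h
 proof -
  have "\<bar>\<Sum>b\<in>Basis. (h \<bullet> b) * U (partial b ka) x z t'\<bar> <= (\<Sum>b\<in>Basis. norm h * Cb b)"
   using Cb(2)[OF _ that] Basis_le_norm[of _ h] by (intro order_trans[OF sum_abs] sum_mono) (auto simp: abs_mult intro!: mult_mono)
  then show ?thesis by (simp add: L_def sum_distrib_left mult.commute)
 qed
 obtain C where R: "heat_ext_by \<sigma> U ka C"
  using U ka unfolding heat_ext_def by blast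
 have C: "0 <= C" using R unfolding heat_ext_by_def by blast
 have R1: "\<bar>U ka x z t'\<bar> <= C" if "0 < t'" "t' < 1" "0 <= z" for x z t'
  using R that unfolding heat_ext_by_def by blast
 have R2: "\<bar>U ka x z1 t' - U ka x z2 t'\<bar> <= C * \<bar>z1 - z2\<bar> powr \<sigma>" if "0 < t'" "t' < 1" "0 <= z1" "0 <= z2" for x z1 z2 t'
  using R that unfolding heat_ext_by_def by blast
 have R3: "\<bar>U ka x z t - U ka x z t'\<bar> <= C * ((t - t') / t')" if "0 < t'" "t' <= t" "t <= 2 * t'" "t < 1" "0 <= z" for x z t' t
  using R that unfolding heat_ext_by_def by (meson le_less_trans)
 have der: "((%x. U ka x z t') has_derivative (%h. \<Sum>b\<in>Basis. (h \<bullet> b) * U (partial b ka) x z t')) (at x)"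
  if "0 < t'" "t' < 1" "0 <= z" for x z t' using R that unfolding heat_ext_by_def by blast
 have lip: "\<bar>U ka x z t' - U ka y z t'\<bar> <= L * norm (x - y)" if "0 < t'" "t' < 1" "0 <= z" for x y z t'
 proof -
  have "norm (U ka x z t' - U ka y z t') <= L * norm (x - y)"
  proof (rule differentiable_bound[where S = UNIV])
   show "((%x. U ka x z t') has_derivative (%h. \<Sum>b\<in>Basis. (h \<bullet> b) * U (partial b ka) x z t')) (at x within UNIV)" for x
    using der[OF that] by simp
   show "onorm (%h. \<Sum>b\<in>Basis. (h \<bullet> b) * U (partial b ka) x z t') <= L" for x
    using grad[OF that] L by (intro onorm_bound) auto
  qed auto
  then show ?thesis by simp
 qed
 show ?thesis
  by (rule that[OF C L R1 R2 R3 der lip grad])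
qed

lemma holder_continuous:
 fixes v :: "real => real"
 assumes "!!z1 z2. 0 <= z1 ==> 0 <= z2 ==> \<bar>v z1 - v z2\<bar> <= C * \<bar>z1 - z2\<bar> powr \<sigma>" "0 < \<sigma>"
 shows "continuous_on {0..} v"
 unfolding continuous_on_def
proof
 fix z :: real assume z: "z \<in> {0..}"
 have "((%y. C * \<bar>y - z\<bar> powr \<sigma>) \<longlongrightarrow> C * \<bar>z - z\<bar> powr \<sigma>) (at z within {0..})"
  using assms(2) by (intro tendsto_mult tendsto_const tendsto_powr' tendsto_rabs tendsto_diff tendsto_ident_at) auto
 then have lim: "((%y. C * \<bar>y - z\<bar> powr \<sigma>) \<longlongrightarrow> 0) (at z within {0..})" by simp
 have "\<forall>\<^sub>F y in at z within {0..}. norm (v y - v z) <= C * \<bar>y - z\<bar> powr \<sigma>"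
  unfolding eventually_at_filter using assms(1) z by (intro always_eventually) auto
 then have "((%y. v y - v z) \<longlongrightarrow> 0) (at z within {0..})" using lim by (rule Lim_null_comparison)
 then show "(v \<longlongrightarrow> v z) (at z within {0..})" by (simp add: LIM_zero_iff)
qed

definition nonlocal :: "(real => real) => ('a => real => real => real) => 'a \<times> real => real => real"
 where "nonlocal \<phi> u X t' = layer_conv (layer0 \<phi> t') (%z. u (fst X) z t') (snd X)"

definition nonlocal_normal :: "(real => real) => ('a => real => real => real) => 'a \<times> real => real => real"
 where "nonlocal_normal \<phi> u X t' = layer0 \<phi> t' 0 * u (fst X) (snd X) t'
  + layer_conv (layer1 \<phi> t') (%z. u (fst X) z t') (snd X)"

text \<open>The bounds follow from those of the layer; the normal derivative has a boundary term because the end point of the convolution moves.\<close>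
lemma nonlocal_basic:
 fixes U :: "('a::euclidean_space => real) => 'a => real => real => real"
 assumes U: "heat_ext \<sigma> U" and \<sigma>: "0 < \<sigma>" "\<sigma> <= 1" and ka: "test_fun ka"
  and \<phi>: "profile \<beta> \<phi>" and \<beta>: "0 < \<beta>" "\<beta> < 1" and p: "p = (1 - \<beta>) / 2"
 obtains C where "0 <= C"
  "!!X t'. 0 < t' ==> t' < 1 ==> \<bar>nonlocal \<phi> (U ka) X t'\<bar> <= C * t' powr p"
  "!!X t'. 0 < t' ==> t' < 1 ==> 0 <= snd X ==> \<bar>nonlocal_normal \<phi> (U ka) X t'\<bar> <= C * t' powr (p - 1/2)"
  "!!X Y t'. 0 < t' ==> t' < 1 ==> 0 <= snd X ==> 0 <= snd Y ==>
    \<bar>nonlocal_normal \<phi> (U ka) X t' - nonlocal_normal \<phi> (U ka) Y t'\<bar> <= C * t' powr (p - (1 + \<sigma>) / 2) * norm (X - Y) powr \<sigma>"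
  "!!X s t. 0 < s ==> s <= t ==> t <= 2 * s ==> t < 1 ==>
    \<bar>nonlocal \<phi> (U ka) X t - nonlocal \<phi> (U ka) X s\<bar> <= C * s powr (p - 1) * (t - s)"
proof -
 obtain C L where C: "0 <= C" and L: "0 <= L"
  and Ub: "!!x z t'. 0 < t' ==> t' < 1 ==> 0 <= z ==> \<bar>U ka x z t'\<bar> <= C"
  and Uh: "!!x z1 z2 t'. 0 < t' ==> t' < 1 ==> 0 <= z1 ==> 0 <= z2 ==> \<bar>U ka x z1 t' - U ka x z2 t'\<bar> <= C * \<bar>z1 - z2\<bar> powr \<sigma>"
  and Ut: "!!x z t' t. 0 < t' ==> t' <= t ==> t <= 2 * t' ==> t < 1 ==> 0 <= z ==> \<bar>U ka x z t - U ka x z t'\<bar> <= C * ((t - t') / t')"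
  and Ul: "!!x y z t'. 0 < t' ==> t' < 1 ==> 0 <= z ==> \<bar>U ka x z t' - U ka y z t'\<bar> <= L * norm (x - y)"
  by (rule heat_extD[OF U ka]) (rule that)
 obtain D where D: "0 <= D"
  and D0: "!!t' ze. 0 < t' ==> 0 <= ze ==> \<bar>layer0 \<phi> t' ze\<bar> <= D * t' powr p * hk ze (2 * t')"
  and D1: "!!t' ze. 0 < t' ==> 0 <= ze ==> \<bar>layer1 \<phi> t' ze\<bar> <= D * t' powr (p - 1/2) * hk ze (2 * t')"
  and D2: "!!t' ze1 ze2. 0 < t' ==> 0 <= ze1 ==> ze1 <= ze2 ==>
    \<bar>layer1 \<phi> t' ze2 - layer1 \<phi> t' ze1\<bar> <= D * t' powr (p - 1) * hk ze1 (2 * t') * (ze2 - ze1)"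
  and Dt: "!!s t ze. 0 < s ==> s <= t ==> t <= 2 * s ==> 0 <= ze ==>
    \<bar>layer0 \<phi> t ze - layer0 \<phi> s ze\<bar> <= D * s powr (p - 1) * (t - s) * hk ze (4 * s)"
  by (rule layer_estimates[OF \<phi> \<beta> p]) (rule that)
 note LD = layer0_has_derivative[OF \<phi> \<beta>(2)]
 have c0: "continuous_on UNIV (layer0 \<phi> t')" if "0 < t'" for t'
  using LD(1)[OF that] by (meson DERIV_isCont continuous_at_imp_continuous_on)
 have c1: "continuous_on UNIV (layer1 \<phi> t')" if "0 < t'" for t' using LD(2)[OF that] .
 have cU: "continuous_on {0..} (%z. U ka x z t')" if "0 < t'" "t' < 1" for x t'
  by (rule holder_continuous[OF Uh[OF that] \<sigma>(1)])
 have h2: "hk ze (2 * t') <= t' powr (- (1/2))" if "0 < t'" for t' ze :: real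
 proof -
  have "hk ze (2 * t') <= (2 * t') powr (- (1/2))" using that by (intro heat_kernel_real_le) auto
  also have "... <= t' powr (- (1/2))" using that by (intro powr_mono2') auto
  finally show ?thesis .
 qed
 have add12: "t' powr q * t' powr (- (1/2)) = t' powr (q - 1/2)" for t' q :: real
  by (simp add: powr_add[symmetric])
 have D00: "\<bar>layer0 \<phi> t' 0\<bar> <= D * t' powr (p - 1/2)" if "0 < t'" for t'
 proof -
  have "\<bar>layer0 \<phi> t' 0\<bar> <= D * t' powr p * t' powr (- (1/2))"
   using D0[OF that, of 0] mult_left_mono[OF h2[OF that, of 0], of "D * t' powr p"] D by simp
  then show ?thesis using add12[of t' p] by (simp add: mult.assoc)
 qed
 define K where "K = 4 * D * (C + L)"
 have K: "0 <= K" "D * C <= K" "2 * D * C <= K" "4 * D * C <= K" "4 * D * L <= K"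
  using D C L mult_nonneg_nonneg[OF D C] mult_nonneg_nonneg[OF D L] by (auto simp: K_def algebra_simps)
 have K2: "D * C <= 2 * K + 2 * K" "2 * D * C <= 2 * K + 2 * K" "3 * K <= 2 * K + 2 * K" "2 * D * L <= K"
  using K D L by (linarith, linarith, linarith, use K(5) mult_nonneg_nonneg[OF D L] in linarith)
 have Kb: "a * b <= K * b" if "a <= K" "0 <= b" for a b using that by (rule mult_right_mono)
 have pw: "t' powr a <= t' powr b" if "0 < t'" "t' < 1" "b <= a" for t' a b :: real
  using that by (intro powr_mono') auto
 have nn_bound: "\<bar>layer0 \<phi> t' 0 * a + layer_conv (layer1 \<phi> t') v r\<bar> <= 2 * D * c * t' powr (p - 1/2)"
  if "0 < t'" "0 <= c" "\<bar>a\<bar> <= c" "!!z. 0 <= z ==> \<bar>v z\<bar> <= c" for t' a v c r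
 proof -
  have "\<bar>layer0 \<phi> t' 0 * a\<bar> <= (D * t' powr (p - 1/2)) * c"
   unfolding abs_mult using D00 that D by (intro mult_mono) auto
  moreover have "\<bar>layer_conv (layer1 \<phi> t') v r\<bar> <= (D * t' powr (p - 1/2)) * c"
   using D1[OF that(1)] that D by (intro layer_conv_bound[where s = "2 * t'"]) auto
  ultimately have "\<bar>layer0 \<phi> t' 0 * a + layer_conv (layer1 \<phi> t') v r\<bar> <= 2 * ((D * t' powr (p - 1/2)) * c)"
   by linarith
  then show ?thesis by (simp add: mult_ac)
 qed
 show ?thesis
 proof (rule that[of "2 * K + 2 * K"])
  show "0 <= 2 * K + 2 * K" using K by simp
 next
  fix X :: "'a \<times> real" and t' :: real assume t': "0 < t'" "t' < 1"
  have "\<bar>nonlocal \<phi> (U ka) X t'\<bar> <= (D * t' powr p) * C"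
   unfolding nonlocal_def using D0[OF t'(1)] Ub[OF t'] t' D C by (intro layer_conv_bound[where s = "2 * t'"]) auto
  also have "... = (D * C) * t' powr p" by simp
  also have "... <= (2 * K + 2 * K) * t' powr p" by (rule mult_right_mono[OF K2(1)]) auto
  finally show "\<bar>nonlocal \<phi> (U ka) X t'\<bar> <= (2 * K + 2 * K) * t' powr p" .
 next
  fix X :: "'a \<times> real" and t' :: real assume t': "0 < t'" "t' < 1" and X: "0 <= snd X"
  have "\<bar>nonlocal_normal \<phi> (U ka) X t'\<bar> <= 2 * D * C * t' powr (p - 1/2)"
   unfolding nonlocal_normal_def by (rule nn_bound[OF t'(1) C Ub[OF t' X] Ub[OF t']])
  also have "... <= (2 * K + 2 * K) * t' powr (p - 1/2)" by (rule mult_right_mono[OF K2(2)]) auto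
  finally show "\<bar>nonlocal_normal \<phi> (U ka) X t'\<bar> <= (2 * K + 2 * K) * t' powr (p - 1/2)" .
 next
  fix X :: "'a \<times> real" and s t :: real assume s: "0 < s" "s <= t" "t <= 2 * s" "t < 1"
  then have s1: "s < 1" "0 < t" by auto
  have "nonlocal \<phi> (U ka) X t - nonlocal \<phi> (U ka) X s
   = layer_conv (%ze. layer0 \<phi> t ze - layer0 \<phi> s ze) (%z. U ka (fst X) z t) (snd X)
    + layer_conv (layer0 \<phi> s) (%z. U ka (fst X) z t - U ka (fst X) z s) (snd X)"
   unfolding nonlocal_def
   layer_conv_diff_left[OF c0[OF s1(2)] c0[OF s(1)] cU[OF s1(2) s(4)], symmetric]
   layer_conv_diff[OF c0[OF s(1)] cU[OF s1(2) s(4)] cU[OF s(1) s1(1)], symmetric] by simp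
  moreover have "\<bar>layer_conv (%ze. layer0 \<phi> t ze - layer0 \<phi> s ze) (%z. U ka (fst X) z t) (snd X)\<bar> <= (D * s powr (p - 1) * (t - s)) * C"
   using Dt[OF s(1-3)] Ub[OF s1(2) s(4)] s D C by (intro layer_conv_bound[where s = "4 * s"]) auto
  moreover have "\<bar>layer_conv (layer0 \<phi> s) (%z. U ka (fst X) z t - U ka (fst X) z s) (snd X)\<bar> <= (D * s powr p) * (C * ((t - s) / s))"
   using D0[OF s(1)] Ut[OF s] s D C by (intro layer_conv_bound[where s = "2 * s"]) auto
  moreover have "(D * s powr p) * (C * ((t - s) / s)) = (D * s powr (p - 1) * (t - s)) * C"
   using s by (simp add: powr_diff)
  ultimately have "\<bar>nonlocal \<phi> (U ka) X t - nonlocal \<phi> (U ka) X s\<bar> <= 2 * ((D * s powr (p - 1) * (t - s)) * C)" by linarith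
  also have "... = (2 * D * C) * (s powr (p - 1) * (t - s))" by simp
  also have "... <= (2 * K + 2 * K) * (s powr (p - 1) * (t - s))" by (rule mult_right_mono[OF K2(2)]) (use s in auto)
  finally show "\<bar>nonlocal \<phi> (U ka) X t - nonlocal \<phi> (U ka) X s\<bar> <= (2 * K + 2 * K) * s powr (p - 1) * (t - s)" by (simp add: mult.assoc)
 next
  fix X Y :: "'a \<times> real" and t' :: real assume t': "0 < t'" "t' < 1" and X: "0 <= snd X" and Y: "0 <= snd Y"
  obtain x r where Xeq: "X = (x, r)" by (cases X)
  obtain y s where Yeq: "Y = (y, s)" by (cases Y)
  have r: "0 <= r" and s: "0 <= s" using X Y Xeq Yeq by auto
  let ?N = "%x r. nonlocal_normal \<phi> (U ka) (x, r) t'"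
  define E where "E = t' powr (p - (1 + \<sigma>) / 2)"
  have E: "t' powr (p - 1/2) <= E" "0 <= E" unfolding E_def using \<sigma> by (auto intro!: pw t')
  have part1: "\<bar>?N x r - ?N y r\<bar> <= K * E * norm (x - y) powr \<sigma>"
  proof -
   have eq: "?N x r - ?N y r = layer0 \<phi> t' 0 * (U ka x r t' - U ka y r t') + layer_conv (layer1 \<phi> t') (%z. U ka x z t' - U ka y z t') r"
    unfolding nonlocal_normal_def layer_conv_diff[OF c1[OF t'(1)] cU[OF t'] cU[OF t'], symmetric] by (simp add: algebra_simps)
   have a: "\<bar>?N x r - ?N y r\<bar> <= 2 * D * (L * norm (x - y)) * t' powr (p - 1/2)"
    unfolding eq by (rule nn_bound[OF t'(1) _ Ul[OF t' r] Ul[OF t']]) (use L in auto)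
   have UC: "\<bar>U ka x z t' - U ka y z t'\<bar> <= 2 * C" if "0 <= z" for z
    using Ub[OF t' that, of x] Ub[OF t' that, of y] by linarith
   have b: "\<bar>?N x r - ?N y r\<bar> <= 2 * D * (2 * C) * t' powr (p - 1/2)"
    unfolding eq by (rule nn_bound[OF t'(1) _ UC[OF r] UC]) (use C in auto)
   have "\<bar>?N x r - ?N y r\<bar> <= K * t' powr (p - 1/2) * norm (x - y) powr \<sigma>"
   proof (cases "norm (x - y) <= 1")
    case True
    have "norm (x - y) <= norm (x - y) powr \<sigma>"
     using powr_mono'[of \<sigma> 1 "norm (x - y)"] \<sigma> True by (cases "x = y") auto
    then have "2 * D * (L * norm (x - y)) * t' powr (p - 1/2) <= 2 * D * (L * norm (x - y) powr \<sigma>) * t' powr (p - 1/2)"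
     using D L by (intro mult_right_mono mult_left_mono) auto
    also have "... = (2 * D * L) * (t' powr (p - 1/2) * norm (x - y) powr \<sigma>)" by simp
    also have "... <= K * (t' powr (p - 1/2) * norm (x - y) powr \<sigma>)"
     by (rule Kb[OF K2(4)]) auto
    finally show ?thesis using a by (simp add: mult.assoc)
   next
    case False
    then have "1 <= norm (x - y) powr \<sigma>" using \<sigma> by (intro ge_one_powr_ge_zero) auto
    then have "K * t' powr (p - 1/2) * 1 <= K * t' powr (p - 1/2) * norm (x - y) powr \<sigma>"
     using K by (intro mult_left_mono) auto
    moreover have "2 * D * (2 * C) * t' powr (p - 1/2) <= K * t' powr (p - 1/2)"
     using K by (intro Kb) auto
    ultimately show ?thesis using b by linarith
   qed
   also have "... <= K * E * norm (x - y) powr \<sigma>" using E K by (intro mult_right_mono mult_left_mono) auto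
   finally show ?thesis .
  qed
  have part2': "\<bar>?N y a - ?N y b\<bar> <= 2 * K * E * (a - b) powr \<sigma>" if ab: "0 <= b" "b <= a" for a b
  proof -
   let ?J = "layer_conv (layer1 \<phi> t') (%z. U ka y z t')"
   let ?I = "%a z. indicator {0<..<a} z *\<^sub>R (layer1 \<phi> t' (a - z) * U ka y z t') :: real"
   have J1: "\<bar>?J a - ?J b\<bar> <= 2 * D * C * t' powr (p - 1/2)"
   proof -
    have "\<bar>?J r\<bar> <= (D * t' powr (p - 1/2)) * C" for r
     using D1[OF t'(1)] Ub[OF t'] t' D C by (intro layer_conv_bound[where s = "2 * t'"]) auto
    from this[of a] this[of b] have "\<bar>?J a - ?J b\<bar> <= 2 * ((D * t' powr (p - 1/2)) * C)" by linarith
    then show ?thesis by (simp add: mult_ac)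
   qed
   have J2: "\<bar>?J a - ?J b\<bar> <= 2 * D * C * t' powr (p - 1/2 - 1/2) * (a - b)"
   proof -
    have ii: "integrable lborel (?I r)" for r
     using layer_conv_integrable(1)[OF c1[OF t'(1)] cU[OF t']] by (simp add: set_integrable_def)
    have ih: "integrable lborel (%z. hk (b - z) (2 * t'))" "(LBINT z. hk (b - z) (2 * t')) = 1"
     using lborel_reflect[of "%z. hk z (2 * t')" b] heat_kernel_integrable[of "2 * t'", where 'a = real]
      heat_kernel_integral[of "2 * t'", where 'a = real] t' by auto
    have i1: "integrable lborel (%z. indicator {b..a} z :: real)" by (simp add: emeasure_lborel_Icc_eq)
    have v1: "(LBINT z. indicator {b..a} z) = a - b" using ab by simp
    let ?c = "D * C * t' powr (p - 1)"
    have "\<bar>?J a - ?J b\<bar> = \<bar>LBINT z. ?I a z - ?I b z\<bar>"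
     unfolding layer_conv_def set_lebesgue_integral_def by (subst Bochner_Integration.integral_diff) (rule ii, rule ii, rule refl)
    also have "... <= (LBINT z. ?c * (a - b) * hk (b - z) (2 * t') + ?c * indicator {b..a} z)"
    proof (rule abs_integral_le)
     show "integrable lborel (%z. ?c * (a - b) * hk (b - z) (2 * t') + ?c * indicator {b..a} z)"
      using ih i1 by (intro Bochner_Integration.integrable_add integrable_mult_right)
     fix z :: real
     have c0: "0 <= ?c" using D C by simp
     have nn: "0 <= ?c * (a - b) * hk (b - z) (2 * t')" "0 <= ?c * indicator {b..a} z"
      using c0 ab by auto
     consider "z <= 0 \<or> a <= z" | "0 < z" "z < b" | "0 < z" "b <= z" "z < a" by linarith
     then show "\<bar>?I a z - ?I b z\<bar> <= ?c * (a - b) * hk (b - z) (2 * t') + ?c * indicator {b..a} z"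
     proof cases
      case 1
      then have "?I a z - ?I b z = 0" using ab by auto
      then show ?thesis using nn by linarith
     next
      case 2
      have "\<bar>(layer1 \<phi> t' (a - z) - layer1 \<phi> t' (b - z)) * U ka y z t'\<bar>
       <= (D * t' powr (p - 1) * hk (b - z) (2 * t') * ((a - z) - (b - z))) * C"
       unfolding abs_mult using 2 ab D by (intro mult_mono D2 Ub t') auto
      also have "(a - z) - (b - z) = a - b" by simp
      finally have "\<bar>(layer1 \<phi> t' (a - z) - layer1 \<phi> t' (b - z)) * U ka y z t'\<bar> <= ?c * (a - b) * hk (b - z) (2 * t')"
       by (simp only: mult_ac)
      then have "\<bar>?I a z - ?I b z\<bar> <= ?c * (a - b) * hk (b - z) (2 * t')"
       using 2 ab by (simp add: left_diff_distrib)
      then show ?thesis using nn by linarith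
     next
      case 3
      have "\<bar>layer1 \<phi> t' (a - z)\<bar> <= D * t' powr (p - 1/2) * hk (a - z) (2 * t')"
       using 3 by (intro D1 t') auto
      also have "... <= D * t' powr (p - 1/2) * t' powr (- (1/2))"
       using D by (intro mult_left_mono h2 t') auto
      also have "... = D * t' powr (p - 1)" using add12[of t' "p - 1/2"] by (simp add: mult.assoc)
      finally have "\<bar>layer1 \<phi> t' (a - z) * U ka y z t'\<bar> <= (D * t' powr (p - 1)) * C"
       unfolding abs_mult using 3 D by (intro mult_mono Ub t') auto
      then have "\<bar>?I a z - ?I b z\<bar> <= ?c * indicator {b..a} z" using 3 by (simp add: mult_ac)
      then show ?thesis using nn by linarith
     qed
    qed
    also have "... = ?c * (a - b) + ?c * (a - b)"
     using ih i1 v1 by (subst Bochner_Integration.integral_add) auto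
    finally show ?thesis by (simp add: mult_ac)
   qed
   have J: "\<bar>?J a - ?J b\<bar> <= 2 * D * C * t' powr (p - 1/2 - \<sigma>/2) * (a - b) powr \<sigma>"
    using ab D C by (intro interpolate_powr[OF t'(1) _ \<sigma> _ J1 J2]) auto
   have ee: "p - 1/2 - \<sigma>/2 = p - (1 + \<sigma>) / 2" by (simp add: field_simps)
   have u: "\<bar>layer0 \<phi> t' 0 * (U ka y a t' - U ka y b t')\<bar> <= (D * t' powr (p - 1/2)) * (C * \<bar>a - b\<bar> powr \<sigma>)"
    unfolding abs_mult using D00[OF t'(1)] Uh[OF t', of a b y] ab D by (intro mult_mono) auto
   also have "... <= (D * E) * (C * \<bar>a - b\<bar> powr \<sigma>)" using E D C by (intro mult_right_mono mult_left_mono) auto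
   also have "... = (D * C) * (E * (a - b) powr \<sigma>)" using ab by simp
   also have "... <= K * (E * (a - b) powr \<sigma>)" using K E by (intro Kb) auto
   finally have u: "\<bar>layer0 \<phi> t' 0 * (U ka y a t' - U ka y b t')\<bar> <= K * (E * (a - b) powr \<sigma>)" .
   have "2 * D * C * (E * (a - b) powr \<sigma>) <= K * (E * (a - b) powr \<sigma>)" using K E by (intro Kb) auto
   then have "\<bar>?J a - ?J b\<bar> <= K * (E * (a - b) powr \<sigma>)" using J unfolding ee E_def[symmetric] by (simp add: mult.assoc)
   moreover have "?N y a - ?N y b = layer0 \<phi> t' 0 * (U ka y a t' - U ka y b t') + (?J a - ?J b)"
    by (simp add: nonlocal_normal_def algebra_simps)
   ultimately have "\<bar>?N y a - ?N y b\<bar> <= 2 * (K * (E * (a - b) powr \<sigma>))" using u by linarith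
   then show ?thesis by (simp add: mult_ac)
  qed
  have part2: "\<bar>?N y r - ?N y s\<bar> <= 2 * K * E * \<bar>r - s\<bar> powr \<sigma>"
   using part2'[of s r] part2'[of r s] r s by (cases "s <= r") (auto simp: abs_minus_commute)
  have n1: "norm (x - y) <= norm (X - Y)" "\<bar>r - s\<bar> <= norm (X - Y)"
   using norm_fst_le'[of "X - Y"] norm_snd_le'[of "X - Y"] Xeq Yeq by auto
  have "\<bar>?N x r - ?N y s\<bar> <= K * E * norm (x - y) powr \<sigma> + 2 * K * E * \<bar>r - s\<bar> powr \<sigma>"
   using part1 part2 by linarith
  also have "... <= K * E * norm (X - Y) powr \<sigma> + 2 * K * E * norm (X - Y) powr \<sigma>"
   using n1 \<sigma> K E by (intro add_mono mult_left_mono powr_mono2) auto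
  also have "... = 3 * K * (E * norm (X - Y) powr \<sigma>)" by simp
  also have "... <= (2 * K + 2 * K) * (E * norm (X - Y) powr \<sigma>)" by (rule mult_right_mono[OF K2(3)]) (use E in auto)
  finally show "\<bar>nonlocal_normal \<phi> (U ka) X t' - nonlocal_normal \<phi> (U ka) Y t'\<bar> <= (2 * K + 2 * K) * t' powr (p - (1 + \<sigma>) / 2) * norm (X - Y) powr \<sigma>"
   unfolding Xeq Yeq E_def by (simp add: mult.assoc)
 qed
qed

lemma nonlocal_has_derivative:
 fixes U :: "('a::euclidean_space => real) => 'a => real => real => real"
 assumes U: "heat_ext \<sigma> U" and \<sigma>: "0 < \<sigma>" "\<sigma> <= 1" and ka: "test_fun ka"
  and \<phi>: "profile \<beta> \<phi>" and \<beta>: "0 < \<beta>" "\<beta> < 1" and t': "0 < t'" "t' < 1" and X: "0 <= snd X"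
 shows "((%X. nonlocal \<phi> (U ka) X t') has_derivative
  (%H. (\<Sum>b\<in>Basis. (fst H \<bullet> b) * nonlocal \<phi> (U (partial b ka)) X t') + snd H * nonlocal_normal \<phi> (U ka) X t'))
  (at X within UNIV \<times> {0..})"
proof -
 obtain x r where Xeq: "X = (x, r)" by (cases X)
 have r: "0 <= r" using X Xeq by simp
 obtain C L where C: "0 <= C" and L: "0 <= L"
  and Ub: "!!x z t'. 0 < t' ==> t' < 1 ==> 0 <= z ==> \<bar>U ka x z t'\<bar> <= C"
  and Uh: "!!x z1 z2 t'. 0 < t' ==> t' < 1 ==> 0 <= z1 ==> 0 <= z2 ==> \<bar>U ka x z1 t' - U ka x z2 t'\<bar> <= C * \<bar>z1 - z2\<bar> powr \<sigma>"
  and "!!x z t' t. 0 < t' ==> t' <= t ==> t <= 2 * t' ==> t < 1 ==> 0 <= z ==> \<bar>U ka x z t - U ka x z t'\<bar> <= C * ((t - t') / t')"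
  and Ud: "!!x z t'. 0 < t' ==> t' < 1 ==> 0 <= z ==>
    ((%x. U ka x z t') has_derivative (%h. \<Sum>b\<in>Basis. (h \<bullet> b) * U (partial b ka) x z t')) (at x)"
  and Ul: "!!x y z t'. 0 < t' ==> t' < 1 ==> 0 <= z ==> \<bar>U ka x z t' - U ka y z t'\<bar> <= L * norm (x - y)"
  and Ug: "!!x z t' h. 0 < t' ==> t' < 1 ==> 0 <= z ==> \<bar>\<Sum>b\<in>Basis. (h \<bullet> b) * U (partial b ka) x z t'\<bar> <= L * norm h"
  by (rule heat_extD[OF U ka]) (rule that)
 have cU: "continuous_on {0..} (%z. U ka' x z t')" if tk: "test_fun ka'" for x ka'
 proof -
  obtain C' where "heat_ext_by \<sigma> U ka' C'" using U tk unfolding heat_ext_def by blast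
  then have "\<bar>U ka' x z1 t' - U ka' x z2 t'\<bar> <= C' * \<bar>z1 - z2\<bar> powr \<sigma>" if "0 <= z1" "0 <= z2" for z1 z2
   unfolding heat_ext_by_def using t' that by blast
  then show ?thesis by (rule holder_continuous[OF _ \<sigma>(1)])
 qed
 obtain N where N: "0 <= N" "!!X Y t'. 0 < t' ==> t' < 1 ==> 0 <= snd X ==> 0 <= snd Y ==>
    \<bar>nonlocal_normal \<phi> (U ka) X t' - nonlocal_normal \<phi> (U ka) Y t'\<bar> <= N * t' powr ((1 - \<beta>) / 2 - (1 + \<sigma>) / 2) * norm (X - Y) powr \<sigma>"
  by (rule nonlocal_basic[OF U \<sigma> ka \<phi> \<beta> refl]) (rule that)
 note LD = layer0_has_derivative[OF \<phi> \<beta>(2) t'(1)]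
 have c0: "continuous_on UNIV (layer0 \<phi> t')"
  using LD(1) by (meson DERIV_isCont continuous_at_imp_continuous_on)
 note c1 = LD(2)
 let ?f = "%x r. nonlocal \<phi> (U ka) (x, r) t'"
 have fx: "((%x. ?f x r) has_derivative (%h. \<Sum>b\<in>Basis. (h \<bullet> b) * nonlocal \<phi> (U (partial b ka)) (x, r) t')) (at x within UNIV)"
 proof -
  let ?I = "%a z. indicator {0<..<r} z *\<^sub>R (layer0 \<phi> t' (r - z) * a z) :: real"
  have "compact (layer0 \<phi> t' ` {0..r})" by (intro compact_continuous_image continuous_on_subset[OF c0]) auto
  then obtain B where B: "0 < B" "!!w. w \<in> layer0 \<phi> t' ` {0..r} ==> norm w <= B"
   using compact_imp_bounded bounded_pos by metis
  have B': "\<bar>?I a z\<bar> <= indicator {0<..<r} z * (B * c)" if "0 <= z ==> \<bar>a z\<bar> <= c" for a c z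
  proof (cases "z \<in> {0<..<r}")
   case True
   have "\<bar>layer0 \<phi> t' (r - z)\<bar> <= B" using B(2)[of "layer0 \<phi> t' (r - z)"] True by auto
   then show ?thesis using True that B(1) by (auto simp: abs_mult intro!: mult_mono)
  qed simp
  have ib: "integrable lborel (?I (%z. U (partial b ka) x z t'))" if "b \<in> Basis" for b
   using layer_conv_integrable(1)[OF c0 cU[OF test_fun_partial[OF ka that]]] by (simp add: set_integrable_def)
  have "((%x. LBINT z. ?I (%z. U ka x z t') z) has_derivative
   (%h. LBINT z. ?I (%z. \<Sum>b\<in>Basis. (h \<bullet> b) * U (partial b ka) x z t') z)) (at x within UNIV)"
  proof (rule has_derivative_integral_dominated[where g = "%z. indicator {0<..<r} z * (B * L)"])
   show "integrable lborel (?I (%z. U ka y z t'))" for y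
    using layer_conv_integrable(1)[OF c0 cU[OF ka]] by (simp add: set_integrable_def)
   have "?I (%z. \<Sum>b\<in>Basis. (h \<bullet> b) * U (partial b ka) x z t') = (%z. \<Sum>b\<in>Basis. (h \<bullet> b) * ?I (%z. U (partial b ka) x z t') z)" for h
    by (simp add: fun_eq_iff sum_distrib_left mult_ac)
   then show "?I (%z. \<Sum>b\<in>Basis. (h \<bullet> b) * U (partial b ka) x z t') \<in> borel_measurable lborel" for h
    using ib by (auto intro!: borel_measurable_sum borel_measurable_times)
   show "((%y. ?I (%z. U ka y z t') z) has_derivative (%h. ?I (%z. \<Sum>b\<in>Basis. (h \<bullet> b) * U (partial b ka) x z t') z)) (at x within UNIV)" for z
   proof (cases "z \<in> {0<..<r}")
    case True
    then show ?thesis using Ud[OF t', of z x] by (auto intro!: has_derivative_mult_right)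
   qed simp
   show "\<bar>?I (%z. U ka y z t') z - ?I (%z. U ka x z t') z\<bar> <= indicator {0<..<r} z * (B * L) * norm (y - x)" for y z
    using B'[of z "%z. U ka y z t' - U ka x z t'" "L * norm (y - x)"] Ul[OF t', of z y x]
    by (simp add: right_diff_distrib mult_ac)
   show "\<bar>?I (%z. \<Sum>b\<in>Basis. (h \<bullet> b) * U (partial b ka) x z t') z\<bar> <= indicator {0<..<r} z * (B * L) * norm h" for h z
    using B'[of z "%z. \<Sum>b\<in>Basis. (h \<bullet> b) * U (partial b ka) x z t'" "L * norm h"] Ug[OF t', of z h x] by (simp add: mult_ac)
   show "integrable lborel (%z. indicator {0<..<r} z * (B * L))" using r by (intro integrable_mult_left) simp
  qed auto
  moreover have "(LBINT z. ?I (%z. \<Sum>b\<in>Basis. (h \<bullet> b) * U (partial b ka) x z t') z)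
    = (\<Sum>b\<in>Basis. (h \<bullet> b) * nonlocal \<phi> (U (partial b ka)) (x, r) t')" for h
  proof -
   have "(LBINT z. ?I (%z. \<Sum>b\<in>Basis. (h \<bullet> b) * U (partial b ka) x z t') z)
    = (LBINT z. (\<Sum>b\<in>Basis. (h \<bullet> b) * ?I (%z. U (partial b ka) x z t') z))"
    by (simp add: sum_distrib_left mult_ac)
   also have "... = (\<Sum>b\<in>Basis. LBINT z. (h \<bullet> b) * ?I (%z. U (partial b ka) x z t') z)"
    by (rule Bochner_Integration.integral_sum) (intro integrable_mult_right ib)
   also have "... = (\<Sum>b\<in>Basis. (h \<bullet> b) * (LBINT z. ?I (%z. U (partial b ka) x z t') z))"
    by (simp only: integral_mult_right_zero)
   finally show ?thesis by (simp add: nonlocal_def layer_conv_def set_lebesgue_integral_def)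
  qed
  ultimately show ?thesis by (simp add: nonlocal_def layer_conv_def set_lebesgue_integral_def)
 qed
 have fy: "((%r. ?f x r) has_derivative blinfun_apply (blinfun_scaleR_left (nonlocal_normal \<phi> (U ka) (x, r) t'))) (at r within {0..})"
  if "r \<in> {0..}" for x r
  using volterra_has_derivative[OF cU[OF ka, of x] LD(1) c1, of r] that
  unfolding has_field_derivative_def nonlocal_def nonlocal_normal_def layer_conv_integrable(2)[OF c0 cU[OF ka]]
   layer_conv_integrable(2)[OF c1 cU[OF ka]]
  by (auto elim!: has_derivative_eq_rhs)
 have cont: "continuous (at (x, r) within UNIV \<times> {0..}) (%(x, r). blinfun_scaleR_left (nonlocal_normal \<phi> (U ka) (x, r) t'))"
 proof -
  let ?g = "%Y. nonlocal_normal \<phi> (U ka) Y t'"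
  have "((%Y. ?g Y - ?g (x, r)) \<longlongrightarrow> 0) (at (x, r) within UNIV \<times> {0..})"
  proof (rule Lim_null_comparison)
   let ?A = "N * t' powr ((1 - \<beta>) / 2 - (1 + \<sigma>) / 2)"
   show "\<forall>\<^sub>F Y in at (x, r) within UNIV \<times> {0..}. norm (?g Y - ?g (x, r)) <= ?A * norm (Y - (x, r)) powr \<sigma>"
    unfolding eventually_at_filter using N(2)[OF t'] r by (intro always_eventually) auto
   have "((%Y. ?A * norm (Y - (x, r)) powr \<sigma>) \<longlongrightarrow> ?A * norm ((x, r) - (x, r)) powr \<sigma>) (at (x, r) within UNIV \<times> {0..})"
    using \<sigma>(1) by (intro tendsto_mult tendsto_const tendsto_powr' tendsto_norm tendsto_diff tendsto_ident_at) auto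
   then show "((%Y. ?A * norm (Y - (x, r)) powr \<sigma>) \<longlongrightarrow> 0) (at (x, r) within UNIV \<times> {0..})" by simp
  qed
  then have "(?g \<longlongrightarrow> ?g (x, r)) (at (x, r) within UNIV \<times> {0..})" by (simp add: LIM_zero_iff)
  then have "((%Y. blinfun_scaleR_left (?g Y)) \<longlongrightarrow> blinfun_scaleR_left (?g (x, r))) (at (x, r) within UNIV \<times> {0..})"
   by (rule bounded_linear.tendsto[OF bounded_linear_blinfun_scaleR_left])
  then show ?thesis by (simp add: continuous_within case_prod_unfold)
 qed
 have "((%(x, r). ?f x r) has_derivative (%(tx, ty). (\<Sum>b\<in>Basis. (tx \<bullet> b) * nonlocal \<phi> (U (partial b ka)) (x, r) t')
   + blinfun_apply (blinfun_scaleR_left (nonlocal_normal \<phi> (U ka) (x, r) t')) ty)) (at (x, r) within UNIV \<times> {0..})"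
  by (rule has_derivative_partialsI[OF fx fy cont]) (use r in auto)
 then show ?thesis unfolding Xeq by (simp add: case_prod_unfold)
qed

lemma nonlocal_lipschitz:
 fixes U :: "('a::euclidean_space => real) => 'a => real => real => real"
 assumes U: "heat_ext \<sigma> U" and \<sigma>: "0 < \<sigma>" "\<sigma> <= 1" and ka: "test_fun ka"
  and \<phi>: "profile \<beta> \<phi>" and \<beta>: "0 < \<beta>" "\<beta> < 1" and p: "p = (1 - \<beta>) / 2"
 obtains C where "0 <= C"
  "!!X H t'. 0 < t' ==> t' < 1 ==> 0 <= snd X ==>
   \<bar>(\<Sum>b\<in>Basis. (fst H \<bullet> b) * nonlocal \<phi> (U (partial b ka)) X t') + snd H * nonlocal_normal \<phi> (U ka) X t'\<bar> <= C * t' powr (p - 1/2) * norm H"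
  "!!X Y t'. 0 < t' ==> t' < 1 ==> 0 <= snd X ==> 0 <= snd Y ==>
   \<bar>nonlocal \<phi> (U ka) X t' - nonlocal \<phi> (U ka) Y t'\<bar> <= C * t' powr (p - 1/2) * norm (X - Y)"
proof -
 have "\<exists>C\<ge>0. \<forall>X t'. 0 < t' --> t' < 1 --> \<bar>nonlocal \<phi> (U (partial b ka)) X t'\<bar> <= C * t' powr p" if "b \<in> Basis" for b
  by (rule nonlocal_basic[OF U \<sigma> test_fun_partial[OF ka that] \<phi> \<beta> p]) blast
 then obtain Cb where Cb: "!!b. b \<in> Basis ==> 0 <= Cb b"
  "!!b X t'. b \<in> Basis ==> 0 < t' ==> t' < 1 ==> \<bar>nonlocal \<phi> (U (partial b ka)) X t'\<bar> <= Cb b * t' powr p"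
  by metis
 obtain N where N: "0 <= N"
  "!!X t'. 0 < t' ==> t' < 1 ==> 0 <= snd X ==> \<bar>nonlocal_normal \<phi> (U ka) X t'\<bar> <= N * t' powr (p - 1/2)"
  by (rule nonlocal_basic[OF U \<sigma> ka \<phi> \<beta> p]) (rule that)
 define C where "C = (\<Sum>b\<in>Basis. Cb b) + N"
 have C: "0 <= C" using Cb N by (auto simp: C_def intro!: add_nonneg_nonneg sum_nonneg)
 have grad: "\<bar>(\<Sum>b\<in>Basis. (fst H \<bullet> b) * nonlocal \<phi> (U (partial b ka)) X t') + snd H * nonlocal_normal \<phi> (U ka) X t'\<bar> <= C * t' powr (p - 1/2) * norm H"
  if t': "0 < t'" "t' < 1" and X: "0 <= snd X" for X H t'
 proof -
  have pw: "t' powr p <= t' powr (p - 1/2)" using t' by (intro powr_mono') auto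
  have "\<bar>\<Sum>b\<in>Basis. (fst H \<bullet> b) * nonlocal \<phi> (U (partial b ka)) X t'\<bar> <= (\<Sum>b\<in>Basis. norm H * (Cb b * t' powr (p - 1/2)))"
  proof (intro order_trans[OF sum_abs] sum_mono)
   fix b :: 'a assume b: "b \<in> Basis"
   have "\<bar>fst H \<bullet> b\<bar> <= norm H" using Basis_le_norm[OF b, of "fst H"] norm_fst_le'[of H] by linarith
   moreover have "\<bar>nonlocal \<phi> (U (partial b ka)) X t'\<bar> <= Cb b * t' powr (p - 1/2)"
    by (rule order_trans[OF Cb(2)[OF b t'] mult_left_mono[OF pw Cb(1)[OF b]]])
   ultimately show "\<bar>(fst H \<bullet> b) * nonlocal \<phi> (U (partial b ka)) X t'\<bar> <= norm H * (Cb b * t' powr (p - 1/2))"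
    unfolding abs_mult by (intro mult_mono) auto
  qed
  moreover have "\<bar>snd H * nonlocal_normal \<phi> (U ka) X t'\<bar> <= norm H * (N * t' powr (p - 1/2))"
   unfolding abs_mult using N(2)[OF t' X] norm_snd_le'[of H] by (intro mult_mono) auto
  ultimately have "\<bar>(\<Sum>b\<in>Basis. (fst H \<bullet> b) * nonlocal \<phi> (U (partial b ka)) X t') + snd H * nonlocal_normal \<phi> (U ka) X t'\<bar>
   <= (\<Sum>b\<in>Basis. norm H * (Cb b * t' powr (p - 1/2))) + norm H * (N * t' powr (p - 1/2))" by linarith
  also have "... = C * t' powr (p - 1/2) * norm H"
   by (simp add: C_def sum_distrib_left sum_distrib_right algebra_simps)
  finally show ?thesis .
 qed
 have lip: "\<bar>nonlocal \<phi> (U ka) X t' - nonlocal \<phi> (U ka) Y t'\<bar> <= C * t' powr (p - 1/2) * norm (X - Y)"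
  if t': "0 < t'" "t' < 1" and XY: "0 <= snd X" "0 <= snd Y" for X Y t'
 proof -
  have "norm (nonlocal \<phi> (U ka) X t' - nonlocal \<phi> (U ka) Y t') <= C * t' powr (p - 1/2) * norm (X - Y)"
  proof (rule differentiable_bound[where S = "UNIV \<times> {0..}"])
   show "((%X. nonlocal \<phi> (U ka) X t') has_derivative
    (%H. (\<Sum>b\<in>Basis. (fst H \<bullet> b) * nonlocal \<phi> (U (partial b ka)) X t') + snd H * nonlocal_normal \<phi> (U ka) X t')) (at X within UNIV \<times> {0..})"
    if "X \<in> UNIV \<times> {0..}" for X
    using that by (intro nonlocal_has_derivative[OF U \<sigma> ka \<phi> \<beta> t']) auto
   show "onorm (%H. (\<Sum>b\<in>Basis. (fst H \<bullet> b) * nonlocal \<phi> (U (partial b ka)) X t') + snd H * nonlocal_normal \<phi> (U ka) X t') <= C * t' powr (p - 1/2)"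
    if "X \<in> UNIV \<times> {0..}" for X
    using grad[OF t', of X] that C by (intro onorm_bound) auto
  qed (use XY in \<open>auto intro!: convex_Times simp: mem_Times_iff\<close>)
  then show ?thesis by simp
 qed
 show ?thesis by (rule that[OF C grad lip])
qed

text \<open>Tangential derivatives fall on the test function and cost nothing, so that only the normal derivative is singular.\<close>
theorem nonlocal_singular_kernel:
 fixes U :: "('a::euclidean_space => real) => 'a => real => real => real"
 assumes U: "heat_ext \<sigma> U" and \<sigma>: "0 < \<sigma>" "\<sigma> <= 1" and ka: "test_fun ka"
  and \<phi>: "profile \<beta> \<phi>" and \<beta>: "0 < \<beta>" "\<beta> < 1" and p: "p = (1 - \<beta>) / 2"
 shows "singular_kernel p \<sigma> (UNIV \<times> {0..}) (nonlocal \<phi> (U ka))"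
proof -
 let ?th' = "%X t' H. (\<Sum>b\<in>Basis. (fst H \<bullet> b) * nonlocal \<phi> (U (partial b ka)) X t') + snd H * nonlocal_normal \<phi> (U ka) X t'"
 obtain N where N: "0 <= N"
  and N1: "!!X t'. 0 < t' ==> t' < 1 ==> \<bar>nonlocal \<phi> (U ka) X t'\<bar> <= N * t' powr p"
  and N2: "!!X Y t'. 0 < t' ==> t' < 1 ==> 0 <= snd X ==> 0 <= snd Y ==>
    \<bar>nonlocal_normal \<phi> (U ka) X t' - nonlocal_normal \<phi> (U ka) Y t'\<bar> <= N * t' powr (p - (1 + \<sigma>) / 2) * norm (X - Y) powr \<sigma>"
  and N3: "!!X s t. 0 < s ==> s <= t ==> t <= 2 * s ==> t < 1 ==>
    \<bar>nonlocal \<phi> (U ka) X t - nonlocal \<phi> (U ka) X s\<bar> <= N * s powr (p - 1) * (t - s)"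
  by (rule nonlocal_basic[OF U \<sigma> ka \<phi> \<beta> p]) (rule that)
 obtain L where L: "0 <= L"
  and L1: "!!X H t'. 0 < t' ==> t' < 1 ==> 0 <= snd X ==> \<bar>?th' X t' H\<bar> <= L * t' powr (p - 1/2) * norm H"
  and L2: "!!X Y t'. 0 < t' ==> t' < 1 ==> 0 <= snd X ==> 0 <= snd Y ==>
   \<bar>nonlocal \<phi> (U ka) X t' - nonlocal \<phi> (U ka) Y t'\<bar> <= L * t' powr (p - 1/2) * norm (X - Y)"
  by (rule nonlocal_lipschitz[OF U \<sigma> ka \<phi> \<beta> p]) (rule that)
 have "\<exists>A\<ge>0. \<forall>X Y t'. 0 < t' --> t' < 1 --> 0 <= snd X --> 0 <= snd Y -->
   \<bar>nonlocal \<phi> (U (partial b ka)) X t' - nonlocal \<phi> (U (partial b ka)) Y t'\<bar> <= A * t' powr (p - (1 + \<sigma>) / 2) * norm (X - Y) powr \<sigma>"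
  if b: "b \<in> Basis" for b
 proof -
  note tb = test_fun_partial[OF ka b]
  let ?n = "%X t'. nonlocal \<phi> (U (partial b ka)) X t'"
  obtain A1 where A1: "0 <= A1" "!!X t'. 0 < t' ==> t' < 1 ==> \<bar>?n X t'\<bar> <= A1 * t' powr p"
   by (rule nonlocal_basic[OF U \<sigma> tb \<phi> \<beta> p]) (rule that)
  obtain A2 where A2: "0 <= A2" "!!X Y t'. 0 < t' ==> t' < 1 ==> 0 <= snd X ==> 0 <= snd Y ==>
   \<bar>?n X t' - ?n Y t'\<bar> <= A2 * t' powr (p - 1/2) * norm (X - Y)"
   by (rule nonlocal_lipschitz[OF U \<sigma> tb \<phi> \<beta> p]) (rule that)
  define A where "A = 2 * A1 + A2"
  have A: "0 <= A" "2 * A1 <= A" "A2 <= A" using A1 A2 by (auto simp: A_def)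
  have "\<bar>?n X t' - ?n Y t'\<bar> <= A * t' powr (p - (1 + \<sigma>) / 2) * norm (X - Y) powr \<sigma>"
   if t': "0 < t'" "t' < 1" and XY: "0 <= snd X" "0 <= snd Y" for X Y t'
  proof -
   have "\<bar>?n X t' - ?n Y t'\<bar> <= 2 * A1 * t' powr p" using A1(2)[OF t', of X] A1(2)[OF t', of Y] by linarith
   also have "... <= A * t' powr p" using A by (intro mult_right_mono) auto
   finally have 1: "\<bar>?n X t' - ?n Y t'\<bar> <= A * t' powr p" .
   have "\<bar>?n X t' - ?n Y t'\<bar> <= A2 * t' powr (p - 1/2) * norm (X - Y)" by (rule A2(2)[OF t' XY])
   also have "... <= A * t' powr (p - 1/2) * norm (X - Y)" using A by (intro mult_right_mono) auto
   finally have 2: "\<bar>?n X t' - ?n Y t'\<bar> <= A * t' powr (p - 1/2) * norm (X - Y)" .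
   have "\<bar>?n X t' - ?n Y t'\<bar> <= A * t' powr (p - \<sigma>/2) * norm (X - Y) powr \<sigma>"
    by (rule interpolate_powr[OF t'(1) _ \<sigma> A(1) 1 2]) simp
   also have "... <= A * t' powr (p - (1 + \<sigma>) / 2) * norm (X - Y) powr \<sigma>"
    using A t' by (intro mult_right_mono mult_left_mono powr_mono') (auto simp: field_simps)
   finally show ?thesis .
  qed
  then show ?thesis using A(1) by blast
 qed
 then obtain Ab where Ab: "!!b. b \<in> Basis ==> 0 <= Ab b"
  "!!b X Y t'. b \<in> Basis ==> 0 < t' ==> t' < 1 ==> 0 <= snd X ==> 0 <= snd Y ==>
   \<bar>nonlocal \<phi> (U (partial b ka)) X t' - nonlocal \<phi> (U (partial b ka)) Y t'\<bar> <= Ab b * t' powr (p - (1 + \<sigma>) / 2) * norm (X - Y) powr \<sigma>"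
  by metis
 define C where "C = (\<Sum>b\<in>Basis. Ab b) + N + L"
 have sA: "0 <= (\<Sum>b\<in>Basis. Ab b)" using Ab by (intro sum_nonneg) auto
 have C: "0 <= C" "N <= C" "L <= C" "(\<Sum>b\<in>Basis. Ab b) + N <= C" using sA N L by (auto simp: C_def)
 have "singular_kernel_by C ?th' p \<sigma> (UNIV \<times> {0..}) (nonlocal \<phi> (U ka))"
  unfolding singular_kernel_by_def
 proof (intro conjI ballI allI impI)
  show "0 <= C" by (rule C)
  fix X :: "'a \<times> real" assume "X \<in> UNIV \<times> {0..}"
  then have X: "0 <= snd X" by auto
  show "\<bar>nonlocal \<phi> (U ka) X t - nonlocal \<phi> (U ka) X s\<bar> <= C * s powr (p - 1) * (t - s)"
   if "0 < s" "s <= t" "t <= 2 * s" "t < 1" for s t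
   by (rule order_trans[OF N3[OF that]]) (use C that in \<open>auto intro!: mult_right_mono\<close>)
  fix t' :: real assume "t' \<in> {0<..<1}"
  then have t': "0 < t'" "t' < 1" by auto
  show "\<bar>nonlocal \<phi> (U ka) X t'\<bar> <= C * t' powr p"
   by (rule order_trans[OF N1[OF t']]) (use C in \<open>auto intro!: mult_right_mono\<close>)
  show "((%X. nonlocal \<phi> (U ka) X t') has_derivative ?th' X t') (at X within UNIV \<times> {0..})"
   by (rule nonlocal_has_derivative[OF U \<sigma> ka \<phi> \<beta> t' X])
  show "\<bar>?th' X t' H\<bar> <= C * t' powr (p - 1/2) * norm H" for H
   by (rule order_trans[OF L1[OF t' X]]) (use C in \<open>auto intro!: mult_right_mono\<close>)
  fix Y :: "'a \<times> real" assume "Y \<in> UNIV \<times> {0..}"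
  then have Y: "0 <= snd Y" by auto
  show "\<bar>nonlocal \<phi> (U ka) X t' - nonlocal \<phi> (U ka) Y t'\<bar> <= C * t' powr (p - 1/2) * norm (X - Y)"
   by (rule order_trans[OF L2[OF t' X Y]]) (use C in \<open>auto intro!: mult_right_mono\<close>)
  show "\<bar>?th' X t' H - ?th' Y t' H\<bar> <= C * t' powr (p - (1 + \<sigma>) / 2) * norm (X - Y) powr \<sigma> * norm H" for H
  proof -
   define E where "E = t' powr (p - (1 + \<sigma>) / 2) * norm (X - Y) powr \<sigma>"
   have E: "0 <= E" by (simp add: E_def)
   have "\<bar>(\<Sum>b\<in>Basis. (fst H \<bullet> b) * nonlocal \<phi> (U (partial b ka)) X t') - (\<Sum>b\<in>Basis. (fst H \<bullet> b) * nonlocal \<phi> (U (partial b ka)) Y t')\<bar>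
    = \<bar>\<Sum>b\<in>Basis. (fst H \<bullet> b) * (nonlocal \<phi> (U (partial b ka)) X t' - nonlocal \<phi> (U (partial b ka)) Y t')\<bar>"
    by (simp add: right_diff_distrib sum_subtractf)
   also have "... <= (\<Sum>b\<in>Basis. norm H * (Ab b * E))"
   proof (intro order_trans[OF sum_abs] sum_mono)
    fix b :: 'a assume b: "b \<in> Basis"
    have "\<bar>fst H \<bullet> b\<bar> <= norm H" using Basis_le_norm[OF b, of "fst H"] norm_fst_le'[of H] by linarith
    then show "\<bar>(fst H \<bullet> b) * (nonlocal \<phi> (U (partial b ka)) X t' - nonlocal \<phi> (U (partial b ka)) Y t')\<bar> <= norm H * (Ab b * E)"
     unfolding abs_mult E_def using Ab(2)[OF b t' X Y] by (intro mult_mono) (auto simp: mult.assoc)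
   qed
   finally have 1: "\<bar>(\<Sum>b\<in>Basis. (fst H \<bullet> b) * nonlocal \<phi> (U (partial b ka)) X t') - (\<Sum>b\<in>Basis. (fst H \<bullet> b) * nonlocal \<phi> (U (partial b ka)) Y t')\<bar>
    <= norm H * ((\<Sum>b\<in>Basis. Ab b) * E)" by (simp add: sum_distrib_left sum_distrib_right mult_ac)
   have "\<bar>snd H * (nonlocal_normal \<phi> (U ka) X t' - nonlocal_normal \<phi> (U ka) Y t')\<bar> <= norm H * (N * E)"
    unfolding abs_mult E_def using N2[OF t' X Y] norm_snd_le'[of H] by (intro mult_mono) (auto simp: mult.assoc)
   then have "\<bar>?th' X t' H - ?th' Y t' H\<bar> <= norm H * ((\<Sum>b\<in>Basis. Ab b) * E) + norm H * (N * E)"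
    using 1 by (simp add: right_diff_distrib abs_le_iff)
   also have "... = ((\<Sum>b\<in>Basis. Ab b) + N) * (E * norm H)" by (simp add: algebra_simps)
   also have "... <= C * (E * norm H)" using C E by (intro mult_right_mono) auto
   finally show ?thesis by (simp add: E_def mult.assoc)
  qed
 qed
 then show ?thesis unfolding singular_kernel_def by blast
qed

section \<open>Harmonic extension operators\<close>

text \<open>The stationary version of \<open>heat_ext_by\<close>, to be verified for the Newtonian and the Poisson extension.\<close>
definition ext_by :: "real => (('a::euclidean_space => real) => 'a => real => real) => ('a => real) => real => bool"
 where "ext_by \<sigma> V ka C \<longleftrightarrow> 0 <= C \<and> (\<forall>x z. 0 <= z -->
  \<bar>V ka x z\<bar> <= C \<and>
  (\<forall>z2\<ge>0. \<bar>V ka x z - V ka x z2\<bar> <= C * \<bar>z - z2\<bar> powr \<sigma>) \<and>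
  ((%x. V ka x z) has_derivative (%h. \<Sum>b\<in>Basis. (h \<bullet> b) * V (partial b ka) x z)) (at x))"

definition ext_op :: "real => (('a::euclidean_space => real) => 'a => real => real) => bool"
 where "ext_op \<sigma> V \<longleftrightarrow> (\<forall>ka. test_fun ka --> (\<exists>C. ext_by \<sigma> V ka C))"

definition heat_avg :: "(('a::euclidean_space => real) => 'a => real => real) => ('a => real) => 'a => real => real => real"
 where "heat_avg V ka x z t' = (LBINT \<eta>. hk \<eta> t' * V ka (x - \<eta>) z)"

lemma sum_gradient_bound:
 fixes h :: "'a::euclidean_space"
 assumes "!!b. b \<in> Basis ==> \<bar>f b\<bar> <= c b"
 shows "\<bar>\<Sum>b\<in>Basis. (h \<bullet> b) * f b\<bar> <= (\<Sum>b\<in>Basis. c b) * norm h"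
proof -
 have "\<bar>\<Sum>b\<in>Basis. (h \<bullet> b) * f b\<bar> <= (\<Sum>b\<in>Basis. norm h * c b)"
  using assms Basis_le_norm[of _ h] by (intro order_trans[OF sum_abs] sum_mono) (auto simp: abs_mult intro!: mult_mono)
 then show ?thesis by (simp add: sum_distrib_left mult.commute)
qed

lemma ext_opD:
 assumes V: "ext_op \<sigma> V" and ka: "test_fun ka"
 obtains C L where "0 <= C" "0 <= L"
  "!!x z. 0 <= z ==> \<bar>V ka x z\<bar> <= C"
  "!!x z1 z2. 0 <= z1 ==> 0 <= z2 ==> \<bar>V ka x z1 - V ka x z2\<bar> <= C * \<bar>z1 - z2\<bar> powr \<sigma>"
  "!!x z. 0 <= z ==> ((%x. V ka x z) has_derivative (%h. \<Sum>b\<in>Basis. (h \<bullet> b) * V (partial b ka) x z)) (at x)"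
  "!!x y z. 0 <= z ==> \<bar>V ka x z - V ka y z\<bar> <= L * norm (x - y)"
  "!!x z h. 0 <= z ==> \<bar>\<Sum>b\<in>Basis. (h \<bullet> b) * V (partial b ka) x z\<bar> <= L * norm h"
  "!!z. 0 <= z ==> (%x. V ka x z) \<in> borel_measurable borel"
proof -
 have "\<exists>C. ext_by \<sigma> V (partial b ka) C" if "b \<in> Basis" for b
  using V test_fun_partial[OF ka that] unfolding ext_op_def by blast
 then obtain Cb where "!!b. b \<in> Basis ==> ext_by \<sigma> V (partial b ka) (Cb b)" by metis
 then have Cb: "!!b. b \<in> Basis ==> 0 <= Cb b"
  "!!b x z. b \<in> Basis ==> 0 <= z ==> \<bar>V (partial b ka) x z\<bar> <= Cb b"
  unfolding ext_by_def by auto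
 define L where "L = (\<Sum>b\<in>Basis. Cb b)"
 have L: "0 <= L" unfolding L_def using Cb by (intro sum_nonneg) auto
 have grad: "\<bar>\<Sum>b\<in>Basis. (h \<bullet> b) * V (partial b ka) x z\<bar> <= L * norm h" if "0 <= z" for x z h
  unfolding L_def by (rule sum_gradient_bound) (rule Cb(2)[OF _ that])
 obtain C where R: "ext_by \<sigma> V ka C" using V ka unfolding ext_op_def by blast
 have C: "0 <= C" using R unfolding ext_by_def by blast
 have R1: "\<bar>V ka x z\<bar> <= C" if "0 <= z" for x z using R that unfolding ext_by_def by blast
 have R2: "\<bar>V ka x z1 - V ka x z2\<bar> <= C * \<bar>z1 - z2\<bar> powr \<sigma>" if "0 <= z1" "0 <= z2" for x z1 z2
  using R that unfolding ext_by_def by blast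
 have der: "((%x. V ka x z) has_derivative (%h. \<Sum>b\<in>Basis. (h \<bullet> b) * V (partial b ka) x z)) (at x)" if "0 <= z" for x z
  using R that unfolding ext_by_def by blast
 have lip: "\<bar>V ka x z - V ka y z\<bar> <= L * norm (x - y)" if "0 <= z" for x y z
 proof -
  have "norm (V ka x z - V ka y z) <= L * norm (x - y)"
  proof (rule differentiable_bound[where S = UNIV])
   show "((%x. V ka x z) has_derivative (%h. \<Sum>b\<in>Basis. (h \<bullet> b) * V (partial b ka) x z)) (at x within UNIV)" for x
    using der[OF that] by simp
   show "onorm (%h. \<Sum>b\<in>Basis. (h \<bullet> b) * V (partial b ka) x z) <= L" for x
    using grad[OF that] L by (intro onorm_bound) auto
  qed auto
  then show ?thesis by simp
 qed
 have meas: "(%x. V ka x z) \<in> borel_measurable borel" if "0 <= z" for z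
 proof -
  have "continuous_on UNIV (%x. V ka x z)"
   using der[OF that] has_derivative_continuous by (fastforce intro!: continuous_at_imp_continuous_on)
  then show ?thesis by (rule borel_measurable_continuous_onI)
 qed
 show ?thesis by (rule that[OF C L R1 R2 der lip grad meas])
qed

lemma heat_avg_integrable:
 fixes f :: "'a::euclidean_space => real"
 assumes "0 < t'" "f \<in> borel_measurable borel" "!!x. \<bar>f x\<bar> <= C"
 shows "integrable lborel (%\<eta>. hk \<eta> t' * f (x - \<eta>))"
  and "\<bar>LBINT \<eta>. hk \<eta> t' * f (x - \<eta>)\<bar> <= C"
proof -
 note [measurable] = assms(2)
 show "integrable lborel (%\<eta>. hk \<eta> t' * f (x - \<eta>))"
  by (rule integrable_mult_bounded[OF heat_kernel_integrable[OF assms(1)], where B = C]) (use assms(3) in auto)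
 have "\<bar>LBINT \<eta>. hk \<eta> t' * f (x - \<eta>)\<bar> <= (LBINT \<eta>. C * hk (\<eta>::'a) t')"
 proof (rule abs_integral_le)
  show "integrable lborel (%\<eta>. C * hk (\<eta>::'a) t')" using heat_kernel_integrable[OF assms(1), where 'a = 'a] by simp
  show "\<bar>hk \<eta> t' * f (x - \<eta>)\<bar> <= C * hk \<eta> t'" for \<eta>
   using mult_left_mono[OF assms(3)[of "x - \<eta>"], of "hk \<eta> t'"] by (simp add: abs_mult mult.commute)
 qed
 then show "\<bar>LBINT \<eta>. hk \<eta> t' * f (x - \<eta>)\<bar> <= C"
  using heat_kernel_integral[OF assms(1), where 'a = 'a] by simp
qed

text \<open>Averaging in the tangential variable preserves all bounds; the time difference falls on the Gaussian.\<close>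
theorem heat_avg_ext:
 fixes V :: "('a::euclidean_space => real) => 'a => real => real"
 assumes V: "ext_op \<sigma> V"
 shows "heat_ext \<sigma> (heat_avg V)"
 unfolding heat_ext_def
proof (intro allI impI)
 fix ka :: "'a => real" assume ka: "test_fun ka"
 obtain C L where C: "0 <= C" and L: "0 <= L"
  and Vb: "!!x z. 0 <= z ==> \<bar>V ka x z\<bar> <= C"
  and Vh: "!!x z1 z2. 0 <= z1 ==> 0 <= z2 ==> \<bar>V ka x z1 - V ka x z2\<bar> <= C * \<bar>z1 - z2\<bar> powr \<sigma>"
  and Vd: "!!x z. 0 <= z ==> ((%x. V ka x z) has_derivative (%h. \<Sum>b\<in>Basis. (h \<bullet> b) * V (partial b ka) x z)) (at x)"
  and Vl: "!!x y z. 0 <= z ==> \<bar>V ka x z - V ka y z\<bar> <= L * norm (x - y)"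
  and Vg: "!!x z h. 0 <= z ==> \<bar>\<Sum>b\<in>Basis. (h \<bullet> b) * V (partial b ka) x z\<bar> <= L * norm h"
  and Vm: "!!z. 0 <= z ==> (%x. V ka x z) \<in> borel_measurable borel"
  by (rule ext_opD[OF V ka]) (rule that)
 define G where "G = gauss_const TYPE('a) * 2 powr (DIM('a) / 2)"
 have G: "0 < G" using gauss_const_pos[where 'a = 'a] by (simp add: G_def)
 note hi = heat_avg_integrable
 have "heat_ext_by \<sigma> (heat_avg V) ka (C + G * C)"
  unfolding heat_ext_by_def
 proof (intro conjI allI impI)
  show "0 <= C + G * C" using C G by simp
  fix t' z :: real and x :: 'a assume t': "0 < t'" "t' < 1" and z: "0 <= z"
  note i = hi(1)[OF _ Vm Vb]
  have "\<bar>heat_avg V ka x z t'\<bar> <= C" unfolding heat_avg_def by (rule hi(2)[OF t'(1) Vm[OF z] Vb[OF z]])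
  then show "\<bar>heat_avg V ka x z t'\<bar> <= C + G * C" using C G by (simp add: add_increasing2)
  show "\<bar>heat_avg V ka x z t' - heat_avg V ka x z2 t'\<bar> <= (C + G * C) * \<bar>z - z2\<bar> powr \<sigma>" if z2: "0 <= z2" for z2
  proof -
   have "heat_avg V ka x z t' - heat_avg V ka x z2 t' = (LBINT \<eta>. hk \<eta> t' * (V ka (x - \<eta>) z - V ka (x - \<eta>) z2))"
    unfolding heat_avg_def using i[OF t'(1) z z, of x] i[OF t'(1) z2 z2, of x] by (simp add: right_diff_distrib)
   also have "\<bar>...\<bar> <= C * \<bar>z - z2\<bar> powr \<sigma>"
    by (rule hi(2)[OF t'(1), where f = "%x. V ka x z - V ka x z2"]) (use Vm[OF z] Vm[OF z2] Vh[OF z z2] in auto)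
   also have "... <= (C + G * C) * \<bar>z - z2\<bar> powr \<sigma>" using C G by (intro mult_right_mono) auto
   finally show ?thesis .
  qed
  show "\<bar>heat_avg V ka x z t - heat_avg V ka x z t'\<bar> <= (C + G * C) * ((t - t') / t')" if t: "t' <= t" "t <= 2 * t'" "t < 1" for t
  proof -
   have t0: "0 < t" using t' t by simp
   have "heat_avg V ka x z t - heat_avg V ka x z t' = (LBINT \<eta>. (hk \<eta> t - hk \<eta> t') * V ka (x - \<eta>) z)"
    unfolding heat_avg_def using i[OF t'(1) z z, of x] i[OF t0 z z, of x] by (simp add: left_diff_distrib)
   also have "\<bar>...\<bar> <= (LBINT \<eta>. (G * ((t - t') / t') * C) * hk (\<eta>::'a) (4 * t'))"
   proof (rule abs_integral_le)
    show "integrable lborel (%\<eta>. (G * ((t - t') / t') * C) * hk (\<eta>::'a) (4 * t'))"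
     using heat_kernel_integrable[of "4 * t'", where 'a = 'a] t' by simp
    show "\<bar>(hk \<eta> t - hk \<eta> t') * V ka (x - \<eta>) z\<bar> <= G * ((t - t') / t') * C * hk \<eta> (4 * t')" for \<eta>
    proof -
     have "\<bar>hk \<eta> t - hk \<eta> t'\<bar> <= G * ((t - t') / t') * hk \<eta> (4 * t')"
      using heat_kernel_time_difference[OF t'(1) t(1,2), of \<eta>] by (simp add: G_def)
     then have "\<bar>hk \<eta> t - hk \<eta> t'\<bar> * \<bar>V ka (x - \<eta>) z\<bar> <= (G * ((t - t') / t') * hk \<eta> (4 * t')) * C"
      using Vb[OF z] G t' t by (intro mult_mono) auto
     then show ?thesis by (simp add: abs_mult mult_ac)
    qed
   qed
   also have "... = G * C * ((t - t') / t')"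
    using heat_kernel_integral[of "4 * t'", where 'a = 'a] t' by simp
   also have "... <= (C + G * C) * ((t - t') / t')" using C t' t by (intro mult_right_mono) auto
   finally show ?thesis .
  qed
  show "((%x. heat_avg V ka x z t') has_derivative (%h. \<Sum>b\<in>Basis. (h \<bullet> b) * heat_avg V (partial b ka) x z t')) (at x)"
  proof -
   have ib: "integrable lborel (%\<eta>. hk \<eta> t' * V (partial b ka) (x - \<eta>) z)" if b: "b \<in> Basis" for b
   proof -
    obtain Cb where "!!x z. 0 <= z ==> \<bar>V (partial b ka) x z\<bar> <= Cb" "!!z. 0 <= z ==> (%x. V (partial b ka) x z) \<in> borel_measurable borel"
     by (rule ext_opD[OF V test_fun_partial[OF ka b]]) (rule that)
    then show ?thesis by (intro hi(1)[OF t'(1)]) (use z in auto)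
   qed
   have "((%x. LBINT \<eta>. hk \<eta> t' * V ka (x - \<eta>) z) has_derivative
    (%h. LBINT \<eta>. hk \<eta> t' * (\<Sum>b\<in>Basis. (h \<bullet> b) * V (partial b ka) (x - \<eta>) z))) (at x within UNIV)"
   proof (rule has_derivative_integral_dominated[where g = "%\<eta>. hk \<eta> t' * L"])
    show "integrable lborel (%\<eta>. hk \<eta> t' * V ka (y - \<eta>) z)" for y by (rule i[OF t'(1) z z])
    have "(%\<eta>. hk \<eta> t' * (\<Sum>b\<in>Basis. (h \<bullet> b) * V (partial b ka) (x - \<eta>) z))
     = (%\<eta>. \<Sum>b\<in>Basis. (h \<bullet> b) * (hk \<eta> t' * V (partial b ka) (x - \<eta>) z))" for h
     by (simp add: fun_eq_iff sum_distrib_left mult_ac)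
    then show "(%\<eta>. hk \<eta> t' * (\<Sum>b\<in>Basis. (h \<bullet> b) * V (partial b ka) (x - \<eta>) z)) \<in> borel_measurable lborel" for h
     using ib by (auto intro!: borel_measurable_sum borel_measurable_times)
    show "((%y. hk \<eta> t' * V ka (y - \<eta>) z) has_derivative (%h. hk \<eta> t' * (\<Sum>b\<in>Basis. (h \<bullet> b) * V (partial b ka) (x - \<eta>) z))) (at x within UNIV)" for \<eta>
    proof (rule has_derivative_mult_right)
     have "((%y. y - \<eta>) has_derivative (%h. h)) (at x within UNIV)" by (auto intro!: derivative_eq_intros)
     from has_derivative_compose[OF this Vd[OF z, of "x - \<eta>"]]
     show "((%y. V ka (y - \<eta>) z) has_derivative (%h. \<Sum>b\<in>Basis. (h \<bullet> b) * V (partial b ka) (x - \<eta>) z)) (at x within UNIV)" by simp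
    qed
    show "\<bar>hk \<eta> t' * V ka (y - \<eta>) z - hk \<eta> t' * V ka (x - \<eta>) z\<bar> <= hk \<eta> t' * L * norm (y - x)" for y \<eta>
     using mult_left_mono[OF Vl[OF z, of "y - \<eta>" "x - \<eta>"], of "hk \<eta> t'"] by (simp add: abs_mult right_diff_distrib[symmetric] mult.assoc)
    show "\<bar>hk \<eta> t' * (\<Sum>b\<in>Basis. (h \<bullet> b) * V (partial b ka) (x - \<eta>) z)\<bar> <= hk \<eta> t' * L * norm h" for h \<eta>
     using mult_left_mono[OF Vg[OF z, of h "x - \<eta>"], of "hk \<eta> t'"] by (simp add: abs_mult mult.assoc)
    show "integrable lborel (%\<eta>. hk (\<eta>::'a) t' * L)" using heat_kernel_integrable[OF t'(1), where 'a = 'a] by simp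
   qed auto
   moreover have "(LBINT \<eta>. hk \<eta> t' * (\<Sum>b\<in>Basis. (h \<bullet> b) * V (partial b ka) (x - \<eta>) z))
     = (\<Sum>b\<in>Basis. (h \<bullet> b) * heat_avg V (partial b ka) x z t')" for h
   proof -
    have "(LBINT \<eta>. hk \<eta> t' * (\<Sum>b\<in>Basis. (h \<bullet> b) * V (partial b ka) (x - \<eta>) z))
     = (LBINT \<eta>. (\<Sum>b\<in>Basis. (h \<bullet> b) * (hk \<eta> t' * V (partial b ka) (x - \<eta>) z)))"
     by (simp add: sum_distrib_left mult_ac)
    also have "... = (\<Sum>b\<in>Basis. LBINT \<eta>. (h \<bullet> b) * (hk \<eta> t' * V (partial b ka) (x - \<eta>) z))"
     by (rule Bochner_Integration.integral_sum) (intro integrable_mult_right ib)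
    also have "... = (\<Sum>b\<in>Basis. (h \<bullet> b) * heat_avg V (partial b ka) x z t')"
     by (simp only: integral_mult_right_zero heat_avg_def)
    finally show ?thesis .
   qed
   ultimately show ?thesis by (simp add: heat_avg_def)
  qed
 qed
 then show "\<exists>C. heat_ext_by \<sigma> (heat_avg V) ka C" by blast
qed

lemma heat_avg_initial:
 fixes V :: "('a::euclidean_space => real) => 'a => real => real"
 assumes V: "ext_op \<sigma> V" and ka: "test_fun ka"
 obtains K where "0 <= K" "!!x z t'. 0 <= z ==> 0 < t' ==> \<bar>heat_avg V ka x z t' - V ka x z\<bar> <= K * sqrt t'"
proof -
 obtain C L where C: "0 <= C" and L: "0 <= L"
  and Vb: "!!x z. 0 <= z ==> \<bar>V ka x z\<bar> <= C"
  and "!!x z1 z2. 0 <= z1 ==> 0 <= z2 ==> \<bar>V ka x z1 - V ka x z2\<bar> <= C * \<bar>z1 - z2\<bar> powr \<sigma>"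
  and Vl: "!!x y z. 0 <= z ==> \<bar>V ka x z - V ka y z\<bar> <= L * norm (x - y)"
  and Vm: "!!z. 0 <= z ==> (%x. V ka x z) \<in> borel_measurable borel"
  by (rule ext_opD[OF V ka]) (rule that)
 define G where "G = gauss_const TYPE('a)"
 have G: "0 < G" using gauss_const_pos[where 'a = 'a] by (simp add: G_def)
 have "\<bar>heat_avg V ka x z t' - V ka x z\<bar> <= (L * G) * sqrt t'" if z: "0 <= z" and t': "0 < t'" for x z t'
 proof -
  have "(LBINT \<eta>. hk (\<eta>::'a) t' * V ka x z) = V ka x z"
   using heat_kernel_integral[OF t', where 'a = 'a] by simp
  moreover have "integrable lborel (%\<eta>. hk (\<eta>::'a) t' * V ka x z)" using heat_kernel_integrable[OF t', where 'a = 'a] by simp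
  ultimately have "heat_avg V ka x z t' - V ka x z = (LBINT \<eta>. hk \<eta> t' * (V ka (x - \<eta>) z - V ka x z))"
   unfolding heat_avg_def using heat_avg_integrable(1)[OF t' Vm[OF z] Vb[OF z], of x]
   by (simp add: right_diff_distrib)
  also have "\<bar>...\<bar> <= (LBINT \<eta>. (L * (G * sqrt t')) * hk (\<eta>::'a) (2 * t'))"
  proof (rule abs_integral_le)
   show "integrable lborel (%\<eta>. (L * (G * sqrt t')) * hk (\<eta>::'a) (2 * t'))"
    using heat_kernel_integrable[of "2 * t'", where 'a = 'a] t' by simp
   show "\<bar>hk \<eta> t' * (V ka (x - \<eta>) z - V ka x z)\<bar> <= L * (G * sqrt t') * hk \<eta> (2 * t')" for \<eta>
   proof -
    have "hk \<eta> t' * \<bar>V ka (x - \<eta>) z - V ka x z\<bar> <= hk \<eta> t' * (L * norm \<eta>)"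
     using Vl[OF z, of "x - \<eta>" x] by (intro mult_left_mono) auto
    also have "... = L * (norm \<eta> * hk \<eta> t')" by simp
    also have "... <= L * (G * sqrt t' * hk \<eta> (2 * t'))"
     unfolding G_def by (intro mult_left_mono heat_kernel_moment t' L)
    finally show ?thesis by (simp add: abs_mult mult.assoc)
   qed
  qed
  also have "... = (L * G) * sqrt t'" using heat_kernel_integral[of "2 * t'", where 'a = 'a] t' by simp
  finally show ?thesis .
 qed
 then show ?thesis using that[of "L * G"] L G by simp
qed

text \<open>Near the singularity the bound of \<open>ka\<close> is used, away from it its integral.\<close>
lemma riesz_integrable:
 fixes s :: real
 assumes s: "0 <= s" "s < real DIM('a::euclidean_space)"
 obtains K where "0 <= K"
  "!!ka x c. integrable lborel ka ==> (!!y. \<bar>ka y\<bar> <= c) ==>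
    integrable lborel (%y::'a. norm y powr (- s) * \<bar>ka (x - y)\<bar>) \<and>
    (LBINT y. norm y powr (- s) * \<bar>ka (x - y)\<bar>) <= K * c + (LBINT y. \<bar>ka y\<bar>)"
proof -
 let ?b = "%z::'a. indicator (ball 0 1) z * norm z powr (- s)"
 have ib: "integrable lborel ?b" by (rule integrable_norm_powr_ball[OF s])
 define K where "K = (LBINT z. ?b z)"
 have K: "0 <= K" unfolding K_def by (intro Bochner_Integration.integral_nonneg) auto
 show ?thesis
 proof (rule that[OF K])
  fix ka :: "'a => real" and x c assume i: "integrable lborel ka" and c: "!!y. \<bar>ka y\<bar> <= c"
  have c0: "0 <= c" using c[of 0] by linarith
  have [measurable]: "ka \<in> borel_measurable borel" using i by auto
  have i2: "integrable lborel (%y. \<bar>ka (x - y)\<bar>)" "(LBINT y. \<bar>ka (x - y)\<bar>) = (LBINT y. \<bar>ka y\<bar>)"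
   using lborel_reflect[of "%y. \<bar>ka y\<bar>" x] i by auto
  have le: "norm y powr (- s) * \<bar>ka (x - y)\<bar> <= ?b y * c + \<bar>ka (x - y)\<bar>" for y
  proof (cases "norm y < 1")
   case True
   then show ?thesis using mult_left_mono[OF c[of "x - y"], of "norm y powr (- s)"] by simp
  next
   case False
   then have "norm y powr (- s) <= 1" using powr_mono2'[of "- s" 1 "norm y"] s by simp
   then have "norm y powr (- s) * \<bar>ka (x - y)\<bar> <= 1 * \<bar>ka (x - y)\<bar>" by (intro mult_right_mono) auto
   then show ?thesis using False by simp
  qed
  have ig: "integrable lborel (%y. ?b y * c + \<bar>ka (x - y)\<bar>)" using ib i2 by (intro Bochner_Integration.integrable_add integrable_mult_left)
  have I: "integrable lborel (%y. norm y powr (- s) * \<bar>ka (x - y)\<bar>)"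
  proof (rule Bochner_Integration.integrable_bound[OF ig])
   show "AE y in lborel. norm (norm y powr (- s) * \<bar>ka (x - y)\<bar>) <= norm (?b y * c + \<bar>ka (x - y)\<bar>)"
    using le by (intro AE_I2) (auto intro: order_trans[OF _ abs_ge_self])
  qed measurable
  have "(LBINT y. norm y powr (- s) * \<bar>ka (x - y)\<bar>) <= (LBINT y. ?b y * c + \<bar>ka (x - y)\<bar>)"
   by (rule Bochner_Integration.integral_mono[OF I ig le])
  also have "... = K * c + (LBINT y. \<bar>ka y\<bar>)"
   using ib i2 by (subst Bochner_Integration.integral_add) (auto simp: K_def)
  finally show "integrable lborel (%y::'a. norm y powr (- s) * \<bar>ka (x - y)\<bar>) \<and>
    (LBINT y. norm y powr (- s) * \<bar>ka (x - y)\<bar>) <= K * c + (LBINT y. \<bar>ka y\<bar>)"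
   using I by blast
 qed
qed

text \<open>The Newtonian kernel of the space of one more dimension, restricted to height \<open>z\<close> and without its constant.\<close>
definition newt :: "real => 'a::euclidean_space => real"
 where "newt z y = ((norm y)\<^sup>2 + z\<^sup>2) powr ((1 - real DIM('a)) / 2)"

definition newt_op :: "('a::euclidean_space => real) => 'a => real => real"
 where "newt_op ka x z = (LBINT y. newt z y * ka (x - y))"

lemma newt_measurable [measurable]: "(newt z :: 'a::euclidean_space => real) \<in> borel_measurable borel"
proof -
 have "(%y::'a. (norm y)\<^sup>2 + z\<^sup>2) \<in> borel_measurable borel" by measurable
 moreover have "(%x::real. x powr ((1 - real DIM('a)) / 2)) \<in> borel_measurable borel" by measurable
 ultimately show ?thesis unfolding newt_def[abs_def] by (rule measurable_compose)
qed

lemma newt_nonneg [simp]: "0 <= newt z y" by (simp add: newt_def)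

lemma newt_le:
 assumes "y ~= 0" shows "newt z (y::'a::euclidean_space) <= norm y powr (1 - real DIM('a))"
proof -
 have "newt z y <= ((norm y)\<^sup>2) powr ((1 - real DIM('a)) / 2)"
  unfolding newt_def using assms by (intro powr_mono2') (auto simp: DIM_ge_Suc0 intro: Suc_leI)
 also have "... = norm y powr (2 * ((1 - real DIM('a)) / 2))"
  using powr_powr[of "norm y" 2 "(1 - real DIM('a)) / 2"] by simp
 also have "2 * ((1 - real DIM('a)) / 2) = 1 - real DIM('a)" by simp
 finally show ?thesis .
qed

lemma newt_holder:
 fixes y :: "'a::euclidean_space"
 assumes y: "y ~= 0" and \<sigma>: "0 < \<sigma>" "\<sigma> <= 1"
 shows "\<bar>newt z1 y - newt z2 y\<bar> <= real DIM('a) * norm y powr (- (real DIM('a) - 1 + \<sigma>)) * \<bar>z1 - z2\<bar> powr \<sigma>"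
proof -
 define m where "m = real DIM('a)"
 have m: "1 <= m" by (simp add: m_def DIM_ge_Suc0 Suc_leI)
 define r where "r = norm y"
 have r: "0 < r" using y by (simp add: r_def)
 define k where "k = r powr (1 - m)"
 define t where "t = \<bar>z1 - z2\<bar> / r"
 have t: "0 <= t" using r by (simp add: t_def)
 have a: "\<bar>newt z1 y - newt z2 y\<bar> <= k"
 proof -
  have "newt z1 y <= k" "newt z2 y <= k" using newt_le[OF y] by (auto simp: k_def r_def m_def)
  then show ?thesis using newt_nonneg[of z1 y] newt_nonneg[of z2 y] by linarith
 qed
 have b: "norm (newt z1 y - newt z2 y) <= m * (k / r) * norm (z1 - z2)"
 proof (rule field_differentiable_bound[where S = UNIV])
  fix z :: real
  define q where "q = r\<^sup>2 + z\<^sup>2"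
  have q: "0 < q" "r\<^sup>2 <= q" "z\<^sup>2 <= q" using r by (auto simp: q_def add_pos_nonneg)
  show "((%z. newt z y) has_real_derivative ((1 - m) / 2 * q powr ((1 - m) / 2 - 1) * (2 * z))) (at z within UNIV)"
   unfolding newt_def using q by (auto intro!: derivative_eq_intros simp: q_def r_def m_def)
  have "\<bar>z\<bar> <= sqrt q" using q(3) real_le_rsqrt[of "\<bar>z\<bar>" q] by simp
  then have "\<bar>z\<bar> <= q powr (1/2)" using q by (simp add: powr_half_sqrt)
  then have "q powr ((1 - m) / 2 - 1) * \<bar>z\<bar> <= q powr ((1 - m) / 2 - 1) * q powr (1/2)" by (intro mult_left_mono) auto
  also have "... = q powr (- m / 2)" by (simp add: powr_add[symmetric] field_simps)
  also have "... <= (r\<^sup>2) powr (- m / 2)" using q r m by (intro powr_mono2') auto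
  also have "... = r powr (- m)" using powr_powr[of r 2 "- m / 2"] r by simp
  also have "... = k / r" using r powr_diff[of r "1 - m" 1] by (simp add: k_def)
  finally have 1: "q powr ((1 - m) / 2 - 1) * \<bar>z\<bar> <= k / r" .
  have "norm ((1 - m) / 2 * q powr ((1 - m) / 2 - 1) * (2 * z)) = (m - 1) * (q powr ((1 - m) / 2 - 1) * \<bar>z\<bar>)"
   using m by (simp add: abs_mult)
  also have "... <= m * (k / r)" using 1 m r by (intro mult_mono) (auto simp: k_def)
  finally show "norm ((1 - m) / 2 * q powr ((1 - m) / 2 - 1) * (2 * z)) <= m * (k / r)" .
 qed auto
 have "\<bar>newt z1 y - newt z2 y\<bar> <= m * k * t powr \<sigma>"
 proof (cases "t <= 1")
  case True
  have "t <= t powr \<sigma>" using powr_mono'[of \<sigma> 1 t] t \<sigma> True by (cases "t = 0") auto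
  then have "m * k * t <= m * k * t powr \<sigma>" using m by (intro mult_left_mono) (auto simp: k_def)
  then show ?thesis using b by (simp add: t_def)
 next
  case False
  then have "1 <= t powr \<sigma>" using \<sigma> by (intro ge_one_powr_ge_zero) auto
  then have "1 * k * 1 <= m * k * t powr \<sigma>" using m by (intro mult_mono) (auto simp: k_def)
  then show ?thesis using a by simp
 qed
 also have "t powr \<sigma> = \<bar>z1 - z2\<bar> powr \<sigma> * r powr (- \<sigma>)"
  using r by (simp add: t_def powr_divide powr_minus_divide)
 also have "m * k * (\<bar>z1 - z2\<bar> powr \<sigma> * r powr (- \<sigma>)) = m * (k * r powr (- \<sigma>)) * \<bar>z1 - z2\<bar> powr \<sigma>" by simp
 also have "k * r powr (- \<sigma>) = r powr (- (m - 1 + \<sigma>))" by (simp add: k_def powr_add[symmetric] algebra_simps)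
 finally show ?thesis by (simp add: m_def r_def)
qed

lemma test_fun_lipschitz:
 fixes ka :: "'a::euclidean_space => real"
 assumes ka: "test_fun ka"
 obtains L where "0 <= L" "!!x y. \<bar>ka x - ka y\<bar> <= L * norm (x - y)"
  "!!x h. \<bar>\<Sum>b\<in>Basis. (h \<bullet> b) * partial b ka x\<bar> <= L * norm h"
proof -
 have "\<exists>C\<ge>0. \<forall>x. \<bar>partial b ka x\<bar> <= C" if "b \<in> Basis" for b
  by (rule test_funD(5)[OF test_fun_partial[OF ka that]])
 then obtain Cb where Cb: "!!b. b \<in> Basis ==> 0 <= Cb b" "!!b x. b \<in> Basis ==> \<bar>partial b ka x\<bar> <= Cb b" by metis
 define L where "L = (\<Sum>b\<in>Basis. Cb b)"
 have L: "0 <= L" unfolding L_def using Cb by (intro sum_nonneg) auto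
 have g: "\<bar>\<Sum>b\<in>Basis. (h \<bullet> b) * partial b ka x\<bar> <= L * norm h" for x h
  unfolding L_def by (rule sum_gradient_bound) (rule Cb(2))
 have "norm (ka x - ka y) <= L * norm (x - y)" for x y
 proof (rule differentiable_bound[where S = UNIV])
  show "(ka has_derivative (%h. \<Sum>b\<in>Basis. (h \<bullet> b) * partial b ka x)) (at x within UNIV)" for x
   using test_funD(6)[OF ka] by simp
  show "onorm (%h. \<Sum>b\<in>Basis. (h \<bullet> b) * partial b ka x) <= L" for x
   using g L by (intro onorm_bound) auto
 qed auto
 then show ?thesis using that[OF L _ g] by simp
qed

lemma has_derivative_shift:
 fixes ka :: "'a::euclidean_space => real"
 assumes "test_fun ka"
 shows "((%x. ka (x - a)) has_derivative (%h. \<Sum>b\<in>Basis. (h \<bullet> b) * partial b ka (x - a))) (at x within S)"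
proof -
 have "((%x. x - a) has_derivative (%h. h)) (at x within S)" by (auto intro!: derivative_eq_intros)
 from has_derivative_compose[OF this test_funD(6)[OF assms, of "x - a"]] show ?thesis by simp
qed

lemma test_fun_conv_has_derivative:
 fixes ka :: "'a::euclidean_space => real" and k :: "'b => real" and Y :: "'b => 'a"
 assumes ka: "test_fun ka" and k: "k \<in> borel_measurable M" and Y: "Y \<in> borel_measurable M"
  and int: "!!R. integrable M (%y. k y * indicator (cball 0 R) (Y y))"
 shows "((%x. \<integral>y. k y * ka (x - Y y) \<partial>M) has_derivative (%h. \<Sum>b\<in>Basis. (h \<bullet> b) * (\<integral>y. k y * partial b ka (x - Y y) \<partial>M))) (at x)"
  and "integrable M (%y. k y * ka (x - Y y))"
proof -
 note [measurable] = k Y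
 have supp: "indicator (cball 0 (norm x + 2)) (Y y) = (1::real)" if "norm (u - x) < 1" "norm (u - Y y) < 1" for u y
 proof -
  have "norm (Y y) <= norm x + norm (u - x) + norm (u - Y y)" by norm
  then show ?thesis using that by (auto simp: indicator_def dist_norm)
 qed
 have bd: "\<bar>k y * f\<bar> <= \<bar>k y * indicator (cball 0 (norm x + 2)) (Y y)\<bar> * c"
  if "\<bar>f\<bar> <= c" "0 <= c" "f ~= 0 ==> indicator (cball 0 (norm x + 2)) (Y y) = (1::real)" for f c y
  using that mult_left_mono[OF that(1), of "\<bar>k y\<bar>"] by (cases "f = 0") (auto simp: abs_mult)
 have I: "integrable M (%y. k y * ka' (u - Y y))" if u: "norm (u - x) < 1" and t: "test_fun ka'" for ka' u
 proof -
  obtain c where c: "0 <= c" "!!x. \<bar>ka' x\<bar> <= c" using test_funD(5)[OF t] by blast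
  note [measurable] = test_funD(2)[OF t]
  show ?thesis
  proof (rule Bochner_Integration.integrable_bound)
   show "integrable M (%y. \<bar>k y * indicator (cball 0 (norm x + 2)) (Y y)\<bar> * c)"
    by (intro integrable_mult_left integrable_abs int)
   show "AE y in M. norm (k y * ka' (u - Y y)) <= norm (\<bar>k y * indicator (cball 0 (norm x + 2)) (Y y)\<bar> * c)"
   proof (rule AE_I2)
    fix y
    have "\<bar>k y * ka' (u - Y y)\<bar> <= \<bar>k y * indicator (cball 0 (norm x + 2)) (Y y)\<bar> * c"
     by (rule bd[OF c(2,1)], rule supp[OF u]) (use test_funD(3)[OF t, of "u - Y y"] in force)
    then show "norm (k y * ka' (u - Y y)) <= norm (\<bar>k y * indicator (cball 0 (norm x + 2)) (Y y)\<bar> * c)"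
     using c by simp
   qed
  qed measurable
 qed
 show "integrable M (%y. k y * ka (x - Y y))" by (rule I[OF _ ka]) simp
 obtain L where L: "0 <= L" "!!x y. \<bar>ka x - ka y\<bar> <= L * norm (x - y)"
  "!!x h. \<bar>\<Sum>b\<in>Basis. (h \<bullet> b) * partial b ka x\<bar> <= L * norm h"
  by (rule test_fun_lipschitz[OF ka]) (rule that)
 let ?G = "%y h. k y * (\<Sum>b\<in>Basis. (h \<bullet> b) * partial b ka (x - Y y))"
 have Geq: "?G y h = (\<Sum>b\<in>Basis. (h \<bullet> b) * (k y * partial b ka (x - Y y)))" for y h
  by (simp add: sum_distrib_left mult_ac)
 have Ib: "integrable M (%y. k y * partial b ka (x - Y y))" if "b \<in> Basis" for b
  by (rule I[OF _ test_fun_partial[OF ka that]]) simp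
 have "((%x. \<integral>y. k y * ka (x - Y y) \<partial>M) has_derivative (%h. \<integral>y. ?G y h \<partial>M)) (at x within ball x 1)"
 proof (rule has_derivative_integral_dominated[where g = "%y. \<bar>k y * indicator (cball 0 (norm x + 2)) (Y y)\<bar> * L"])
  show "integrable M (%y. k y * ka (u - Y y))" if "u \<in> ball x 1" for u
   by (rule I[OF _ ka]) (use that in \<open>simp add: dist_norm norm_minus_commute\<close>)
  show "(%y. ?G y h) \<in> borel_measurable M" for h
   unfolding Geq using Ib by (auto intro!: borel_measurable_sum borel_measurable_times)
  show "((%u. k y * ka (u - Y y)) has_derivative ?G y) (at x within ball x 1)" for y
   by (intro has_derivative_mult_right has_derivative_shift ka)
  show "\<bar>k y * ka (u - Y y) - k y * ka (x - Y y)\<bar> <= \<bar>k y * indicator (cball 0 (norm x + 2)) (Y y)\<bar> * L * norm (u - x)"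
   if u: "u \<in> ball x 1" for u y
  proof -
   have u': "norm (u - x) < 1" using u by (simp add: dist_norm norm_minus_commute)
   have "\<bar>k y * (ka (u - Y y) - ka (x - Y y))\<bar> <= \<bar>k y * indicator (cball 0 (norm x + 2)) (Y y)\<bar> * (L * norm (u - x))"
   proof (rule bd)
    show "\<bar>ka (u - Y y) - ka (x - Y y)\<bar> <= L * norm (u - x)" using L(2)[of "u - Y y" "x - Y y"] by simp
    assume "ka (u - Y y) - ka (x - Y y) ~= 0"
    then have "norm (u - Y y) < 1 \<or> norm (x - Y y) < 1"
     using test_funD(3)[OF ka, of "u - Y y"] test_funD(3)[OF ka, of "x - Y y"]
     by (cases "1 <= norm (u - Y y)"; cases "1 <= norm (x - Y y)") auto
    then show "indicator (cball 0 (norm x + 2)) (Y y) = (1::real)" using supp[of u y] supp[of x y] u' by auto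
   qed (use L in simp)
   then show ?thesis by (simp add: right_diff_distrib mult.assoc)
  qed
  show "\<bar>?G y h\<bar> <= \<bar>k y * indicator (cball 0 (norm x + 2)) (Y y)\<bar> * L * norm h" for y h
  proof -
   have "\<bar>?G y h\<bar> <= \<bar>k y * indicator (cball 0 (norm x + 2)) (Y y)\<bar> * (L * norm h)"
   proof (rule bd[OF L(3)])
    assume "(\<Sum>b\<in>Basis. (h \<bullet> b) * partial b ka (x - Y y)) ~= 0"
    then obtain b where b: "b \<in> Basis" "(h \<bullet> b) * partial b ka (x - Y y) ~= 0" by (rule sum.not_neutral_contains_not_neutral)
    then have "partial b ka (x - Y y) ~= 0" by simp
    then have "norm (x - Y y) < 1"
     using test_funD(3)[OF test_fun_partial[OF ka b(1)], of "x - Y y"] by (cases "1 <= norm (x - Y y)") auto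
    then show "indicator (cball 0 (norm x + 2)) (Y y) = (1::real)" using supp[of x y] by simp
   qed (use L in simp)
   then show ?thesis by (simp add: mult.assoc)
  qed
  show "integrable M (%y. \<bar>k y * indicator (cball 0 (norm x + 2)) (Y y)\<bar> * L)"
   by (intro integrable_mult_left integrable_abs int)
 qed auto
 moreover have "at x within ball x 1 = at x" by (rule at_within_open) auto
 moreover have "(\<integral>y. ?G y h \<partial>M) = (\<Sum>b\<in>Basis. (h \<bullet> b) * (\<integral>y. k y * partial b ka (x - Y y) \<partial>M))" for h
  unfolding Geq using Ib by (subst Bochner_Integration.integral_sum) auto
 ultimately show "((%x. \<integral>y. k y * ka (x - Y y) \<partial>M) has_derivative (%h. \<Sum>b\<in>Basis. (h \<bullet> b) * (\<integral>y. k y * partial b ka (x - Y y) \<partial>M))) (at x)"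
  by simp
qed

text \<open>The Hoelder bound in \<open>z\<close> trades a power \<open>\<sigma> < 1\<close> of the height for one of the singularity at the origin, which stays integrable.\<close>
theorem newt_op_ext:
 assumes m: "2 <= DIM('a::euclidean_space)" and \<sigma>: "0 < \<sigma>" "\<sigma> < 1"
 shows "ext_op \<sigma> (newt_op :: ('a => real) => 'a => real => real)"
 unfolding ext_op_def
proof (intro allI impI)
 fix ka :: "'a => real" assume ka: "test_fun ka"
 let ?m = "real DIM('a)"
 obtain c where c: "0 <= c" "!!x. \<bar>ka x\<bar> <= c" using test_funD(5)[OF ka] by blast
 note ika = test_funD(4)[OF ka]
 note [measurable] = test_funD(2)[OF ka]
 obtain K1 where K1: "0 <= K1" "!!ka x c. integrable lborel ka ==> (!!y. \<bar>ka y\<bar> <= c) ==>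
    integrable lborel (%y::'a. norm y powr (- (?m - 1)) * \<bar>ka (x - y)\<bar>) \<and>
    (LBINT y. norm y powr (- (?m - 1)) * \<bar>ka (x - y)\<bar>) <= K1 * c + (LBINT y. \<bar>ka y\<bar>)"
  by (rule riesz_integrable[where s = "?m - 1" and 'a = 'a]) (use m in auto)
 obtain K2 where K2: "0 <= K2" "!!ka x c. integrable lborel ka ==> (!!y. \<bar>ka y\<bar> <= c) ==>
    integrable lborel (%y::'a. norm y powr (- (?m - 1 + \<sigma>)) * \<bar>ka (x - y)\<bar>) \<and>
    (LBINT y. norm y powr (- (?m - 1 + \<sigma>)) * \<bar>ka (x - y)\<bar>) <= K2 * c + (LBINT y. \<bar>ka y\<bar>)"
  by (rule riesz_integrable[where s = "?m - 1 + \<sigma>" and 'a = 'a]) (use m \<sigma> in auto)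
 define A where "A = (LBINT y. \<bar>ka y\<bar>)"
 have A: "0 <= A" unfolding A_def by (intro Bochner_Integration.integral_nonneg) auto
 define C where "C = (K1 * c + A) + ?m * (K2 * c + A)"
 have C0: "0 <= K1 * c + A" "0 <= ?m * (K2 * c + A)" using K1 K2 A c by auto
 have AE0: "AE y in (lborel :: 'a measure). y ~= 0" by (rule AE_lborel_singleton)
 have intN: "integrable lborel (%y. newt z y * indicator (cball 0 R) (y::'a))" for z R
 proof (rule Bochner_Integration.integrable_bound)
  have "integrable lborel (%y::'a. norm y powr (- (?m - 1)) * \<bar>indicator (cball 0 R) (0 - y) :: real\<bar>)"
   using K1(2)[of "indicator (cball 0 R)" 1 0] emeasure_compact_finite[of "cball (0::'a) R"] by (auto simp: indicator_def)
  then show "integrable lborel (%y::'a. norm y powr (- (?m - 1)) * indicator (cball 0 R) y)"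
   by (rule Bochner_Integration.integrable_cong[THEN iffD1, rotated -1]) (auto simp: indicator_def)
  show "AE y in lborel. norm (newt z y * indicator (cball 0 R) y) <= norm (norm (y::'a) powr (- (?m - 1)) * indicator (cball 0 R) y)"
   using AE0 by eventually_elim (auto simp: indicator_def newt_le)
 qed (intro borel_measurable_times borel_measurable_indicator, auto)
 note der = test_fun_conv_has_derivative[where M = lborel and Y = "%y. y" and k = "newt z" for z]
 have int: "integrable lborel (%y. newt z y * ka (x - y))" for x z
  by (rule der(2)[OF ka]) (use intN in auto)
 have "ext_by \<sigma> newt_op ka C"
  unfolding ext_by_def
 proof (intro conjI allI impI)
  show "0 <= C" using C0 by (simp add: C_def)
  fix x :: 'a and z :: real assume "0 <= z"
  have "\<bar>newt_op ka x z\<bar> <= (LBINT y. norm y powr (- (?m - 1)) * \<bar>ka (x - y)\<bar>)"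
   unfolding newt_op_def
  proof (rule abs_integral_le_AE)
   show "integrable lborel (%y::'a. norm y powr (- (?m - 1)) * \<bar>ka (x - y)\<bar>)" using K1(2)[OF ika c(2)] by blast
   show "AE y in lborel. \<bar>newt z y * ka (x - y)\<bar> <= norm y powr (- (?m - 1)) * \<bar>ka (x - y)\<bar>"
    using AE0 by eventually_elim (auto simp: abs_mult intro!: mult_right_mono newt_le)
  qed
  also have "... <= K1 * c + A" unfolding A_def using K1(2)[OF ika c(2)] by blast
  finally show "\<bar>newt_op ka x z\<bar> <= C" using C0 by (simp add: C_def)
  show "\<bar>newt_op ka x z - newt_op ka x z2\<bar> <= C * \<bar>z - z2\<bar> powr \<sigma>" for z2
  proof -
   have "\<bar>newt_op ka x z - newt_op ka x z2\<bar> = \<bar>LBINT y. (newt z y - newt z2 y) * ka (x - y)\<bar>"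
    unfolding newt_op_def using int[of z x] int[of z2 x] by (simp add: left_diff_distrib)
   also have "... <= (LBINT y. (?m * \<bar>z - z2\<bar> powr \<sigma>) * (norm y powr (- (?m - 1 + \<sigma>)) * \<bar>ka (x - y)\<bar>))"
   proof (rule abs_integral_le_AE)
    show "integrable lborel (%y::'a. (?m * \<bar>z - z2\<bar> powr \<sigma>) * (norm y powr (- (?m - 1 + \<sigma>)) * \<bar>ka (x - y)\<bar>))"
     using K2(2)[OF ika c(2), of x] by (intro integrable_mult_right) blast
    show "AE y in lborel. \<bar>(newt z y - newt z2 y) * ka (x - y)\<bar> <= (?m * \<bar>z - z2\<bar> powr \<sigma>) * (norm y powr (- (?m - 1 + \<sigma>)) * \<bar>ka (x - y)\<bar>)"
     using AE0
    proof eventually_elim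
     case (elim y)
     have "\<bar>newt z y - newt z2 y\<bar> * \<bar>ka (x - y)\<bar> <= (?m * norm y powr (- (?m - 1 + \<sigma>)) * \<bar>z - z2\<bar> powr \<sigma>) * \<bar>ka (x - y)\<bar>"
      using \<sigma> by (intro mult_right_mono newt_holder elim) auto
     then show ?case by (simp add: abs_mult mult_ac)
    qed
   qed
   also have "... = (?m * \<bar>z - z2\<bar> powr \<sigma>) * (LBINT y. norm y powr (- (?m - 1 + \<sigma>)) * \<bar>ka (x - y)\<bar>)"
    by (rule integral_mult_right_zero)
   also have "... <= (?m * \<bar>z - z2\<bar> powr \<sigma>) * (K2 * c + A)"
    unfolding A_def using K2(2)[OF ika c(2)] by (intro mult_left_mono) auto
   also have "... = ?m * (K2 * c + A) * \<bar>z - z2\<bar> powr \<sigma>" by simp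
   also have "... <= C * \<bar>z - z2\<bar> powr \<sigma>" using C0 by (intro mult_right_mono) (auto simp: C_def)
   finally show ?thesis .
  qed
  show "((%x. newt_op ka x z) has_derivative (%h. \<Sum>b\<in>Basis. (h \<bullet> b) * newt_op (partial b ka) x z)) (at x)"
   unfolding newt_op_def by (rule der(1)[OF ka]) (use intN in auto)
 qed
 then show "\<exists>C. ext_by \<sigma> newt_op ka C" by blast
qed

definition poisson_op :: "('a::euclidean_space => real) => 'a => real => real"
 where "poisson_op ka x z = (LBINT \<xi>. (1 + (norm \<xi>)\<^sup>2) powr (- ((DIM('a) + 1) / 2)) * ka (x - z *\<^sub>R \<xi>))"

text \<open>In the scaled form the dependence on \<open>z\<close> sits in the smooth function, and the kernel has moments of each order below 1.\<close>
theorem poisson_op_ext: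
 assumes \<sigma>: "0 < \<sigma>" "\<sigma> < 1"
 shows "ext_op \<sigma> (poisson_op :: ('a::euclidean_space => real) => 'a => real => real)"
 unfolding ext_op_def
proof (intro allI impI)
 fix ka :: "'a => real" assume ka: "test_fun ka"
 let ?p = "%\<xi>::'a. (1 + (norm \<xi>)\<^sup>2) powr (- ((DIM('a) + 1) / 2))"
 let ?q = "%\<xi>::'a. (1 + (norm \<xi>)\<^sup>2) powr (- ((DIM('a) + 1 - \<sigma>) / 2))"
 obtain c where c: "0 <= c" "!!x. \<bar>ka x\<bar> <= c" using test_funD(5)[OF ka] by blast
 note [measurable] = test_funD(2)[OF ka]
 obtain L where L: "0 <= L" "!!x y. \<bar>ka x - ka y\<bar> <= L * norm (x - y)"
  by (rule test_fun_lipschitz[OF ka]) (rule that)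
 have ip: "integrable lborel ?p" by (rule integrable_japanese) (simp add: divide_strict_right_mono)
 have iq: "integrable lborel ?q" by (rule integrable_japanese) (use \<sigma> in \<open>simp add: divide_strict_right_mono\<close>)
 have [measurable]: "?p \<in> borel_measurable borel" using ip by auto
 define P where "P = (LBINT \<xi>. ?p \<xi>)"
 define Q where "Q = (LBINT \<xi>. ?q \<xi>)"
 have PQ: "0 <= P" "0 <= Q" unfolding P_def Q_def by (auto intro!: Bochner_Integration.integral_nonneg)
 define C where "C = P * c + (L + 2 * c) * Q"
 have C0: "0 <= P * c" "0 <= (L + 2 * c) * Q" using PQ L c by auto
 note der = test_fun_conv_has_derivative[where M = lborel and Y = "%\<xi>. z *\<^sub>R \<xi>" and k = ?p for z]
 have iR: "integrable lborel (%\<xi>. ?p \<xi> * indicator (cball 0 R) (z *\<^sub>R \<xi>))" for z R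
 proof (rule integrable_mult_bounded[OF ip, where B = 1])
  have "(%\<xi>::'a. z *\<^sub>R \<xi>) \<in> borel \<rightarrow>\<^sub>M borel" "indicator (cball (0::'a) R) \<in> borel \<rightarrow>\<^sub>M (borel :: real measure)"
   by (auto intro!: borel_measurable_indicator)
  from measurable_compose[OF this]
  show "(%\<xi>::'a. indicator (cball 0 R) (z *\<^sub>R \<xi>) :: real) \<in> borel_measurable lborel" by simp
 qed simp
 have int: "integrable lborel (%\<xi>. ?p \<xi> * ka (x - z *\<^sub>R \<xi>))" for x z
  by (rule integrable_mult_bounded[OF ip, where B = c]) (use c in auto)
 have hold: "\<bar>ka x - ka y\<bar> <= (L + 2 * c) * norm (x - y) powr \<sigma>" for x y
 proof (cases "norm (x - y) <= 1")
  case True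
  have "norm (x - y) <= norm (x - y) powr \<sigma>"
   using powr_mono'[of \<sigma> 1 "norm (x - y)"] \<sigma> True by (cases "x = y") auto
  then have "L * norm (x - y) <= (L + 2 * c) * norm (x - y) powr \<sigma>" using L c by (intro mult_mono) auto
  then show ?thesis using L(2)[of x y] by linarith
 next
  case False
  then have "1 <= norm (x - y) powr \<sigma>" using \<sigma> by (intro ge_one_powr_ge_zero) auto
  then have "2 * c * 1 <= (L + 2 * c) * norm (x - y) powr \<sigma>" using L c by (intro mult_mono) auto
  then show ?thesis using c(2)[of x] c(2)[of y] by linarith
 qed
 have "ext_by \<sigma> poisson_op ka C"
  unfolding ext_by_def
 proof (intro conjI allI impI)
  show "0 <= C" using C0 by (simp add: C_def)
  fix x :: 'a and z :: real assume "0 <= z"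
  have "\<bar>poisson_op ka x z\<bar> <= (LBINT \<xi>. ?p \<xi> * c)"
   unfolding poisson_op_def
   by (rule abs_integral_le) (use ip c in \<open>auto simp: abs_mult intro!: mult_left_mono\<close>)
  also have "... = P * c" by (simp add: P_def)
  finally show "\<bar>poisson_op ka x z\<bar> <= C" using C0 by (simp add: C_def)
  show "\<bar>poisson_op ka x z - poisson_op ka x z2\<bar> <= C * \<bar>z - z2\<bar> powr \<sigma>" for z2
  proof -
   have "\<bar>poisson_op ka x z - poisson_op ka x z2\<bar> = \<bar>LBINT \<xi>. ?p \<xi> * (ka (x - z *\<^sub>R \<xi>) - ka (x - z2 *\<^sub>R \<xi>))\<bar>"
    unfolding poisson_op_def using int[of x z] int[of x z2] by (simp add: right_diff_distrib)
   also have "... <= (LBINT \<xi>. ((L + 2 * c) * \<bar>z - z2\<bar> powr \<sigma>) * ?q \<xi>)"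
   proof (rule abs_integral_le)
    show "integrable lborel (%\<xi>. ((L + 2 * c) * \<bar>z - z2\<bar> powr \<sigma>) * ?q \<xi>)" using iq by simp
    fix \<xi> :: 'a
    have "norm ((x - z *\<^sub>R \<xi>) - (x - z2 *\<^sub>R \<xi>)) = \<bar>z - z2\<bar> * norm \<xi>"
     by (simp add: scaleR_left_diff_distrib[symmetric] abs_minus_commute)
    then have "\<bar>ka (x - z *\<^sub>R \<xi>) - ka (x - z2 *\<^sub>R \<xi>)\<bar> <= (L + 2 * c) * (\<bar>z - z2\<bar> powr \<sigma> * norm \<xi> powr \<sigma>)"
     using hold[of "x - z *\<^sub>R \<xi>" "x - z2 *\<^sub>R \<xi>"] by (simp add: powr_mult)
    then have "?p \<xi> * \<bar>ka (x - z *\<^sub>R \<xi>) - ka (x - z2 *\<^sub>R \<xi>)\<bar> <= ?p \<xi> * ((L + 2 * c) * (\<bar>z - z2\<bar> powr \<sigma> * norm \<xi> powr \<sigma>))"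
     by (intro mult_left_mono) auto
    also have "... = ((L + 2 * c) * \<bar>z - z2\<bar> powr \<sigma>) * (?p \<xi> * norm \<xi> powr \<sigma>)" by simp
    also have "... <= ((L + 2 * c) * \<bar>z - z2\<bar> powr \<sigma>) * ?q \<xi>"
    proof (rule mult_left_mono)
     have "norm \<xi> powr \<sigma> <= (1 + (norm \<xi>)\<^sup>2) powr (\<sigma> / 2)"
     proof (cases "\<xi> = 0")
      case False
      have "norm \<xi> powr \<sigma> = ((norm \<xi>)\<^sup>2) powr (\<sigma> / 2)" using powr_powr[of "norm \<xi>" 2 "\<sigma> / 2"] by simp
      also have "... <= (1 + (norm \<xi>)\<^sup>2) powr (\<sigma> / 2)" using \<sigma> by (intro powr_mono2) auto
      finally show ?thesis .
     qed simp
     then have "?p \<xi> * norm \<xi> powr \<sigma> <= ?p \<xi> * (1 + (norm \<xi>)\<^sup>2) powr (\<sigma> / 2)" by (intro mult_left_mono) auto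
     also have "... = (1 + (norm \<xi>)\<^sup>2) powr (- ((DIM('a) + 1) / 2) + \<sigma> / 2)" by (rule powr_add[symmetric])
     also have "- ((DIM('a) + 1) / 2) + \<sigma> / 2 = - ((DIM('a) + 1 - \<sigma>) / 2)" by (simp add: field_simps)
     finally show "?p \<xi> * norm \<xi> powr \<sigma> <= ?q \<xi>" .
    qed (use L c in auto)
    finally show "\<bar>?p \<xi> * (ka (x - z *\<^sub>R \<xi>) - ka (x - z2 *\<^sub>R \<xi>))\<bar> <= ((L + 2 * c) * \<bar>z - z2\<bar> powr \<sigma>) * ?q \<xi>"
     by (simp add: abs_mult)
   qed
   also have "... = (L + 2 * c) * Q * \<bar>z - z2\<bar> powr \<sigma>" by (simp add: Q_def)
   also have "... <= C * \<bar>z - z2\<bar> powr \<sigma>" using C0 by (intro mult_right_mono) (auto simp: C_def)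
   finally show ?thesis .
  qed
  show "((%x. poisson_op ka x z) has_derivative (%h. \<Sum>b\<in>Basis. (h \<bullet> b) * poisson_op (partial b ka) x z)) (at x)"
   unfolding poisson_op_def by (rule der(1)[OF ka]) (use iR in auto)
 qed
 then show "\<exists>C. ext_by \<sigma> poisson_op ka C" by blast
qed

section \<open>Convolutions with Gaussians\<close>

lemma heat_kernel_shift_le:
 fixes w e :: "'a::euclidean_space"
 assumes t: "0 < t" and e: "norm e = 1" and s: "\<bar>s\<bar> <= 1"
 shows "hk (w + s *\<^sub>R e) (2 * t) <= 2 powr (DIM('a) / 2) * exp (1 / (8 * t)) * hk w (4 * t)"
proof -
 have "norm w <= norm (w + s *\<^sub>R e) + \<bar>s\<bar>"
 proof -
  have "norm w = norm ((w + s *\<^sub>R e) - s *\<^sub>R e)" by simp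
  also have "... <= norm (w + s *\<^sub>R e) + norm (s *\<^sub>R e)" by (rule norm_triangle_ineq4)
  finally show ?thesis using e by simp
 qed
 then have "(norm w)\<^sup>2 <= (norm (w + s *\<^sub>R e) + 1)\<^sup>2" using s by (intro power_mono) auto
 also have "... <= 2 * (norm (w + s *\<^sub>R e))\<^sup>2 + 2"
  using sum_squares_bound[of "norm (w + s *\<^sub>R e)" 1] by (simp add: power2_sum)
 finally have "- (norm (w + s *\<^sub>R e))\<^sup>2 <= 1 + - (norm w)\<^sup>2 / 2" by simp
 then have "- (norm (w + s *\<^sub>R e))\<^sup>2 / (8 * t) <= (1 + - (norm w)\<^sup>2 / 2) / (8 * t)"
  using t by (intro divide_right_mono) auto
 also have "... = 1 / (8 * t) + - (norm w)\<^sup>2 / (16 * t)" by (simp add: add_divide_distrib diff_divide_distrib)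
 finally have 1: "exp (- (norm (w + s *\<^sub>R e))\<^sup>2 / (8 * t)) <= exp (1 / (8 * t)) * exp (- (norm w)\<^sup>2 / (16 * t))"
  by (simp add: exp_add[symmetric])
 have 2: "(4 * pi * (2 * t)) powr (- real DIM('a) / 2) = 2 powr (DIM('a) / 2) * (4 * pi * (4 * t)) powr (- real DIM('a) / 2)"
  using t powr_mult[of 2 "4 * pi * (2 * t)" "- real DIM('a) / 2"] by (simp add: powr_minus_divide)
 have "hk (w + s *\<^sub>R e) (2 * t) = (4 * pi * (2 * t)) powr (- real DIM('a) / 2) * exp (- (norm (w + s *\<^sub>R e))\<^sup>2 / (8 * t))"
  by (simp add: heat_kernel_def)
 also have "... <= (4 * pi * (2 * t)) powr (- real DIM('a) / 2) * (exp (1 / (8 * t)) * exp (- (norm w)\<^sup>2 / (16 * t)))"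
  using 1 by (intro mult_left_mono) auto
 also have "... = 2 powr (DIM('a) / 2) * exp (1 / (8 * t)) * hk w (4 * t)"
  unfolding 2 by (simp add: heat_kernel_def)
 finally show ?thesis .
qed

definition hkd :: "'a::euclidean_space => real => 'a => real"
 where "hkd e t v = - (v \<bullet> e) / (2 * t) * hk v t"

lemma hkd_measurable [measurable]:
 fixes f :: "'b => 'a::euclidean_space"
 assumes [measurable]: "f \<in> borel_measurable M"
 shows "(%x. hkd e t (f x)) \<in> borel_measurable M"
 unfolding hkd_def by measurable

lemma hkd_bound:
 assumes "0 < t" "norm e = 1"
 shows "\<bar>hkd e t (v::'a::euclidean_space)\<bar> <= gauss_const TYPE('a) * t powr (- (1/2)) * hk v (2 * t)"
 using heat_kernel_gradient_bound[OF assms(1), of v e] assms(2) by (simp add: hkd_def)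

lemma hkd_integrable:
 assumes "0 < t" "norm e = 1"
 shows "integrable lborel (hkd e t :: 'a::euclidean_space => real)"
proof (rule Bochner_Integration.integrable_bound)
 show "integrable lborel (%v::'a. gauss_const TYPE('a) * t powr (- (1/2)) * hk v (2 * t))"
  using heat_kernel_integrable[of "2 * t", where 'a = 'a] assms by simp
 show "AE v in lborel. norm (hkd e t (v::'a)) <= norm (gauss_const TYPE('a) * t powr (- (1/2)) * hk v (2 * t))"
  using hkd_bound[OF assms] by (intro AE_I2) (auto intro: order_trans[OF _ abs_ge_self])
qed simp

lemma gaussian_conv_has_derivative:
 fixes f :: "'a::euclidean_space => real"
 assumes t: "0 < t" and f: "f \<in> borel_measurable borel" "!!v. \<bar>f v\<bar> <= C" and e: "norm e = 1"
 shows "((%s. LBINT v. hk (u + s *\<^sub>R e - v) t * f v) has_real_derivative (LBINT v. hkd e t (u - v) * f v)) (at 0)"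
  and "integrable lborel (%v. hkd e t (u - v) * f v)"
  and "integrable lborel (%v. hk (u - v) t * f v)"
proof -
 note [measurable] = f(1)
 have C: "0 <= C" using f(2)[of 0] by linarith
 have ih: "integrable lborel (%v::'a. hk (u - v) t)" if "0 < t" for u t
  using lborel_reflect(1)[of "%v. hk v t" u] heat_kernel_integrable[OF that] by blast
 show i1: "integrable lborel (%v. hk (u - v) t * f v)" for u
  by (rule integrable_mult_bounded[OF ih[OF t]]) (use f in auto)
 have id: "integrable lborel (%v::'a. hkd e t (u - v))"
  using lborel_reflect(1)[of "hkd e t" u] hkd_integrable[OF t e] by blast
 show i2: "integrable lborel (%v. hkd e t (u - v) * f v)"
  by (rule integrable_mult_bounded[OF id]) (use f in auto)
 define G where "G = gauss_const TYPE('a) * t powr (- (1/2))"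
 define K where "K = 2 powr (DIM('a) / 2) * exp (1 / (8 * t))"
 have GK: "0 <= G" "0 <= K" using gauss_const_pos[where 'a = 'a] by (auto simp: G_def K_def)
 have der: "((%s. hk (w + s *\<^sub>R e) t) has_derivative (%h. hkd e t (w + s *\<^sub>R e) * h)) (at s within S)" for w s S
 proof -
  have "((%s. w + s *\<^sub>R e) has_derivative (%h. h *\<^sub>R e)) (at s within S)" by (auto intro!: derivative_eq_intros)
  from has_derivative_compose[OF this heat_kernel_has_derivative[where S = UNIV, of t "w + s *\<^sub>R e"]] t
  show ?thesis by (simp add: hkd_def mult_ac)
 qed
 have bd: "\<bar>hkd e t (w + s *\<^sub>R e)\<bar> <= G * K * hk w (4 * t)" if "\<bar>s\<bar> <= 1" for w s
 proof -
  have "\<bar>hkd e t (w + s *\<^sub>R e)\<bar> <= G * hk (w + s *\<^sub>R e) (2 * t)"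
   unfolding G_def by (rule hkd_bound[OF t e])
  also have "... <= G * (K * hk w (4 * t))"
   unfolding K_def using GK by (intro mult_left_mono heat_kernel_shift_le t e that) auto
  finally show ?thesis by simp
 qed
 have lip: "\<bar>hk (w + s *\<^sub>R e) t - hk w t\<bar> <= G * K * hk w (4 * t) * \<bar>s\<bar>" if "\<bar>s\<bar> < 1" for w s
 proof -
  have "norm (hk (w + s *\<^sub>R e) t - hk (w + 0 *\<^sub>R e) t) <= G * K * hk w (4 * t) * norm (s - 0)"
  proof (rule differentiable_bound[where S = "ball 0 1"])
   show "onorm (%h. hkd e t (w + r *\<^sub>R e) * h) <= G * K * hk w (4 * t)" if "r \<in> ball 0 1" for r
    using bd[of r w] that GK by (intro onorm_bound) (auto simp: abs_mult intro!: mult_right_mono)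
  qed (use der that in auto)
  then show ?thesis by simp
 qed
 have "((%s. LBINT v. hk (u + s *\<^sub>R e - v) t * f v) has_derivative (%h. LBINT v. hkd e t (u - v) * f v * h)) (at 0 within ball 0 1)"
 proof (rule has_derivative_integral_dominated[where g = "%v. G * K * C * hk (u - v) (4 * t)"])
  show "integrable lborel (%v. hk (u + s *\<^sub>R e - v) t * f v)" for s by (rule i1)
  show "integrable lborel (%v. G * K * C * hk (u - v) (4 * t))" using ih[of "4 * t" u] t by simp
  show "(%v. hkd e t (u - v) * f v * h) \<in> borel_measurable lborel" for h using i2 by auto
  fix v :: 'a
  have eq: "u + s *\<^sub>R e - v = (u - v) + s *\<^sub>R e" for s by simp
  show "((%s. hk (u + s *\<^sub>R e - v) t * f v) has_derivative (%h. hkd e t (u - v) * f v * h)) (at 0 within ball 0 1)"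
   unfolding eq using has_derivative_mult_left[OF der[of "u - v" 0 "ball 0 1"], of "f v"] by (simp add: mult_ac)
  show "\<bar>hk (u + s *\<^sub>R e - v) t * f v - hk (u + 0 *\<^sub>R e - v) t * f v\<bar> <= G * K * C * hk (u - v) (4 * t) * norm (s - 0)"
   if "s \<in> ball 0 1" for s
  proof -
   have "\<bar>hk ((u - v) + s *\<^sub>R e) t - hk (u - v) t\<bar> * \<bar>f v\<bar> <= (G * K * hk (u - v) (4 * t) * \<bar>s\<bar>) * C"
    using that f(2)[of v] GK by (intro mult_mono lip) auto
   moreover have "hk (u - v + s *\<^sub>R e) t * f v - hk (u - v) t * f v = (hk (u - v + s *\<^sub>R e) t - hk (u - v) t) * f v"
    by (simp only: left_diff_distrib)
   ultimately show ?thesis unfolding eq by (simp add: abs_mult mult_ac)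
  qed
  show "\<bar>hkd e t (u - v) * f v * h\<bar> <= G * K * C * hk (u - v) (4 * t) * norm h" for h
  proof -
   have "\<bar>hkd e t (u - v)\<bar> * \<bar>f v\<bar> <= (G * K * hk (u - v) (4 * t)) * C"
    using bd[of 0 "u - v"] f(2)[of v] GK by (intro mult_mono) auto
   then have "\<bar>hkd e t (u - v)\<bar> * \<bar>f v\<bar> * \<bar>h\<bar> <= (G * K * hk (u - v) (4 * t)) * C * \<bar>h\<bar>" by (intro mult_right_mono) auto
   then show ?thesis by (simp add: abs_mult mult_ac)
  qed
 qed auto
 moreover have "at (0::real) within ball 0 1 = at 0" by (rule at_within_open) auto
 moreover have "(LBINT v. hkd e t (u - v) * f v * h) = (LBINT v. hkd e t (u - v) * f v) * h" for h
  by (rule integral_mult_left_zero)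
 ultimately show "((%s. LBINT v. hk (u + s *\<^sub>R e - v) t * f v) has_real_derivative (LBINT v. hkd e t (u - v) * f v)) (at 0)"
  by (simp add: has_field_derivative_def)
qed

section \<open>The gradient of the Newton potential\<close>

text \<open>Up to the constant \<open>green_const\<close>, the derivative in direction \<open>i\<close> of the Newtonian potential at the point with tangential part \<open>y\<close> and height \<open>z\<close>.\<close>
definition grad_newt :: "'a::euclidean_space \<times> real => real => 'a => real"
 where "grad_newt i z y = (y \<bullet> fst i + z * snd i) * ((norm y)\<^sup>2 + z\<^sup>2) powr (- ((real DIM('a) + 1) / 2))"

lemma grad_newt_measurable [measurable]:
 fixes g :: "'b => 'a::euclidean_space"
 assumes f: "f \<in> borel_measurable M" and g: "g \<in> borel_measurable M"
 shows "(%x. grad_newt i (f x) (g x)) \<in> borel_measurable M"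
proof -
 have "(%x. (norm (g x))\<^sup>2 + (f x)\<^sup>2) \<in> borel_measurable M" using f g by measurable
 moreover have "(%x::real. x powr (- ((real DIM('a) + 1) / 2))) \<in> borel_measurable borel" by measurable
 ultimately have 1: "(%x. ((norm (g x))\<^sup>2 + (f x)\<^sup>2) powr (- ((real DIM('a) + 1) / 2))) \<in> borel_measurable M"
  by (rule measurable_compose)
 have 2: "(%x. g x \<bullet> fst i + f x * snd i) \<in> borel_measurable M" using f g by measurable
 show ?thesis unfolding grad_newt_def using 1 2 by (rule borel_measurable_times[rotated])
qed

lemma grad_newt_le:
 fixes y :: "'a::euclidean_space"
 assumes z: "0 < z" and i: "norm i = 1"
 shows "\<bar>grad_newt i z y\<bar> <= ((norm y)\<^sup>2 + z\<^sup>2) powr (- (real DIM('a) / 2))"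
  and "\<bar>grad_newt i z y\<bar> <= (z\<^sup>2) powr (- (real DIM('a) / 2))"
  and "y ~= 0 ==> \<bar>grad_newt i z y\<bar> <= z powr (- (1/2)) * norm y powr (- (real DIM('a) - 1/2))"
proof -
 define m where "m = real DIM('a)"
 have m: "1 <= m" by (simp add: m_def DIM_ge_Suc0 Suc_leI)
 define q where "q = (norm y)\<^sup>2 + z\<^sup>2"
 have q: "0 < q" "z\<^sup>2 <= q" "(norm y)\<^sup>2 <= q" using z by (auto simp: q_def add_nonneg_pos)
 have "\<bar>y \<bullet> fst i + z * snd i\<bar> = \<bar>(y, z) \<bullet> i\<bar>" by (simp add: inner_prod_def)
 also have "... <= norm (y, z)" using Cauchy_Schwarz_ineq2[of "(y, z)" i] i by simp
 also have "... = q powr (1/2)" using q by (simp add: norm_Pair q_def powr_half_sqrt)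
 finally have "\<bar>grad_newt i z y\<bar> <= q powr (1/2) * q powr (- ((m + 1) / 2))"
  unfolding grad_newt_def abs_mult by (intro mult_mono) (auto simp: q_def m_def)
 also have "... = q powr (- (m / 2))" by (simp add: powr_add[symmetric] add_divide_distrib)
 finally have a: "\<bar>grad_newt i z y\<bar> <= q powr (- (m / 2))" .
 then show "\<bar>grad_newt i z y\<bar> <= ((norm y)\<^sup>2 + z\<^sup>2) powr (- (real DIM('a) / 2))" by (simp add: q_def m_def)
 have "q powr (- (m / 2)) <= (z\<^sup>2) powr (- (m / 2))" using q z m by (intro powr_mono2') auto
 with a show "\<bar>grad_newt i z y\<bar> <= (z\<^sup>2) powr (- (real DIM('a) / 2))" by (simp add: m_def)
 assume y: "y ~= 0"
 have "q powr (- (m / 2)) = q powr (- (1/4)) * q powr (- ((m - 1/2) / 2))"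
  by (simp add: powr_add[symmetric] diff_divide_distrib)
 also have "... <= (z\<^sup>2) powr (- (1/4)) * ((norm y)\<^sup>2) powr (- ((m - 1/2) / 2))"
  using q z y m by (intro mult_mono powr_mono2') auto
 also have "(z\<^sup>2) powr (- (1/4)) = z powr (- (1/2))" using powr_powr[of z 2 "- (1/4)"] z by simp
 also have "((norm y)\<^sup>2) powr (- ((m - 1/2) / 2)) = norm y powr (2 * (- ((m - 1/2) / 2)))"
  using powr_powr[of "norm y" 2 "- ((m - 1/2) / 2)"] y by simp
 also have "2 * (- ((m - 1/2) / 2)) = - (m - 1/2)" by (simp add: field_simps)
 finally show "\<bar>grad_newt i z y\<bar> <= z powr (- (1/2)) * norm y powr (- (real DIM('a) - 1/2))"
  using a by (simp add: m_def)
qed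

text \<open>The factor \<open>z powr (- (1/2))\<close> is integrable at 0. It comes from splitting off half a power of the height in the kernel, which leaves a locally integrable singularity in
the tangential variable.\<close>
lemma grad_newt_conv_bound:
 fixes ka :: "'a::euclidean_space => real"
 assumes ka: "integrable lborel ka" "!!y. \<bar>ka y\<bar> <= c"
 obtains K where "0 <= K"
  "!!(i::'a \<times> real) (z::real) u. norm i = 1 ==> 0 < z ==> \<bar>LBINT v. ka (u - v) * grad_newt i z v\<bar> <= K * z powr (- (1/2))"
proof -
 let ?s = "real DIM('a) - 1/2"
 have "1 <= real DIM('a)" by (simp add: DIM_ge_Suc0 Suc_leI)
 then have ms: "0 <= ?s" "?s < real DIM('a)" by linarith+
 obtain K0 where K0: "0 <= K0" "!!ka x c. integrable lborel ka ==> (!!y. \<bar>ka y\<bar> <= c) ==>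
    integrable lborel (%y::'a. norm y powr (- ?s) * \<bar>ka (x - y)\<bar>) \<and>
    (LBINT y. norm y powr (- ?s) * \<bar>ka (x - y)\<bar>) <= K0 * c + (LBINT y. \<bar>ka y\<bar>)"
  by (rule riesz_integrable[where s = ?s and 'a = 'a]) (use ms in auto)
 have c0: "0 <= c" using ka(2)[of 0] by linarith
 define K where "K = K0 * c + (LBINT y. \<bar>ka y\<bar>)"
 have K: "0 <= K" using K0 c0 by (auto simp: K_def intro!: add_nonneg_nonneg Bochner_Integration.integral_nonneg)
 note R = K0(2)[OF ka]
 show ?thesis
 proof (rule that[OF K])
  fix i :: "'a \<times> real" and z :: real and u assume i: "norm i = 1" and z: "0 < z"
  have "\<bar>LBINT v. ka (u - v) * grad_newt i z v\<bar> <= (LBINT v. z powr (- (1/2)) * (norm v powr (- ?s) * \<bar>ka (u - v)\<bar>))"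
  proof (rule abs_integral_le_AE)
   show "integrable lborel (%v. z powr (- (1/2)) * (norm v powr (- ?s) * \<bar>ka (u - v)\<bar>))"
    using R[of u] by (intro integrable_mult_right) blast
   show "AE v in lborel. \<bar>ka (u - v) * grad_newt i z v\<bar> <= z powr (- (1/2)) * (norm v powr (- ?s) * \<bar>ka (u - v)\<bar>)"
    using AE_lborel_singleton[of 0]
   proof eventually_elim
    case (elim v)
    have "\<bar>ka (u - v)\<bar> * \<bar>grad_newt i z v\<bar> <= \<bar>ka (u - v)\<bar> * (z powr (- (1/2)) * norm v powr (- ?s))"
     by (intro mult_left_mono grad_newt_le(3) z i elim) auto
    then show ?case by (simp add: abs_mult mult_ac)
   qed
  qed
  also have "... = z powr (- (1/2)) * (LBINT v. norm v powr (- ?s) * \<bar>ka (u - v)\<bar>)" by (rule integral_mult_right_zero)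
  also have "... <= z powr (- (1/2)) * K" unfolding K_def using R[of u] by (intro mult_left_mono) auto
  finally show "\<bar>LBINT v. ka (u - v) * grad_newt i z v\<bar> <= K * z powr (- (1/2))" by (simp add: mult.commute)
 qed
qed

text \<open>Rescaling by \<open>z\<close> turns the normal derivative of the Newtonian potential into the Poisson kernel, bounded down to \<open>z = 0\<close>.\<close>
lemma grad_newt_conv_normal:
 fixes ka :: "'a::euclidean_space => real"
 assumes "0 < z"
 shows "(LBINT y. grad_newt (0, 1) z y * ka (x - y)) = poisson_op ka x z"
proof -
 let ?f = "%y. grad_newt (0, 1) z y * ka (x - y)"
 define m where "m = real DIM('a)"
 have eq: "?f (0 + z *\<^sub>R \<xi>) = (1 / z ^ DIM('a)) * ((1 + (norm \<xi>)\<^sup>2) powr (- ((DIM('a) + 1) / 2)) * ka (x - z *\<^sub>R \<xi>))" for \<xi>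
 proof -
  have "(norm (z *\<^sub>R \<xi>))\<^sup>2 + z\<^sup>2 = z\<^sup>2 * (1 + (norm \<xi>)\<^sup>2)" by (simp add: power_mult_distrib algebra_simps)
  then have "((norm (z *\<^sub>R \<xi>))\<^sup>2 + z\<^sup>2) powr (- ((m + 1) / 2)) = (z\<^sup>2) powr (- ((m + 1) / 2)) * (1 + (norm \<xi>)\<^sup>2) powr (- ((m + 1) / 2))"
   by (simp only: powr_mult)
  also have "(z\<^sup>2) powr (- ((m + 1) / 2)) = z powr (- (m + 1))"
  proof -
   have "2 * (- ((m + 1) / 2)) = - (m + 1)" by (simp add: field_simps)
   then show ?thesis using powr_powr[of z 2 "- ((m + 1) / 2)"] assms by (simp only: powr_numeral)
  qed
  also have "... = 1 / (z * z ^ DIM('a))"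
   using assms powr_minus_divide[of z "m + 1"] by (simp add: powr_add m_def powr_realpow mult.commute)
  finally show ?thesis using assms by (simp add: grad_newt_def m_def add.commute[of 1])
 qed
 have "(LBINT \<xi>. ?f (0 + z *\<^sub>R \<xi>)) = (LBINT y. ?f y) / \<bar>z\<bar> ^ DIM('a)"
  by (rule lborel_affine_transfer(2)) (use assms in simp)
 moreover have "(LBINT \<xi>. ?f (0 + z *\<^sub>R \<xi>)) = (1 / z ^ DIM('a)) * poisson_op ka x z"
  unfolding eq poisson_op_def by (rule integral_mult_right_zero)
 ultimately show ?thesis using assms by simp
qed

lemma newt_has_derivative:
 fixes y :: "'a::euclidean_space"
 assumes "0 < z"
 shows "((%y. newt z y) has_derivative (%h. (1 - real DIM('a)) * grad_newt (h, 0) z y)) (at y within S)"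
proof -
 have pos: "0 < y \<bullet> y + z\<^sup>2" using assms by (simp add: add_nonneg_pos)
 have e: "(1 - real DIM('a)) / 2 - 1 = - ((real DIM('a) + 1) / 2)" by (simp add: field_simps)
 have "((%y. (y \<bullet> y + z\<^sup>2) powr ((1 - real DIM('a)) / 2)) has_derivative
   (%h. (y \<bullet> h + h \<bullet> y) * ((1 - real DIM('a)) / 2 * (y \<bullet> y + z\<^sup>2) powr ((1 - real DIM('a)) / 2 - 1)))) (at y within S)"
 proof -
  have "((%y. y \<bullet> y + z\<^sup>2) has_derivative (%h. y \<bullet> h + h \<bullet> y)) (at y within S)"
   by (auto intro!: derivative_eq_intros)
  moreover have "((%q. q powr ((1 - real DIM('a)) / 2)) has_derivative (%s. s * ((1 - real DIM('a)) / 2 * (y \<bullet> y + z\<^sup>2) powr ((1 - real DIM('a)) / 2 - 1)))) (at (y \<bullet> y + z\<^sup>2))"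
   using has_real_derivative_powr[OF pos, of "(1 - real DIM('a)) / 2"]
   unfolding has_field_derivative_def by (rule has_derivative_eq_rhs) (auto simp: mult_ac)
  ultimately show ?thesis by (rule has_derivative_compose)
 qed
 then show ?thesis
  unfolding newt_def grad_newt_def power2_norm_eq_inner e
  by (rule has_derivative_eq_rhs) (auto simp: inner_commute field_simps)
qed

text \<open>A tangential derivative is moved to the test function; both sides are the derivative of one convolution.\<close>
lemma grad_newt_conv_tangential:
 fixes ka :: "'a::euclidean_space => real"
 assumes z: "0 < z" and ka: "test_fun ka" and b: "b \<in> Basis" and m: "2 <= DIM('a)"
 shows "(1 - real DIM('a)) * (LBINT y. grad_newt (b, 0) z y * ka (x - y)) = newt_op (partial b ka) x z"
proof -
 let ?m = "real DIM('a)"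
 note [measurable] = test_funD(2)[OF ka]
 have nb: "norm b = 1" "norm (b, 0 :: real) = 1" using b by (auto simp: norm_Pair)
 define L where "L = (?m - 1) * (z\<^sup>2) powr (- (?m / 2))"
 have L0: "0 <= L" using m by (simp add: L_def)
 have gb: "\<bar>(1 - ?m) * grad_newt (h, 0) z y\<bar> <= L * norm h" for h y :: 'a
 proof (cases "h = 0")
  case False
  have "grad_newt (h, 0) z y = norm h * grad_newt (h /\<^sub>R norm h, 0) z y" using False by (simp add: grad_newt_def)
  moreover have "\<bar>grad_newt (h /\<^sub>R norm h, 0) z y\<bar> <= (z\<^sup>2) powr (- (?m / 2))"
   by (rule grad_newt_le(2)[OF z]) (use False in \<open>simp add: norm_Pair\<close>)
  ultimately have "\<bar>grad_newt (h, 0) z y\<bar> <= norm h * (z\<^sup>2) powr (- (?m / 2))" by (simp add: abs_mult mult_left_mono)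
  then have "(?m - 1) * \<bar>grad_newt (h, 0) z y\<bar> <= (?m - 1) * (norm h * (z\<^sup>2) powr (- (?m / 2)))"
   using m by (intro mult_left_mono) auto
  then show ?thesis using m by (simp add: L_def abs_mult mult_ac)
 qed (simp add: grad_newt_def)
 have lip: "\<bar>newt z x - newt z y\<bar> <= L * norm (x - y)" for x y :: 'a
 proof -
  have "norm (newt z x - newt z y) <= L * norm (x - y)"
  proof (rule differentiable_bound[where S = UNIV])
   show "onorm (%h. (1 - ?m) * grad_newt (h, 0) z x) <= L" for x :: 'a
    using gb L0 by (intro onorm_bound) auto
  qed (use newt_has_derivative[OF z] in auto)
  then show ?thesis by simp
 qed
 have nbd: "\<bar>newt z y\<bar> <= (z\<^sup>2) powr ((1 - ?m) / 2)" for y :: 'a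
  unfolding newt_def using m z by (auto intro!: powr_mono2')
 have i1: "integrable lborel (%y. ka y * newt z (x - y))" for x
  by (rule integrable_mult_bounded[OF test_funD(4)[OF ka], where B = "(z\<^sup>2) powr ((1 - ?m) / 2)"]) (use nbd in auto)
 have 1: "((%x. LBINT y. ka y * newt z (x - y)) has_derivative (%h. LBINT y. ka y * ((1 - ?m) * grad_newt (h, 0) z (x - y)))) (at x within UNIV)" for x
 proof (rule has_derivative_integral_dominated[where g = "%y. \<bar>ka y\<bar> * L"])
  show "integrable lborel (%y. ka y * newt z (u - y))" for u by (rule i1)
  show "integrable lborel (%y. \<bar>ka y\<bar> * L)" using test_funD(4)[OF ka] by simp
  fix y
  have "((%x. x - y) has_derivative (%h. h)) (at x within UNIV)" by (auto intro!: derivative_eq_intros)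
  from has_derivative_compose[OF this newt_has_derivative[OF z, where S = UNIV]]
  show "((%u. ka y * newt z (u - y)) has_derivative (%h. ka y * ((1 - ?m) * grad_newt (h, 0) z (x - y)))) (at x within UNIV)"
   by (rule has_derivative_mult_right)
  show "\<bar>ka y * newt z (u - y) - ka y * newt z (x - y)\<bar> <= \<bar>ka y\<bar> * L * norm (u - x)" for u
   using mult_left_mono[OF lip[of "u - y" "x - y"], of "\<bar>ka y\<bar>"] by (simp add: right_diff_distrib[symmetric] abs_mult mult.assoc)
  show "\<bar>ka y * ((1 - ?m) * grad_newt (h, 0) z (x - y))\<bar> <= \<bar>ka y\<bar> * L * norm h" for h
   using mult_left_mono[OF gb[of h "x - y"], of "\<bar>ka y\<bar>"] by (simp only: abs_mult mult.assoc abs_ge_zero)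
 qed auto
 have swap: "(LBINT y. f y * g (x - y)) = (LBINT y. g y * f (x - y))" for f g :: "'a => real" and x
  using lborel_reflect(2)[of "%y. f y * g (x - y)" x] by (simp add: mult.commute)
 have e1: "(%x. LBINT y. ka y * newt z (x - y)) = (%x. newt_op ka x z)"
  unfolding newt_op_def by (rule ext, rule swap)
 obtain \<sigma> :: real where "0 < \<sigma>" "\<sigma> < 1" by (rule that[of "1/2"]) auto
 then obtain C where "ext_by \<sigma> newt_op ka C" using newt_op_ext[OF m] ka unfolding ext_op_def by blast
 then have 2: "((%x. newt_op ka x z) has_derivative (%h. \<Sum>b\<in>Basis. (h \<bullet> b) * newt_op (partial b ka) x z)) (at x)"
  unfolding ext_by_def using z by (auto simp: less_imp_le)
 have "(LBINT y. ka y * ((1 - ?m) * grad_newt (b, 0) z (x - y))) = (\<Sum>c\<in>Basis. (b \<bullet> c) * newt_op (partial c ka) x z)"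
  using has_derivative_unique[OF 1[of x, unfolded e1] 2] by (simp add: fun_eq_iff)
 also have "... = newt_op (partial b ka) x z" using b by (simp add: inner_Basis if_distrib[of "%r. r * _"] cong: if_cong)
 finally have "newt_op (partial b ka) x z = (LBINT y. (1 - ?m) * (ka y * grad_newt (b, 0) z (x - y)))" by (simp add: mult_ac)
 also have "... = (1 - ?m) * (LBINT y. ka y * grad_newt (b, 0) z (x - y))" by (rule integral_mult_right_zero)
 also have "(LBINT y. ka y * grad_newt (b, 0) z (x - y)) = (LBINT y. grad_newt (b, 0) z y * ka (x - y))" by (rule swap)
 finally show ?thesis by simp
qed

section \<open>Interchanging the integrals in the nonlocal part of the Green tensor\<close>

lemma integrable_product:
 fixes f :: "'a::euclidean_space => real" and g :: "'b::euclidean_space => real"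
 assumes f: "integrable lborel f" and g: "integrable lborel g"
 shows "integrable lborel (%y. f (fst y) * g (snd y))"
  and "(LBINT y. f (fst y) * g (snd y)) = (LBINT y. f y) * (LBINT y. g y)"
proof -
 note [measurable] = borel_measurable_integrable[OF f] borel_measurable_integrable[OF g]
 have i: "integrable (lborel \<Otimes>\<^sub>M lborel) (%y. f (fst y) * g (snd y))"
 proof (rule lborel_pair.Fubini_integrable)
  have "(%x. LBINT y. norm (f (fst (x, y)) * g (snd (x, y)))) = (%x. \<bar>f x\<bar> * (LBINT y. \<bar>g y\<bar>))"
   by (simp add: abs_mult)
  then show "integrable lborel (%x. LBINT y. norm (f (fst (x, y)) * g (snd (x, y))))"
   using f by simp
  show "AE x in lborel. integrable lborel (%y. f (fst (x, y)) * g (snd (x, y)))" using g by simp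
 qed measurable
 then show "integrable lborel (%y. f (fst y) * g (snd y))" by (simp only: lborel_prod)
 have "(LBINT x. LBINT y. f (fst (x, y)) * g (snd (x, y))) = (\<integral>y. f (fst y) * g (snd y) \<partial>(lborel \<Otimes>\<^sub>M lborel))"
  by (rule lborel_pair.integral_fst'[OF i])
 then show "(LBINT y. f (fst y) * g (snd y)) = (LBINT y. f y) * (LBINT y. g y)"
  by (simp add: lborel_prod)
qed

lemma convolution_swap:
 fixes f k G :: "'a::euclidean_space => real"
 assumes f: "integrable lborel f" and k: "integrable lborel k"
  and G: "G \<in> borel_measurable borel" "!!v. \<bar>G v\<bar> <= C"
 shows "(LBINT y. f y * (LBINT v. k (x - y - v) * G v)) = (LBINT v. G v * (LBINT y. f y * k (x - v - y)))"
proof -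
 note [measurable] = borel_measurable_integrable[OF f] borel_measurable_integrable[OF k] G(1)
 have ik: "integrable lborel (%v. k (x - y - v))" for y using lborel_reflect(1)[of k "x - y"] k by simp
 have i0: "integrable (lborel \<Otimes>\<^sub>M lborel) (%p. f (fst p) * k (x - fst p - snd p))"
 proof (rule lborel_pair.Fubini_integrable)
  have "(LBINT v. \<bar>k (x - y - v)\<bar>) = (LBINT v. \<bar>k v\<bar>)" for y
   using lborel_reflect(2)[of "%v. \<bar>k v\<bar>" "x - y"] .
  then have "(%y. LBINT v. norm (f (fst (y, v)) * k (x - fst (y, v) - snd (y, v)))) = (%y. \<bar>f y\<bar> * (LBINT v. \<bar>k v\<bar>))"
   by (simp add: abs_mult)
  then show "integrable lborel (%y. LBINT v. norm (f (fst (y, v)) * k (x - fst (y, v) - snd (y, v))))"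
   using f by simp
  show "AE y in lborel. integrable lborel (%v. f (fst (y, v)) * k (x - fst (y, v) - snd (y, v)))" using ik by simp
 qed measurable
 have "integrable (lborel \<Otimes>\<^sub>M lborel) (%p. f (fst p) * k (x - fst p - snd p) * G (snd p))"
  by (rule integrable_mult_bounded[OF i0]) (use G in measurable)
 then have i: "integrable (lborel \<Otimes>\<^sub>M lborel) (case_prod (%y v. f y * k (x - y - v) * G v))"
  by (simp add: case_prod_unfold)
 have "(LBINT y. f y * (LBINT v. k (x - y - v) * G v)) = (LBINT y. (LBINT v. f y * k (x - y - v) * G v))"
  by (simp add: mult.assoc)
 also have "... = (LBINT v. (LBINT y. f y * k (x - y - v) * G v))"
  using lborel_pair.Fubini_integral[OF i] by simp
 also have "... = (LBINT v. G v * (LBINT y. f y * k (x - v - y)))"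
  by (simp add: algebra_simps diff_diff_add)
 finally show ?thesis .
qed

text \<open>The tangential derivative in the Green tensor falls on the Gaussian; it is moved to \<open>ka\<close>, after which the order of the two convolutions is changed.\<close>
lemma gaussian_derivative_conv:
 fixes ka G :: "'a::euclidean_space => real"
 assumes ka: "test_fun ka" and t: "0 < t" and e: "e \<in> Basis"
  and G: "G \<in> borel_measurable borel" "!!v. \<bar>G v\<bar> <= C"
 shows "(LBINT y. ka y * (LBINT v. hkd e t (x - y - v) * G v))
  = (LBINT w. hk w t * (LBINT v. G v * partial e ka (x - w - v)))"
proof -
 have e1: "norm e = 1" using e by simp
 obtain c where c: "!!x. \<bar>ka x\<bar> <= c" using test_funD(5)[OF ka] by blast
 note ih = heat_kernel_integrable[OF t, where 'a = 'a]
 have ibp: "(LBINT y. ka y * hkd e t (u - y)) = (LBINT w. hk w t * partial e ka (u - w))" for u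
 proof -
  have 1: "((%s. LBINT v. hk (u + s *\<^sub>R e - v) t * ka v) has_real_derivative (LBINT v. hkd e t (u - v) * ka v)) (at 0)"
   by (rule gaussian_conv_has_derivative(1)[OF t test_funD(2)[OF ka] c e1])
  have sw: "(LBINT v. hk (z - v) t * ka v) = (LBINT v. hk v t * ka (z - v))" for z
   using lborel_reflect(2)[of "%v. hk v t * ka (z - v)" z] by simp
  have d1: "((%x. LBINT v. hk v t * ka (x - v)) has_derivative (%h. \<Sum>b\<in>Basis. (h \<bullet> b) * (LBINT v. hk v t * partial b ka (x - v)))) (at x)" for x
   by (rule test_fun_conv_has_derivative(1)[OF ka])
    (use ih in \<open>auto intro!: integrable_mult_bounded[where B = 1] borel_measurable_indicator\<close>)
  have d2: "((%s. u + s *\<^sub>R e) has_derivative (%h. h *\<^sub>R e)) (at 0)" by (auto intro!: derivative_eq_intros)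
  have "((%s. LBINT v. hk v t * ka (u + s *\<^sub>R e - v)) has_derivative
    (%h. \<Sum>b\<in>Basis. ((h *\<^sub>R e) \<bullet> b) * (LBINT v. hk v t * partial b ka (u + 0 *\<^sub>R e - v)))) (at 0)"
   by (rule has_derivative_compose[OF d2 d1])
  then have 2: "((%s. LBINT v. hk (u + s *\<^sub>R e - v) t * ka v) has_derivative
    (%h. \<Sum>b\<in>Basis. ((h *\<^sub>R e) \<bullet> b) * (LBINT v. hk v t * partial b ka (u - v)))) (at 0)"
   unfolding sw by simp
  have "(LBINT v. hkd e t (u - v) * ka v) = (\<Sum>b\<in>Basis. ((1 *\<^sub>R e) \<bullet> b) * (LBINT v. hk v t * partial b ka (u - v)))"
   using fun_cong[OF has_derivative_unique[OF 1[unfolded has_field_derivative_def] 2], of 1] by simp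
  also have "... = (LBINT w. hk w t * partial e ka (u - w))"
   using e by (simp add: inner_Basis if_distrib[of "%r. r * _"] cong: if_cong)
  finally show ?thesis by (simp add: mult.commute)
 qed
 have "(LBINT y. ka y * (LBINT v. hkd e t (x - y - v) * G v)) = (LBINT v. G v * (LBINT y. ka y * hkd e t (x - v - y)))"
  by (rule convolution_swap[OF test_funD(4)[OF ka] hkd_integrable[OF t e1] G])
 also have "... = (LBINT v. G v * (LBINT w. hk w t * partial e ka (x - v - w)))" by (simp only: ibp)
 also have "... = (LBINT w. hk w t * (LBINT v. partial e ka (x - w - v) * G v))"
  by (rule convolution_swap[OF ih test_funD(4)[OF test_fun_partial[OF ka e]] G, symmetric])
 finally show ?thesis by (simp add: mult.commute)
qed

lemma integrable_inverse_sqrt: "integrable lborel (%z::real. indicator {0<..<r} z * z powr (- (1/2)))"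
proof (cases "0 <= r")
 case True
 then have "set_integrable lborel {0<..<r} (%z. (r - z) powr (- 0) * z powr (- (1/2)))"
  by (intro Beta_convolution(1)) auto
 then show ?thesis unfolding set_integrable_def
  by (rule Bochner_Integration.integrable_cong[THEN iffD1, rotated -1]) (auto simp: indicator_def)
qed simp

text \<open>Fubini: the normal variable of the force meets only the Gaussian factor, which produces \<open>layer0\<close>, and the tangential one only \<open>B\<close>.\<close>
lemma half_space_layer:
 fixes B :: "'a::euclidean_space => real => real" and x :: 'a and r :: real
 assumes t: "0 < t" and \<phi>: "profile \<beta> \<phi>" and \<beta>: "\<beta> < 1" and ka: "integrable lborel ka"
  and B: "(%p. B (fst p) (snd p)) \<in> borel_measurable borel" "!!u z. 0 < z ==> \<bar>B u z\<bar> <= K * z powr (- (1/2))"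
 defines "G \<equiv> %y::'a \<times> real. LINT z:{0<..<r}|lborel. hk (r + snd y - z) t * B (x - fst y) z"
 shows "integrable lborel (%y. indicator {0<..} (snd y) * (G y * (ka (fst y) * \<phi> (snd y))))"
  and "(LBINT y. indicator {0<..} (snd y) * (G y * (ka (fst y) * \<phi> (snd y))))
   = layer_conv (layer0 \<phi> t) (%z. LBINT y. ka y * B (x - y) z) r"
proof -
 let ?\<phi> = "%y::real. indicator {0<..} y * \<phi> y"
 define H where "H = (%(y::'a \<times> real) z. indicator {0<..<r} z * (hk (r + snd y - z) t * B (x - fst y) z) * (ka (fst y) * ?\<phi> (snd y)))"
 note [measurable] = profile_measurable[OF \<phi>] borel_measurable_integrable[OF ka]
 have mX: "(%p::('a \<times> real) \<times> real. (x - fst (fst p), snd p)) \<in> borel_measurable borel"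
   "(%p::('a \<times> real) \<times> real. r + snd (fst p) - snd p) \<in> borel_measurable borel"
   "(%p::('a \<times> real) \<times> real. fst p) \<in> borel_measurable borel" "(%p::('a \<times> real) \<times> real. snd p) \<in> borel_measurable borel"
  by (intro borel_measurable_continuous_onI continuous_intros)+
 have mB: "(%p::('a \<times> real) \<times> real. B (x - fst (fst p)) (snd p)) \<in> borel_measurable borel"
  using measurable_compose[OF mX(1) B(1)] by simp
 have mBz: "(%u. B u z) \<in> borel_measurable borel" for z
  using measurable_compose[OF _ B(1), of "%u. (u, z)" borel] by simp
 have "(%y. ka (fst y) * ?\<phi> (snd y)) \<in> borel_measurable borel"
  using borel_measurable_integrable[OF integrable_product(1)[OF ka profile_integrable[OF \<phi> \<beta>]]] by simp
 from measurable_compose[OF mX(3) this] have mp: "(%p::('a \<times> real) \<times> real. ka (fst (fst p)) * ?\<phi> (snd (fst p))) \<in> borel_measurable borel" .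
 have mi: "(%p::('a \<times> real) \<times> real. indicator {0<..<r} (snd p) :: real) \<in> borel_measurable borel"
  by (rule measurable_compose[OF mX(4)]) (auto intro!: borel_measurable_indicator)
 have "(%p. H (fst p) (snd p)) \<in> borel_measurable borel"
  unfolding H_def by (intro borel_measurable_times heat_kernel_measurable mX mp mi mB borel_measurable_const)
 then have mH: "(%p. H (fst p) (snd p)) \<in> borel_measurable ((lborel :: ('a \<times> real) measure) \<Otimes>\<^sub>M lborel)"
  by (simp add: lborel_prod)
 have "integrable (lborel \<Otimes>\<^sub>M lborel) (%p. (\<bar>ka (fst (fst p))\<bar> * \<bar>?\<phi> (snd (fst p))\<bar>) * (t powr (- (1/2)) * K * (indicator {0<..<r} (snd p) * (snd p) powr (- (1/2)))))"
 proof -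
  have 1: "integrable lborel (%y. \<bar>ka (fst y)\<bar> * \<bar>?\<phi> (snd y)\<bar>)"
   by (rule integrable_product(1)[of "%y. \<bar>ka y\<bar>" "%y. \<bar>?\<phi> y\<bar>"]) (use ka profile_integrable[OF \<phi> \<beta>] in auto)
  have 2: "integrable lborel (%z. t powr (- (1/2)) * K * (indicator {0<..<r} z * z powr (- (1/2))))"
   using integrable_inverse_sqrt by (rule integrable_mult_right)
  show ?thesis using integrable_product(1)[OF 1 2] by (simp only: lborel_prod)
 qed
 then have iH: "integrable (lborel \<Otimes>\<^sub>M lborel) (%p. H (fst p) (snd p))"
 proof (rule Bochner_Integration.integrable_bound[OF _ mH], intro AE_I2)
  fix p :: "('a \<times> real) \<times> real"
  obtain y z where p: "p = (y, z)" by (cases p)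
  show "norm (H (fst p) (snd p)) <= norm ((\<bar>ka (fst (fst p))\<bar> * \<bar>?\<phi> (snd (fst p))\<bar>) * (t powr (- (1/2)) * K * (indicator {0<..<r} (snd p) * (snd p) powr (- (1/2)))))"
  proof (cases "z \<in> {0<..<r}")
   case True
   have "hk (r + snd y - z) t * \<bar>B (x - fst y) z\<bar> <= t powr (- (1/2)) * (K * z powr (- (1/2)))"
    using True t by (intro mult_mono heat_kernel_real_le B(2)) auto
   then have "hk (r + snd y - z) t * \<bar>B (x - fst y) z\<bar> * (\<bar>ka (fst y)\<bar> * \<bar>?\<phi> (snd y)\<bar>) <= t powr (- (1/2)) * (K * z powr (- (1/2))) * (\<bar>ka (fst y)\<bar> * \<bar>?\<phi> (snd y)\<bar>)"
    by (intro mult_right_mono) auto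
   also have "... <= \<bar>...\<bar>" by (rule abs_ge_self)
   finally show ?thesis unfolding p H_def using True by (simp add: abs_mult mult_ac)
  qed (simp add: p H_def)
 qed
 have eqG: "indicator {0<..} (snd y) * (G y * (ka (fst y) * \<phi> (snd y))) = (LBINT z. H y z)" for y
  by (simp add: G_def H_def set_lebesgue_integral_def mult_ac)
 show "integrable lborel (%y. indicator {0<..} (snd y) * (G y * (ka (fst y) * \<phi> (snd y))))"
  unfolding eqG using lborel_pair.integrable_fst'[OF iH] by simp
 have "(LBINT y. LBINT z. H y z) = (LBINT z. LBINT y. H y z)"
  using lborel_pair.Fubini_integral[of H] iH by (simp add: case_prod_unfold)
 also have "... = layer_conv (layer0 \<phi> t) (%z. LBINT y. ka y * B (x - y) z) r"
  unfolding layer_conv_def set_lebesgue_integral_def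
 proof (rule Bochner_Integration.integral_cong[OF refl])
  fix z :: real
  show "(LBINT y. H y z) = indicator {0<..<r} z *\<^sub>R (layer0 \<phi> t (r - z) * (LBINT y. ka y * B (x - y) z))"
  proof (cases "z \<in> {0<..<r}")
   case True
   have i1: "integrable lborel (%y. ka y * B (x - y) z)"
    by (rule integrable_mult_bounded[OF ka, where B = "K * z powr (- (1/2))"]) (use True B(2) mBz in \<open>auto intro: measurable_compose\<close>)
   have i2: "integrable lborel (%y. ?\<phi> y * hk (y + (r - z)) t)" by (rule layer0_has_derivative(3)[OF \<phi> \<beta> t])
   have "(LBINT y. H y z) = (LBINT y. (ka (fst y) * B (x - fst y) z) * (?\<phi> (snd y) * hk (snd y + (r - z)) t))"
    using True by (intro Bochner_Integration.integral_cong) (auto simp: H_def mult_ac algebra_simps)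
   also have "... = (LBINT y. ka y * B (x - y) z) * layer0 \<phi> t (r - z)"
    unfolding layer0_def by (rule integrable_product(2)[OF i1 i2])
   finally show ?thesis using True by simp
  qed (simp add: H_def)
 qed
 finally show "(LBINT y. indicator {0<..} (snd y) * (G y * (ka (fst y) * \<phi> (snd y))))
   = layer_conv (layer0 \<phi> t) (%z. LBINT y. ka y * B (x - y) z) r" by (simp only: eqG)
qed

section \<open>The auxiliary part of the Green tensor\<close>

definition green_const :: "'a::euclidean_space itself => real"
 where "green_const _ = 1 / ((real DIM('a) + 1) * unit_ball_vol (real DIM('a) + 1))"

lemma green_const_pos: "0 < green_const TYPE('a::euclidean_space)"
 by (simp add: green_const_def)

lemma partial_newton_potential:
 fixes v :: "'a::euclidean_space"
 assumes z: "0 < z" and m: "2 <= DIM('a)"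
 shows "partial i newton_potential (v, z) = green_const TYPE('a) * grad_newt i z v"
proof -
 define m where "m = real DIM('a)"
 have m2: "2 <= m" using m by (simp add: m_def)
 define c where "c = 1 / ((m + 1) * (m - 1) * unit_ball_vol (m + 1))"
 have N: "newton_potential w = - c * (w \<bullet> w) powr ((1 - m) / 2)" for w :: "'a \<times> real"
 proof (cases "w = 0")
  case False
  have "2 * ((1 - m) / 2) = 1 - m" by simp
  then have "norm w powr (1 - m) = ((norm w)\<^sup>2) powr ((1 - m) / 2)"
   using powr_powr[of "norm w" 2 "(1 - m) / 2"] False by (simp only: powr_numeral norm_ge_zero zero_less_norm_iff)
  then show ?thesis by (simp add: newton_potential_def c_def m_def power2_norm_eq_inner[symmetric] add.commute)
 qed (simp add: newton_potential_def)
 let ?w = "(v, z)"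
 have pos: "0 < ?w \<bullet> ?w" using z by (simp add: add_nonneg_pos)
 have q: "?w \<bullet> ?w = (norm v)\<^sup>2 + z\<^sup>2" by (simp add: inner_Pair dot_square_norm[of v] power2_eq_square[of z])
 have "((%w. w \<bullet> w) has_derivative (%h. ?w \<bullet> h + h \<bullet> ?w)) (at ?w)" by (auto intro!: derivative_eq_intros)
 moreover have "((%q. q powr ((1 - m) / 2)) has_derivative (%s. (1 - m) / 2 * (?w \<bullet> ?w) powr ((1 - m) / 2 - 1) * s)) (at (?w \<bullet> ?w))"
  using has_real_derivative_powr[OF pos, of "(1 - m) / 2"] by (simp only: has_field_derivative_def)
 ultimately have "((%w. (w \<bullet> w) powr ((1 - m) / 2)) has_derivative (%h. (1 - m) / 2 * (?w \<bullet> ?w) powr ((1 - m) / 2 - 1) * (?w \<bullet> h + h \<bullet> ?w))) (at ?w)"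
  by (rule has_derivative_compose)
 then have der: "(newton_potential has_derivative (%h. - c * ((1 - m) / 2 * (?w \<bullet> ?w) powr ((1 - m) / 2 - 1) * (?w \<bullet> h + h \<bullet> ?w)))) (at ?w)"
  unfolding N by (rule has_derivative_mult_right)
 have alg: "- c * ((1 - m) / 2 * P * (2 * Q)) = (c * (m - 1)) * (Q * P)" for P Q by (simp add: field_simps)
 from partial_eq[OF der, of i]
 have "partial i newton_potential ?w = - c * ((1 - m) / 2 * ((norm v)\<^sup>2 + z\<^sup>2) powr ((1 - m) / 2 - 1) * (?w \<bullet> i + i \<bullet> ?w))" by (simp only: q)
 also have "(1 - m) / 2 - 1 = - ((m + 1) / 2)" by (simp add: field_simps)
 also have "?w \<bullet> i + i \<bullet> ?w = 2 * (v \<bullet> fst i + z * snd i)" by (simp add: inner_prod_def inner_commute)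
 also have "- c * ((1 - m) / 2 * ((norm v)\<^sup>2 + z\<^sup>2) powr (- ((m + 1) / 2)) * (2 * (v \<bullet> fst i + z * snd i))) = (c * (m - 1)) * grad_newt i z v"
  using alg[of "((norm v)\<^sup>2 + z\<^sup>2) powr (- ((m + 1) / 2))" "v \<bullet> fst i + z * snd i"] by (simp only: grad_newt_def m_def)
 also have "c * (m - 1) = green_const TYPE('a)" using m2 by (simp add: c_def green_const_def m_def)
 finally show ?thesis .
qed

lemma green_aux_eq:
 assumes t: "0 < t" and m: "2 <= CARD('m::finite)"
 shows "green_aux i y t (x :: real ^ 'm, r) = green_const TYPE(real ^ 'm) *
  (LINT z:{0<..<r}|lborel. hk (r + snd y - z) t * (LBINT v. hk (x - fst y - v) t * grad_newt i z v))"
proof -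
 have "(LINT v|lborel. hk ((x, r) - reflect y - (v, z)) t * partial i newton_potential (v, z))
  = green_const TYPE(real ^ 'm) * (hk (r + snd y - z) t * (LBINT v. hk (x - fst y - v) t * grad_newt i z v))"
  if "z \<in> {0<..<r}" for z
 proof -
  have "(x, r) - reflect y - (v, z) = (x - fst y - v, r + snd y - z)" for v by (simp add: reflect_def)
  then have "(LINT v|lborel. hk ((x, r) - reflect y - (v, z)) t * partial i newton_potential (v, z))
   = (LBINT v. (green_const TYPE(real ^ 'm) * hk (r + snd y - z) t) * (hk (x - fst y - v) t * grad_newt i z v))"
   using that t m by (simp add: heat_kernel_Pair partial_newton_potential mult_ac)
  then show ?thesis by simp
 qed
 then have "green_aux i y t (x, r) = (LINT z:{0<..<r}|lborel. green_const TYPE(real ^ 'm) * (hk (r + snd y - z) t * (LBINT v. hk (x - fst y - v) t * grad_newt i z v)))"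
  unfolding green_aux_def snd_conv by (intro set_lebesgue_integral_cong) auto
 then show ?thesis by simp
qed

text \<open>The derivative passes under the integral over the height because of the integrable bound \<open>z powr (- (1/2))\<close>.\<close>
lemma green_aux_partial:
 assumes t: "0 < t" and m: "2 <= CARD('m::finite)" and i: "norm i = 1" and e: "norm e = 1"
 shows "partial (e, 0) (green_aux i y t) (x :: real ^ 'm, r) = green_const TYPE(real ^ 'm) *
  (LINT z:{0<..<r}|lborel. hk (r + snd y - z) t * (LBINT v. hkd e t (x - fst y - v) * grad_newt i z v))"
proof -
 let ?h = "%z. indicator {0<..<r} z * hk (r + snd y - z) t :: real"
 define A where "A = (%(u::real^'m) z. LBINT v. hk (u - v) t * grad_newt i z v)"
 define B where "B = (%(u::real^'m) z. LBINT v. hkd e t (u - v) * grad_newt i z v)"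
 define u where "u = x - fst y"
 obtain K1 where K1: "0 <= K1" "!!z u. 0 < z ==> \<bar>A u z\<bar> <= K1 * z powr (- (1/2))"
  unfolding A_def by (rule grad_newt_conv_bound[OF heat_kernel_integrable[where 'a = "real^'m", OF t] order_trans[OF eq_refl[OF abs_of_nonneg[OF heat_kernel_nonneg]] heat_kernel_le[OF t]]])
   (use i in blast)
 have "\<exists>c. \<forall>v::real^'m. \<bar>hkd e t v\<bar> <= c"
 proof (intro exI allI)
  fix v :: "real^'m"
  show "\<bar>hkd e t v\<bar> <= gauss_const TYPE(real^'m) * t powr (- (1/2)) * (4 * pi * (2 * t)) powr (- real DIM(real^'m) / 2)"
   by (rule order_trans[OF hkd_bound[OF t e]], rule mult_left_mono[OF heat_kernel_le])
    (use t gauss_const_pos[where 'a = "real^'m"] in auto)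
 qed
 then obtain c where c: "!!v::real^'m. \<bar>hkd e t v\<bar> <= c" by blast
 obtain K2 where K2: "0 <= K2" "!!z u. 0 < z ==> \<bar>B u z\<bar> <= K2 * z powr (- (1/2))"
  unfolding B_def by (rule grad_newt_conv_bound[OF hkd_integrable[OF t e] c]) (use i in blast)
 have [measurable]: "A u \<in> borel_measurable borel" "B u \<in> borel_measurable borel" for u
  unfolding A_def B_def by measurable
 have der: "((%s. A (u + s *\<^sub>R e) z) has_real_derivative B (u + s *\<^sub>R e) z) (at s)" if z: "0 < z" for s z
 proof -
  have "((%s'. A ((u + s *\<^sub>R e) + s' *\<^sub>R e) z) has_real_derivative B (u + s *\<^sub>R e) z) (at 0)"
   unfolding A_def B_def by (rule gaussian_conv_has_derivative(1)[OF t _ grad_newt_le(2)[OF z i] e]) simp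
  moreover have "(u + s *\<^sub>R e) + s' *\<^sub>R e = u + (s' + s) *\<^sub>R e" for s' by (simp add: algebra_simps)
  ultimately show ?thesis using DERIV_shift[of "%s. A (u + s *\<^sub>R e) z" _ 0 s] by simp
 qed
 have lip: "\<bar>A (u + s *\<^sub>R e) z - A u z\<bar> <= K2 * z powr (- (1/2)) * \<bar>s\<bar>" if z: "0 < z" for s z
 proof -
  have "norm (A (u + s *\<^sub>R e) z - A (u + 0 *\<^sub>R e) z) <= K2 * z powr (- (1/2)) * norm (s - 0)"
   by (rule field_differentiable_bound[where S = UNIV and f = "%s. A (u + s *\<^sub>R e) z" and f' = "%s. B (u + s *\<^sub>R e) z"])
    (use der[OF z] K2(2)[OF z] in auto)
  then show ?thesis by simp
 qed
 have h: "0 <= ?h z" "?h z <= indicator {0<..<r} z * t powr (- (1/2))" for z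
  using heat_kernel_real_le[OF t, of "r + snd y - z"] by (auto simp: indicator_def)
 define g where "g = (%z. (t powr (- (1/2)) * (K1 + K2)) * (indicator {0<..<r} z * z powr (- (1/2))))"
 have g: "integrable lborel g" unfolding g_def using integrable_inverse_sqrt by (rule integrable_mult_right)
 have hb: "\<bar>?h z * a\<bar> <= g z * s" if "0 < z ==> \<bar>a\<bar> <= Q * z powr (- (1/2)) * s" "Q <= K1 + K2" "0 <= s" for z a Q s
 proof (cases "z \<in> {0<..<r}")
  case True
  have "\<bar>a\<bar> <= (K1 + K2) * z powr (- (1/2)) * s"
  proof (rule order_trans[OF that(1)])
   show "Q * z powr (- (1/2)) * s <= (K1 + K2) * z powr (- (1/2)) * s" using that by (intro mult_right_mono) auto
  qed (use True in simp)
  then have "?h z * \<bar>a\<bar> <= t powr (- (1/2)) * ((K1 + K2) * z powr (- (1/2)) * s)"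
   using h[of z] True by (intro mult_mono) auto
  then show ?thesis using h(1)[of z] True by (simp add: g_def abs_mult mult_ac)
 qed (simp add: g_def)
 have "((%s. LBINT z. ?h z * A (u + s *\<^sub>R e) z) has_derivative (%s. LBINT z. ?h z * B u z * s)) (at 0 within UNIV)"
 proof (rule has_derivative_integral_dominated[OF _ _ _ _ _ _ g])
  show "integrable lborel (%z. ?h z * A (u + s *\<^sub>R e) z)" for s
  proof (rule Bochner_Integration.integrable_bound[OF g], measurable, rule AE_I2)
   fix z show "norm (?h z * A (u + s *\<^sub>R e) z) <= norm (g z)"
    using hb[where Q = K1 and s = 1, OF _ _ zero_le_one, of z "A (u + s *\<^sub>R e) z"] K1(2)[of z] K2(1) by auto
  qed
  fix z
  show "((%s. ?h z * A (u + s *\<^sub>R e) z) has_derivative (%s. ?h z * B u z * s)) (at 0 within UNIV)"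
  proof (cases "0 < z")
   case True
   from DERIV_cmult[OF der[OF this, of 0], of "?h z"] show ?thesis by (simp add: has_field_derivative_def)
  qed simp
  show "\<bar>?h z * A (u + s *\<^sub>R e) z - ?h z * A (u + 0 *\<^sub>R e) z\<bar> <= g z * norm (s - 0)" for s
   using hb[where Q = K2 and s = "\<bar>s\<bar>", of z "A (u + s *\<^sub>R e) z - A u z"] lip[of z s] K1(1) by (simp add: right_diff_distrib)
  show "\<bar>?h z * B u z * s\<bar> <= g z * norm s" for s
  proof -
   have "\<bar>B u z * s\<bar> <= K2 * z powr (- (1/2)) * \<bar>s\<bar>" if "0 < z"
    using mult_right_mono[OF K2(2)[OF that], of "\<bar>s\<bar>" u] by (simp add: abs_mult)
   from hb[OF this] show ?thesis using K1(1) by (simp add: mult.assoc)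
  qed
 qed auto
 moreover have "green_aux i y t ((x, r) + s *\<^sub>R (e, 0)) = green_const TYPE(real ^ 'm) * (LBINT z. ?h z * A (u + s *\<^sub>R e) z)" for s
  using green_aux_eq[OF t m, of i y "x + s *\<^sub>R e" r]
  by (simp add: A_def u_def set_lebesgue_integral_def algebra_simps)
 ultimately have "((%s. green_aux i y t ((x, r) + s *\<^sub>R (e, 0))) has_derivative (%s. green_const TYPE(real ^ 'm) * (LBINT z. ?h z * B u z * s))) (at 0)"
  using has_derivative_mult_right by simp
 then have "((%s. green_aux i y t ((x, r) + s *\<^sub>R (e, 0))) has_real_derivative green_const TYPE(real ^ 'm) * (LBINT z. ?h z * B u z)) (at 0)"
  by (simp only: has_field_derivative_def integral_mult_left_zero mult.assoc[of "green_const _", symmetric])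
 then have "partial (e, 0) (green_aux i y t) (x, r) = green_const TYPE(real ^ 'm) * (LBINT z. ?h z * B u z)"
  unfolding partial_def by (rule DERIV_imp_deriv)
 then show ?thesis by (simp add: B_def u_def set_lebesgue_integral_def mult.assoc)
qed

section \<open>The data\<close>

text \<open>Near 0 the derivative is explicit; on the remaining compact interval both functions are bounded by continuity.\<close>
lemma normal_profileD:
 assumes gN: "normal_profile \<beta> gN" and \<beta>: "0 < \<beta>" "\<beta> < 1"
 shows "!!y. 0 < y ==> (gN has_real_derivative deriv gN y) (at y)"
  and "!!y. 0 < y ==> y < 1 ==> deriv gN y = (1 - \<beta>) * y powr (- \<beta>)"
  and "profile \<beta> (deriv gN)" and "profile 0 gN"
proof -
 have sm: "smooth_on {0<..} gN" using gN by (simp add: normal_profile_def)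
 show der: "(gN has_real_derivative deriv gN y) (at y)" if "0 < y" for y
 proof -
  have "(gN has_derivative (%h. h * partial 1 gN y)) (at y)"
   using smooth_on_has_derivative[OF sm, of y] that by simp
  then have "(gN has_real_derivative partial 1 gN y) (at y)"
   unfolding has_field_derivative_def by (rule has_derivative_eq_rhs) (auto simp: mult.commute)
  with DERIV_imp_deriv[OF this] show ?thesis by simp
 qed
 have dp: "deriv gN y = partial 1 gN y" if "0 < y" for y
  using partial_eq[OF der[OF that, unfolded has_field_derivative_def], of 1] by simp
 show small: "deriv gN y = (1 - \<beta>) * y powr (- \<beta>)" if "0 < y" "y < 1" for y
 proof -
  have "((%r. r powr (1 - \<beta>)) has_real_derivative (1 - \<beta>) * y powr (1 - \<beta> - 1)) (at y)"
   by (rule has_real_derivative_powr[OF that(1)])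
  then have "(gN has_real_derivative (1 - \<beta>) * y powr (1 - \<beta> - 1)) (at y)"
   by (rule DERIV_cong_ev[THEN iffD1, OF refl _ refl, rotated])
    (rule eventually_nhds_in_open[of "{0<..<1}" y, THEN eventually_mono]; use that gN in \<open>auto simp: normal_profile_def\<close>)
  with DERIV_imp_deriv[OF this] show ?thesis by simp
 qed
 have zero: "gN y = 0 \<and> deriv gN y = 0" if "2 <= y" for y
 proof -
  let ?C = "closure {r. 0 < r \<and> gN r ~= 0}"
  have "y \<in> - ?C \<inter> {0<..}" using that gN by (auto simp: normal_profile_def)
  moreover have "open (- ?C \<inter> {0<..})" by (intro open_Int open_Compl) auto
  moreover have "gN z = 0" if "z \<in> - ?C \<inter> {0<..}" for z
   using that closure_subset[of "{r. 0 < r \<and> gN r ~= 0}"] by auto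
  ultimately have ev: "eventually (%z. gN z = 0) (nhds y)" unfolding eventually_nhds by blast
  then have "(gN has_real_derivative 0) (at y)"
   using DERIV_cong_ev[OF refl ev refl, of 0] by simp
  with DERIV_imp_deriv[OF this] show ?thesis using eventually_nhds_x_imp_x[OF ev] by simp
 qed
 have cont: "continuous_on {0<..} gN" "continuous_on {0<..} (deriv gN)"
  using smooth_on_continuous[OF sm] continuous_on_eq[OF smooth_on_continuous[OF smooth_on_partial[OF _ sm, of 1]], of "deriv gN"] dp
  by auto
 have bd: "\<exists>A\<ge>0. \<forall>y\<in>{1/2..2}. \<bar>f y\<bar> <= A" if "continuous_on {0<..} f" for f :: "real => real"
 proof -
  have "compact (f ` {1/2..2})" by (intro compact_continuous_image continuous_on_subset[OF that]) auto
  then obtain A where "\<forall>y\<in>{1/2..2}. \<bar>f y\<bar> <= A" by (auto dest!: compact_imp_bounded simp: bounded_iff)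
  then show ?thesis by (intro exI[of _ "max A 0"]) (auto simp: le_max_iff_disj)
 qed
 have prof: "profile b f" if b: "0 <= b" and c: "continuous_on {0<..} f" and s: "!!y. 0 < y ==> y < 1 ==> \<bar>f y\<bar> <= y powr (- b)"
  and z: "!!y. 2 <= y ==> f y = 0" for b f
 proof -
  obtain A where A: "0 <= A" "!!y. y \<in> {1/2..2} ==> \<bar>f y\<bar> <= A" using bd[OF c] by blast
  have "\<bar>f y\<bar> <= (1 + A * 2 powr b) * y powr (- b)" if y: "0 < y" for y
  proof -
   consider "y < 1" | "1 <= y" "y <= 2" | "2 <= y" by linarith
   then show ?thesis
   proof cases
    case 1
    have "1 * y powr (- b) <= (1 + A * 2 powr b) * y powr (- b)" using A by (intro mult_right_mono) auto
    then show ?thesis using s[OF y 1] by linarith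
   next
    case 2
    have "1 = 2 powr b * 2 powr (- b)" by (simp add: powr_add[symmetric])
    also have "... <= 2 powr b * y powr (- b)" using 2 b by (intro mult_left_mono powr_mono2') auto
    finally have "A * 1 <= A * (2 powr b * y powr (- b))" using A by (intro mult_left_mono) auto
    also have "... <= (1 + A * 2 powr b) * y powr (- b)" by (simp add: algebra_simps)
    finally show ?thesis using A(2)[of y] 2 by simp
   next
    case 3
    then show ?thesis using z A by simp
   qed
  qed
  then show ?thesis unfolding profile_def using c z by auto
 qed
 show "profile \<beta> (deriv gN)"
 proof (rule prof)
  show "\<bar>deriv gN y\<bar> <= y powr (- \<beta>)" if "0 < y" "y < 1" for y
   using small[OF that] \<beta> by (simp add: abs_mult mult_left_le_one_le)
 qed (use cont zero \<beta> in auto)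
 show "profile 0 gN"
 proof (rule prof)
  show "\<bar>gN y\<bar> <= y powr (- 0)" if "0 < y" "y < 1" for y
   using that gN \<beta> by (simp add: normal_profile_def powr_le1)
 qed (use cont zero in auto)
qed

lemma tangential_cutoff_test_fun: "tangential_cutoff gT ==> test_fun gT"
 by (simp add: tangential_cutoff_def test_fun_def)

lemma grad_newt_ext:
 fixes i :: "'a::euclidean_space \<times> real"
 assumes i: "i \<in> Basis" and ka: "test_fun ka" and m: "2 <= DIM('a)" and \<sigma>: "0 < \<sigma>" "\<sigma> < 1"
 obtains V ka' c where "ext_op \<sigma> V" "test_fun ka'"
  "!!x z. 0 < z ==> (LBINT y. grad_newt i z y * ka (x - y)) = c * V ka' x z"
proof (cases "i = (0, 1)")
 case True
 then show ?thesis using that[OF poisson_op_ext[OF \<sigma>] ka, where c = 1] grad_newt_conv_normal[where ka = ka] by simp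
next
 case False
 then obtain b where b: "b \<in> Basis" "i = (b, 0)" using i by (auto simp: Basis_prod_def)
 then show ?thesis
  using that[OF newt_op_ext[OF m \<sigma>] test_fun_partial[OF ka b(1)], where c = "1 / (1 - real DIM('a))"]
   grad_newt_conv_tangential[OF _ ka b(1) m] m by (simp add: field_simps)
qed

section \<open>Representation of the solution\<close>

definition dirichlet :: "('m::finite space => real) => 'm space => real => real"
 where "dirichlet F x t' = (LBINT y. F y * (hk (x - y) t' - hk (x - reflect y) t'))"

definition half_prod :: "('a => real) => (real => real) => 'a \<times> real => real"
 where "half_prod ka \<phi> y = ka (fst y) * (indicator {0<..} (snd y) * \<phi> (snd y))"

text \<open>The response in component \<open>i\<close> to the spatial force, after the delay \<open>t'\<close>: the two Dirichlet terms of the Green tensor and its nonlocal term.\<close>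
definition theta :: "real => 'm::finite => (real ^ 'm => real) => (real => real) => 'm space => 'm space => real => real"
 where "theta a k gT gN i x t' =
  of_bool (i = e_tangent k) * a * dirichlet (half_prod gT (deriv gN)) x t'
  - of_bool (i = e_normal) * a * dirichlet (half_prod (partial (axis k 1) gT) gN) x t'
  - 4 * a * green_const TYPE(real ^ 'm) *
   nonlocal (deriv gN) (%x z t'. LBINT w. hk w t' * (LBINT v. grad_newt i z v * partial (axis k 1) gT (x - w - v))) x t'"

lemma reflect_measurable: "(%y::'m::finite space. x - reflect y) \<in> borel_measurable borel"
 unfolding reflect_def by (intro borel_measurable_continuous_onI continuous_intros)

lemma half_prod_integrable:
 fixes ka :: "'a::euclidean_space => real"
 assumes "integrable lborel ka" "profile b \<phi>" "b < 1"
 shows "integrable lborel (half_prod ka \<phi>)"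
 unfolding half_prod_def by (rule integrable_product(1)[OF assms(1) profile_integrable[OF assms(2,3)]])

lemma dirichlet_integrable:
 assumes F: "integrable lborel F" and t': "0 < t'"
 shows "integrable lborel (%y. F y * (hk (x - y) t' - hk (x - reflect y) t'))"
proof (rule integrable_mult_bounded[OF F])
 show "(%y. hk (x - y) t' - hk (x - reflect y) t') \<in> borel_measurable lborel"
  using reflect_measurable[of x] by simp
 show "\<bar>hk (x - y) t' - hk (x - reflect y) t'\<bar> <= (4 * pi * t') powr (- real DIM('a space) / 2)" for y
  using heat_kernel_le[OF t', of "x - y"] heat_kernel_le[OF t', of "x - reflect y"]
   heat_kernel_nonneg[of "x - y" t'] heat_kernel_nonneg[of "x - reflect y" t'] by linarith
qed

lemma e_Basis: "(e_normal :: 'm::finite space) \<in> Basis" "(e_tangent k :: 'm space) \<in> Basis" "e_tangent k ~= (e_normal :: 'm space)"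
 by (auto simp: e_normal_def e_tangent_def Basis_prod_def axis_in_Basis_iff)

lemma theta_eq:
 fixes gT :: "real ^ 'm::finite => real"
 assumes m: "2 <= CARD('m)" and \<beta>: "0 < \<beta>" "\<beta> < 1" and gT: "test_fun gT" and gN: "normal_profile \<beta> gN"
  and i: "i \<in> Basis" and t': "0 < t'"
 shows "(LINT y:half_space|lborel. \<Sum>j\<in>Basis. green_tensor i j x y t' * (stokes_force a \<alpha> k gT gN y s \<bullet> j))
  = time_profile \<alpha> s * theta a k gT gN i x t'"
proof -
 let ?e = "axis k 1 :: real ^ 'm" and ?h = "time_profile \<alpha> s" and ?c = "green_const TYPE(real ^ 'm)"
 have e: "?e \<in> Basis" by (simp add: axis_in_Basis_iff)
 note N = normal_profileD[OF gN \<beta>]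
 have gd: "partial e_normal (%x. gT (fst x) * gN (snd x)) y = gT (fst y) * deriv gN (snd y)"
   "partial (e_tangent k) (%x. gT (fst x) * gN (snd x)) y = partial ?e gT (fst y) * gN (snd y)" if "0 < snd y" for y
 proof -
  have "((%s. gN (snd y + s)) has_real_derivative deriv gN (snd y)) (at 0)"
   using N(1)[OF that] DERIV_shift[of gN _ 0 "snd y"] by (simp add: add.commute)
  from DERIV_cmult[OF this, of "gT (fst y)"]
  show "partial e_normal (%x. gT (fst x) * gN (snd x)) y = gT (fst y) * deriv gN (snd y)"
   unfolding partial_def e_normal_def by (intro DERIV_imp_deriv) simp
  have d2: "((%s. fst y + s *\<^sub>R ?e) has_derivative (%h. h *\<^sub>R ?e)) (at 0)" by (auto intro!: derivative_eq_intros)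
  have "(gT has_derivative (%h. \<Sum>b\<in>Basis. (h \<bullet> b) * partial b gT (fst y))) (at (fst y + 0 *\<^sub>R ?e))"
   using test_funD(6)[OF gT, of "fst y"] by simp
  from has_derivative_compose[OF d2 this]
  have "((%s. gT (fst y + s *\<^sub>R ?e)) has_real_derivative partial ?e gT (fst y)) (at 0)"
   unfolding has_field_derivative_def
   by (rule has_derivative_eq_rhs) (use e in \<open>auto simp: fun_eq_iff inner_Basis if_distrib[of "%r. _ * r"] if_distrib[of "%r. r * _"] cong: if_cong\<close>)
  from DERIV_cmult_right[OF this, of "gN (snd y)"]
  show "partial (e_tangent k) (%x. gT (fst x) * gN (snd x)) y = partial ?e gT (fst y) * gN (snd y)"
   unfolding partial_def e_tangent_def by (intro DERIV_imp_deriv) simp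
 qed
 define D where "D = (%y. hk (x - y) t' - hk (x - reflect y) t')"
 define B where "B = (%(u::real^'m) z. LBINT v. hkd ?e t' (u - v) * grad_newt i z v)"
 define G where "G = (%y::'m space. LINT z:{0<..<snd x}|lborel. hk (snd x + snd y - z) t' * B (fst x - fst y) z)"
 have i1: "norm i = 1" and e1: "norm ?e = 1" using i e by auto
 have pg: "partial (e_tangent k) (green_aux i y t') x = ?c * G y" for y
  using green_aux_partial[OF t' m i1 e1, of y "fst x" "snd x"] by (simp add: G_def B_def e_tangent_def)
 have inner: "indicator half_space y *\<^sub>R (\<Sum>j\<in>Basis. green_tensor i j x y t' * (stokes_force a \<alpha> k gT gN y s \<bullet> j))
  = ?h * (of_bool (i = e_tangent k) * a * (half_prod gT (deriv gN) y * D y) - of_bool (i = e_normal) * a * (half_prod (partial ?e gT) gN y * D y)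
    - 4 * a * ?c * (indicator {0<..} (snd y) * (G y * (gT (fst y) * deriv gN (snd y)))))" for y
 proof (cases "0 < snd y")
  case True
  define P Q where "P = a * (gT (fst y) * deriv gN (snd y)) * ?h" and "Q = a * (partial ?e gT (fst y) * gN (snd y)) * ?h"
  have f: "stokes_force a \<alpha> k gT gN y s = P *\<^sub>R e_tangent k - Q *\<^sub>R e_normal"
   using gd[OF True] by (simp add: stokes_force_def P_def Q_def)
  have "(\<Sum>j\<in>Basis. green_tensor i j x y t' * (stokes_force a \<alpha> k gT gN y s \<bullet> j))
   = (\<Sum>j\<in>Basis. (if j = e_tangent k then P * green_tensor i j x y t' else 0) - (if j = e_normal then Q * green_tensor i j x y t' else 0))"
  proof (intro sum.cong refl)
   fix j :: "'m space" assume j: "j \<in> Basis"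
   have "e_tangent k \<bullet> j = of_bool (j = e_tangent k)" "e_normal \<bullet> j = of_bool (j = e_normal)"
    by (subst inner_Basis; use j e_Basis in auto)+
   then show "green_tensor i j x y t' * (stokes_force a \<alpha> k gT gN y s \<bullet> j)
    = (if j = e_tangent k then P * green_tensor i j x y t' else 0) - (if j = e_normal then Q * green_tensor i j x y t' else 0)"
    unfolding f by (simp add: inner_diff_left algebra_simps)
  qed
  also have "... = P * green_tensor i (e_tangent k) x y t' - Q * green_tensor i e_normal x y t'"
   unfolding sum_subtractf by (simp add: e_Basis)
  also have "... = P * (of_bool (i = e_tangent k) * D y - 4 * (?c * G y)) - Q * (of_bool (i = e_normal) * D y)"
   using e_Basis(3)[of k] pg by (simp add: green_tensor_def D_def)
  finally show ?thesis using True by (simp add: half_space_def half_prod_def P_def Q_def algebra_simps)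
 qed (simp add: half_space_def half_prod_def)
 have mB: "(%p. B (fst p) (snd p)) \<in> borel_measurable borel"
 proof -
  have "(%p. B (fst p) (snd p)) \<in> borel_measurable (borel \<Otimes>\<^sub>M borel)" unfolding B_def by measurable
  then show ?thesis by (simp only: borel_prod)
 qed
 have "\<exists>c. \<forall>v::real^'m. \<bar>hkd ?e t' v\<bar> <= c"
 proof (intro exI allI)
  fix v :: "real^'m"
  show "\<bar>hkd ?e t' v\<bar> <= gauss_const TYPE(real^'m) * t' powr (- (1/2)) * (4 * pi * (2 * t')) powr (- real DIM(real^'m) / 2)"
   by (rule order_trans[OF hkd_bound[OF t' e1]], rule mult_left_mono[OF heat_kernel_le])
    (use t' gauss_const_pos[where 'a = "real^'m"] in auto)
 qed
 then obtain c where c: "!!v::real^'m. \<bar>hkd ?e t' v\<bar> <= c" by blast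
 obtain K where K: "0 <= K" "!!z u. 0 < z ==> \<bar>B u z\<bar> <= K * z powr (- (1/2))"
  unfolding B_def by (rule grad_newt_conv_bound[OF hkd_integrable[OF t' e1] c]) (use i1 in blast)
 note L = half_space_layer[where B = B and x = "fst x" and r = "snd x", OF t' N(3) \<beta>(2) test_funD(4)[OF gT] mB K(2)]
 have W: "(LBINT y. gT y * B (fst x - y) z) = (LBINT w. hk w t' * (LBINT v. grad_newt i z v * partial ?e gT (fst x - w - v)))"
  if z: "0 < z" for z
  unfolding B_def by (rule gaussian_derivative_conv[OF gT t' e _ grad_newt_le(2)[OF z i1]]) simp
 have nl: "(LBINT y. indicator {0<..} (snd y) * (G y * (gT (fst y) * deriv gN (snd y))))
   = nonlocal (deriv gN) (%x z t'. LBINT w. hk w t' * (LBINT v. grad_newt i z v * partial ?e gT (x - w - v))) x t'"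
 proof -
  have "(LBINT y. indicator {0<..} (snd y) * (G y * (gT (fst y) * deriv gN (snd y))))
   = layer_conv (layer0 (deriv gN) t') (%z. LBINT y. gT y * B (fst x - y) z) (snd x)"
   unfolding G_def by (rule L(2))
  then show ?thesis unfolding nonlocal_def layer_conv_def by (rule trans) (intro set_lebesgue_integral_cong; use W in auto)
 qed
 have I3: "integrable lborel (%y. indicator {0<..} (snd y) * (G y * (gT (fst y) * deriv gN (snd y))))"
  unfolding G_def by (rule L(1))
 have I1: "integrable lborel (%y. half_prod gT (deriv gN) y * D y)"
  unfolding D_def by (intro dirichlet_integrable half_prod_integrable[OF test_funD(4)[OF gT] N(3) \<beta>(2)] t')
 have I2: "integrable lborel (%y. half_prod (partial ?e gT) gN y * D y)"
  unfolding D_def by (intro dirichlet_integrable half_prod_integrable[OF test_funD(4)[OF test_fun_partial[OF gT e]] N(4)] t') simp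
 have dd: "dirichlet F x t' = (LBINT y. F y * D y)" for F by (simp add: dirichlet_def D_def)
 show ?thesis
  unfolding set_lebesgue_integral_def inner theta_def dd nl[symmetric]
  using I1 I2 I3 by simp
qed

text \<open>The substitution of the delay for the time at which the force acts.\<close>
theorem stokes_solution_eq:
 fixes gT :: "real ^ 'm::finite => real"
 assumes m: "2 <= CARD('m)" and \<beta>: "0 < \<beta>" "\<beta> < 1" and gT: "test_fun gT" and gN: "normal_profile \<beta> gN"
 shows "stokes_solution (stokes_force a \<alpha> k gT gN) x t = (\<Sum>i\<in>Basis. time_conv \<alpha> (theta a k gT gN i x) (t - 1/2) *\<^sub>R i)"
 unfolding stokes_solution_def
proof (intro sum.cong refl arg_cong2[where f = "(*\<^sub>R)"])
 fix i :: "'m space" assume i: "i \<in> Basis"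
 let ?\<theta> = "theta a k gT gN i x"
 have "(LINT s:{0<..<t}|lborel. LINT y:half_space|lborel. \<Sum>j\<in>Basis. green_tensor i j x y (t - s) * (stokes_force a \<alpha> k gT gN y s \<bullet> j))
  = (LINT s:{0<..<t}|lborel. time_profile \<alpha> s * ?\<theta> (t - s))"
  using theta_eq[OF m \<beta> gT gN i] by (intro set_lebesgue_integral_cong) auto
 also have "... = (LBINT t'. indicator {0<..<t} (t - t') *\<^sub>R (time_profile \<alpha> (t - t') * ?\<theta> (t - (t - t'))))"
  unfolding set_lebesgue_integral_def by (rule lborel_reflect(2)[symmetric])
 also have "... = time_conv \<alpha> ?\<theta> (t - 1/2)"
  unfolding time_conv_def set_lebesgue_integral_def
  by (intro Bochner_Integration.integral_cong) (auto simp: indicator_def time_profile_def algebra_simps)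
 finally show "(LINT s:{0<..<t}|lborel. LINT y:half_space|lborel. \<Sum>j\<in>Basis. green_tensor i j x y (t - s) * (stokes_force a \<alpha> k gT gN y s \<bullet> j))
  = time_conv \<alpha> ?\<theta> (t - 1/2)" .
qed

section \<open>Parabolic Hoelder continuity of the solution\<close>

text \<open>In each tangential direction one of the two orientations increases the norm.\<close>
lemma far_region_has_rays: "has_rays (far_region :: 'm::finite space set)"
 unfolding has_rays_def
proof (intro ballI)
 fix x b :: "'m space" assume x: "x \<in> far_region" and b: "b \<in> Basis"
 show "\<exists>c\<in>{b, - b}. \<forall>s\<ge>0. x + s *\<^sub>R c \<in> far_region"
 proof (cases "fst b = 0")
  case True
  then have "b = (0, 1)" using b by (auto simp: Basis_prod_def)
  then show ?thesis using x by (auto simp: far_region_def intro!: bexI[of _ b])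
 next
  case False
  then obtain b1 where b1: "b = (b1, 0)" using b by (auto simp: Basis_prod_def)
  define c where "c = (if 0 <= fst x \<bullet> b1 then b1 else - b1)"
  have "norm (fst x) <= norm (fst x + s *\<^sub>R c)" if "0 <= s" for s
  proof (rule power2_le_imp_le)
   have "0 <= s * (fst x \<bullet> c)" using that by (intro mult_nonneg_nonneg) (auto simp: c_def)
   moreover have "0 <= s * (s * (c \<bullet> c))" using that by simp
   ultimately show "(norm (fst x))\<^sup>2 <= (norm (fst x + s *\<^sub>R c))\<^sup>2"
    by (simp add: power2_norm_eq_inner inner_add_left inner_add_right inner_commute[of c "fst x"] distrib_left)
  qed simp
  then have "\<forall>s\<ge>0. x + s *\<^sub>R (c, 0) \<in> far_region" using x by (auto simp: far_region_def intro: order_trans)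
  moreover have "(c, 0) \<in> {b, - b}" by (auto simp: c_def b1)
  ultimately show ?thesis by blast
 qed
qed

lemma dirichlet_singular_kernel:
 fixes ka :: "real ^ 'm::finite => real"
 assumes p: "0 < p" "p <= 1/2" and \<sigma>: "0 < \<sigma>" "\<sigma> <= 1"
  and ka: "test_fun ka" and \<phi>: "profile b \<phi>" "b < 1"
 shows "singular_kernel p \<sigma> far_region (dirichlet (half_prod ka \<phi>))"
  and "\<exists>C. \<forall>x\<in>far_region. \<forall>t'\<in>{0<..<1}. \<bar>dirichlet (half_prod ka \<phi>) x t'\<bar> <= C * t'"
proof -
 let ?F = "half_prod ka \<phi>"
 have F: "integrable lborel ?F" by (rule half_prod_integrable[OF test_funD(4)[OF ka] \<phi>])
 have far: "1 <= norm (x - y) \<and> 1 <= norm (x - reflect y)" if "x \<in> far_region" "?F y ~= 0" for x y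
 proof -
  have "ka (fst y) ~= 0" using that(2) by (auto simp: half_prod_def)
  then have "norm (fst y) < 1" using test_funD(3)[OF ka, of "fst y"] by (cases "1 <= norm (fst y)") auto
  then have "1 <= norm (fst x - fst y)"
   using that(1) norm_triangle_ineq2[of "fst x" "fst y"] by (simp add: far_region_def)
  then show ?thesis using norm_fst_le'[of "x - y"] norm_fst_le'[of "x - reflect y"] by (simp add: reflect_def)
 qed
 have Y: "(%y::'m space. y) \<in> borel_measurable lborel" by simp
 have Z: "reflect \<in> borel_measurable (lborel :: 'm space measure)"
  using borel_measurable_diff[OF borel_measurable_const reflect_measurable[of 0], of 0] by simp
 note A = local_singular_kernel[OF p \<sigma> F Y far[THEN conjunct1]]
 note B = local_singular_kernel[OF p \<sigma> F Z far[THEN conjunct2]]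
 have D: "dirichlet ?F x t' = (LBINT y. ?F y * hk (x - y) t') + (-1) * (LBINT y. ?F y * hk (x - reflect y) t')"
  if "0 < t'" for x t'
 proof -
  have "integrable lborel (%y. ?F y * hk (x - Y y) t')" if [measurable]: "Y \<in> borel_measurable lborel" for Y
  proof (rule integrable_mult_bounded[OF F])
   show "\<bar>hk (x - Y y) t'\<bar> <= (4 * pi * t') powr (- real DIM('m space) / 2)" for y
    using heat_kernel_le[OF \<open>0 < t'\<close>, of "x - Y y"] by (simp only: abs_of_nonneg heat_kernel_nonneg)
  qed measurable
  from this[OF Y] this[OF Z] show ?thesis unfolding dirichlet_def by (simp add: right_diff_distrib)
 qed
 show "singular_kernel p \<sigma> far_region (dirichlet ?F)"
  by (rule singular_kernel_cong[OF singular_kernel_add[OF A(1) singular_kernel_scale[OF B(1), where c = "-1"]]]) (use D in auto)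
 from A(2) obtain C1 where C1: "\<forall>x\<in>far_region. \<forall>t'\<in>{0<..<1}. \<bar>LBINT y. ?F y * hk (x - y) t'\<bar> <= C1 * t'" ..
 from B(2) obtain C2 where C2: "\<forall>x\<in>far_region. \<forall>t'\<in>{0<..<1}. \<bar>LBINT y. ?F y * hk (x - reflect y) t'\<bar> <= C2 * t'" ..
 have "\<bar>dirichlet ?F x t'\<bar> <= (C1 + C2) * t'" if "x \<in> far_region" "t' \<in> {0<..<1}" for x t'
 proof -
  note C1[rule_format, OF that] C2[rule_format, OF that]
  then show ?thesis unfolding D[OF greaterThanLessThan_iff[THEN iffD1, OF that(2), THEN conjunct1]] distrib_right by linarith
 qed
 then show "\<exists>C. \<forall>x\<in>far_region. \<forall>t'\<in>{0<..<1}. \<bar>dirichlet ?F x t'\<bar> <= C * t'" by blast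
qed

lemma nonlocal_heat_avg:
 assumes V: "!!x z. 0 < z ==> g x z = c * V ka x z"
 shows "nonlocal \<phi> (%x z t'. LBINT w. hk w t' * g (x - w) z) X t' = c * nonlocal \<phi> (heat_avg V ka) X t'"
proof -
 have "(LINT z:{0<..<snd X}|lborel. layer0 \<phi> t' (snd X - z) * (LBINT w. hk w t' * g (fst X - w) z))
   = (LINT z:{0<..<snd X}|lborel. c * (layer0 \<phi> t' (snd X - z) * heat_avg V ka (fst X) z t'))"
  using V by (intro set_lebesgue_integral_cong) (auto simp: heat_avg_def mult.left_commute)
 then show ?thesis by (simp add: nonlocal_def layer_conv_def)
qed

lemma theta_singular_kernel:
 fixes gT :: "real ^ 'm::finite => real"
 assumes m: "2 <= CARD('m)" and \<beta>: "0 < \<beta>" "\<beta> < 1" and gT: "test_fun gT" and gN: "normal_profile \<beta> gN"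
  and i: "i \<in> Basis" and \<sigma>: "0 < \<sigma>" "\<sigma> < 1" and p: "p = (1 - \<beta>) / 2"
 shows "singular_kernel p \<sigma> far_region (theta a k gT gN i)"
proof -
 let ?e = "axis k 1 :: real ^ 'm"
 have e: "?e \<in> Basis" by (simp add: axis_in_Basis_iff)
 have m': "2 <= DIM(real ^ 'm)" using m by simp
 note N = normal_profileD[OF gN \<beta>]
 have p': "0 < p" "p <= 1/2" using \<beta> p by auto
 have \<sigma>': "\<sigma> <= 1" using \<sigma> by simp
 note L1 = dirichlet_singular_kernel(1)[OF p' \<sigma>(1) \<sigma>' gT N(3) \<beta>(2)]
 note L2 = dirichlet_singular_kernel(1)[OF p' \<sigma>(1) \<sigma>' test_fun_partial[OF gT e] N(4) zero_less_one]
 obtain V ka' c where V: "ext_op \<sigma> V" "test_fun ka'"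
  "!!x z. 0 < z ==> (LBINT y. grad_newt i z y * partial ?e gT (x - y)) = c * V ka' x z"
  by (rule grad_newt_ext[OF i test_fun_partial[OF gT e] m' \<sigma>]) (rule that)
 have L3': "singular_kernel p \<sigma> far_region (nonlocal (deriv gN) (heat_avg V ka'))"
  by (rule singular_kernel_subset[OF nonlocal_singular_kernel[OF heat_avg_ext[OF V(1)] \<sigma>(1) \<sigma>' V(2) N(3) \<beta> p]])
   (auto simp: far_region_def)
 have nl: "nonlocal (deriv gN) (%x z t'. LBINT w. hk w t' * (LBINT v. grad_newt i z v * partial ?e gT (x - w - v))) X t'
   = c * nonlocal (deriv gN) (heat_avg V ka') X t'" for X t'
  by (rule nonlocal_heat_avg[where g = "%x z. LBINT y. grad_newt i z y * partial ?e gT (x - y)"]) (rule V(3))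
 note L3 = singular_kernel_scale[OF L3', where c = "- (4 * a * green_const TYPE(real ^ 'm) * c)"]
 show ?thesis
  by (rule singular_kernel_cong[OF singular_kernel_add[OF singular_kernel_add[OF singular_kernel_scale[OF L1, where c = "of_bool (i = e_tangent k) * a"]
    singular_kernel_scale[OF L2, where c = "- (of_bool (i = e_normal) * a)"]] L3]])
   (unfold theta_def nl, simp add: algebra_simps)
qed

lemma norm_components_le:
 fixes c :: "'b::euclidean_space => real"
 assumes "!!i. i \<in> Basis ==> \<bar>c i\<bar> <= M i * r"
 shows "norm (\<Sum>i\<in>Basis. c i *\<^sub>R i :: 'b) <= (\<Sum>i\<in>(Basis :: 'b set). M i) * r"
proof -
 have "norm (\<Sum>i\<in>Basis. c i *\<^sub>R i :: 'b) <= (\<Sum>i\<in>(Basis :: 'b set). \<bar>c i\<bar>)"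
  by (rule order_trans[OF norm_sum]) simp
 also have "... <= (\<Sum>i\<in>(Basis :: 'b set). M i * r)" by (rule sum_mono) (rule assms)
 finally show ?thesis by (simp add: sum_distrib_right)
qed

lemma parabolic_holder_low_components:
 fixes u :: "'b::euclidean_space => 'a::euclidean_space => real => real"
 assumes "!!i. i \<in> Basis ==> parabolic_holder_low \<gamma> S I (u i)"
 shows "parabolic_holder_low \<gamma> S I (%x t. \<Sum>i\<in>Basis. u i x t *\<^sub>R i)"
proof -
 have "\<forall>i\<in>Basis. \<exists>M. (\<forall>x\<in>S. \<forall>t\<in>I. \<bar>u i x t\<bar> <= M) \<and>
   (\<forall>x\<in>S. \<forall>y\<in>S. \<forall>t\<in>I. \<forall>s\<in>I. \<bar>u i x t - u i y s\<bar> <= M * (norm (x - y) powr \<gamma> + \<bar>t - s\<bar> powr (\<gamma> / 2)))"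
  using assms by (simp add: parabolic_holder_low_def)
 from bchoice[OF this] obtain M where M: "!!i x t. i \<in> Basis ==> x \<in> S ==> t \<in> I ==> \<bar>u i x t\<bar> <= M i"
  "!!i x y t s. i \<in> Basis ==> x \<in> S ==> y \<in> S ==> t \<in> I ==> s \<in> I ==>
    \<bar>u i x t - u i y s\<bar> <= M i * (norm (x - y) powr \<gamma> + \<bar>t - s\<bar> powr (\<gamma> / 2))"
  by blast
 show ?thesis
  unfolding parabolic_holder_low_def sum_subtractf[symmetric] scaleR_left_diff_distrib[symmetric]
  using norm_components_le[of _ M 1] norm_components_le[of _ M] M
  by (intro exI[of _ "sum M Basis"]) simp
qed

lemma parabolic_holder_components:
 fixes u :: "'b::euclidean_space => 'a::euclidean_space => real => real"
 assumes u: "!!i. i \<in> Basis ==> parabolic_holder \<gamma> S I (u i)"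
 shows "parabolic_holder \<gamma> S I (%x t. \<Sum>i\<in>Basis. u i x t *\<^sub>R i)"
proof (cases "\<gamma> <= 1")
 case True
 then show ?thesis using u parabolic_holder_low_components[of \<gamma> S I u] by (simp add: parabolic_holder_def)
next
 case False
 have "\<forall>i\<in>Basis. \<exists>M. (\<forall>x\<in>S. \<forall>t\<in>I. \<bar>u i x t\<bar> <= M) \<and> (\<forall>x\<in>S. \<forall>t\<in>I. \<forall>s\<in>I. \<bar>u i x t - u i x s\<bar> <= M * \<bar>t - s\<bar> powr (\<gamma> / 2))"
  using u False by (simp add: parabolic_holder_def)
 from bchoice[OF this] obtain M where M: "!!i x t. i \<in> Basis ==> x \<in> S ==> t \<in> I ==> \<bar>u i x t\<bar> <= M i"
  "!!i x t s. i \<in> Basis ==> x \<in> S ==> t \<in> I ==> s \<in> I ==> \<bar>u i x t - u i x s\<bar> <= M i * \<bar>t - s\<bar> powr (\<gamma> / 2)"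
  by blast
 have "\<forall>i\<in>Basis. \<exists>u'. (\<forall>x\<in>S. \<forall>t\<in>I. ((%y. u i y t) has_derivative u' x t) (at x within S)) \<and>
   (\<forall>b\<in>Basis. parabolic_holder_low (\<gamma> - 1) S I (%x t. u' x t b))"
  using u False by (simp add: parabolic_holder_def)
 from bchoice[OF this] obtain u' where u': "!!i x t. i \<in> Basis ==> x \<in> S ==> t \<in> I ==> ((%y. u i y t) has_derivative u' i x t) (at x within S)"
  "!!i b. i \<in> Basis ==> b \<in> Basis ==> parabolic_holder_low (\<gamma> - 1) S I (%x t. u' i x t b)"
  by blast
 have "\<exists>M. (\<forall>x\<in>S. \<forall>t\<in>I. norm (\<Sum>i\<in>Basis. u i x t *\<^sub>R i :: 'b) <= M) \<and>
   (\<forall>x\<in>S. \<forall>t\<in>I. \<forall>s\<in>I. norm ((\<Sum>i\<in>Basis. u i x t *\<^sub>R i :: 'b) - (\<Sum>i\<in>Basis. u i x s *\<^sub>R i)) <= M * \<bar>t - s\<bar> powr (\<gamma> / 2))"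
  unfolding sum_subtractf[symmetric] scaleR_left_diff_distrib[symmetric]
  using norm_components_le[of _ M 1] norm_components_le[of _ M] M
  by (intro exI[of _ "sum M Basis"]) simp
 moreover have "\<exists>v'. (\<forall>x\<in>S. \<forall>t\<in>I. ((%y. \<Sum>i\<in>Basis. u i y t *\<^sub>R i :: 'b) has_derivative v' x t) (at x within S)) \<and>
   (\<forall>b\<in>Basis. parabolic_holder_low (\<gamma> - 1) S I (%x t. v' x t b))"
  using u' parabolic_holder_low_components[of "\<gamma> - 1" S I "%i x t. u' i x t b" for b]
  by (intro exI[of _ "%x t h. \<Sum>i\<in>Basis. u' i x t h *\<^sub>R i"]) (auto intro!: has_derivative_sum has_derivative_scaleR_left)
 ultimately show ?thesis using False by (simp add: parabolic_holder_def)
qed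

theorem stokes_parabolic_holder:
 fixes gT :: "real ^ 'm::finite => real"
 assumes m: "2 <= CARD('m)" and \<alpha>: "0 < \<alpha>" "\<alpha> < 1" and \<beta>: "0 < \<beta>" "\<beta> < 1"
  and \<epsilon>: "\<epsilon>0 = 3 - 2 * \<alpha> - \<beta>" "0 < \<epsilon>0" "\<epsilon>0 < 2" and gT: "test_fun gT" and gN: "normal_profile \<beta> gN"
 shows "parabolic_holder \<epsilon>0 far_region {0<..<1} (stokes_solution (stokes_force a \<alpha> k gT gN))"
proof -
 define \<sigma> where "\<sigma> = (if 1 < \<epsilon>0 then \<epsilon>0 - 1 else 1/2)"
 have \<sigma>: "0 < \<sigma>" "\<sigma> < 1" "1 < \<epsilon>0 ==> \<sigma> = \<epsilon>0 - 1" using \<epsilon> by (auto simp: \<sigma>_def)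
 have "parabolic_holder \<epsilon>0 far_region {0<..<1} (%x t. \<Sum>i\<in>Basis. time_conv \<alpha> (theta a k gT gN i x) (t - 1/2) *\<^sub>R i)"
  by (intro parabolic_holder_components singular_kernel_parabolic_holder[OF \<alpha> \<beta> \<epsilon> refl \<sigma>(3)]
   theta_singular_kernel[OF m \<beta> gT gN _ \<sigma>(1,2) refl] far_region_has_rays)
 then show ?thesis by (simp only: stokes_solution_eq[OF m \<beta> gT gN, abs_def])
qed

section \<open>Positivity of the pressure coefficient away from the support\<close>

text \<open>A lower bound for the second derivative in direction \<open>e\<close> of the Newtonian kernel \<open>q powr ((1 - m) / 2)\<close>, where \<open>q\<close> is the squared distance. It has the sign of
\<open>(m + 1) * (w \<bullet> e)\<^sup>2 - q\<close>, which is at least 3 in the ball around \<open>4 * e\<close> for heights at most 1; and \<open>q \<le> 37\<close> there.\<close>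
lemma grad_newt_increment:
 fixes w :: "'a::euclidean_space"
 assumes e: "e \<in> Basis" and m: "2 <= DIM('a)" and z: "0 < z" "z <= 1" and h: "0 <= h"
  and w: "norm (w - 4 *\<^sub>R e) < 2" "norm (w + h *\<^sub>R e - 4 *\<^sub>R e) < 2"
 defines "m \<equiv> real DIM('a)"
 shows "3 * (m - 1) * 37 powr (- ((m + 3) / 2)) * h
  <= (1 - m) * grad_newt (e, 0) z (w + h *\<^sub>R e) - (1 - m) * grad_newt (e, 0) z w"
proof -
 let ?c = "3 * (m - 1) * 37 powr (- ((m + 3) / 2))"
 define b where "b = w \<bullet> e"
 define q where "q = (%s. (norm w)\<^sup>2 + 2 * b * s + s\<^sup>2 + z\<^sup>2)"
 have m2: "2 <= m" using assms by (simp add: m_def)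
 have ee: "e \<bullet> e = 1" "norm e = 1" using e by auto
 have nq: "(norm (w + s *\<^sub>R e))\<^sup>2 + z\<^sup>2 = q s" for s
  unfolding q_def b_def power2_norm_eq_inner using ee
  by (simp add: inner_add_left inner_add_right inner_commute[of e w] algebra_simps power2_eq_square)
 define f where "f = (%s. (1 - m) * ((b + s) * q s powr (- ((m + 1) / 2))) - ?c * s)"
 have gf: "(1 - m) * grad_newt (e, 0) z (w + s *\<^sub>R e) = f s + ?c * s" for s
  unfolding grad_newt_def nq f_def b_def m_def[symmetric] using ee by (simp add: inner_add_left)
 have "f 0 <= f h"
 proof (rule DERIV_nonneg_imp_nondecreasing[OF h])
  fix s assume s: "0 <= s" "s <= h"
  have "norm ((w + s *\<^sub>R e) - 4 *\<^sub>R e) < 2"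
  proof -
   have "w + s *\<^sub>R e \<in> ball (4 *\<^sub>R e) 2"
   proof (rule subsetD[OF closed_segment_subset[OF _ _ convex_ball]])
    show "w + s *\<^sub>R e \<in> closed_segment w (w + h *\<^sub>R e)"
     unfolding closed_segment_def using s h
     by (cases "h = 0") (auto intro!: exI[of _ "s / h"] simp: algebra_simps scaleR_diff_left[symmetric])
   qed (use w in \<open>auto simp: dist_norm norm_minus_commute\<close>)
   then show ?thesis by (simp add: dist_norm norm_minus_commute)
  qed
  then have "(norm ((w + s *\<^sub>R e) - 4 *\<^sub>R e))\<^sup>2 < 2\<^sup>2" by (intro power_strict_mono) auto
  moreover have "(norm ((w + s *\<^sub>R e) - 4 *\<^sub>R e))\<^sup>2 = q s - z\<^sup>2 - 8 * (b + s) + 16"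
   unfolding nq[of s, symmetric] power2_norm_eq_inner b_def using ee
   by (simp add: inner_add_left inner_add_right inner_diff_left inner_diff_right inner_commute[of e w] algebra_simps)
  ultimately have n4: "q s < 8 * (b + s) - 12 + z\<^sup>2" by simp
  have bs: "b + s = (w + s *\<^sub>R e) \<bullet> e" using ee by (simp add: b_def inner_add_left)
  have "\<bar>b + s\<bar> <= norm (w + s *\<^sub>R e)" unfolding bs using Basis_le_norm[OF e] .
  then have lo: "(b + s)\<^sup>2 + z\<^sup>2 <= q s" unfolding nq[of s, symmetric] by (simp add: abs_le_square_iff[symmetric])
  have z1: "z\<^sup>2 <= 1" "0 < z\<^sup>2" using z by (auto simp: power_le_one)
  have "(b + s - 2) * (b + s - 6) < 0" using n4 lo by (simp add: algebra_simps power2_eq_square)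
  then have bs26: "2 < b + s" "b + s < 6" by (auto simp: mult_less_0_iff)
  have "0 < q s" using lo z1 zero_le_power2[of "b + s"] by linarith
  moreover have "8 * (b + s) < 8 * 6" using bs26(2) by simp
  then have "q s <= 37" using z1(1) n4 by simp
  ultimately have q0: "0 < q s" "q s <= 37" by auto
  have "q s - (m + 1) * (b + s)\<^sup>2 <= q s - 3 * (b + s)\<^sup>2" using m2 by (intro diff_left_mono mult_right_mono) auto
  also have "... <= -3"
  proof -
   have "0 <= (b + s - 2) * (3 * (b + s) - 2)" using bs26 by (intro mult_nonneg_nonneg) auto
   then show ?thesis using n4 z1 by (simp add: algebra_simps power2_eq_square)
  qed
  finally have sg: "q s - (m + 1) * (b + s)\<^sup>2 <= -3" .
  have dq: "(q has_real_derivative 2 * (b + s)) (at s)"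
   unfolding q_def by (auto intro!: derivative_eq_intros simp: algebra_simps)
  have "((%s. q s powr (- ((m + 1) / 2))) has_real_derivative (- ((m + 1) / 2)) * q s powr (- ((m + 1) / 2) - 1) * (2 * (b + s))) (at s)"
   by (rule DERIV_chain2[OF has_real_derivative_powr[OF q0(1)] dq])
  from DERIV_mult[OF DERIV_add[OF DERIV_const DERIV_ident, of b] this]
  have "(f has_real_derivative (1 - m) * ((0 + 1) * q s powr (- ((m + 1) / 2)) + (- ((m + 1) / 2)) * q s powr (- ((m + 1) / 2) - 1) * (2 * (b + s)) * (b + s)) - ?c * 1) (at s)"
   unfolding f_def by (intro DERIV_diff DERIV_cmult DERIV_ident) simp
  moreover have "0 <= (1 - m) * ((0 + 1) * q s powr (- ((m + 1) / 2)) + (- ((m + 1) / 2)) * q s powr (- ((m + 1) / 2) - 1) * (2 * (b + s)) * (b + s)) - ?c * 1"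
  proof -
   have e1: "- ((m + 1) / 2) = 1 + (- ((m + 3) / 2))" "- ((m + 1) / 2) - 1 = - ((m + 3) / 2)" by (auto simp: field_simps)
   have "q s powr (- ((m + 1) / 2)) = q s * q s powr (- ((m + 3) / 2))"
    unfolding e1(1) using q0 powr_add[of "q s" 1 "- ((m + 3) / 2)"] by simp
   then have "(1 - m) * ((0 + 1) * q s powr (- ((m + 1) / 2)) + (- ((m + 1) / 2)) * q s powr (- ((m + 1) / 2) - 1) * (2 * (b + s)) * (b + s))
     = (m - 1) * (- (q s - (m + 1) * (b + s)\<^sup>2)) * q s powr (- ((m + 3) / 2))"
    unfolding e1(2) by (simp add: field_simps power2_eq_square)
   also have "... \<ge> (m - 1) * 3 * 37 powr (- ((m + 3) / 2))"
    using sg m2 q0 by (intro mult_mono powr_mono2' mult_left_mono mult_nonneg_nonneg) auto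
   finally show ?thesis by (simp add: mult_ac)
  qed
  ultimately show "\<exists>y. (f has_real_derivative y) (at s) \<and> 0 <= y" by blast
 qed
 then show ?thesis using gf[of h] gf[of 0] by simp
qed

lemma test_fun_integral_pos:
 fixes ka :: "'a::euclidean_space => real"
 assumes ka: "test_fun ka" and nn: "!!x. 0 <= ka x" and nz: "ka x0 ~= 0"
 shows "0 < (LBINT y. ka y)"
proof -
 have "(LBINT y. ka y) ~= 0"
 proof
  assume "(LBINT y. ka y) = 0"
  then have "AE y in lborel. ka y = 0" using integral_nonneg_eq_0_iff_AE[OF test_funD(4)[OF ka]] nn by simp
  then have "AE y in lborel. y \<notin> {y. ka y ~= 0}" by simp
  moreover have op: "open {y. ka y ~= 0}" using test_funD(1)[OF ka] by (intro open_Collect_neq) auto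
  ultimately have "{y. ka y ~= 0} \<in> null_sets lborel" by (subst AE_iff_null_sets) auto
  then have "negligible {y. ka y ~= 0}" by (simp add: negligible_iff_null_sets null_sets_completionI)
  then show False using open_not_negligible[OF op] nz by blast
 qed
 moreover have "0 <= (LBINT y. ka y)" using nn by simp
 ultimately show ?thesis by simp
qed

text \<open>Were the second derivative smaller than \<open>c\<close>, the first derivative minus \<open>c * s\<close> would decrease at 0. This contradicts \<open>grad_newt_increment\<close> integrated against \<open>gT\<close>. The value at
height 0 is a limit.\<close>
lemma newt_op_lower:
 fixes gT :: "'a::euclidean_space => real"
 assumes gT: "test_fun gT" "!!x. 0 <= gT x" "gT x0 ~= 0" and e: "e \<in> Basis" and m: "2 <= DIM('a)"
 obtains c where "0 < c" "!!x z. norm (x - 4 *\<^sub>R e) < 1 ==> 0 <= z ==> z <= 1 ==> c <= newt_op (partial e (partial e gT)) x z"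
proof -
 let ?m = "real DIM('a)"
 define c0 where "c0 = 3 * (?m - 1) * 37 powr (- ((?m + 3) / 2))"
 define c where "c = c0 * (LBINT y. gT y)"
 have c0: "0 < c0" using m by (simp add: c0_def)
 have c: "0 < c" using c0 test_fun_integral_pos[OF gT] by (simp add: c_def)
 note g1 = test_fun_partial[OF gT(1) e]
 note g2 = test_fun_partial[OF g1 e]
 have V: "ext_op (1/2) (newt_op :: ('a => real) => 'a => real => real)" by (rule newt_op_ext[OF m]) auto
 have pos: "c <= newt_op (partial e (partial e gT)) x z" if x: "norm (x - 4 *\<^sub>R e) < 1" and z: "0 < z" "z <= 1" for x z
 proof (rule ccontr)
  let ?F = "%s. newt_op (partial e gT) (x + s *\<^sub>R e) z - c * s"
  assume neg: "\<not> c <= newt_op (partial e (partial e gT)) x z"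
  have d0: "((%x. newt_op (partial e gT) x z) has_derivative (%h. \<Sum>b\<in>Basis. (h \<bullet> b) * newt_op (partial b (partial e gT)) x z)) (at x)" for x
   by (rule ext_opD[OF V g1]) (use z in auto)
  have d1: "((%x. newt_op (partial e gT) x z) has_derivative (%h. \<Sum>b\<in>Basis. (h \<bullet> b) * newt_op (partial b (partial e gT)) x z)) (at (x + 0 *\<^sub>R e))"
   using d0[of x] by simp
  have "((%s. x + s *\<^sub>R e) has_derivative (%h. h *\<^sub>R e)) (at 0)" by (auto intro!: derivative_eq_intros)
  from has_derivative_compose[OF this d1]
  have "((%s. newt_op (partial e gT) (x + s *\<^sub>R e) z) has_real_derivative newt_op (partial e (partial e gT)) x z) (at 0)"
   unfolding has_field_derivative_def
   by (rule has_derivative_eq_rhs) (use e in \<open>auto simp: fun_eq_iff inner_Basis if_distrib[of "%r. _ * r"] if_distrib[of "%r. r * _"] cong: if_cong\<close>)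
  then have dF: "(?F has_real_derivative newt_op (partial e (partial e gT)) x z - c * 1) (at 0)"
   by (intro DERIV_diff DERIV_cmult DERIV_ident)
  obtain d where d: "0 < d" "!!h. 0 < h ==> h < d ==> ?F (0 + h) < ?F 0"
   using DERIV_neg_dec_right[OF dF] neg by auto
  \<comment> \<open>The bound keeps the shifted point in the unit ball around \<open>4 * e\<close>.\<close>
  define h where "h = min (d / 2) ((1 - norm (x - 4 *\<^sub>R e)) / 2)"
  have h: "0 < h" "h < d" using d x by (auto simp: h_def)
  have xh: "norm (x + h *\<^sub>R e - 4 *\<^sub>R e) < 1"
  proof -
   have "norm (x + h *\<^sub>R e - 4 *\<^sub>R e) <= norm (x - 4 *\<^sub>R e) + norm (h *\<^sub>R e)"
    using norm_triangle_ineq[of "x - 4 *\<^sub>R e" "h *\<^sub>R e"] by (simp add: algebra_simps)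
   also have "... < 1" using h e x by (auto simp: h_def min_def field_simps)
   finally show ?thesis .
  qed
  have rep: "newt_op (partial e gT) y z = (LBINT u. gT u * ((1 - ?m) * grad_newt (e, 0) z (y - u)))"
   "integrable lborel (%u. gT u * ((1 - ?m) * grad_newt (e, 0) z (y - u)))" for y
  proof -
   have "newt_op (partial e gT) y z = (1 - ?m) * (LBINT u. grad_newt (e, 0) z u * gT (y - u))"
    by (rule grad_newt_conv_tangential[OF z(1) gT(1) e m, symmetric])
   also have "(LBINT u. grad_newt (e, 0) z u * gT (y - u)) = (LBINT u. grad_newt (e, 0) z (y - u) * gT u)"
    using lborel_reflect(2)[of "%u. grad_newt (e, 0) z u * gT (y - u)" y] by simp
   finally show "newt_op (partial e gT) y z = (LBINT u. gT u * ((1 - ?m) * grad_newt (e, 0) z (y - u)))"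
    by (simp add: mult_ac integral_mult_right_zero[symmetric] del: integral_mult_right_zero)
   have "integrable lborel (%u. gT u * grad_newt (e, 0) z (y - u))"
    by (rule integrable_mult_bounded[OF test_funD(4)[OF gT(1)] _ grad_newt_le(2)[OF z(1)]]) (use e in \<open>auto simp: norm_Pair\<close>)
   from integrable_mult_right[OF this, of "1 - ?m"]
   show "integrable lborel (%u. gT u * ((1 - ?m) * grad_newt (e, 0) z (y - u)))" by (simp add: mult_ac)
  qed
  have "c * h = (LBINT u. gT u * (c0 * h))" by (simp add: c_def)
  also have "... <= (LBINT u. gT u * ((1 - ?m) * grad_newt (e, 0) z (x + h *\<^sub>R e - u)) - gT u * ((1 - ?m) * grad_newt (e, 0) z (x - u)))"
  proof (rule Bochner_Integration.integral_mono)
   show "integrable lborel (%u. gT u * (c0 * h))" using test_funD(4)[OF gT(1)] by simp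
   fix u
   show "gT u * (c0 * h) <= gT u * ((1 - ?m) * grad_newt (e, 0) z (x + h *\<^sub>R e - u)) - gT u * ((1 - ?m) * grad_newt (e, 0) z (x - u))"
   proof (cases "1 <= norm u")
    case True
    then show ?thesis using test_funD(3)[OF gT(1)] by simp
   next
    case False
    have "norm (x - u - 4 *\<^sub>R e) < 2" "norm (x - u + h *\<^sub>R e - 4 *\<^sub>R e) < 2"
     using False x xh norm_triangle_ineq4[of "x - 4 *\<^sub>R e" u] norm_triangle_ineq4[of "x + h *\<^sub>R e - 4 *\<^sub>R e" u]
     by (auto simp: algebra_simps)
    from mult_left_mono[OF grad_newt_increment[OF e m z less_imp_le[OF h(1)] this] gT(2)[of u]]
    show ?thesis by (simp add: c0_def algebra_simps)
   qed
  qed (intro Bochner_Integration.integrable_diff rep)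
  also have "... = newt_op (partial e gT) (x + h *\<^sub>R e) z - newt_op (partial e gT) x z"
   unfolding rep(1) by (rule Bochner_Integration.integral_diff) (rule rep)+
  finally show False using d(2)[OF h] by simp
 qed
 show ?thesis
 proof (rule that[OF c])
  fix x z assume x: "norm (x - 4 *\<^sub>R e) < 1" and z: "0 <= z" "z <= (1::real)"
  show "c <= newt_op (partial e (partial e gT)) x z"
  proof (cases "z = 0")
   case True
   obtain C where C: "!!x z1 z2. 0 <= z1 ==> 0 <= z2 ==> \<bar>newt_op (partial e (partial e gT)) x z1 - newt_op (partial e (partial e gT)) x z2\<bar> <= C * \<bar>z1 - z2\<bar> powr (1/2)"
    by (rule ext_opD[OF V g2]) (rule that)
   have "continuous_on {0..} (newt_op (partial e (partial e gT)) x)" by (rule holder_continuous[OF C]) auto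
   then have "(newt_op (partial e (partial e gT)) x \<longlongrightarrow> newt_op (partial e (partial e gT)) x 0) (at 0 within {0..})"
    by (simp add: continuous_on)
   then have "(newt_op (partial e (partial e gT)) x \<longlongrightarrow> newt_op (partial e (partial e gT)) x 0) (at_right 0)"
    by (rule tendsto_within_subset) auto
   then have "c <= newt_op (partial e (partial e gT)) x 0"
   proof (rule tendsto_lowerbound)
    show "\<forall>\<^sub>F z in at_right 0. c <= newt_op (partial e (partial e gT)) x z"
     by (rule eventually_at_rightI[of 0 1]) (use pos[OF x] in auto)
   qed simp
   then show ?thesis by (simp add: True)
  qed (use pos[OF x] z in auto)
 qed
qed

section \<open>Lower bounds for the layer potential\<close>

text \<open>For \<open>y\<close> and \<open>ze\<close> below the square root of the time the Gaussian is comparable to its maximum. The part of the profile with \<open>y \<ge> 1\<close>, whose sign is unknown, is seen through an exponentially small tail.\<close>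
lemma layer0_lower:
 assumes \<phi>: "profile \<beta> \<phi>" and \<beta>: "0 < \<beta>" "\<beta> < 1" and p: "p = (1 - \<beta>) / 2"
  and small: "!!y. 0 < y ==> y < 1 ==> \<phi> y = (1 - \<beta>) * y powr (- \<beta>)"
 obtains b C where "0 < b" "0 <= C"
  "!!t' ze. 0 < t' ==> t' < 1 ==> 0 <= ze ==> b * t' powr (p - 1/2) * indicator {0<..<sqrt t'} ze - C * t' * hk ze t' <= layer0 \<phi> t' ze"
proof -
 let ?\<phi> = "%y::real. indicator {0<..} y * \<phi> y"
 obtain K where K: "0 < K" "!!(z::real) t. 1/2 <= norm z ==> 0 < t ==> t <= 4 ==> hk z t <= K * t\<^sup>2"
  by (rule heat_kernel_far_bound) (rule that)
 note i\<phi> = profile_integrable[OF \<phi> \<beta>(2)]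
 define C where "C = sqrt (4 * pi) * K * (LBINT y. \<bar>?\<phi> y\<bar>)"
 define b where "b = (1 - \<beta>) * Beta (1 - \<beta>) 1 * ((4 * pi) powr (- (1/2)) * exp (-1))"
 have b: "0 < b" using \<beta> Beta_real_pos[of "1 - \<beta>" 1] by (simp add: b_def)
 have C: "0 <= C" using K by (simp add: C_def)
 show ?thesis
 proof (rule that[OF b C])
  fix t' ze :: real assume t': "0 < t'" "t' < 1" and ze: "0 <= ze"
  define s where "s = sqrt t'"
  have s: "0 < s" "s <= 1" "s\<^sup>2 = t'" using t' by (auto simp: s_def)
  define q where "q = (4 * pi * t') powr (- (1/2)) * exp (-1) * indicator {0<..<s} ze"
  define r where "r = sqrt (4 * pi * t') * (K * t'\<^sup>2) * hk ze t'"
  have q0: "0 <= q" and r0: "0 <= r" using K t' by (auto simp: q_def r_def)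
  have iB: "set_integrable lborel {0<..<s} (%y. (s - y) powr (- 0) * y powr (- \<beta>))"
   "(LINT y:{0<..<s}|lborel. (s - y) powr (- 0) * y powr (- \<beta>)) = Beta (1 + - \<beta>) (1 - 0) * s powr (1 - 0 + - \<beta>)"
   using \<beta> s by (intro Beta_convolution; simp)+
  have eqB: "indicator {0<..<s} y *\<^sub>R ((s - y) powr (- 0) * y powr (- \<beta>)) = indicator {0<..<s} y * y powr (- \<beta>)" for y
   by (auto simp: indicator_def)
  have i1: "integrable lborel (%y. indicator {0<..<s} y * y powr (- \<beta>))"
   and v1: "(LBINT y. indicator {0<..<s} y * y powr (- \<beta>)) = Beta (1 - \<beta>) 1 * s powr (1 - \<beta>)"
   using iB unfolding set_integrable_def set_lebesgue_integral_def eqB by simp_all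
  have "(LBINT y. (1 - \<beta>) * q * (indicator {0<..<s} y * y powr (- \<beta>)) - r * \<bar>?\<phi> y\<bar>) <= layer0 \<phi> t' ze"
   unfolding layer0_def
  proof (rule Bochner_Integration.integral_mono)
   show "integrable lborel (%y. (1 - \<beta>) * q * (indicator {0<..<s} y * y powr (- \<beta>)) - r * \<bar>?\<phi> y\<bar>)"
    using i1 i\<phi> by simp
   show "integrable lborel (%y. ?\<phi> y * hk (y + ze) t')" by (rule layer0_has_derivative(3)[OF \<phi> \<beta>(2) t'(1)])
   fix y :: real
   consider "y <= 0" | "0 < y" "y < 1" | "1 <= y" by linarith
   then show "(1 - \<beta>) * q * (indicator {0<..<s} y * y powr (- \<beta>)) - r * \<bar>?\<phi> y\<bar> <= ?\<phi> y * hk (y + ze) t'"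
   proof cases
    case 2
    have \<phi>y: "?\<phi> y = (1 - \<beta>) * y powr (- \<beta>)" using small 2 by simp
    have "q * indicator {0<..<s} y <= hk (y + ze) t'"
    proof (cases "y < s \<and> ze < s \<and> 0 < ze")
     case True
     have "(y + ze)\<^sup>2 <= (2 * s)\<^sup>2" using True 2 ze by (intro power_mono) auto
     also have "... = 4 * t'" using s by (simp add: power_mult_distrib)
     finally have "exp (-1) <= exp (- (y + ze)\<^sup>2 / (4 * t'))" using t' by (simp add: field_simps)
     then show ?thesis using True 2 t' by (simp add: q_def heat_kernel_def)
    qed (use 2 in \<open>auto simp: q_def indicator_def\<close>)
    then have "(1 - \<beta>) * y powr (- \<beta>) * (q * indicator {0<..<s} y) <= (1 - \<beta>) * y powr (- \<beta>) * hk (y + ze) t'"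
     using \<beta> by (intro mult_left_mono) auto
    moreover have "0 <= r * \<bar>?\<phi> y\<bar>" using r0 by simp
    ultimately show ?thesis unfolding \<phi>y by (simp add: mult_ac)
   next
    case 3
    have "hk (y + ze) t' <= sqrt (4 * pi * t') * hk y t' * hk ze t'"
     using 3 ze t' by (intro heat_kernel_add_le) auto
    also have "... <= sqrt (4 * pi * t') * (K * t'\<^sup>2) * hk ze t'"
     using 3 t' by (intro mult_right_mono mult_left_mono K(2)) auto
    finally have "\<bar>?\<phi> y\<bar> * hk (y + ze) t' <= \<bar>?\<phi> y\<bar> * r" unfolding r_def by (intro mult_left_mono) auto
    moreover have "- (\<bar>?\<phi> y\<bar> * hk (y + ze) t') <= ?\<phi> y * hk (y + ze) t'"
     using mult_right_mono[of "- \<bar>?\<phi> y\<bar>" "?\<phi> y" "hk (y + ze) t'"] by simp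
    moreover have "indicator {0<..<s} y = (0::real)" using 3 s by simp
    ultimately show ?thesis by (simp add: mult.commute)
   qed simp
  qed
  also have "(LBINT y. (1 - \<beta>) * q * (indicator {0<..<s} y * y powr (- \<beta>)) - r * \<bar>?\<phi> y\<bar>)
    = (1 - \<beta>) * q * (Beta (1 - \<beta>) 1 * s powr (1 - \<beta>)) - r * (LBINT y. \<bar>?\<phi> y\<bar>)"
   using i1 i\<phi> by (subst Bochner_Integration.integral_diff) (auto simp: v1)
  finally have A: "(1 - \<beta>) * q * (Beta (1 - \<beta>) 1 * s powr (1 - \<beta>)) - r * (LBINT y. \<bar>?\<phi> y\<bar>) <= layer0 \<phi> t' ze" .
  have "s powr (1 - \<beta>) = t' powr p" using powr_powr[of t' "1/2" "1 - \<beta>"] t' by (simp add: s_def powr_half_sqrt[symmetric] p)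
  moreover have "(4 * pi * t') powr (- (1/2)) = (4 * pi) powr (- (1/2)) * t' powr (- (1/2))" by (rule powr_mult)
  moreover have "t' powr (p - 1/2) = t' powr (- (1/2)) * t' powr p" by (simp add: powr_add[symmetric])
  ultimately have B: "(1 - \<beta>) * q * (Beta (1 - \<beta>) 1 * s powr (1 - \<beta>)) = b * t' powr (p - 1/2) * indicator {0<..<sqrt t'} ze"
   by (simp add: b_def q_def s_def mult_ac)
  have "sqrt (4 * pi * t') * t'\<^sup>2 <= sqrt (4 * pi) * t'"
  proof -
   have "sqrt t' * t' * t' <= 1 * 1 * t'" using t' by (intro mult_mono) auto
   then have "sqrt (4 * pi) * (sqrt t' * t' * t') <= sqrt (4 * pi) * t'" by (intro mult_left_mono) auto
   then show ?thesis by (simp only: real_sqrt_mult power2_eq_square mult.assoc)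
  qed
  then have "sqrt (4 * pi * t') * t'\<^sup>2 * (K * hk ze t' * (LBINT y. \<bar>?\<phi> y\<bar>)) <= sqrt (4 * pi) * t' * (K * hk ze t' * (LBINT y. \<bar>?\<phi> y\<bar>))"
   using K by (intro mult_right_mono mult_nonneg_nonneg) auto
  then have "r * (LBINT y. \<bar>?\<phi> y\<bar>) <= C * t' * hk ze t'" by (simp add: r_def C_def mult_ac)
  then show "b * t' powr (p - 1/2) * indicator {0<..<sqrt t'} ze - C * t' * hk ze t' <= layer0 \<phi> t' ze"
   using A B by linarith
 qed
qed

text \<open>The layer collects a fixed part of its mass within the square root of the time and has a Gaussian tail, so that doubling a large multiple of this distance adds little.\<close>
lemma layer0_mass:
 assumes \<phi>: "profile \<beta> \<phi>" and \<beta>: "0 < \<beta>" "\<beta> < 1" and p: "p = (1 - \<beta>) / 2"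
  and small: "!!y. 0 < y ==> y < 1 ==> \<phi> y = (1 - \<beta>) * y powr (- \<beta>)"
 defines "P \<equiv> %t'. layer_conv (layer0 \<phi> t') (%z. 1)"
 obtains b C \<Lambda> where "0 < b" "0 <= C" "1 <= \<Lambda>"
  "!!t' r. 0 < t' ==> t' < 1 ==> \<Lambda> * sqrt t' <= r ==> b * t' powr p - C * t' <= P t' r"
  "!!t' r. 0 < t' ==> t' < 1 ==> \<Lambda> * sqrt t' <= r ==> b * t' powr p - C * t' <= 2 * P t' r - P t' (2 * r)"
proof -
 obtain b C where b: "0 < b" and C: "0 <= C"
  and lo: "!!t' ze. 0 < t' ==> t' < 1 ==> 0 <= ze ==> b * t' powr (p - 1/2) * indicator {0<..<sqrt t'} ze - C * t' * hk ze t' <= layer0 \<phi> t' ze"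
  by (rule layer0_lower[OF \<phi> \<beta> p small]) (assumption | rule that)+
 obtain D where D: "0 <= D" "!!t' ze. 0 < t' ==> 0 <= ze ==> \<bar>layer0 \<phi> t' ze\<bar> <= D * t' powr p * hk ze (2 * t')"
  by (rule layer_estimates[OF \<phi> \<beta> p]) (rule that)
 have "((%l::real. D * (2 powr (1/2) * exp (- l))) \<longlongrightarrow> D * (2 powr (1/2) * 0)) at_top"
  by (intro tendsto_intros filterlim_compose[OF exp_at_bot filterlim_uminus_at_bot_at_top])
 then have "eventually (%l. D * (2 powr (1/2) * exp (- l)) < b / 2) at_top" using b by (intro order_tendstoD(2)) auto
 then obtain l where l: "!!l'. l <= l' ==> D * (2 powr (1/2) * exp (- l')) < b / 2" by (auto simp: eventually_at_top_linorder)
 define \<Lambda> where "\<Lambda> = max 1 (16 * l)"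
 have \<Lambda>: "1 <= \<Lambda>" "l <= \<Lambda>\<^sup>2 / 16"
 proof -
  show 1: "1 <= \<Lambda>" by (simp add: \<Lambda>_def)
  have "16 * l <= \<Lambda> * 1" by (simp add: \<Lambda>_def)
  also have "... <= \<Lambda> * \<Lambda>" using 1 by (intro mult_left_mono) auto
  finally show "l <= \<Lambda>\<^sup>2 / 16" by (simp add: power2_eq_square)
 qed
 have small_tail: "D * (2 powr (1/2) * exp (- (\<Lambda>\<^sup>2 / 16))) <= b / 2" using l[OF \<Lambda>(2)] by simp
 have hi: "integrable lborel (%ze::real. indicator A ze * hk ze t)" "(LBINT ze. indicator A ze * hk (ze::real) t) <= 1"
  if "0 < t" "A \<in> sets borel" for t A
 proof -
  show i: "integrable lborel (%ze::real. indicator A ze * hk ze t)"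
   using integrable_mult_indicator[OF _ heat_kernel_integrable[OF that(1)], of A] that(2) by simp
  have "(LBINT ze. indicator A ze * hk (ze::real) t) <= (LBINT ze. hk (ze::real) t)"
   by (rule Bochner_Integration.integral_mono[OF i heat_kernel_integrable[OF that(1)]]) (auto simp: indicator_def)
  then show "(LBINT ze. indicator A ze * hk (ze::real) t) <= 1" using heat_kernel_integral[OF that(1), where 'a = real] by simp
 qed
 have P: "P t' r = (LBINT ze. indicator {0<..<r} ze * layer0 \<phi> t' ze)" for t' r
 proof -
  have "P t' r = (LBINT z. indicator {0<..<r} (r - z) * layer0 \<phi> t' (r - z))"
   unfolding P_def layer_conv_def set_lebesgue_integral_def
   by (intro Bochner_Integration.integral_cong) (auto simp: indicator_def)
  then show ?thesis using lborel_reflect(2)[of "%ze. indicator {0<..<r} ze * layer0 \<phi> t' ze" r] by simp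
 qed
 have il: "integrable lborel (%ze. indicator A ze * layer0 \<phi> t' ze)" if t': "0 < t'" and A: "A \<in> sets borel" "A \<subseteq> {0..}" for A t'
 proof (rule Bochner_Integration.integrable_bound)
  show "integrable lborel (%ze. D * t' powr p * (indicator A ze * hk ze (2 * t')))" using hi(1)[of "2 * t'" A] t' A by simp
  have "continuous_on UNIV (layer0 \<phi> t')"
   using layer0_has_derivative(1)[OF \<phi> \<beta>(2) t'] by (meson DERIV_continuous_on continuous_on_subset DERIV_subset subset_UNIV)
  then have "layer0 \<phi> t' \<in> borel_measurable borel" by (rule borel_measurable_continuous_onI)
  then show "(%ze. indicator A ze * layer0 \<phi> t' ze) \<in> borel_measurable lborel" using A by simp
  show "AE ze in lborel. norm (indicator A ze * layer0 \<phi> t' ze) <= norm (D * t' powr p * (indicator A ze * hk ze (2 * t')))"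
   using D A t' by (intro AE_I2) (auto simp: indicator_def abs_mult subset_eq)
 qed
 have low: "b * t' powr p - C * t' <= P t' r" if t': "0 < t'" "t' < 1" and r: "\<Lambda> * sqrt t' <= r" for t' r
 proof -
  have "1 * sqrt t' <= \<Lambda> * sqrt t'" using \<Lambda>(1) t' by (intro mult_right_mono) auto
  then have sr: "sqrt t' <= r" using r by linarith
  have ii: "integrable lborel (%ze. indicator {0<..<sqrt t'} ze :: real)"
   by (rule integrable_real_indicator) (use t' in auto)
  have "(LBINT ze. b * t' powr (p - 1/2) * indicator {0<..<sqrt t'} ze - C * t' * (indicator {0<..<r} ze * hk ze t')) <= P t' r"
   unfolding P
  proof (rule Bochner_Integration.integral_mono)
   show "integrable lborel (%ze. b * t' powr (p - 1/2) * indicator {0<..<sqrt t'} ze - C * t' * (indicator {0<..<r} ze * hk ze t'))"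
    using hi(1)[OF t'(1)] ii by simp
   show "b * t' powr (p - 1/2) * indicator {0<..<sqrt t'} ze - C * t' * (indicator {0<..<r} ze * hk ze t') <= indicator {0<..<r} ze * layer0 \<phi> t' ze" for ze
    using lo[OF t', of ze] sr by (cases "ze \<in> {0<..<r}") (auto simp: indicator_def)
  qed (rule il; use t' in auto)
  also have "(LBINT ze. b * t' powr (p - 1/2) * indicator {0<..<sqrt t'} ze - C * t' * (indicator {0<..<r} ze * hk ze t'))
   = b * t' powr (p - 1/2) * sqrt t' - C * t' * (LBINT ze. indicator {0<..<r} ze * hk ze t')"
   using hi(1)[OF t'(1)] ii t' by (subst Bochner_Integration.integral_diff) auto
  also have "b * t' powr (p - 1/2) * sqrt t' = b * t' powr p" using t' by (simp add: powr_half_sqrt[symmetric] powr_add[symmetric])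
  finally have "b * t' powr p - C * t' * (LBINT ze. indicator {0<..<r} ze * hk ze t') <= P t' r" .
  moreover have "C * t' * (LBINT ze. indicator {0<..<r} ze * hk ze t') <= C * t' * 1"
   using C t' hi(2)[OF t'(1)] by (intro mult_left_mono) auto
  ultimately show ?thesis by simp
 qed
 have tail: "P t' (2 * r) - P t' r <= b / 2 * t' powr p" if t': "0 < t'" "t' < 1" and r: "\<Lambda> * sqrt t' <= r" for t' r
 proof -
  have "0 < \<Lambda> * sqrt t'" using \<Lambda>(1) t' by (intro mult_pos_pos) auto
  then have r0: "0 < r" using r by linarith
  have "P t' (2 * r) - P t' r = (LBINT ze. indicator {r..<2*r} ze * layer0 \<phi> t' ze)"
  proof -
   have "(%ze. indicator {r..<2*r} ze * layer0 \<phi> t' ze) = (%ze. indicator {0<..<2*r} ze * layer0 \<phi> t' ze - indicator {0<..<r} ze * layer0 \<phi> t' ze)"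
   proof (rule ext)
    fix ze
    have "indicator {r..<2*r} ze = indicator {0<..<2*r} ze - (indicator {0<..<r} ze :: real)"
     by (cases "ze < r"; cases "0 < ze"; cases "ze < 2 * r") (use r0 in \<open>auto simp: indicator_def\<close>)
    then show "indicator {r..<2*r} ze * layer0 \<phi> t' ze = indicator {0<..<2*r} ze * layer0 \<phi> t' ze - indicator {0<..<r} ze * layer0 \<phi> t' ze"
     by (simp add: left_diff_distrib)
   qed
   then show ?thesis unfolding P by (simp add: il t' subset_eq)
  qed
  also have "... <= (LBINT ze. (D * t' powr p * (2 powr (1/2) * exp (- (\<Lambda>\<^sup>2 / 16)))) * (indicator {r..<2*r} ze * hk ze (4 * t')))"
  proof (rule Bochner_Integration.integral_mono)
   show "integrable lborel (%ze. (D * t' powr p * (2 powr (1/2) * exp (- (\<Lambda>\<^sup>2 / 16)))) * (indicator {r..<2*r} ze * hk ze (4 * t')))"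
    using hi(1)[of "4 * t'"] t' by simp
   fix ze :: real
   show "indicator {r..<2*r} ze * layer0 \<phi> t' ze <= (D * t' powr p * (2 powr (1/2) * exp (- (\<Lambda>\<^sup>2 / 16)))) * (indicator {r..<2*r} ze * hk ze (4 * t'))"
   proof (cases "ze \<in> {r..<2*r}")
    case True
    have "(\<Lambda> * sqrt t')\<^sup>2 <= ze\<^sup>2" using True r \<Lambda>(1) t' by (intro power_mono) auto
    then have "exp (- ze\<^sup>2 / (16 * t')) <= exp (- (\<Lambda>\<^sup>2 / 16))" using t' by (simp add: power_mult_distrib field_simps)
    then have "2 powr (1/2) * exp (- ze\<^sup>2 / (16 * t')) * hk ze (4 * t') <= 2 powr (1/2) * exp (- (\<Lambda>\<^sup>2 / 16)) * hk ze (4 * t')"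
     by (intro mult_right_mono mult_left_mono) auto
    then have "hk ze (2 * t') <= 2 powr (1/2) * exp (- (\<Lambda>\<^sup>2 / 16)) * hk ze (4 * t')"
     using heat_kernel_double[of "2 * t'" ze] t' by simp
    then have "D * t' powr p * hk ze (2 * t') <= D * t' powr p * (2 powr (1/2) * exp (- (\<Lambda>\<^sup>2 / 16)) * hk ze (4 * t'))"
     using D(1) by (intro mult_left_mono) auto
    moreover have "layer0 \<phi> t' ze <= D * t' powr p * hk ze (2 * t')" using D(2)[OF t'(1), of ze] True r0 by auto
    ultimately show ?thesis using True by (simp add: mult_ac)
   qed simp
  qed (rule il; use t' r0 in auto)
  also have "... = (D * t' powr p * (2 powr (1/2) * exp (- (\<Lambda>\<^sup>2 / 16)))) * (LBINT ze. indicator {r..<2*r} ze * hk ze (4 * t'))"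
   by (rule integral_mult_right_zero)
  also have "... <= (D * t' powr p * (2 powr (1/2) * exp (- (\<Lambda>\<^sup>2 / 16)))) * 1"
   using D(1) t' hi(2)[of "4 * t'"] by (intro mult_left_mono) auto
  also have "... <= b / 2 * t' powr p"
   using mult_right_mono[OF small_tail, of "t' powr p"] by (simp add: mult_ac)
  finally show ?thesis .
 qed
 show ?thesis
 proof (rule that[of "b / 2" C \<Lambda>])
  fix t' r assume t': "0 < t'" "t' < (1::real)" and r: "\<Lambda> * sqrt t' <= r"
  have "0 <= b / 2 * t' powr p" using b by simp
  then show "b / 2 * t' powr p - C * t' <= P t' r" using low[OF t' r] by simp
  show "b / 2 * t' powr p - C * t' <= 2 * P t' r - P t' (2 * r)" using low[OF t' r] tail[OF t' r] by simp
 qed (use b C \<Lambda> in auto)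
qed

section \<open>Lower bounds for the solution\<close>

lemma layer_conv_const: "layer_conv \<psi> (%z. c) r = c * layer_conv \<psi> (%z. 1) r"
proof -
 have "(LINT z:{0<..<r}|lborel. \<psi> (r - z) * c) = (LINT z:{0<..<r}|lborel. c * \<psi> (r - z))" by (simp only: mult.commute)
 then show ?thesis by (simp add: layer_conv_def)
qed

text \<open>To leading order the tangential factor may be evaluated at the boundary and at time 0.\<close>
lemma heat_avg_layer:
 fixes V :: "('a::euclidean_space => real) => 'a => real => real"
 assumes V: "ext_op \<sigma> V" and \<sigma>: "0 < \<sigma>" "\<sigma> <= 1" and ka: "test_fun ka"
  and \<phi>: "profile \<beta> \<phi>" and \<beta>: "0 < \<beta>" "\<beta> < 1" and p: "p = (1 - \<beta>) / 2"
 obtains K where "0 <= K" "!!x r t'. 0 < t' ==> t' < 1 ==> 0 <= r ==>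
   \<bar>nonlocal \<phi> (heat_avg V ka) (x, r) t' - V ka x 0 * layer_conv (layer0 \<phi> t') (%z. 1) r\<bar> <= K * t' powr p * (sqrt t' + r powr \<sigma>)"
proof -
 obtain D where D: "0 <= D" "!!t' ze. 0 < t' ==> 0 <= ze ==> \<bar>layer0 \<phi> t' ze\<bar> <= D * t' powr p * hk ze (2 * t')"
  by (rule layer_estimates[OF \<phi> \<beta> p]) (rule that)
 obtain K1 where K1: "0 <= K1" "!!x z t'. 0 <= z ==> 0 < t' ==> \<bar>heat_avg V ka x z t' - V ka x z\<bar> <= K1 * sqrt t'"
  by (rule heat_avg_initial[OF V ka]) (rule that)
 obtain C where C: "0 <= C" "!!x z1 z2. 0 <= z1 ==> 0 <= z2 ==> \<bar>V ka x z1 - V ka x z2\<bar> <= C * \<bar>z1 - z2\<bar> powr \<sigma>"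
  by (rule ext_opD[OF V ka]) (rule that)
 obtain C' where C': "!!x z1 z2 t'. 0 < t' ==> t' < 1 ==> 0 <= z1 ==> 0 <= z2 ==>
   \<bar>heat_avg V ka x z1 t' - heat_avg V ka x z2 t'\<bar> <= C' * \<bar>z1 - z2\<bar> powr \<sigma>"
  by (rule heat_extD[OF heat_avg_ext[OF V] ka]) (rule that)
 show ?thesis
 proof (rule that[of "D * (K1 + C)"])
  fix x :: 'a and r t' :: real assume t': "0 < t'" "t' < 1" and r: "0 <= r"
  let ?\<psi> = "layer0 \<phi> t'" and ?U = "%z. heat_avg V ka x z t'" and ?v = "V ka x 0"
  have c\<psi>: "continuous_on UNIV ?\<psi>"
   using layer0_has_derivative(1)[OF \<phi> \<beta>(2) t'(1)] by (intro DERIV_continuous_on) (auto intro: DERIV_subset)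
  have cU: "continuous_on {0..} ?U" by (rule holder_continuous[OF C'[OF t'] \<sigma>(1)])
  have "nonlocal \<phi> (heat_avg V ka) (x, r) t' - ?v * layer_conv ?\<psi> (%z. 1) r = layer_conv ?\<psi> ?U r - layer_conv ?\<psi> (%z. ?v) r"
   unfolding nonlocal_def layer_conv_const[of ?\<psi> ?v] by simp
  also have "... = layer_conv ?\<psi> (%z. ?U z - ?v) r" by (rule layer_conv_diff[OF c\<psi> cU]) simp
  also have "... = layer_conv ?\<psi> (%z. ?U (min z r) - ?v) r"
   unfolding layer_conv_def by (intro set_lebesgue_integral_cong) auto
  finally have eq: "nonlocal \<phi> (heat_avg V ka) (x, r) t' - ?v * layer_conv ?\<psi> (%z. 1) r = layer_conv ?\<psi> (%z. ?U (min z r) - ?v) r" .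
  have "\<bar>layer_conv ?\<psi> (%z. ?U (min z r) - ?v) r\<bar> <= (D * t' powr p) * ((K1 + C) * (sqrt t' + r powr \<sigma>))"
  proof (rule layer_conv_bound[where s = "2 * t'"])
   show "\<bar>?U (min z r) - ?v\<bar> <= (K1 + C) * (sqrt t' + r powr \<sigma>)" if z: "0 <= z" for z
   proof -
    have "\<bar>?U (min z r) - V ka x (min z r)\<bar> <= K1 * sqrt t'" using z r t' by (intro K1(2)) auto
    moreover have "\<bar>V ka x (min z r) - ?v\<bar> <= C * \<bar>min z r - 0\<bar> powr \<sigma>" using z r by (intro C(2)) auto
    moreover have "C * \<bar>min z r - 0\<bar> powr \<sigma> <= C * r powr \<sigma>" using z r \<sigma> C(1) by (intro mult_left_mono powr_mono2) auto
    moreover have "0 <= K1 * r powr \<sigma>" "0 <= C * sqrt t'" using K1(1) C(1) t' by auto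
    moreover have "(K1 + C) * (sqrt t' + r powr \<sigma>) = K1 * sqrt t' + K1 * r powr \<sigma> + C * sqrt t' + C * r powr \<sigma>"
     by (simp add: algebra_simps)
    ultimately show ?thesis by linarith
   qed
  qed (use D K1 C t' in \<open>auto intro!: mult_nonneg_nonneg add_nonneg_nonneg\<close>)
  then show "\<bar>nonlocal \<phi> (heat_avg V ka) (x, r) t' - ?v * layer_conv ?\<psi> (%z. 1) r\<bar> <= D * (K1 + C) * t' powr p * (sqrt t' + r powr \<sigma>)"
   unfolding eq by (simp add: mult_ac)
 qed (use D K1 C in auto)
qed

text \<open>With \<open>R\<close> the mass of the layer, or twice this mass minus that up to the doubled distance, the kernel is \<open>c1 * v * R\<close> up to errors that carry a factor \<open>s\<close>, and \<open>v \<ge> c0\<close>. The number \<open>s\<close>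
bounds the square roots of the time and of the distance, so it is chosen small.\<close>
lemma theta_lower:
 fixes gT :: "real ^ 'm::finite => real" and k :: 'm
 assumes m: "2 <= CARD('m)" and \<beta>: "0 < \<beta>" "\<beta> < 1" and p: "p = (1 - \<beta>) / 2" and a: "0 < a"
  and gT: "tangential_cutoff gT" and gN: "normal_profile \<beta> gN"
 defines "\<theta> \<equiv> theta a k gT gN (e_tangent k)"
 obtains c \<Lambda> \<rho> where "0 < c" "1 <= \<Lambda>" "0 < \<rho>"
  "!!x t' r. norm (x - 4 *\<^sub>R axis k 1) < 1 ==> 0 < t' ==> t' < 1 ==> \<Lambda> * sqrt t' <= r ==> r <= \<rho> ==>
    c * t' powr p <= \<theta> (x, r) t' \<and> c * t' powr p <= 2 * \<theta> (x, r) t' - \<theta> (x, 2 * r) t'"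
proof -
 let ?e = "axis k 1 :: real ^ 'm" and ?\<phi> = "deriv gN" and ?m = "real CARD('m)"
 let ?P = "%t'. layer_conv (layer0 ?\<phi> t') (%z. 1)"
 have e: "?e \<in> Basis" by (simp add: axis_in_Basis_iff)
 have m': "2 <= DIM(real ^ 'm)" using m by simp
 have p': "0 < p" "p <= 1/2" using \<beta> p by auto
 note gT' = tangential_cutoff_test_fun[OF gT]
 note N = normal_profileD[OF gN \<beta>]
 define ka where "ka = partial ?e (partial ?e gT)"
 have ka: "test_fun ka" unfolding ka_def by (intro test_fun_partial gT' e)
 have V: "ext_op (1/2) (newt_op :: (real ^ 'm => real) => real ^ 'm => real => real)" by (rule newt_op_ext[OF m']) auto
 obtain x0 where x0: "gT x0 ~= 0" using gT by (auto simp: tangential_cutoff_def)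
 obtain c0 where c0: "0 < c0" "!!x z. norm (x - 4 *\<^sub>R ?e) < 1 ==> 0 <= z ==> z <= 1 ==> c0 <= newt_op ka x z"
  unfolding ka_def by (rule newt_op_lower[OF gT' _ x0 e m']) (use gT in \<open>auto simp: tangential_cutoff_def\<close>)
 obtain Cv where Cv: "0 <= Cv" "!!x z. 0 <= z ==> \<bar>newt_op ka x z\<bar> <= Cv" by (rule ext_opD[OF V ka]) (rule that)
 obtain K where K: "0 <= K" "!!x r t'. 0 < t' ==> t' < 1 ==> 0 <= r ==>
   \<bar>nonlocal ?\<phi> (heat_avg newt_op ka) (x, r) t' - newt_op ka x 0 * ?P t' r\<bar> <= K * t' powr p * (sqrt t' + r powr (1/2))"
  by (rule heat_avg_layer[OF V _ _ ka N(3) \<beta> p]) (simp | rule that)+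
 obtain b C1 \<Lambda> where b: "0 < b" and C1: "0 <= C1" and \<Lambda>: "1 <= \<Lambda>"
  and P1: "!!t' r. 0 < t' ==> t' < 1 ==> \<Lambda> * sqrt t' <= r ==> b * t' powr p - C1 * t' <= ?P t' r"
  and P2: "!!t' r. 0 < t' ==> t' < 1 ==> \<Lambda> * sqrt t' <= r ==> b * t' powr p - C1 * t' <= 2 * ?P t' r - ?P t' (2 * r)"
  by (rule layer0_mass[OF N(3) \<beta> p N(2)]) (assumption | rule that)+
 obtain Cd where Cd: "\<forall>x\<in>far_region. \<forall>t'\<in>{0<..<1}. \<bar>dirichlet (half_prod gT ?\<phi>) x t'\<bar> <= Cd * t'"
  using dirichlet_singular_kernel(2)[OF p' _ _ gT' N(3) \<beta>(2), of 1] by auto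
 define c1 where "c1 = 4 * a * green_const TYPE(real ^ 'm) / (?m - 1)"
 have c1: "0 < c1" using a m green_const_pos[where 'a = "real ^ 'm"] by (simp add: c1_def)
 have \<theta>: "\<theta> X t' = a * dirichlet (half_prod gT ?\<phi>) X t' + c1 * nonlocal ?\<phi> (heat_avg newt_op ka) X t'" for X t'
 proof -
  have "(LBINT y. grad_newt (e_tangent k) z y * partial ?e gT (x - y)) = 1 / (1 - ?m) * newt_op ka x z" if "0 < z" for x z
   using grad_newt_conv_tangential[OF that test_fun_partial[OF gT' e] e m', of x] m
   by (simp add: e_tangent_def ka_def field_simps)
  then have "nonlocal ?\<phi> (%x z t'. LBINT w. hk w t' * (LBINT v. grad_newt (e_tangent k) z v * partial ?e gT (x - w - v))) X t'
   = 1 / (1 - ?m) * nonlocal ?\<phi> (heat_avg newt_op ka) X t'"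
   by (rule nonlocal_heat_avg[where g = "%x z. LBINT y. grad_newt (e_tangent k) z y * partial ?e gT (x - y)"])
  moreover have "1 / (1 - ?m) = - (1 / (?m - 1))" using m by (simp add: field_simps)
  then have "- 4 * a * green_const TYPE(real ^ 'm) * (1 / (1 - ?m) * y) = c1 * y" for y by (simp only: c1_def) simp
  ultimately show ?thesis using e_Basis(3)[of k] unfolding \<theta>_def theta_def by simp
 qed
 define Q where "Q = c1 * (Cv * C1 + 6 * K) + 3 * (a * \<bar>Cd\<bar>)"
 have Q: "0 <= Q" using c1 Cv C1 K a by (auto simp: Q_def)
 \<comment> \<open>\<open>Q * s\<close> collects all errors and is at most half of the main term.\<close>
 define s where "s = min 1 (c1 * c0 * b / (2 * (Q + 1)))"
 have cb: "0 < c1 * c0 * b" using c1 c0 b by simp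
 have s: "0 < s" "s <= 1" using cb Q by (auto simp: s_def)
 have "Q * s <= Q * (c1 * c0 * b / (2 * (Q + 1)))" using Q by (intro mult_left_mono) (auto simp: s_def)
 also have "... = (c1 * c0 * b / 2) * (Q / (Q + 1))" by simp
 also have "... <= (c1 * c0 * b / 2) * 1" using Q cb by (intro mult_left_mono) auto
 finally have Qs: "Q * s <= c1 * c0 * b / 2" by simp
 show ?thesis
 proof (rule that[of "c1 * c0 * b / 2" \<Lambda> "s\<^sup>2 / 2"])
  fix x :: "real ^ 'm" and t' r :: real
  assume x: "norm (x - 4 *\<^sub>R ?e) < 1" and t': "0 < t'" "t' < 1" and r: "\<Lambda> * sqrt t' <= r" "r <= s\<^sup>2 / 2"
  define t where "t = t' powr p"
  define v where "v = newt_op ka x 0"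
  have t: "0 <= t" by (simp add: t_def)
  have v: "c0 <= v" "v <= Cv" using c0(2)[OF x, of 0] Cv(2)[of 0 x] by (auto simp: v_def)
  have "1 * sqrt t' <= \<Lambda> * sqrt t'" using \<Lambda> t' by (intro mult_right_mono) auto
  then have sr: "sqrt t' <= r" using r by linarith
  have r0: "0 < r" using sr t' by (meson less_le_trans real_sqrt_gt_zero)
  have "s\<^sup>2 <= s * 1" unfolding power2_eq_square using s by (intro mult_left_mono) auto
  then have st': "sqrt t' <= s" using sr r s by linarith
  have half: "u powr (1/2) <= s" if "0 <= u" "u <= s\<^sup>2" for u
  proof -
   have "sqrt u <= sqrt (s\<^sup>2)" using that(2) by (rule real_sqrt_le_mono)
   then show ?thesis using s that by (simp add: powr_half_sqrt)
  qed
  have t't: "t' <= t * s"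
  proof -
   have "t' = t * t' powr (1 - p)" using t' by (simp add: t_def powr_add[symmetric])
   also have "... <= t * t' powr (1/2)" using t' p' t by (intro mult_left_mono powr_mono') auto
   also have "... <= t * s" using st' t' t by (intro mult_left_mono) (auto simp: powr_half_sqrt)
   finally show ?thesis .
  qed
  have far: "(x, u) \<in> far_region" if "0 <= u" for u
  proof -
   have "4 <= norm x + norm (x - 4 *\<^sub>R ?e)"
    using norm_triangle_ineq4[of x "x - 4 *\<^sub>R ?e"] by simp
   then show ?thesis using x that by (simp add: far_region_def)
  qed
  have dir: "\<bar>a * dirichlet (half_prod gT ?\<phi>) (x, u) t'\<bar> <= a * \<bar>Cd\<bar> * (t * s)" if "0 <= u" for u
  proof -
   have "\<bar>dirichlet (half_prod gT ?\<phi>) (x, u) t'\<bar> <= Cd * t'" using Cd far[OF that] t' by auto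
   also have "... <= \<bar>Cd\<bar> * t'" using t' by (intro mult_right_mono) auto
   also have "... <= \<bar>Cd\<bar> * (t * s)" using t't by (intro mult_left_mono) auto
   finally have "a * \<bar>dirichlet (half_prod gT ?\<phi>) (x, u) t'\<bar> <= a * (\<bar>Cd\<bar> * (t * s))" using a by (intro mult_left_mono) auto
   then show ?thesis using a by (simp add: abs_mult mult.assoc)
  qed
  have E: "\<bar>nonlocal ?\<phi> (heat_avg newt_op ka) (x, u) t' - v * ?P t' u\<bar> <= 2 * K * (t * s)" if u: "0 <= u" "u <= s\<^sup>2" for u
  proof -
   have "K * t' powr p * (sqrt t' + u powr (1/2)) <= K * t' powr p * (2 * s)"
    using K(1) half[OF u] st' by (intro mult_left_mono) auto
   then show ?thesis using K(2)[OF t' u(1), of x] by (simp add: t_def v_def mult_ac)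
  qed
  have fin: "c1 * c0 * b / 2 * t <= A + c1 * B"
   if A: "- (3 * (a * \<bar>Cd\<bar> * (t * s))) <= A" and B: "v * R - 6 * K * (t * s) <= B" and R: "b * t - C1 * t' <= R" for A B R
  proof -
   have "c0 * (b * t) <= v * (b * t)" using v b t by (intro mult_right_mono mult_nonneg_nonneg) auto
   moreover have "v * (C1 * t') <= Cv * (C1 * (t * s))" using v c0(1) C1 t't t' Cv by (intro mult_mono mult_left_mono) auto
   moreover have "v * (b * t - C1 * t') <= v * R" using R v c0(1) by (intro mult_left_mono) auto
   ultimately have "c0 * (b * t) - Cv * (C1 * (t * s)) - 6 * K * (t * s) <= B" using B by (simp add: right_diff_distrib)
   then have "c1 * (c0 * (b * t) - Cv * (C1 * (t * s)) - 6 * K * (t * s)) <= c1 * B" using c1 by (intro mult_left_mono) auto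
   moreover have "Q * s * t <= c1 * c0 * b / 2 * t" using Qs t by (rule mult_right_mono)
   moreover have "c1 * (c0 * (b * t) - Cv * (C1 * (t * s)) - 6 * K * (t * s)) - 3 * (a * \<bar>Cd\<bar> * (t * s)) = 2 * (c1 * c0 * b / 2 * t) - Q * s * t"
    by (simp add: Q_def algebra_simps)
   moreover have "H <= A + B'" if "X <= B'" "Y <= H" "X - Z = 2 * H - Y" "- Z <= A" for X Y Z H B' :: real using that by linarith
   ultimately show ?thesis using A by blast
  qed
  have u1: "0 <= r" "r <= s\<^sup>2" "0 <= 2 * r" "2 * r <= s\<^sup>2" using r0 r(2) by auto
  have kts: "0 <= K * (t * s)" "0 <= a * \<bar>Cd\<bar> * (t * s)" using K t s a by auto
  let ?N = "nonlocal ?\<phi> (heat_avg newt_op ka)" and ?d = "%X. a * dirichlet (half_prod gT ?\<phi>) X t'"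
  have "c1 * c0 * b / 2 * t <= ?d (x, r) + c1 * ?N (x, r) t'"
   by (rule fin[OF _ _ P1[OF t' r(1), folded t_def]]) (use dir[OF u1(1)] E[OF u1(1,2)] kts in linarith)+
  moreover have "c1 * c0 * b / 2 * t <= (2 * ?d (x, r) - ?d (x, 2 * r)) + c1 * (2 * ?N (x, r) t' - ?N (x, 2 * r) t')"
  proof (rule fin[OF _ _ P2[OF t' r(1), folded t_def]])
   show "- (3 * (a * \<bar>Cd\<bar> * (t * s))) <= 2 * ?d (x, r) - ?d (x, 2 * r)" using dir[OF u1(1)] dir[OF u1(3)] by linarith
   show "v * (2 * ?P t' r - ?P t' (2 * r)) - 6 * K * (t * s) <= 2 * ?N (x, r) t' - ?N (x, 2 * r) t'"
    using E[OF u1(1,2)] E[OF u1(3,4)] by (simp add: right_diff_distrib)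
  qed
  ultimately show "c1 * c0 * b / 2 * t' powr p <= \<theta> (x, r) t' \<and> c1 * c0 * b / 2 * t' powr p <= 2 * \<theta> (x, r) t' - \<theta> (x, 2 * r) t'"
   unfolding \<theta> t_def by (simp add: algebra_simps)
 qed (use cb \<Lambda> s in auto)
qed

lemma solution_lower:
 fixes gT :: "real ^ 'm::finite => real" and k :: 'm
 assumes m: "2 <= CARD('m)" and \<alpha>: "\<alpha> < 1" and \<beta>: "0 < \<beta>" "\<beta> < 1" and a: "0 < a"
  and gT: "tangential_cutoff gT" and gN: "normal_profile \<beta> gN"
 defines "W \<equiv> %X. time_conv \<alpha> (theta a k gT gN (e_tangent k) X)"
 obtains c \<Lambda> \<rho> where "0 < c" "1 <= \<Lambda>" "0 < \<rho>"
  "!!x r T. norm (x - 4 *\<^sub>R axis k 1) < 1 ==> 0 < T ==> T < 1 ==> \<Lambda> * sqrt T <= r ==> r <= \<rho> ==>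
    c * T powr ((3 - 2 * \<alpha> - \<beta>) / 2) <= W (x, r) T \<and> c * T powr ((3 - 2 * \<alpha> - \<beta>) / 2) <= 2 * W (x, r) T - W (x, 2 * r) T"
proof -
 define p where "p = (1 - \<beta>) / 2"
 let ?\<theta> = "theta a k gT gN (e_tangent k)"
 have p': "0 < p" "p <= 1" using \<beta> by (auto simp: p_def)
 obtain c \<Lambda> \<rho> where c: "0 < c" and \<Lambda>: "1 <= \<Lambda>" and \<rho>: "0 < \<rho>"
  and low: "!!x t' r. norm (x - 4 *\<^sub>R axis k 1) < 1 ==> 0 < t' ==> t' < 1 ==> \<Lambda> * sqrt t' <= r ==> r <= \<rho> ==>
    c * t' powr p <= ?\<theta> (x, r) t' \<and> c * t' powr p <= 2 * ?\<theta> (x, r) t' - ?\<theta> (x, 2 * r) t'"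
  by (rule theta_lower[OF m \<beta> p_def a gT gN, of k]) (rule that)
 have "singular_kernel p (1/2) far_region ?\<theta>"
  by (rule theta_singular_kernel[OF m \<beta> tangential_cutoff_test_fun[OF gT] gN e_Basis(2) _ _ p_def]) auto
 then obtain C \<theta>' where sk: "singular_kernel_by C \<theta>' p (1/2) far_region ?\<theta>" unfolding singular_kernel_def by blast
 define B where "B = Beta (1 + p) (1 - \<alpha>)"
 have B: "0 < B" unfolding B_def using p' \<alpha> by (intro Beta_real_pos) auto
 show ?thesis
 proof (rule that[of "c * B" \<Lambda> \<rho>])
  fix x :: "real ^ 'm" and r T :: real
  assume x: "norm (x - 4 *\<^sub>R axis k 1) < 1" and T: "0 < T" "T < 1" and r: "\<Lambda> * sqrt T <= r" "r <= \<rho>"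
  have r0: "0 <= r" using r(1) \<Lambda> T by (meson mult_nonneg_nonneg order_trans real_sqrt_ge_zero less_imp_le zero_le_one)
  have far: "(x, u) \<in> far_region" if "0 <= u" for u
  proof -
   have "4 <= norm x + norm (x - 4 *\<^sub>R axis k 1)"
    using norm_triangle_ineq4[of x "x - 4 *\<^sub>R axis k 1"] by simp
   then show ?thesis using x that by (simp add: far_region_def)
  qed
  have int: "set_integrable lborel {0<..<T} (%t'. (T - t') powr (- \<alpha>) * ?\<theta> (x, u) t')" if "0 <= u" for u
   by (rule set_integrable_conv_bound[OF \<alpha>, where q = p and C = C])
    (use p' T far[OF that] singular_kernel_measurable[OF sk p', of _ T] singular_kernel_byD(2)[OF sk] in auto)
  note i1 = int[OF r0]
  have i2: "set_integrable lborel {0<..<T} (%t'. (T - t') powr (- \<alpha>) * ?\<theta> (x, 2 * r) t')" using int[of "2 * r"] r0 by simp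
  have p1: "-1 < p" using p' by simp
  have iB: "set_integrable lborel {0<..<T} (%t'. c * ((T - t') powr (- \<alpha>) * t' powr p))"
   using Beta_convolution(1)[OF \<alpha> p1 less_imp_le[OF T(1)]] by simp
  have "c * B * T powr ((3 - 2 * \<alpha> - \<beta>) / 2) = c * (LINT t':{0<..<T}|lborel. (T - t') powr (- \<alpha>) * t' powr p)"
  proof -
   have "1 - \<alpha> + p = (3 - 2 * \<alpha> - \<beta>) / 2" by (simp add: p_def field_simps)
   then show ?thesis unfolding Beta_convolution(2)[OF \<alpha> p1 less_imp_le[OF T(1)]] B_def by (simp only: mult.assoc)
  qed
  then have cB: "c * B * T powr ((3 - 2 * \<alpha> - \<beta>) / 2) = (LINT t':{0<..<T}|lborel. c * ((T - t') powr (- \<alpha>) * t' powr p))" by simp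
  have L: "c * t' powr p <= ?\<theta> (x, r) t' \<and> c * t' powr p <= 2 * ?\<theta> (x, r) t' - ?\<theta> (x, 2 * r) t'" if "t' \<in> {0<..<T}" for t'
  proof (rule low[OF x])
   have "\<Lambda> * sqrt t' <= \<Lambda> * sqrt T" using that \<Lambda> by (intro mult_left_mono) auto
   then show "\<Lambda> * sqrt t' <= r" using r by linarith
  qed (use that T r in auto)
  have mono: "c * ((T - t') powr (- \<alpha>) * t' powr p) <= (T - t') powr (- \<alpha>) * y" if "c * t' powr p <= y" for t' y
   using mult_left_mono[OF that, of "(T - t') powr (- \<alpha>)"] by (simp add: mult_ac)
  have A: "c * B * T powr ((3 - 2 * \<alpha> - \<beta>) / 2) <= W (x, r) T"
   unfolding cB W_def time_conv_def by (rule set_integral_mono[OF iB i1]) (use L mono in blast)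
  have eq: "2 * W (x, r) T - W (x, 2 * r) T = (LINT t':{0<..<T}|lborel. 2 * ((T - t') powr (- \<alpha>) * ?\<theta> (x, r) t') - (T - t') powr (- \<alpha>) * ?\<theta> (x, 2 * r) t')"
   unfolding W_def time_conv_def using i1 i2 by (subst set_integral_diff(2)) auto
  have "c * B * T powr ((3 - 2 * \<alpha> - \<beta>) / 2) <= 2 * W (x, r) T - W (x, 2 * r) T"
   unfolding cB eq
  proof (rule set_integral_mono[OF iB])
   show "set_integrable lborel {0<..<T} (%t'. 2 * ((T - t') powr (- \<alpha>) * ?\<theta> (x, r) t') - (T - t') powr (- \<alpha>) * ?\<theta> (x, 2 * r) t')"
    using i1 i2 by (intro set_integral_diff(1)) auto
   show "c * ((T - t') powr (- \<alpha>) * t' powr p) <= 2 * ((T - t') powr (- \<alpha>) * ?\<theta> (x, r) t') - (T - t') powr (- \<alpha>) * ?\<theta> (x, 2 * r) t'"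
    if "t' \<in> {0<..<T}" for t'
    using mono[OF conjunct2[OF L[OF that]]] by (simp add: right_diff_distrib mult_ac)
  qed
  with A show "c * B * T powr ((3 - 2 * \<alpha> - \<beta>) / 2) <= W (x, r) T \<and> c * B * T powr ((3 - 2 * \<alpha> - \<beta>) / 2) <= 2 * W (x, r) T - W (x, 2 * r) T" ..
 qed (use c B \<Lambda> \<rho> in auto)
qed

section \<open>Hoelder spaces along a line\<close>

lemma holder_le_bound: "holder_le K \<sigma> S M u ==> x \<in> S ==> norm (u x) <= M"
 by (cases K) auto

lemma has_derivative_along_ray:
 fixes u :: "'a::real_normed_vector => 'b::real_normed_vector"
 assumes u: "!!y. y \<in> S ==> (u has_derivative u' y) (at y within S)"
  and S: "!!s. s \<in> {0..r} ==> x + s *\<^sub>R b \<in> S" and s: "s \<in> {0..r}"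
 shows "((%s. u (x + s *\<^sub>R b)) has_derivative (%h. h *\<^sub>R u' (x + s *\<^sub>R b) b)) (at s within {0..r})"
proof -
 have "((%s. x + s *\<^sub>R b) has_derivative (%h. h *\<^sub>R b)) (at s within {0..r})" by (auto intro!: derivative_eq_intros)
 moreover have "(u has_derivative u' (x + s *\<^sub>R b)) (at (x + s *\<^sub>R b) within (%s. x + s *\<^sub>R b) ` {0..r})"
  by (rule has_derivative_subset[OF u[OF S[OF s]]]) (use S in auto)
 ultimately have "((%s. u (x + s *\<^sub>R b)) has_derivative (%h. u' (x + s *\<^sub>R b) (h *\<^sub>R b))) (at s within {0..r})"
  by (rule has_derivative_in_compose)
 then show ?thesis using linear_scale[OF has_derivative_linear[OF u[OF S[OF s]]]] by simp
qed

lemma line_increment_le: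
 fixes G :: "real => 'b::real_normed_vector"
 assumes "!!s. s \<in> {0..r} ==> (G has_derivative (%h. h *\<^sub>R G' s)) (at s within {0..r})"
  and "!!s. s \<in> {0..r} ==> norm (G' s) <= H" and r: "0 <= r"
 shows "norm (G r - G 0) <= H * r"
proof -
 have "norm (G r - G 0) <= H * norm (r - 0)"
 proof (rule differentiable_bound[of "{0..r}" G "%s h. h *\<^sub>R G' s"])
  fix s assume s: "s \<in> {0..r}"
  show "onorm (%h. h *\<^sub>R G' s) <= H"
  proof (rule onorm_bound)
   show "0 <= H" using assms(2)[OF s] norm_ge_zero order_trans by blast
   show "norm (h *\<^sub>R G' s) <= H * norm h" for h
    using mult_left_mono[OF assms(2)[OF s], of "\<bar>h\<bar>"] by (simp add: mult.commute)
  qed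
 qed (use assms in auto)
 then show ?thesis using r by simp
qed

lemma holder_le_increment:
 fixes u :: "'a::euclidean_space => 'b::real_normed_vector"
 assumes u: "holder_le K \<sigma> S M u" and \<sigma>: "0 < \<sigma>" "\<sigma> <= 1" and b: "b \<in> Basis"
  and S: "!!s. s \<in> {0..r} ==> x + s *\<^sub>R b \<in> S" and r: "0 <= r"
 shows "norm (u (x + r *\<^sub>R b) - u x) <= M * r powr (min 1 (real K + \<sigma>))"
proof (cases K)
 case 0
 have "norm (u (x + r *\<^sub>R b) - u x) <= M * norm ((x + r *\<^sub>R b) - x) powr \<sigma>"
 proof -
  have h: "norm (u x - u y) <= M * norm (x - y) powr \<sigma>" if "x \<in> S" "y \<in> S" for x y using u that by (simp add: 0)
  show ?thesis by (rule h) (use S[of r] S[of 0] r in auto)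
 qed
 then show ?thesis using 0 \<sigma> b r by (simp add: min_def)
next
 case (Suc k)
 then obtain u' where u': "!!x. x \<in> S ==> (u has_derivative u' x) (at x within S)" "!!b. b \<in> Basis ==> holder_le k \<sigma> S M (%x. u' x b)"
  using u by auto
 have "norm (u (x + r *\<^sub>R b) - u (x + 0 *\<^sub>R b)) <= M * r"
  by (rule line_increment_le[where G = "%s. u (x + s *\<^sub>R b)" and G' = "%s. u' (x + s *\<^sub>R b) b"])
   (use has_derivative_along_ray[OF u'(1) S] holder_le_bound[OF u'(2)[OF b] S] r in auto)
 then show ?thesis using Suc \<sigma> r by (simp add: min_def)
qed

text \<open>Second differences see smoothness up to order 2, which is enough because \<open>\<epsilon>0 < 2\<close>.\<close>
lemma holder_le_second_difference:
 fixes u :: "'a::euclidean_space => 'b::real_normed_vector"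
 assumes u: "holder_le K \<sigma> S M u" and \<sigma>: "0 < \<sigma>" "\<sigma> <= 1" and b: "b \<in> Basis"
  and S: "!!s. 0 <= s ==> x + s *\<^sub>R b \<in> S" and r: "0 < r"
 shows "norm ((u (x + (2 * r) *\<^sub>R b) - u (x + r *\<^sub>R b)) - (u (x + r *\<^sub>R b) - u x)) <= 2 * M * r powr (min 2 (real K + \<sigma>))"
proof (cases K)
 case 0
 have "norm (u (x + r *\<^sub>R b + r *\<^sub>R b) - u (x + r *\<^sub>R b)) <= M * r powr (min 1 (real K + \<sigma>))"
  by (rule holder_le_increment[OF u \<sigma> b]) (use S r in \<open>auto simp: add.assoc scaleR_left_distrib[symmetric]\<close>)
 moreover have "x + r *\<^sub>R b + r *\<^sub>R b = x + (2 * r) *\<^sub>R b" by (simp add: add.assoc scaleR_left_distrib[symmetric])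
 moreover have "norm (u (x + r *\<^sub>R b) - u x) <= M * r powr (min 1 (real K + \<sigma>))"
  by (rule holder_le_increment[OF u \<sigma> b]) (use S r in auto)
 ultimately show ?thesis using norm_triangle_ineq4[of "u (x + (2 * r) *\<^sub>R b) - u (x + r *\<^sub>R b)" "u (x + r *\<^sub>R b) - u x"] 0 \<sigma>
  by (simp add: min_def)
next
 case (Suc k)
 then obtain u' where u': "!!x. x \<in> S ==> (u has_derivative u' x) (at x within S)" "!!b. b \<in> Basis ==> holder_le k \<sigma> S M (%x. u' x b)"
  using u by auto
 have M: "0 <= M" using holder_le_bound[OF u S[of 0]] by (simp add: order_trans[OF norm_ge_zero])
 have shift: "(x + r *\<^sub>R b) + s *\<^sub>R b = (x + s *\<^sub>R b) + r *\<^sub>R b" for s by (simp add: add_ac)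
 have S': "(x + r *\<^sub>R b) + s *\<^sub>R b \<in> S" if "0 <= s" for s
  using S[of "r + s"] r that by (simp add: add.assoc scaleR_left_distrib)
 have "norm ((u ((x + r *\<^sub>R b) + r *\<^sub>R b) - u (x + r *\<^sub>R b)) - (u ((x + r *\<^sub>R b) + 0 *\<^sub>R b) - u (x + 0 *\<^sub>R b))) <= M * r powr (min 1 (real k + \<sigma>)) * r"
 proof (rule line_increment_le[where G = "%s. u ((x + r *\<^sub>R b) + s *\<^sub>R b) - u (x + s *\<^sub>R b)" and G' = "%s. u' ((x + r *\<^sub>R b) + s *\<^sub>R b) b - u' (x + s *\<^sub>R b) b"])
  fix s assume s: "s \<in> {0..r}"
  show "((%s. u ((x + r *\<^sub>R b) + s *\<^sub>R b) - u (x + s *\<^sub>R b)) has_derivative (%h. h *\<^sub>R (u' ((x + r *\<^sub>R b) + s *\<^sub>R b) b - u' (x + s *\<^sub>R b) b))) (at s within {0..r})"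
   unfolding scaleR_right_diff_distrib
   by (intro has_derivative_diff has_derivative_along_ray[OF u'(1)]) (use S S' s in auto)
  show "norm (u' ((x + r *\<^sub>R b) + s *\<^sub>R b) b - u' (x + s *\<^sub>R b) b) <= M * r powr (min 1 (real k + \<sigma>))"
   unfolding shift by (rule holder_le_increment[OF u'(2)[OF b] \<sigma> b]) (use S'[unfolded shift] S s r in \<open>auto simp: add.assoc scaleR_left_distrib[symmetric]\<close>)
 qed (use r in simp)
 also have "M * r powr (min 1 (real k + \<sigma>)) * r = M * r powr (min 1 (real k + \<sigma>) + 1)" using r by (simp add: powr_add)
 also have "min 1 (real k + \<sigma>) + 1 = min 2 (real K + \<sigma>)" using Suc by (auto simp: min_def)
 finally have "norm ((u ((x + r *\<^sub>R b) + r *\<^sub>R b) - u (x + r *\<^sub>R b)) - (u (x + r *\<^sub>R b) - u x)) <= M * r powr (min 2 (real K + \<sigma>))"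
  by simp
 moreover have "(x + r *\<^sub>R b) + r *\<^sub>R b = x + (2 * r) *\<^sub>R b" by (simp add: add.assoc scaleR_left_distrib[symmetric])
 moreover have "0 <= M * r powr (min 2 (real K + \<sigma>))" using M by simp
 ultimately show ?thesis by simp
qed

lemma holder_order_exp:
 assumes "0 < \<gamma>"
 shows "real (holder_order \<gamma>) + holder_exp \<gamma> = \<gamma>" "0 < holder_exp \<gamma>" "holder_exp \<gamma> <= 1"
 using assms unfolding holder_exp_def holder_order_def by linarith+

lemma AE_lebesgue_point:
 fixes A :: "'a::euclidean_space set"
 assumes "AE x in lebesgue. P x" "open A" "A ~= {}"
 shows "\<exists>x\<in>A. P x"
proof (rule ccontr)
 assume "\<not> ?thesis"
 then have "AE x in lebesgue. x \<notin> A" using assms(1) by (auto elim: eventually_mono)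
 then have "A \<in> null_sets lebesgue" using assms(2) by (subst AE_iff_null_sets) auto
 then show False using open_not_negligible[OF assms(2,3)] by (simp add: negligible_iff_null_sets)
qed

lemma Linf_normD:
 assumes "Linf_norm S u <= ereal M" "closed S"
 shows "AE x in lebesgue. x \<in> S --> norm (u x) <= M"
proof -
 have u: "u \<in> borel_measurable (lebesgue_on S)" and le: "esssup (lebesgue_on S) (%x. ereal (norm (u x))) <= ereal M"
  using assms(1) by (auto simp: Linf_norm_def split: if_splits)
 have "AE x in lebesgue_on S. ereal (norm (u x)) <= esssup (lebesgue_on S) (%x. ereal (norm (u x)))"
  by (rule esssup_AE)
 then have "AE x in lebesgue_on S. norm (u x) <= M"
  by (rule eventually_mono) (use le in \<open>auto dest: order_trans\<close>)
 then show ?thesis using assms(2) by (subst (asm) AE_restrict_space_iff) auto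
qed

lemma small_power:
 fixes d c q M :: real
 assumes "0 < d" "0 < c" "0 < q"
 obtains T0 where "0 < T0" "T0 <= q" "!!T. 0 < T ==> T <= T0 ==> M * T powr d < c"
proof -
 define A where "A = c / (2 * (\<bar>M\<bar> + 1))"
 have A: "0 < A" using assms by (simp add: A_def add_pos_nonneg)
 show ?thesis
 proof (rule that[of "min q (A powr (1 / d))"])
  fix T :: real assume T: "0 < T" "T <= min q (A powr (1 / d))"
  have "T powr d <= (A powr (1 / d)) powr d" using T assms by (intro powr_mono2) auto
  then have "T powr d <= A" using assms A by (simp add: powr_powr)
  then have "\<bar>M\<bar> * T powr d <= \<bar>M\<bar> * A" by (intro mult_left_mono) auto
  also have "... < (\<bar>M\<bar> + 1) * A * 2"
   using A mult_nonneg_nonneg[of "\<bar>M\<bar>" A] by (simp add: algebra_simps add_nonneg_pos)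
  also have "... = c" by (simp add: A_def field_simps)
  finally have "\<bar>M\<bar> * T powr d < c" .
  moreover have "M * T powr d <= \<bar>M\<bar> * T powr d" by (intro mult_right_mono) auto
  ultimately show "M * T powr d < c" by linarith
 qed (use A assms in auto)
qed

section \<open>Optimality of the exponent\<close>

text \<open>The points at heights 0, \<open>r\<close> and \<open>2 * r\<close> are used, with \<open>r = \<Lambda> * sqrt T\<close>, for times \<open>1/2 + T\<close> with arbitrarily small \<open>T\<close> at which the Hoelder bound holds.\<close>
theorem not_Linf_holder:
 fixes w :: "'m::finite space => real => 'm space" and W :: "'m space => real => real"
 assumes w: "!!x t. w x t \<bullet> e_tangent k = W x (t - 1/2)" and W0: "!!x T. W (x, 0) T = 0"
  and \<epsilon>: "0 < \<epsilon>0" "\<epsilon>0 < 2" "\<epsilon>0 < \<epsilon>" and c: "0 < c" and \<Lambda>: "1 <= \<Lambda>" and \<rho>: "0 < \<rho>"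
  and low: "!!x r T. norm (x - 4 *\<^sub>R axis k 1) < 1 ==> 0 < T ==> T < 1 ==> \<Lambda> * sqrt T <= r ==> r <= \<rho> ==>
    c * T powr (\<epsilon>0 / 2) <= 2 * W (x, r) T - W (x, 2 * r) T"
 shows "\<not> Linf_holder \<epsilon> far_region {0<..<1} w"
proof
 assume "Linf_holder \<epsilon> far_region {0<..<1} w"
 then obtain M where AE: "AE t in lborel. t \<in> {0<..<1} --> holder_le (holder_order \<epsilon>) (holder_exp \<epsilon>) far_region M (%x. w x t)"
  by (auto simp: Linf_holder_def)
 have \<epsilon>p: "0 < \<epsilon>" using \<epsilon> by simp
 note ho = holder_order_exp[OF \<epsilon>p]
 define \<gamma> where "\<gamma> = min 2 \<epsilon>"
 have \<gamma>: "\<epsilon>0 < \<gamma>" using \<epsilon> by (simp add: \<gamma>_def)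
 define q where "q = min (1/4) ((\<rho> / \<Lambda>)\<^sup>2)"
 have q: "0 < q" using \<rho> \<Lambda> by (simp add: q_def)
 have d: "0 < (\<gamma> - \<epsilon>0) / 2" using \<gamma> by simp
 obtain T0 where T0: "0 < T0" "T0 <= q" "!!T. 0 < T ==> T <= T0 ==> 2 * M * \<Lambda> powr \<gamma> * T powr ((\<gamma> - \<epsilon>0) / 2) < c"
  by (rule small_power[OF d c q]) (rule that)
 have "\<exists>t\<in>{1/2<..<1/2 + T0}. t \<in> {0<..<1} --> holder_le (holder_order \<epsilon>) (holder_exp \<epsilon>) far_region M (%x. w x t)"
  by (rule AE_lebesgue_point[OF AE_completion[OF AE]]) (use T0 in auto)
 then obtain t where t1: "t \<in> {1/2<..<1/2 + T0}" and H: "t \<in> {0<..<1} --> holder_le (holder_order \<epsilon>) (holder_exp \<epsilon>) far_region M (%x. w x t)" by blast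
 from t1 have t: "1/2 < t" "t < 1/2 + T0" by auto
 define T where "T = t - 1/2"
 define r where "r = \<Lambda> * sqrt T"
 have T: "0 < T" "T <= T0" "T < 1" "T <= (\<rho> / \<Lambda>)\<^sup>2" "t < 1" using t T0(2) by (auto simp: T_def q_def)
 have r: "0 < r" using \<Lambda> T by (simp add: r_def)
 have "sqrt T <= \<rho> / \<Lambda>" using T(4) \<rho> \<Lambda> by (intro real_le_lsqrt) auto
 then have r\<rho>: "r <= \<rho>" using \<Lambda> by (simp add: r_def field_simps)
 let ?x = "(4 *\<^sub>R axis k 1, 0) :: 'm space" and ?u = "%x. w x t"
 have nb: "norm (e_tangent k :: 'm space) = 1" using e_Basis(2) by (rule norm_Basis)
 have "norm ((?u (?x + (2 * r) *\<^sub>R e_normal) - ?u (?x + r *\<^sub>R e_normal)) - (?u (?x + r *\<^sub>R e_normal) - ?u ?x)) <= 2 * M * r powr (min 2 (real (holder_order \<epsilon>) + holder_exp \<epsilon>))"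
  by (rule holder_le_second_difference[OF H[rule_format] ho(2,3) e_Basis(1) _ r])
   (use t T in \<open>auto simp: far_region_def e_normal_def\<close>)
 then have up: "norm ((?u (?x + (2 * r) *\<^sub>R e_normal) - ?u (?x + r *\<^sub>R e_normal)) - (?u (?x + r *\<^sub>R e_normal) - ?u ?x)) <= 2 * M * r powr \<gamma>"
  unfolding ho(1) \<gamma>_def .
 have "((?u (?x + (2 * r) *\<^sub>R e_normal) - ?u (?x + r *\<^sub>R e_normal)) - (?u (?x + r *\<^sub>R e_normal) - ?u ?x)) \<bullet> e_tangent k
  = - (2 * W (4 *\<^sub>R axis k 1, r) T - W (4 *\<^sub>R axis k 1, 2 * r) T)"
  by (simp add: inner_diff_left w W0 e_normal_def T_def)
 moreover have "\<bar>((?u (?x + (2 * r) *\<^sub>R e_normal) - ?u (?x + r *\<^sub>R e_normal)) - (?u (?x + r *\<^sub>R e_normal) - ?u ?x)) \<bullet> e_tangent k\<bar>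
  <= norm ((?u (?x + (2 * r) *\<^sub>R e_normal) - ?u (?x + r *\<^sub>R e_normal)) - (?u (?x + r *\<^sub>R e_normal) - ?u ?x))"
  by (rule Basis_le_norm[OF e_Basis(2)])
 moreover have "c * T powr (\<epsilon>0 / 2) <= 2 * W (4 *\<^sub>R axis k 1, r) T - W (4 *\<^sub>R axis k 1, 2 * r) T"
  by (rule low) (use T r\<rho> in \<open>auto simp: r_def\<close>)
 ultimately have "c * T powr (\<epsilon>0 / 2) <= 2 * M * r powr \<gamma>" using up by linarith
 also have "r powr \<gamma> = \<Lambda> powr \<gamma> * T powr ((\<gamma> - \<epsilon>0) / 2) * T powr (\<epsilon>0 / 2)"
 proof -
  have "(sqrt T) powr \<gamma> = T powr ((\<gamma> - \<epsilon>0) / 2 + \<epsilon>0 / 2)" using T powr_powr[of T "1/2" \<gamma>] by (simp add: powr_half_sqrt[symmetric] diff_divide_distrib)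
  then show ?thesis by (simp add: r_def powr_mult powr_add)
 qed
 finally have "c * T powr (\<epsilon>0 / 2) <= (2 * M * \<Lambda> powr \<gamma> * T powr ((\<gamma> - \<epsilon>0) / 2)) * T powr (\<epsilon>0 / 2)" by (simp add: mult_ac)
 then have "c <= 2 * M * \<Lambda> powr \<gamma> * T powr ((\<gamma> - \<epsilon>0) / 2)" using T(1) by simp
 then show False using T0(3)[OF T(1,2)] by simp
qed

lemma far_region_closed: "closed (far_region :: 'm::finite space set)"
 unfolding far_region_def Collect_conj_eq
 by (intro closed_Int closed_Collect_le continuous_intros)

text \<open>The solution vanishes up to time 1/2. If one time derivative is available, it must vanish at 1/2 as seen from the left, while from the right the difference quotients blow up
like \<open>T powr (\<epsilon>0 / 2 - 1)\<close>. The lower bounds hold on open sets, hence not only on a null set.\<close>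
theorem not_holder_Linf:
 fixes w :: "'m::finite space => real => 'm space" and W :: "'m space => real => real"
 assumes w: "!!x t. w x t \<bullet> e_tangent k = W x (t - 1/2)" and w0: "!!x t. t <= 1/2 ==> w x t = 0"
  and \<epsilon>: "0 < \<epsilon>0" "\<epsilon>0 < 2" "\<epsilon>0 < \<epsilon>" and c: "0 < c" and \<Lambda>: "1 <= \<Lambda>" and \<rho>: "0 < \<rho>"
  and low: "!!x r T. norm (x - 4 *\<^sub>R axis k 1) < 1 ==> 0 < T ==> T < 1 ==> \<Lambda> * sqrt T <= r ==> r <= \<rho> ==>
    c * T powr (\<epsilon>0 / 2) <= W (x, r) T"
 shows "\<not> holder_Linf (\<epsilon> / 2) {0<..<1} far_region w"
proof
 assume H: "holder_Linf (\<epsilon> / 2) {0<..<1} far_region w"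
 have \<epsilon>p: "0 < \<epsilon> / 2" using \<epsilon> by simp
 note ho = holder_order_exp[OF \<epsilon>p]
 define q where "q = min (1/4) ((\<rho> / (2 * \<Lambda>))\<^sup>2)"
 have q: "0 < q" using \<rho> \<Lambda> by (simp add: q_def)
 have point: "\<exists>x. norm (w x (1/2 + T)) \<ge> c * T powr (\<epsilon>0 / 2) \<and> P x"
  if T: "0 < T" "T <= q" and AE: "AE x in lebesgue. x \<in> far_region --> P x" for T P
 proof -
  \<comment> \<open>An open part of the far region on which the lower bound holds at time \<open>1/2 + T\<close>.\<close>
  let ?A = "ball (4 *\<^sub>R axis k 1) 1 \<times> {\<Lambda> * sqrt T<..<\<rho>} :: 'm space set"
  have "sqrt T <= \<rho> / (2 * \<Lambda>)" using T \<rho> \<Lambda> by (intro real_le_lsqrt) (auto simp: q_def)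
  then have "\<Lambda> * sqrt T <= \<rho> / 2" using \<Lambda> by (simp add: field_simps)
  then have ne: "\<Lambda> * sqrt T < \<rho>" using \<rho> by linarith
  have "?A ~= {}" using dense[OF ne] by auto
  then obtain X where X: "X \<in> ?A" "X \<in> far_region --> P X"
   using AE_lebesgue_point[OF AE, of ?A] by (auto simp: open_Times)
  obtain x r where xr: "X = (x, r)" by (cases X)
  have x: "norm (x - 4 *\<^sub>R axis k 1) < 1" using X(1) by (simp add: xr dist_norm norm_minus_commute)
  have r: "\<Lambda> * sqrt T <= r" "r <= \<rho>" using X(1) by (auto simp: xr)
  have "0 <= \<Lambda> * sqrt T" using \<Lambda> T by simp
  moreover have "4 <= norm x + norm (x - 4 *\<^sub>R axis k 1)"
   using norm_triangle_ineq4[of x "x - 4 *\<^sub>R axis k 1"] by simp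
  ultimately have "X \<in> far_region" using x r by (simp add: xr far_region_def)
  moreover have "c * T powr (\<epsilon>0 / 2) <= W X T" unfolding xr by (rule low[OF x _ _ r]) (use T in \<open>auto simp: q_def\<close>)
  moreover have "W X T = w X (1/2 + T) \<bullet> e_tangent k" by (simp add: w)
  moreover have "w X (1/2 + T) \<bullet> e_tangent k <= norm (w X (1/2 + T))"
   using Basis_le_norm[OF e_Basis(2), of "w X (1/2 + T)" k] by simp
  ultimately show ?thesis using X(2) by (intro exI[of _ X]) auto
 qed
 show False
 proof (cases "holder_order (\<epsilon> / 2)")
  case 0
  then have ex: "holder_exp (\<epsilon> / 2) = \<epsilon> / 2" using ho(1) by simp
  obtain M where "\<forall>t\<in>{0<..<1}. \<forall>s\<in>{0<..<1}. Linf_norm far_region (%x. w x t - w x s) <= ereal (M * \<bar>t - s\<bar> powr (\<epsilon> / 2))"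
   using H unfolding holder_Linf_def 0 ex holder_time_Linf.simps by blast
  note M = this[rule_format]
  have d: "0 < (\<epsilon> - \<epsilon>0) / 2" using \<epsilon> by simp
  obtain T where T: "0 < T" "T <= q" "M * T powr ((\<epsilon> - \<epsilon>0) / 2) < c"
   using small_power[OF d c q, of M] by (metis order_refl)
  have "Linf_norm far_region (%x. w x (1/2 + T) - w x (1/2)) <= ereal (M * \<bar>1/2 + T - 1/2\<bar> powr (\<epsilon> / 2))"
   using T by (intro M) (auto simp: q_def)
  from Linf_normD[OF this far_region_closed]
  have "AE x in lebesgue. x \<in> far_region --> norm (w x (1/2 + T)) <= M * T powr (\<epsilon> / 2)" using T w0 by simp
  from point[OF T(1,2) this] have "c * T powr (\<epsilon>0 / 2) <= M * T powr (\<epsilon> / 2)" by (auto dest: order_trans)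
  also have "T powr (\<epsilon> / 2) = T powr ((\<epsilon> - \<epsilon>0) / 2) * T powr (\<epsilon>0 / 2)" by (simp add: powr_add[symmetric] diff_divide_distrib)
  finally have "c <= M * T powr ((\<epsilon> - \<epsilon>0) / 2)" using T(1) by (simp add: mult.assoc[symmetric])
  then show False using T(3) by simp
 next
  case (Suc j)
  let ?t = "1/2 :: real"
  obtain F' where "\<forall>t\<in>{0<..<1}. ((%s. Linf_norm far_region (%x. (w x s - w x t) /\<^sub>R (s - t) - F' t x)) \<longlongrightarrow> 0) (at t within {0<..<1})"
   using H unfolding holder_Linf_def Suc holder_time_Linf.simps by blast
  note F' = this[rule_format]
  have "eventually (%s. Linf_norm far_region (%x. (w x s - w x ?t) /\<^sub>R (s - ?t) - F' ?t x) < ereal (c / 2)) (at ?t within {0<..<1})"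
   using F'[of ?t] c by (intro order_tendstoD(2)) auto
  then obtain \<delta> where \<delta>: "0 < \<delta>" "!!s. s \<in> {0<..<1} ==> s ~= ?t ==> dist s ?t < \<delta> ==>
    Linf_norm far_region (%x. (w x s - w x ?t) /\<^sub>R (s - ?t) - F' ?t x) < ereal (c / 2)"
   unfolding eventually_at by blast
  define T where "T = min q (\<delta> / 2)"
  have T: "0 < T" "T <= q" "T < 1/2" "T < \<delta>" using q \<delta>(1) by (auto simp: T_def q_def)
  have L: "AE x in lebesgue. x \<in> far_region --> norm ((w x s - w x ?t) /\<^sub>R (s - ?t) - F' ?t x) <= c / 2"
   if "s = ?t + T \<or> s = ?t - T" for s
   by (rule Linf_normD[OF less_imp_le[OF \<delta>(2)] far_region_closed]) (use that T in \<open>auto simp: dist_real_def\<close>)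
  have 1: "AE x in lebesgue. x \<in> far_region --> norm (F' ?t x) <= c / 2"
   using L[of "?t - T"] w0 T by simp
  have 2: "AE x in lebesgue. x \<in> far_region --> norm (w x (?t + T) /\<^sub>R T - F' ?t x) <= c / 2"
   using L[of "?t + T"] w0 by simp
  have "AE x in lebesgue. x \<in> far_region --> norm (w x (?t + T)) <= c * T"
   using 1 2
  proof eventually_elim
   case (elim x)
   show ?case
   proof
    assume "x \<in> far_region"
    then have "norm (w x (?t + T) /\<^sub>R T) <= c"
     using elim norm_triangle_ineq[of "w x (?t + T) /\<^sub>R T - F' ?t x" "F' ?t x"] by simp
    then show "norm (w x (?t + T)) <= c * T" using T(1) by (simp add: field_simps)
   qed
  qed
  from point[OF T(1,2) this] have "c * T powr (\<epsilon>0 / 2) <= c * T" by (auto dest: order_trans)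
  then have "T powr (\<epsilon>0 / 2) <= T powr 1" using c T by simp
  moreover have "T powr 1 < T powr (\<epsilon>0 / 2)" using T \<epsilon> by (intro powr_less_mono') auto
  ultimately show False by simp
 qed
qed

theorem theorem1p8:
  fixes n :: nat and k :: "'m::finite"
    and \<alpha> \<beta> \<epsilon>0 a :: real
    and gT :: "real ^ 'm \<Rightarrow> real" and gN :: "real \<Rightarrow> real"
    and w :: "'m space \<Rightarrow> real \<Rightarrow> 'm space"
  assumes "n \<ge> 3" and "DIM('m space) = n"
    and "0 < \<alpha>" "\<alpha> < 1" and "0 < \<beta>" "\<beta> < 1"
    and "\<epsilon>0 = 3 - 2 * \<alpha> - \<beta>" and "\<epsilon>0 \<in> {0<..<2}"
    and "0 < a" and "tangential_cutoff gT" and "normal_profile \<beta> gN"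
    and "w = stokes_solution (stokes_force a \<alpha> k gT gN)"
  shows "parabolic_holder \<epsilon>0 far_region {0<..<1} w \<and>
    (\<forall>\<epsilon>>\<epsilon>0. \<not> Linf_holder \<epsilon> far_region {0<..<1} w
           \<and> \<not> holder_Linf (\<epsilon> / 2) {0<..<1} far_region w)"
proof -
 have m: "2 <= CARD('m)" using assms(1,2) by simp
 have \<epsilon>: "0 < \<epsilon>0" "\<epsilon>0 < 2" using assms(8) by auto
 note gT = tangential_cutoff_test_fun[OF assms(10)]
 define W where "W = (%x. time_conv \<alpha> (theta a k gT gN (e_tangent k) x))"
 have w: "w x t = (\<Sum>i\<in>Basis. time_conv \<alpha> (theta a k gT gN i x) (t - 1/2) *\<^sub>R i)" for x t
  unfolding assms(12) by (rule stokes_solution_eq[OF m assms(5,6) gT assms(11)])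
 have wk: "w x t \<bullet> e_tangent k = W x (t - 1/2)" for x t
  unfolding w W_def by (rule inner_sum_left_Basis[OF e_Basis(2)])
 have w0: "w x t = 0" if "t <= 1/2" for x t unfolding w using that by (simp add: time_conv_nonpos)
 have W0: "W (x, 0) T = 0" for x T
 proof -
  have "norm (fst y, - snd y) = norm y" for y :: "'m space" by (simp add: norm_prod_def)
  from this[of "(x, 0) - y" for y] have "hk ((x, 0) - y) t' = hk ((x, 0) - reflect y) t'" for y t'
   by (simp add: heat_kernel_def reflect_def minus_prod_def)
  then have "theta a k gT gN (e_tangent k) (x, 0) = (%t'. 0)"
   by (simp add: theta_def dirichlet_def nonlocal_def layer_conv_def set_lebesgue_integral_def fun_eq_iff)
  then show ?thesis by (simp add: W_def time_conv_def)
 qed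
 let ?W = "%X. time_conv \<alpha> (theta a k gT gN (e_tangent k) X)"
 obtain c \<Lambda> \<rho> where c: "0 < c" "1 <= \<Lambda>" "0 < \<rho>"
  and low': "!!x r T. norm (x - 4 *\<^sub>R axis k 1) < 1 ==> 0 < T ==> T < 1 ==> \<Lambda> * sqrt T <= r ==> r <= \<rho> ==>
    c * T powr ((3 - 2 * \<alpha> - \<beta>) / 2) <= ?W (x, r) T \<and> c * T powr ((3 - 2 * \<alpha> - \<beta>) / 2) <= 2 * ?W (x, r) T - ?W (x, 2 * r) T"
  by (rule solution_lower[OF m assms(4-6,9-11), of k]) (rule that)
 have low: "c * T powr (\<epsilon>0 / 2) <= W (x, r) T \<and> c * T powr (\<epsilon>0 / 2) <= 2 * W (x, r) T - W (x, 2 * r) T"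
  if "norm (x - 4 *\<^sub>R axis k 1) < 1" "0 < T" "T < 1" "\<Lambda> * sqrt T <= r" "r <= \<rho>" for x r T
  unfolding W_def assms(7) by (rule low'[OF that])
 have "parabolic_holder \<epsilon>0 far_region {0<..<1} w"
  unfolding assms(12) by (rule stokes_parabolic_holder[OF m assms(3-7) \<epsilon> gT assms(11)])
 moreover have "\<not> Linf_holder \<epsilon> far_region {0<..<1} w" if "\<epsilon>0 < \<epsilon>" for \<epsilon>
  by (rule not_Linf_holder[where w = w and W = W and k = k, OF wk W0 \<epsilon> that c]) (rule low[THEN conjunct2]; assumption)
 moreover have "\<not> holder_Linf (\<epsilon> / 2) {0<..<1} far_region w" if "\<epsilon>0 < \<epsilon>" for \<epsilon>
  by (rule not_holder_Linf[where w = w and W = W and k = k, OF wk w0 \<epsilon> that c]) (assumption | rule low[THEN conjunct1])+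
 ultimately show ?thesis by blast
qed

end
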